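(* Let $A$ generate a $C_0$-semigroup $\{T(t)\}_{t\ge 0}$ on the Banach space $X$ such that $T(t)$ is compact for every $t>0$, let $Y$ be a separable Hilbert space, let $B:Y\to X$ be bounded and linear, and let $x_0\in X$. Let $U:[a,b]\times X\multimap Y$ be a multivalued map such that: (U1) $(t,x)\mapsto U(t,x)$ is measurable; (U2) the set $U(t,x)$ is convex in $Y$ for all $(t,x)\in[a,b]\times X$; (U3) there are $a_U\in L^2([a,b],\mathbb{R}^+)$ and $c_U\ge 0$ such that for all $x\in X$ and a.e. $t\in[a,b]$, $\|U(t,x)\|_Y:=\sup\{\|u\|_Y:u\in U(t,x)\}\le a_U(t)+c_U(\Psi(t,a))^{1-\gamma}\|x\|_X$; (U4) there is $k_4\in L^1([a,b],\mathbb{R}^+)$ such that for all $x,y\in X$ and a.e. $t\in[a,b]$, $d_H(U(t,x),U(t,y))\le k_4(t)(\Psi(t,a))^{1-\gamma}\|x-y\|_X$, where $d_H$ is the Hausdorff distance. Let $h:[a,b]\times X\times Y\to\mathbb{R}$ satisfy: (H1) for all $(x,u)\in X\times Y$ the map $t\mapsto h(t,x,u)$ is measurable; (H2) there are $k_1,k_2\in L^1([a,b],\mathbb{R}^+)$ and $c_h\ge 0$ with $|h(t,x,u)|\le k_1(t)+k_2(t)\|x\|_X+c_h\|u\|_Y$ for all $(x,u)\in X\times Y$ and a.e. $t\in[a,b]$; (H3) for a.e. $t\in[a,b]$ and all $u\in Y$, the function $x\mapsto h(t,x,u)$ is lower semicontinuous; (H4) for a.e. $t\in[a,b]$ and all $x\in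 X$, the function $u\mapsto h(t,x,u)$ is lower semicontinuous and convex; (H5) for each bounded set $D\subset Y$ there is $a_D\in L^2([a,b],\mathbb{R}^+)$ with $|h(t,x,u)-h(t,y,u)|\le a_D(t)\|x-y\|_X$ for all $x,y\in X$, $u\in D$ and a.e. $t\in[a,b]$. Let $\mathcal{J}:C^{1-\gamma;\psi}([a,b],X)\times L^2([a,b],Y)\to\mathbb{R}$ be defined by $\mathcal{J}(q,u)=\int_a^b h(t,q(t),u(t))\,dt$, and let $R_U(x_0)$ be the set of all mild solutions $(q,u)$ of the feedback control system ${}^{H}D^{\alpha,\beta;\psi}_{a+}q(t)=Aq(t)+Bu(t)$, $t\in[a,b]$, $(I^{1-\gamma;\psi}_{a+}q)(a)=x_0$, with $u(t)\in U(t,q(t))$ for a.e. $t\in[a,b]$. Then there exists $(q^*,u^* )\in R_U(x_0)\subset C^{1-\gamma;\psi}([a,b],X)\times L^2([a,b],Y)$ such that $$\mathcal{J}(q^*,u^* )=\inf_{(q,u)\in R_U(x_0)}\mathcal{J}(q,u).$$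
   Context: Setting: $-\infty<a<b<\infty$, $\frac12<\alpha\le 1$, $0\le\beta\le 1$, $\gamma=\alpha+\beta(1-\alpha)$; $\psi\in C^1([a,b],\mathbb{R})$ is increasing with $\psi'(t)\ne 0$ for all $t$; $\Psi(t,s)=\psi(t)-\psi(s)$. All vector integrals are Bochner integrals. Fractional integral: $I^{\delta;\psi}_{a+}f(t)=\frac{1}{\Gamma(\delta)}\int_a^t\psi'(s)(\Psi(t,s))^{\delta-1}f(s)\,ds$ for $\delta>0$, and $I^{0;\psi}_{a+}f=f$. The $\psi$-Hilfer derivative is ${}^{H}D^{\alpha,\beta;\psi}_{a+}f=I^{\beta(1-\alpha);\psi}_{a+}\left(\frac{1}{\psi'(t)}\frac{d}{dt}\right)I^{(1-\beta)(1-\alpha);\psi}_{a+}f$ (the control system is understood through the mild solutions below). Space: $C^{1-\gamma;\psi}([a,b],X)=\{q\in C((a,b],X):(\Psi(t,a))^{1-\gamma}q(t)\in C([a,b],X)\}$ (i.e. $t\mapsto(\Psi(t,a))^{1-\gamma}q(t)$ extends continuously to $[a,b]$) with norm $\sup_t\|(\Psi(t,a))^{1-\gamma}q(t)\|$. Operators: for $t>0$, $P_\alpha(t)=\int_0^\infty\alpha\theta M_\alpha(\theta)T(t^\alpha\theta)\,d\theta$, where $M_\alpha(\theta)=\sum_{n=1}^\infty\frac{(-\theta)^{n-1}}{(n-1)!\,\Gamma(1-\alpha n)}$ is the Wright (Mainardi) function for $0<\alpha<1$, and $P_1(t)=T(t)$ when $\alpha=1$; $K_\alpha(t)=t^{\alpha-1}P_\alpha(t)$;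 $S_{\alpha,\beta}(t)=\frac{1}{\Gamma(\gamma-\alpha)}\int_0^t(t-s)^{\gamma-\alpha-1}K_\alpha(s)\,ds$ (strong integral) if $\gamma>\alpha$, and $S_{\alpha,\beta}(t)=K_\alpha(t)$ if $\gamma=\alpha$. Mild solution: $(q,u)\in C^{1-\gamma;\psi}([a,b],X)\times L^2([a,b],Y)$ is a mild solution of the feedback control system if $q(t)=S_{\alpha,\beta}(\Psi(t,a))x_0+\int_a^tK_\alpha(\Psi(t,s))Bu(s)\psi'(s)\,ds$ for $t\in(a,b]$ and $u(t)\in U(t,q(t))$ for a.e. $t\in[a,b]$. Measurability of $U$: for every closed $V\subset Y$, the set $\{(t,x):U(t,x)\cap V\ne\emptyset\}$ belongs to the product of the Lebesgue $\sigma$-algebra of $[a,b]$ and the Borel $\sigma$-algebra of $X$.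
   Formalization: The values U(t,x) are assumed nonempty and closed (without closedness the claim fails: X=Y=R, T=I, α=1, U=(0,1], h=u has infimum 0 not attained); that J is real-valued, i.e. h(t,q(t),u(t)) is integrable for all (q,u) in the space, is stated as a hypothesis. *)

theory Defs
  imports "HOL-Analysis.Analysis"
begin

text \<open>
  The Bochner integral of the library is restricted to second-countable spaces. The following is
  the same definition for an arbitrary normed space: approximation in \<open>L\<^sup>1\<close> by integrable simple
  functions, which for a function on a non-separable space also enforces strong measurability.
\<close>

definition has_bochner :: "'a measure \<Rightarrow> ('a \<Rightarrow> 'b::real_normed_vector) \<Rightarrow> 'b \<Rightarrow> bool" where
  "has_bochner M f x \<longleftrightarrow> f \<in> borel_measurable M \<and>
     (\<exists>s. (\<forall>i. Bochner_Integration.simple_bochner_integrable M (s i)) \<and>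
          (\<lambda>i. \<integral>\<^sup>+ y. ennreal (norm (f y - s i y)) \<partial>M) \<longlonglongrightarrow> 0 \<and>
          (\<lambda>i. Bochner_Integration.simple_bochner_integral M (s i)) \<longlonglongrightarrow> x)"

lemma has_bochner_eq_library:
  fixes f :: "'a \<Rightarrow> 'b::{real_normed_vector, second_countable_topology}"
  shows "has_bochner M f x \<longleftrightarrow> has_bochner_integral M f x"
  unfolding has_bochner_def has_bochner_integral.simps by blast

definition bochner :: "'a measure \<Rightarrow> ('a \<Rightarrow> 'b::real_normed_vector) \<Rightarrow> 'b" where
  "bochner M f = (if \<exists>x. has_bochner M f x then THE x. has_bochner M f x else 0)"

definition L1_nonneg :: "real \<Rightarrow> real \<Rightarrow> (real \<Rightarrow> real) \<Rightarrow> bool" where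
  "L1_nonneg a b k \<longleftrightarrow> integrable (lebesgue_on {a..b}) k \<and> (\<forall>t\<in>{a..b}. 0 \<le> k t)"

definition L2 :: "real \<Rightarrow> real \<Rightarrow> (real \<Rightarrow> 'y::{real_normed_vector, second_countable_topology}) set" where
  "L2 a b = {u. u \<in> borel_measurable (lebesgue_on {a..b}) \<and>
                integrable (lebesgue_on {a..b}) (\<lambda>t. (norm (u t))\<^sup>2)}"

definition L2_nonneg :: "real \<Rightarrow> real \<Rightarrow> (real \<Rightarrow> real) \<Rightarrow> bool" where
  "L2_nonneg a b k \<longleftrightarrow> k \<in> L2 a b \<and> (\<forall>t\<in>{a..b}. 0 \<le> k t)"

text \<open>Both are extended-real valued and are only used on nonempty sets.\<close>

definition set_norm :: "'y::real_normed_vector set \<Rightarrow> ereal" where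
  "set_norm V = (SUP v\<in>V. ereal (norm v))"

definition hausdorff_dist :: "'y::metric_space set \<Rightarrow> 'y set \<Rightarrow> ereal" where
  "hausdorff_dist V W = max (SUP v\<in>V. ereal (infdist v W)) (SUP w\<in>W. ereal (infdist w V))"

definition lower_semicontinuous :: "('z::topological_space \<Rightarrow> real) \<Rightarrow> bool" where
  "lower_semicontinuous f \<longleftrightarrow> (\<forall>x c. c < f x \<longrightarrow> (\<forall>\<^sub>F y in nhds x. c < f y))"

text \<open>Only the values at \<open>t \<ge> 0\<close> of a semigroup are relevant.\<close>

definition C0_semigroup :: "(real \<Rightarrow> 'x::real_normed_vector \<Rightarrow>\<^sub>L 'x) \<Rightarrow> bool" where
  "C0_semigroup T \<longleftrightarrow>
     T 0 = id_blinfun \<and>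
     (\<forall>s\<ge>0. \<forall>t\<ge>0. T (s + t) = T s o\<^sub>L T t) \<and>
     (\<forall>x. ((\<lambda>t. blinfun_apply (T t) x) \<longlongrightarrow> x) (at_right 0))"

text \<open>An unbounded operator is given by its domain \<open>D\<close> and a function used only on \<open>D\<close>.\<close>

definition generates ::
  "'x set \<Rightarrow> ('x \<Rightarrow> 'x) \<Rightarrow> (real \<Rightarrow> 'x::real_normed_vector \<Rightarrow>\<^sub>L 'x) \<Rightarrow> bool" where
  "generates D A T \<longleftrightarrow> C0_semigroup T \<and>
     D = {x. \<exists>y. ((\<lambda>t. (1 / t) *\<^sub>R (blinfun_apply (T t) x - x)) \<longlongrightarrow> y) (at_right 0)} \<and>
     (\<forall>x\<in>D. ((\<lambda>t. (1 / t) *\<^sub>R (blinfun_apply (T t) x - x)) \<longlongrightarrow> A x) (at_right 0))"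

definition compact_operator ::
  "('x::real_normed_vector \<Rightarrow>\<^sub>L 'z::real_normed_vector) \<Rightarrow> bool" where
  "compact_operator L \<longleftrightarrow> (\<forall>S. bounded S \<longrightarrow> compact (closure (blinfun_apply L ` S)))"

text \<open>
  The Mainardi function, with the series index shifted to start at 0; \<open>rGamma\<close> is the entire
  function \<open>1/\<Gamma>\<close>, so terms at the poles of \<open>\<Gamma>\<close> vanish.
\<close>

definition wright_M :: "real \<Rightarrow> real \<Rightarrow> real" where
  "wright_M \<alpha> \<theta> = (\<Sum>n. (- \<theta>) ^ n / fact n * rGamma (1 - \<alpha> * real (Suc n)))"

text \<open>The operator-valued integrals are strong ones, hence defined pointwise.\<close>

definition P_op ::
  "(real \<Rightarrow> 'x::real_normed_vector \<Rightarrow>\<^sub>L 'x) \<Rightarrow> real \<Rightarrow> real \<Rightarrow> 'x \<Rightarrow> 'x" where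
  "P_op T \<alpha> t x =
     (if \<alpha> = 1 then blinfun_apply (T t) x
      else bochner (lebesgue_on {0..})
             (\<lambda>\<theta>. (\<alpha> * \<theta> * wright_M \<alpha> \<theta>) *\<^sub>R blinfun_apply (T (t powr \<alpha> * \<theta>)) x))"

definition K_op ::
  "(real \<Rightarrow> 'x::real_normed_vector \<Rightarrow>\<^sub>L 'x) \<Rightarrow> real \<Rightarrow> real \<Rightarrow> 'x \<Rightarrow> 'x" where
  "K_op T \<alpha> t x = (t powr (\<alpha> - 1)) *\<^sub>R P_op T \<alpha> t x"

text \<open>Here \<open>\<gamma> = \<alpha> + \<beta> (1 - \<alpha>)\<close>, so that always \<open>\<gamma> \<ge> \<alpha>\<close>.\<close>

definition S_op ::
  "(real \<Rightarrow> 'x::real_normed_vector \<Rightarrow>\<^sub>L 'x) \<Rightarrow> real \<Rightarrow> real \<Rightarrow> real \<Rightarrow> 'x \<Rightarrow> 'x" where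
  "S_op T \<alpha> \<beta> t x =
     (let \<gamma> = \<alpha> + \<beta> * (1 - \<alpha>) in
      if \<gamma> = \<alpha> then K_op T \<alpha> t x
      else (1 / Gamma (\<gamma> - \<alpha>)) *\<^sub>R
             bochner (lebesgue_on {0..t}) (\<lambda>s. ((t - s) powr (\<gamma> - \<alpha> - 1)) *\<^sub>R K_op T \<alpha> s x))"

text \<open>
  The weighted space \<open>C\<^bsup>1-\<gamma>;\<psi>\<^esup>([a,b],X)\<close>. Its members are functions on \<open>(a,b]\<close>, here extended
  arbitrarily to the real line; likewise members of \<^const>\<open>L2\<close> matter only almost everywhere
  on \<open>[a,b]\<close>.
\<close>

definition C_weighted ::
  "real \<Rightarrow> real \<Rightarrow> (real \<Rightarrow> real) \<Rightarrow> real \<Rightarrow> (real \<Rightarrow> 'x::real_normed_vector) set" where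
  "C_weighted a b \<psi> \<gamma> = {q. continuous_on {a<..b} q \<and>
     (\<exists>g. continuous_on {a..b} g \<and>
          (\<forall>t\<in>{a<..b}. g t = ((\<psi> t - \<psi> a) powr (1 - \<gamma>)) *\<^sub>R q t))}"

text \<open>The set \<open>R\<^sub>U(x\<^sub>0)\<close>; the argument \<open>\<psi>'\<close> is the derivative of \<open>\<psi>\<close>.\<close>

definition mild_solutions ::
  "real \<Rightarrow> real \<Rightarrow> (real \<Rightarrow> real) \<Rightarrow> (real \<Rightarrow> real) \<Rightarrow> real \<Rightarrow> real \<Rightarrow>
   (real \<Rightarrow> 'x::real_normed_vector \<Rightarrow>\<^sub>L 'x) \<Rightarrow>
   ('y::{real_normed_vector, second_countable_topology} \<Rightarrow>\<^sub>L 'x) \<Rightarrow>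
   (real \<Rightarrow> 'x \<Rightarrow> 'y set) \<Rightarrow> 'x \<Rightarrow> ((real \<Rightarrow> 'x) \<times> (real \<Rightarrow> 'y)) set" where
  "mild_solutions a b \<psi> \<psi>' \<alpha> \<beta> T B U x0 =
     {(q, u). q \<in> C_weighted a b \<psi> (\<alpha> + \<beta> * (1 - \<alpha>)) \<and> u \<in> L2 a b \<and>
        (\<forall>t\<in>{a<..b}. q t = S_op T \<alpha> \<beta> (\<psi> t - \<psi> a) x0 +
            bochner (lebesgue_on {a..t})
              (\<lambda>s. \<psi>' s *\<^sub>R K_op T \<alpha> (\<psi> t - \<psi> s) (blinfun_apply B (u s)))) \<and>
        (AE t in lebesgue_on {a..b}. u t \<in> U t (q t))}"

definition cost ::
  "real \<Rightarrow> real \<Rightarrow> (real \<Rightarrow> 'x \<Rightarrow> 'y \<Rightarrow> real) \<Rightarrow> (real \<Rightarrow> 'x) \<Rightarrow> (real \<Rightarrow> 'y) \<Rightarrow> real" where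
  "cost a b h q u = (\<integral>t. h t (q t) (u t) \<partial>lebesgue_on {a..b})"

end

theory Submission
  imports Defs "HOL-Complex_Analysis.Complex_Analysis" "HOL-Real_Asymp.Real_Asymp"
begin

text \<open>
  A mild solution is determined by its control \<open>u\<close>: its state is \<open>s0 + Q u\<close>, where
  \<open>s0 t = S\<^sub>\<alpha>\<^sub>,\<^sub>\<beta> (\<psi> t - \<psi> a) x0\<close> is the free motion and \<open>Q\<close> is the linear Volterra operator with the kernel
  \<open>\<psi>' s K\<^sub>\<alpha> (\<psi> t - \<psi> s) B\<close>. So the cost has to be minimized over the controls \<open>u\<close> in \<open>L\<^sup>2\<close> with
  \<open>u t \<in> U t (s0 t + Q u t)\<close> for almost every \<open>t\<close>, and this is done by the direct method.

  \<^emph>\<open>Compactness.\<close> By a shift of its Hankel contour the Wright function decays faster than every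
  exponential (\<open>wright_M_decay\<close>). So \<open>P\<^sub>\<alpha>\<close> is an absolutely convergent mean of the compact semigroup,
  whatever its growth: it is strongly continuous, and away from \<open>0\<close> it is compact and norm continuous
  (\<open>P_op_regular\<close>). The kernel of \<open>Q\<close> has the singularity \<open>(t - s)\<^sup>\<alpha>\<^sup>-\<^sup>1\<close>, which is square integrable
  because \<open>\<alpha> > 1 / 2\<close>; consequently \<open>Q\<close> maps bounded sets of \<open>L\<^sup>2\<close> to relatively compact sets of continuous
  functions (\<open>Q_subsequence\<close>). The state space is separable because the semigroup is compact
  (\<open>separable\<close>), and so the vector integral has its usual properties.

  \<^emph>\<open>Solutions.\<close> The growth condition on \<open>U\<close> and a Volterra inequality bound all solutions by one function
  in \<open>L\<^sup>2\<close> (\<open>a_priori_bound\<close>). The bound also holds for the problem with a delayed state, which is solved by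
  finitely many steps with the measurable selection of minimal norm (\<open>delayed_solution\<close>). Letting the
  delay tend to \<open>0\<close> yields a solution (\<open>admissible_exists\<close>). The passage to the limit is the closedness
  result \<open>solutions_closed\<close>: the states converge uniformly along a subsequence, convex combinations of
  the tails of the controls converge almost everywhere by Mazur's lemma (\<open>Mazur_dominated\<close>), and the limit
  control is a selection of \<open>U\<close> since \<open>U t x\<close> is closed and convex and depends continuously on \<open>x\<close>.

  \<^emph>\<open>Cost.\<close> For a minimizing sequence the states and controls converge in the same sense. On \<open>[a + \<epsilon>, b]\<close>
  the states are bounded, the growth condition on \<open>h\<close> provides an integrable majorant, and the cost is
  lower semicontinuous because \<open>h\<close> is Lipschitz continuous in the state and convex and lower
  semicontinuous in the control. Near \<open>a\<close> the states may be unbounded and there is no majorant. There the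
  integrals are uniformly small because the cost is finite for all pairs, by a gliding hump argument:
  if the integrals were not small, then parts of the given states and controls could be glued to a
  pair for which the cost integrand is not integrable (\<open>uniformly_small_near_start\<close>).
\<close>

section \<open>The Bochner integral in a separable Banach space\<close>

abbreviation (input) sbi where "sbi \<equiv> Bochner_Integration.simple_bochner_integrable"
abbreviation (input) sbint where "sbint \<equiv> Bochner_Integration.simple_bochner_integral"

lemma measurable_simple_compose:
  assumes s: "simple_function M s" and h: "\<And>v. h v \<in> measurable M N"
  shows "(\<lambda>x. h (s x) x) \<in> measurable M N"
proof (rule measurable_compose_countable'[where I = "s ` space M"])
  show "s \<in> measurable M (count_space (s ` space M))"
    using s by (auto simp: simple_function_def measurable_count_space_eq2)
  show "countable (s ` space M)" using s by (auto simp: simple_function_def countable_finite)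
qed (use h in auto)

lemma has_bochner_restrict_space:
  assumes \<Omega>: "\<Omega> \<inter> space M \<in> sets M" and h: "has_bochner (restrict_space M \<Omega>) f x"
  shows "has_bochner M (\<lambda>y. indicator \<Omega> y *\<^sub>R f y) x"
proof -
  obtain s where f: "f \<in> borel_measurable (restrict_space M \<Omega>)"
    and s: "\<And>i. sbi (restrict_space M \<Omega>) (s i)"
    and l: "(\<lambda>i. \<integral>\<^sup>+ y. ennreal (norm (f y - s i y)) \<partial>restrict_space M \<Omega>) \<longlonglongrightarrow> 0"
    and x: "(\<lambda>i. sbint (restrict_space M \<Omega>) (s i)) \<longlonglongrightarrow> x"
    using h unfolding has_bochner_def by blast
  have nn: "(\<integral>\<^sup>+ y. ennreal (norm (f y - s i y)) \<partial>restrict_space M \<Omega>) =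
        (\<integral>\<^sup>+ y. ennreal (norm (indicator \<Omega> y *\<^sub>R f y - indicator \<Omega> y *\<^sub>R s i y)) \<partial>M)" for i
    by (subst nn_integral_restrict_space[OF \<Omega>]) (auto intro!: nn_integral_cong simp: indicator_def)
  show ?thesis
    unfolding has_bochner_def
  proof (intro conjI exI[of _ "\<lambda>i y. indicator \<Omega> y *\<^sub>R s i y"] allI)
    show "(\<lambda>y. indicator \<Omega> y *\<^sub>R f y) \<in> borel_measurable M"
      using f borel_measurable_restrict_space_iff[OF \<Omega>] by blast
    show "sbi M (\<lambda>y. indicator \<Omega> y *\<^sub>R s i y)" for i
      using s simple_bochner_integrable_restrict_space[OF \<Omega>] by blast
    show "(\<lambda>i. \<integral>\<^sup>+ y. ennreal (norm (indicator \<Omega> y *\<^sub>R f y - indicator \<Omega> y *\<^sub>R s i y)) \<partial>M) \<longlonglongrightarrow> 0"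
      using l unfolding nn .
    show "(\<lambda>i. sbint M (\<lambda>y. indicator \<Omega> y *\<^sub>R s i y)) \<longlonglongrightarrow> x"
      using x unfolding simple_bochner_integral_restrict_space[OF \<Omega> s] .
  qed
qed

lemma has_bochner_linear:
  assumes "bounded_linear L" and h: "has_bochner M f x"
  shows "has_bochner M (\<lambda>y. L (f y)) (L x)"
proof -
  interpret L: bounded_linear L by fact
  obtain K where K: "\<And>x. norm (L x) \<le> norm x * K" "K \<ge> 0" using L.nonneg_bounded by blast
  obtain s where f: "f \<in> borel_measurable M" and s: "\<And>i. sbi M (s i)"
    and l: "(\<lambda>i. \<integral>\<^sup>+ y. ennreal (norm (f y - s i y)) \<partial>M) \<longlonglongrightarrow> 0"
    and x: "(\<lambda>i. sbint M (s i)) \<longlonglongrightarrow> x"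
    using h unfolding has_bochner_def by blast
  have 1: "sbi M (\<lambda>y. L (s i y))" for i
    using simple_bochner_integrable_compose2[OF _ s[of i] s[of i], of "\<lambda>y z. L y"] by (simp add: L.zero)
  have 2: "sbint M (\<lambda>y. L (s i y)) = L (sbint M (s i))" for i
    by (rule simple_bochner_integral_linear[OF L.linear s])
  have "(\<lambda>i. ennreal K * (\<integral>\<^sup>+ y. ennreal (norm (f y - s i y)) \<partial>M)) \<longlonglongrightarrow> ennreal K * 0"
    by (intro tendsto_mult_ennreal tendsto_const l) auto
  then have u: "(\<lambda>i. ennreal K * (\<integral>\<^sup>+ y. ennreal (norm (f y - s i y)) \<partial>M)) \<longlonglongrightarrow> 0" by simp
  have 3: "(\<lambda>i. \<integral>\<^sup>+ y. ennreal (norm (L (f y) - L (s i y))) \<partial>M) \<longlonglongrightarrow> 0"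
  proof (rule tendsto_sandwich[OF _ _ tendsto_const u])
    show "\<forall>\<^sub>F n in sequentially. (\<integral>\<^sup>+ y. ennreal (norm (L (f y) - L (s n y))) \<partial>M) \<le>
       ennreal K * (\<integral>\<^sup>+ y. ennreal (norm (f y - s n y)) \<partial>M)"
    proof (intro always_eventually allI)
      fix n
      have "simple_function M (s n)" using s[of n] by (auto elim: simple_bochner_integrable.cases)
      have m: "(\<lambda>y. norm (f y - s n y)) \<in> borel_measurable M"
      proof (rule measurable_simple_compose[where h = "\<lambda>v y. norm (f y - v)", OF \<open>simple_function M (s n)\<close>])
        show "(\<lambda>y. norm (f y - v)) \<in> borel_measurable M" for v
          by (rule measurable_compose[OF f]) (intro borel_measurable_continuous_onI continuous_intros)
      qed
      have "(\<integral>\<^sup>+ y. ennreal (norm (L (f y) - L (s n y))) \<partial>M)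
          \<le> (\<integral>\<^sup>+ y. ennreal K * ennreal (norm (f y - s n y)) \<partial>M)"
        by (intro nn_integral_mono)
           (use K in \<open>auto simp: L.diff[symmetric] ennreal_mult[symmetric] mult.commute intro!: ennreal_leI\<close>)
      also have "\<dots> = ennreal K * (\<integral>\<^sup>+ y. ennreal (norm (f y - s n y)) \<partial>M)"
        using m by (intro nn_integral_cmult) auto
      finally show "(\<integral>\<^sup>+ y. ennreal (norm (L (f y) - L (s n y))) \<partial>M) \<le>
       ennreal K * (\<integral>\<^sup>+ y. ennreal (norm (f y - s n y)) \<partial>M)" .
    qed
  qed auto
  have 4: "(\<lambda>y. L (f y)) \<in> borel_measurable M"
    by (rule measurable_compose[OF f])
       (intro borel_measurable_continuous_onI L.continuous_on continuous_on_id)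
  show ?thesis unfolding has_bochner_def using 1 3 4 2 L.tendsto[OF x]
    by (intro conjI exI[of _ "\<lambda>i y. L (s i y)"]) auto
qed

text \<open>Absolute integrability; it implies integrability as soon as the space is separable.\<close>

definition abs_int :: "'a measure \<Rightarrow> ('a \<Rightarrow> 'b::real_normed_vector) \<Rightarrow> bool" where
  "abs_int M f \<longleftrightarrow> f \<in> borel_measurable M \<and> integrable M (\<lambda>x. norm (f x))"

locale separable_banach =
  fixes D :: "'x::banach set"
  assumes countable_D: "countable D" and dense_D: "closure D = UNIV"
begin

text \<open>The value \<open>s i x\<close> is a point nearest to \<open>f x\<close> among \<open>0\<close> and the first \<open>i\<close> points of the dense
  set; the presence of \<open>0\<close> gives the bound \<open>2 \<parallel>f x\<parallel>\<close>.\<close>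

lemma simple_approximation:
  assumes f: "(f :: 'a \<Rightarrow> 'x) \<in> borel_measurable M"
  obtains s where "\<And>i. simple_function M (s i)" "\<And>x. (\<lambda>i. s i x) \<longlonglongrightarrow> f x"
    "\<And>i x. norm (s i x) \<le> 2 * norm (f x)"
proof -
  have D: "D \<noteq> {}" using dense_D by auto
  define e where "e = (\<lambda>i. case i of 0 \<Rightarrow> 0 | Suc j \<Rightarrow> from_nat_into D j)"
  define P where "P = (\<lambda>i x j. j \<le> i \<and> (\<forall>l\<in>{..i}. dist (f x) (e j) \<le> dist (f x) (e l)))"
  define m where "m = (\<lambda>i x. LEAST j. P i x j)"
  have ex: "\<exists>j. P i x j" for i x
  proof -
    have "Min ((\<lambda>l. dist (f x) (e l)) ` {..i}) \<in> (\<lambda>l. dist (f x) (e l)) ` {..i}" by (intro Min_in) auto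
    then obtain j where "j \<le> i" "dist (f x) (e j) = Min ((\<lambda>l. dist (f x) (e l)) ` {..i})"
      unfolding image_iff by (metis atMost_iff)
    then show ?thesis unfolding P_def by (intro exI[of _ j]) auto
  qed
  have Pm: "P i x (m i x)" for i x unfolding m_def by (rule LeastI_ex[OF ex])
  have m_le: "m i x \<le> i" for i x using Pm[of i x] unfolding P_def by blast
  have m_min: "dist (f x) (e (m i x)) \<le> dist (f x) (e l)" if "l \<le> i" for i x l
    using Pm[of i x] that unfolding P_def by blast
  have [measurable]: "(\<lambda>x. dist (f x) c) \<in> borel_measurable M" for c
    by (rule measurable_compose[OF f]) (intro borel_measurable_continuous_onI continuous_intros)
  have mm: "m i \<in> measurable M (count_space UNIV)" for i
    unfolding m_def P_def by measurable
  have "simple_function M (m i)" for i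
  proof -
    have "finite (m i ` space M)" by (rule finite_subset[of _ "{..i}"]) (use m_le in auto)
    moreover have "m i -` {y} \<inter> space M \<in> sets M" for y
      using mm[of i] by (rule measurable_sets) auto
    ultimately show ?thesis by (auto simp: simple_function_def)
  qed
  then have s: "simple_function M (\<lambda>x. e (m i x))" for i by (rule simple_function_compose1)
  have b: "norm (e (m i x)) \<le> 2 * norm (f x)" for i x
  proof -
    have "dist (f x) (e (m i x)) \<le> dist (f x) (e 0)" by (rule m_min) simp
    then have "norm (f x - e (m i x)) \<le> norm (f x)" by (simp add: dist_norm e_def)
    then show ?thesis
      using norm_triangle_ineq2[of "e (m i x)" "f x"] norm_minus_commute[of "f x" "e (m i x)"] by linarith
  qed
  have c: "(\<lambda>i. e (m i x)) \<longlonglongrightarrow> f x" for x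
  proof (rule metric_LIMSEQ_I)
    fix r :: real assume r: "0 < r"
    have "f x \<in> closure D" unfolding dense_D by (rule UNIV_I)
    then obtain d where d: "d \<in> D" "dist d (f x) < r"
      using r unfolding closure_approachable by blast
    from from_nat_into_surj[OF countable_D d(1)] obtain n where n: "from_nat_into D n = d" ..
    have "dist (e (m i x)) (f x) < r" if "i \<ge> Suc n" for i
    proof -
      have "dist (f x) (e (m i x)) \<le> dist (f x) (e (Suc n))" using that by (rule m_min)
      also have "\<dots> < r" using d n by (simp add: e_def dist_commute)
      finally show ?thesis by (simp add: dist_commute)
    qed
    then show "\<exists>no. \<forall>n\<ge>no. dist (e (m n x)) (f x) < r" by blast
  qed
  show thesis using that[of "\<lambda>i x. e (m i x)"] s c b by blast
qed

text \<open>Joint measurability for a function that is continuous in one variable: by pointwise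
  approximation it suffices to insert simple functions.\<close>

lemma caratheodory_measurable:
  fixes h :: "'x \<Rightarrow> 'a \<Rightarrow> 'z::metric_space"
  assumes f: "f \<in> borel_measurable M" and h: "\<And>v. h v \<in> borel_measurable M"
    and c: "\<And>x. x \<in> space M \<Longrightarrow> continuous_on UNIV (\<lambda>v. h v x)"
  shows "(\<lambda>x. h (f x) x) \<in> borel_measurable M"
proof -
  obtain s where s: "\<And>i. simple_function M (s i)" "\<And>x. (\<lambda>i. s i x) \<longlonglongrightarrow> f x"
    using simple_approximation[OF f] by metis
  show ?thesis
  proof (rule borel_measurable_LIMSEQ_metric)
    show "(\<lambda>x. h (s i x) x) \<in> borel_measurable M" for i
      by (rule measurable_simple_compose[OF s(1) h])
    show "(\<lambda>i. h (s i x) x) \<longlonglongrightarrow> h (f x) x" if "x \<in> space M" for x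
      by (rule continuous_on_tendsto_compose[OF c[OF that] s(2)]) auto
  qed
qed

lemma measurable_diff:
  assumes f: "(f :: 'a \<Rightarrow> 'x) \<in> borel_measurable M" and g: "g \<in> borel_measurable M"
  shows "(\<lambda>x. f x - g x) \<in> borel_measurable M"
  by (rule caratheodory_measurable[OF f, where h = "\<lambda>v x. v - g x"])
     (intro measurable_compose[OF g] borel_measurable_continuous_onI continuous_intros)+

lemma measurable_add:
  assumes f: "(f :: 'a \<Rightarrow> 'x) \<in> borel_measurable M" and g: "g \<in> borel_measurable M"
  shows "(\<lambda>x. f x + g x) \<in> borel_measurable M"
  by (rule caratheodory_measurable[OF f, where h = "\<lambda>v x. v + g x"])
     (intro measurable_compose[OF g] borel_measurable_continuous_onI continuous_intros)+

lemma measurable_scaleR: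
  assumes f: "(f :: 'a \<Rightarrow> 'x) \<in> borel_measurable M" and g: "g \<in> borel_measurable M"
  shows "(\<lambda>x. (g x :: real) *\<^sub>R f x) \<in> borel_measurable M"
  by (rule caratheodory_measurable[OF f, where h = "\<lambda>v x. g x *\<^sub>R v"])
     (intro measurable_compose[OF g] borel_measurable_continuous_onI continuous_intros)+

lemma measurable_norm: "(f :: 'a \<Rightarrow> 'x) \<in> borel_measurable M \<Longrightarrow> (\<lambda>x. norm (f x)) \<in> borel_measurable M"
  by (rule measurable_compose[of f _ borel], assumption)
     (intro borel_measurable_continuous_onI continuous_on_norm_id)

text \<open>Passing to the limit in simple approximations of both integrands. With \<open>f = g\<close> this is
  uniqueness of the integral; the other case of interest is the triangle inequality.\<close>

lemma has_bochner_diff_bound: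
  assumes f: "has_bochner M f (x :: 'x)" and g: "has_bochner M g y"
  shows "ennreal (norm (x - y)) \<le> (\<integral>\<^sup>+ z. ennreal (norm (f z - g z)) \<partial>M)"
proof -
  obtain s where fm: "f \<in> borel_measurable M" and s: "\<And>i. sbi M (s i)"
    and s0: "(\<lambda>i. \<integral>\<^sup>+ y. ennreal (norm (f y - s i y)) \<partial>M) \<longlonglongrightarrow> 0"
    and sx: "(\<lambda>i. sbint M (s i)) \<longlonglongrightarrow> x"
    using f unfolding has_bochner_def by blast
  obtain t where gm: "g \<in> borel_measurable M" and t: "\<And>i. sbi M (t i)"
    and t0: "(\<lambda>i. \<integral>\<^sup>+ y. ennreal (norm (g y - t i y)) \<partial>M) \<longlonglongrightarrow> 0"
    and ty: "(\<lambda>i. sbint M (t i)) \<longlonglongrightarrow> y"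
    using g unfolding has_bochner_def by blast
  have sm: "s i \<in> borel_measurable M" "t i \<in> borel_measurable M" for i
    using s t by (auto intro: borel_measurable_simple_function elim: simple_bochner_integrable.cases)
  have [measurable]: "(\<lambda>z. norm (f z - s i z)) \<in> borel_measurable M"
    "(\<lambda>z. norm (f z - g z)) \<in> borel_measurable M" "(\<lambda>z. norm (g z - t i z)) \<in> borel_measurable M" for i
    using fm gm sm by (auto intro!: measurable_norm measurable_diff)
  let ?I = "\<integral>\<^sup>+ z. ennreal (norm (f z - g z)) \<partial>M"
  have *: "ennreal (norm (sbint M (s i) - sbint M (t i))) \<le>
     (\<integral>\<^sup>+ y. ennreal (norm (f y - s i y)) \<partial>M) + ?I + (\<integral>\<^sup>+ y. ennreal (norm (g y - t i y)) \<partial>M)" for i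
  proof -
    have "ennreal (norm (sbint M (s i) - sbint M (t i))) = norm (sbint M (\<lambda>x. s i x - t i x))"
      using s t by (subst simple_bochner_integral_diff) auto
    also have "\<dots> \<le> sbint M (\<lambda>x. norm (s i x - t i x))"
      using simple_bochner_integrable_compose2[of "(-)" M "s i" "t i"] s t
      by (auto intro!: simple_bochner_integral_norm_bound)
    also have "\<dots> = (\<integral>\<^sup>+x. norm (s i x - t i x) \<partial>M)"
      using simple_bochner_integrable_compose2[of "\<lambda>x y. norm (x - y)" M "s i" "t i"] s t
      by (auto intro!: simple_bochner_integral_eq_nn_integral)
    also have "\<dots> \<le> (\<integral>\<^sup>+x. ennreal (norm (f x - s i x)) + ennreal (norm (f x - g x)) +
        ennreal (norm (g x - t i x)) \<partial>M)"
    proof (rule nn_integral_mono)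
      fix x
      have "s i x - t i x = (f x - g x) - (f x - s i x) + (g x - t i x)" by simp
      then have "norm (s i x - t i x) \<le> norm (f x - s i x) + norm (f x - g x) + norm (g x - t i x)"
        using norm_triangle_ineq[of "(f x - g x) - (f x - s i x)" "g x - t i x"]
          norm_triangle_ineq4[of "f x - g x" "f x - s i x"] by simp
      then show "ennreal (norm (s i x - t i x)) \<le> ennreal (norm (f x - s i x)) +
          ennreal (norm (f x - g x)) + ennreal (norm (g x - t i x))"
        by (simp add: ennreal_plus[symmetric] ennreal_leI del: ennreal_plus)
    qed
    also have "\<dots> = (\<integral>\<^sup>+ y. ennreal (norm (f y - s i y)) \<partial>M) + ?I +
        (\<integral>\<^sup>+ y. ennreal (norm (g y - t i y)) \<partial>M)"
      by (simp add: nn_integral_add)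
    finally show ?thesis .
  qed
  have r: "(\<lambda>i. (\<integral>\<^sup>+ y. ennreal (norm (f y - s i y)) \<partial>M) + ?I +
      (\<integral>\<^sup>+ y. ennreal (norm (g y - t i y)) \<partial>M)) \<longlonglongrightarrow> 0 + ?I + 0"
    by (intro tendsto_add s0 t0 tendsto_const)
  have l: "(\<lambda>i. ennreal (norm (sbint M (s i) - sbint M (t i)))) \<longlonglongrightarrow> ennreal (norm (x - y))"
    by (intro tendsto_ennrealI tendsto_norm tendsto_diff sx ty)
  show ?thesis using LIMSEQ_le[OF l r] * by auto
qed

lemma bochner_eqI: "has_bochner M f (x :: 'x) \<Longrightarrow> bochner M f = x"
proof -
  assume h: "has_bochner M f x"
  have "y = x" if "has_bochner M f y" for y
    using has_bochner_diff_bound[OF that h] by simp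
  then have "(THE y. has_bochner M f y) = x" using h by (intro the_equality)
  with h show ?thesis unfolding bochner_def by (simp add: exI[of _ x])
qed

text \<open>The integrals of the simple approximations form a Cauchy sequence, and the space is complete.\<close>

lemma has_bochner_bochner:
  assumes "abs_int M (f :: 'a \<Rightarrow> 'x)"
  shows "has_bochner M f (bochner M f)"
proof -
  have f: "f \<in> borel_measurable M" and i: "integrable M (\<lambda>x. norm (f x))"
    using assms by (auto simp: abs_int_def)
  obtain s where s: "\<And>i. simple_function M (s i)" "\<And>x. (\<lambda>i. s i x) \<longlonglongrightarrow> f x"
    "\<And>i x. norm (s i x) \<le> 2 * norm (f x)"
    using simple_approximation[OF f] by metis
  have sm: "s i \<in> borel_measurable M" for i using s by (auto intro: borel_measurable_simple_function)
  have "(\<integral>\<^sup>+ x. ennreal (norm (f x)) \<partial>M) < \<infinity>"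
    using i by (simp add: integrable_iff_bounded)
  have sb: "sbi M (s i)" for i
  proof (rule simple_bochner_integrableI_bounded[OF s(1)])
    have "integrable M (\<lambda>x. norm (s i x))"
      by (rule Bochner_Integration.integrable_bound[of _ "\<lambda>x. 2 * norm (f x)"])
         (use i s sm in \<open>auto intro!: measurable_norm\<close>)
    then show "(\<integral>\<^sup>+ x. ennreal (norm (s i x)) \<partial>M) < \<infinity>" by (simp add: integrable_iff_bounded)
  qed
  have dm: "(\<lambda>x. norm (f x - s i x)) \<in> borel_measurable M" for i
    using f sm by (intro measurable_norm measurable_diff)
  have dom: "norm (f x - s i x) \<le> 3 * norm (f x)" for i x
    using norm_triangle_ineq4[of "f x" "s i x"] s(3)[of i x] by simp
  have di: "integrable M (\<lambda>x. norm (f x - s i x))" for i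
    by (rule Bochner_Integration.integrable_bound[of _ "\<lambda>x. 3 * norm (f x)"]) (use i dm dom in auto)
  have "(\<lambda>i. \<integral>x. norm (f x - s i x) \<partial>M) \<longlonglongrightarrow> (\<integral>x. 0 \<partial>M)"
  proof (rule integral_dominated_convergence[where w = "\<lambda>x. 3 * norm (f x)"])
    show "AE x in M. (\<lambda>i. norm (f x - s i x)) \<longlonglongrightarrow> 0"
      by (subst norm_minus_commute) (intro AE_I2 tendsto_norm_zero LIM_zero s(2))
  qed (use i dm dom in auto)
  then have "(\<lambda>i. ennreal (\<integral>x. norm (f x - s i x) \<partial>M)) \<longlonglongrightarrow> ennreal (\<integral>x. 0 \<partial>M)"
    by (rule tendsto_ennrealI)
  then have z: "(\<lambda>i. \<integral>\<^sup>+ x. ennreal (norm (f x - s i x)) \<partial>M) \<longlonglongrightarrow> 0"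
    using di by (subst nn_integral_eq_integral) auto
  have "Cauchy (\<lambda>i. sbint M (s i))"
  proof (rule CauchyI)
    fix e :: real assume "e > 0"
    have "norm (sbint M (s m) - sbint M (s n)) \<le> (\<integral>x. norm (f x - s m x) \<partial>M) + (\<integral>x. norm (f x - s n x) \<partial>M)" for m n
    proof -
      have h: "has_bochner M (s i) (sbint M (s i))" for i
        unfolding has_bochner_def using sm sb by (intro conjI exI[of _ "\<lambda>_. s i"]) auto
      have tri: "norm (s m x - s n x) \<le> norm (f x - s m x) + norm (f x - s n x)" for x
        using norm_triangle_ineq4[of "f x - s n x" "f x - s m x"] by (simp add: norm_minus_commute)
      have si: "integrable M (\<lambda>x. norm (s m x - s n x))"
        by (rule Bochner_Integration.integrable_bound[of _ "\<lambda>x. norm (f x - s m x) + norm (f x - s n x)"])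
          (use di sm tri in \<open>auto intro!: measurable_norm measurable_diff\<close>)
      have "ennreal (norm (sbint M (s m) - sbint M (s n))) \<le> (\<integral>\<^sup>+ z. ennreal (norm (s m z - s n z)) \<partial>M)"
        by (rule has_bochner_diff_bound[OF h h])
      also have "\<dots> = ennreal (\<integral>z. norm (s m z - s n z) \<partial>M)"
        using si by (simp add: nn_integral_eq_integral)
      finally have "norm (sbint M (s m) - sbint M (s n)) \<le> (\<integral>z. norm (s m z - s n z) \<partial>M)"
        by (simp add: ennreal_le_iff integral_nonneg_AE)
      also have "\<dots> \<le> (\<integral>z. norm (f z - s m z) + norm (f z - s n z) \<partial>M)"
        by (intro integral_mono si Bochner_Integration.integrable_add di tri)
      also have "\<dots> = (\<integral>x. norm (f x - s m x) \<partial>M) + (\<integral>x. norm (f x - s n x) \<partial>M)"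
        using di by simp
      finally show ?thesis .
    qed
    moreover have "(\<lambda>i. \<integral>x. norm (f x - s i x) \<partial>M) \<longlonglongrightarrow> 0"
      using \<open>(\<lambda>i. \<integral>x. norm (f x - s i x) \<partial>M) \<longlonglongrightarrow> (\<integral>x. 0 \<partial>M)\<close> by simp
    then obtain N where N: "\<And>n. n \<ge> N \<Longrightarrow> norm ((\<integral>x. norm (f x - s n x) \<partial>M) - 0) < e / 2"
      using \<open>e > 0\<close> LIMSEQ_D[of _ 0 "e/2"] half_gt_zero by blast
    ultimately have "norm (sbint M (s m) - sbint M (s n)) < e" if "m \<ge> N" "n \<ge> N" for m n
    proof -
      have "norm (sbint M (s m) - sbint M (s n)) \<le> (\<integral>x. norm (f x - s m x) \<partial>M) + (\<integral>x. norm (f x - s n x) \<partial>M)"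
        by fact
      then show ?thesis using N[OF that(1)] N[OF that(2)] by simp
    qed
    then show "\<exists>N. \<forall>m\<ge>N. \<forall>n\<ge>N. norm (sbint M (s m) - sbint M (s n)) < e" by blast
  qed
  then obtain l where l: "(\<lambda>i. sbint M (s i)) \<longlonglongrightarrow> l" using Cauchy_convergent convergent_def by blast
  have "has_bochner M f l" unfolding has_bochner_def using f sb z l by blast
  with bochner_eqI[OF this] show ?thesis by simp
qed

lemma abs_int_bound:
  assumes "(f :: 'a \<Rightarrow> 'x) \<in> borel_measurable M" "integrable M w" "AE x in M. norm (f x) \<le> w x"
  shows "abs_int M f"
proof -
  have "AE x in M. norm (norm (f x)) \<le> norm (w x)" using assms(3) by eventually_elim simp
  then show ?thesis unfolding abs_int_def
    by (intro conjI Bochner_Integration.integrable_bound[OF assms(2)] assms(1) measurable_norm)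
qed

lemma abs_int_diff:
  assumes "abs_int M (f :: 'a \<Rightarrow> 'x)" "abs_int M g" shows "abs_int M (\<lambda>x. f x - g x)"
  using assms unfolding abs_int_def[of _ f] abs_int_def[of _ g]
  by (intro abs_int_bound[of _ _ "\<lambda>x. norm (f x) + norm (g x)"] measurable_diff
      Bochner_Integration.integrable_add AE_I2 norm_triangle_ineq4) simp_all

lemma abs_int_add:
  assumes "abs_int M (f :: 'a \<Rightarrow> 'x)" "abs_int M g" shows "abs_int M (\<lambda>x. f x + g x)"
  using assms unfolding abs_int_def[of _ f] abs_int_def[of _ g]
  by (intro abs_int_bound[of _ _ "\<lambda>x. norm (f x) + norm (g x)"] measurable_add
      Bochner_Integration.integrable_add AE_I2 norm_triangle_ineq) simp_all

lemma norm_bochner_diff_le: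
  assumes f: "abs_int M (f :: 'a \<Rightarrow> 'x)" and g: "abs_int M g"
  shows "norm (bochner M f - bochner M g) \<le> (\<integral>x. norm (f x - g x) \<partial>M)"
proof -
  have i: "integrable M (\<lambda>x. norm (f x - g x))" using abs_int_diff[OF f g] unfolding abs_int_def by (rule conjunct2)
  have "ennreal (norm (bochner M f - bochner M g)) \<le> ennreal (\<integral>x. norm (f x - g x) \<partial>M)"
    using has_bochner_diff_bound[OF has_bochner_bochner[OF f] has_bochner_bochner[OF g]]
    by (subst (asm) nn_integral_eq_integral[OF i]) auto
  then show ?thesis by (simp add: ennreal_le_iff integral_nonneg_AE)
qed

lemma abs_int_zero: "abs_int M (\<lambda>x. 0 :: 'x)" by (simp add: abs_int_def)

lemma bochner_zero: "bochner M (\<lambda>x. 0 :: 'x) = 0"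
  using has_bochner_linear[OF bounded_linear_zero has_bochner_bochner[OF abs_int_zero, of M]]
  by (intro bochner_eqI) simp

lemma norm_bochner_le:
  assumes f: "abs_int M (f :: 'a \<Rightarrow> 'x)"
  shows "norm (bochner M f) \<le> (\<integral>x. norm (f x) \<partial>M)"
  using norm_bochner_diff_le[OF f abs_int_zero] by (simp add: bochner_zero)

lemma bochner_cong_AE:
  assumes f: "abs_int M (f :: 'a \<Rightarrow> 'x)" and g: "g \<in> borel_measurable M" and e: "AE x in M. f x = g x"
  shows "bochner M f = bochner M g"
proof -
  have g': "abs_int M g"
  proof (rule abs_int_bound[OF g, of "\<lambda>x. norm (f x)"])
    show "AE x in M. norm (g x) \<le> norm (f x)" using e by eventually_elim simp
  qed (use f in \<open>auto simp: abs_int_def\<close>)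
  have "(\<integral>x. norm (f x - g x) \<partial>M) = (\<integral>x. 0 \<partial>M)"
  proof (rule integral_cong_AE)
    show "AE x in M. norm (f x - g x) = 0" using e by eventually_elim simp
  qed (use f g in \<open>auto simp: abs_int_def intro!: measurable_norm measurable_diff\<close>)
  then show ?thesis using norm_bochner_diff_le[OF f g'] by simp
qed

lemma has_bochner_add:
  assumes f: "has_bochner M f (x :: 'x)" and g: "has_bochner M g y"
  shows "has_bochner M (\<lambda>z. f z + g z) (x + y)"
proof -
  obtain s where fm: "f \<in> borel_measurable M" and s: "\<And>i. sbi M (s i)"
    and s0: "(\<lambda>i. \<integral>\<^sup>+ y. ennreal (norm (f y - s i y)) \<partial>M) \<longlonglongrightarrow> 0"
    and sx: "(\<lambda>i. sbint M (s i)) \<longlonglongrightarrow> x"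
    using f unfolding has_bochner_def by blast
  obtain t where gm: "g \<in> borel_measurable M" and t: "\<And>i. sbi M (t i)"
    and t0: "(\<lambda>i. \<integral>\<^sup>+ y. ennreal (norm (g y - t i y)) \<partial>M) \<longlonglongrightarrow> 0"
    and ty: "(\<lambda>i. sbint M (t i)) \<longlonglongrightarrow> y"
    using g unfolding has_bochner_def by blast
  have sm: "s i \<in> borel_measurable M" "t i \<in> borel_measurable M" for i
    using s t by (auto intro: borel_measurable_simple_function elim: simple_bochner_integrable.cases)
  have [measurable]: "(\<lambda>z. norm (f z - s i z)) \<in> borel_measurable M"
    "(\<lambda>z. norm (g z - t i z)) \<in> borel_measurable M" for i
    using fm gm sm by (auto intro!: measurable_norm measurable_diff)
  have u: "(\<lambda>i. (\<integral>\<^sup>+ y. ennreal (norm (f y - s i y)) \<partial>M) + (\<integral>\<^sup>+ y. ennreal (norm (g y - t i y)) \<partial>M)) \<longlonglongrightarrow> 0"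
    using tendsto_add[OF s0 t0] by simp
  have "(\<lambda>i. \<integral>\<^sup>+ y. ennreal (norm ((f y + g y) - (s i y + t i y))) \<partial>M) \<longlonglongrightarrow> 0"
  proof (rule tendsto_sandwich[OF _ _ tendsto_const u])
    show "\<forall>\<^sub>F i in sequentially. (\<integral>\<^sup>+ y. ennreal (norm ((f y + g y) - (s i y + t i y))) \<partial>M) \<le>
       (\<integral>\<^sup>+ y. ennreal (norm (f y - s i y)) \<partial>M) + (\<integral>\<^sup>+ y. ennreal (norm (g y - t i y)) \<partial>M)"
    proof (intro always_eventually allI)
      fix i
      have "(\<integral>\<^sup>+ y. ennreal (norm ((f y + g y) - (s i y + t i y))) \<partial>M) \<le>
        (\<integral>\<^sup>+ y. ennreal (norm (f y - s i y)) + ennreal (norm (g y - t i y)) \<partial>M)"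
        by (intro nn_integral_mono)
           (auto simp: ennreal_plus[symmetric] norm_diff_triangle_ineq intro!: ennreal_leI simp del: ennreal_plus)
      then show "(\<integral>\<^sup>+ y. ennreal (norm ((f y + g y) - (s i y + t i y))) \<partial>M) \<le>
       (\<integral>\<^sup>+ y. ennreal (norm (f y - s i y)) \<partial>M) + (\<integral>\<^sup>+ y. ennreal (norm (g y - t i y)) \<partial>M)"
        by (simp add: nn_integral_add)
    qed
  qed auto
  moreover have "sbi M (\<lambda>z. s i z + t i z)" for i
    using simple_bochner_integrable_compose2[OF _ s[of i] t[of i], of "(+)"] by simp
  moreover have "(\<lambda>i. sbint M (\<lambda>z. s i z + t i z)) \<longlonglongrightarrow> x + y"
    using tendsto_add[OF sx ty] s t by (simp add: simple_bochner_integral_add)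
  ultimately show ?thesis unfolding has_bochner_def using fm gm
    by (intro conjI exI[of _ "\<lambda>i z. s i z + t i z"]) (auto intro!: measurable_add)
qed

lemma bochner_add:
  "abs_int M (f :: 'a \<Rightarrow> 'x) \<Longrightarrow> abs_int M g \<Longrightarrow> bochner M (\<lambda>x. f x + g x) = bochner M f + bochner M g"
  by (rule bochner_eqI[OF has_bochner_add[OF has_bochner_bochner has_bochner_bochner]])

lemma bochner_scaleR:
  "abs_int M (f :: 'a \<Rightarrow> 'x) \<Longrightarrow> bochner M (\<lambda>x. c *\<^sub>R f x) = c *\<^sub>R bochner M f"
  by (rule bochner_eqI[OF has_bochner_linear[OF bounded_linear_scaleR_right has_bochner_bochner]])

lemma abs_int_scaleR: "abs_int M (f :: 'a \<Rightarrow> 'x) \<Longrightarrow> abs_int M (\<lambda>x. c *\<^sub>R f x)"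
  by (auto simp: abs_int_def intro!: measurable_scaleR)

lemma bochner_dominated_convergence:
  assumes F: "\<And>n. (F n :: 'a \<Rightarrow> 'x) \<in> borel_measurable M" and f: "f \<in> borel_measurable M"
    and w: "integrable M w" and l: "AE x in M. (\<lambda>n. F n x) \<longlonglongrightarrow> f x"
    and b: "\<And>n. AE x in M. norm (F n x) \<le> w x"
  shows "(\<lambda>n. bochner M (F n)) \<longlonglongrightarrow> bochner M f"
proof -
  have fb: "AE x in M. norm (f x) \<le> w x"
  proof -
    have "AE x in M. \<forall>n. norm (F n x) \<le> w x" using b by (simp add: AE_all_countable)
    with l show ?thesis
    proof eventually_elim
      case (elim x)
      then show ?case by (intro LIMSEQ_le_const2[OF tendsto_norm]) auto
    qed
  qed
  have Fi: "abs_int M (F n)" for n by (rule abs_int_bound[OF F w b])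
  have fi: "abs_int M f" by (rule abs_int_bound[OF f w fb])
  have "(\<lambda>n. \<integral>x. norm (F n x - f x) \<partial>M) \<longlonglongrightarrow> (\<integral>x. 0 \<partial>M)"
  proof (rule integral_dominated_convergence[where w = "\<lambda>x. 2 * w x"])
    show "AE x in M. (\<lambda>i. norm (F i x - f x)) \<longlonglongrightarrow> 0"
      using l by eventually_elim (simp add: LIM_zero tendsto_norm_zero)
    show "AE x in M. norm (norm (F i x - f x)) \<le> 2 * w x" for i
      using b[of i] fb
    proof eventually_elim
      case (elim x)
      then show ?case using norm_triangle_ineq4[of "F i x" "f x"] by simp
    qed
  qed (use F f w in \<open>auto intro!: measurable_norm measurable_diff\<close>)
  then have L: "(\<lambda>n. \<integral>x. norm (F n x - f x) \<partial>M) \<longlonglongrightarrow> 0" by simp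
  have "(\<lambda>n. norm (bochner M (F n) - bochner M f)) \<longlonglongrightarrow> 0"
    by (rule tendsto_sandwich[OF _ _ tendsto_const L])
       (intro always_eventually allI norm_ge_zero norm_bochner_diff_le Fi fi)+
  then show ?thesis by (rule LIM_zero_cancel[OF tendsto_norm_zero_cancel])
qed

end

lemma second_countable_separable_banach:
  "\<exists>D :: 'y::{banach, second_countable_topology} set. separable_banach D"
proof -
  obtain D :: "'y set" where D: "countable D" "\<And>X. open X \<Longrightarrow> X \<noteq> {} \<Longrightarrow> \<exists>d\<in>D. d \<in> X"
    using countable_dense_exists[where 'a = 'y] by auto
  have "closure D = UNIV"
  proof -
    have "x \<in> closure D" for x
      unfolding closure_approachable
    proof (intro allI impI)
      fix e :: real assume "e > 0"
      then obtain d where "d \<in> D" "d \<in> ball x e" using D(2)[of "ball x e"] by auto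
      then show "\<exists>y\<in>D. dist y x < e" by (auto simp: dist_commute)
    qed
    then show ?thesis by auto
  qed
  with D show ?thesis unfolding separable_banach_def by blast
qed

text \<open>The substitution \<open>s = t r\<close> for vector integrals, read off from simple functions.\<close>

lemma has_bochner_scale_interval:
  fixes f :: "real \<Rightarrow> 'x::real_normed_vector"
  assumes h: "has_bochner (lebesgue_on {0..1}) f x" and t: "t > 0"
  shows "has_bochner (lebesgue_on {0..t}) (\<lambda>s. f (s / t)) (t *\<^sub>R x)"
proof -
  let ?M = "lebesgue_on {0..1::real}" and ?N = "lebesgue_on {0..t}" and ?g = "\<lambda>s. s / t"
  have pre: "?g -` A \<inter> {0..t} = (\<lambda>x. t *\<^sub>R x + 0) ` A" if "A \<subseteq> {0..1}" for A
  proof -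
    have "x \<in> (\<lambda>x. t *\<^sub>R x + 0) ` A" if "x / t \<in> A" for x
      using that t by (intro image_eqI[of _ _ "x / t"]) auto
    moreover have "t * x \<le> t \<and> 0 \<le> t * x" if "x \<in> A" for x
      using that t \<open>A \<subseteq> {0..1}\<close> by auto
    ultimately show ?thesis using t by auto
  qed
  have em: "emeasure ?N (?g -` A \<inter> {0..t}) = ennreal t * emeasure ?M A"
    and ms: "?g -` A \<inter> {0..t} \<in> sets ?N" if A: "A \<in> sets ?M" for A
  proof -
    have A': "A \<subseteq> {0..1}" "A \<in> sets lebesgue" using A by (auto simp: sets_restrict_space)
    have "(*\<^sub>R) (1 / t) -` A \<inter> space lebesgue \<in> sets lebesgue"
      by (rule measurable_sets[OF lebesgue_measurable_scaling A'(2)])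
    also have "(*\<^sub>R) (1 / t) -` A \<inter> space lebesgue = ?g -` A" by auto
    finally show ms: "?g -` A \<inter> {0..t} \<in> sets ?N"
      by (auto simp: sets_restrict_space)
    have "emeasure ?N (?g -` A \<inter> {0..t}) = emeasure lebesgue (?g -` A \<inter> {0..t})"
      using emeasure_restrict_space[of "{0..t}" lebesgue "?g -` A \<inter> {0..t}"] by auto
    also have "\<dots> = ennreal t * emeasure lebesgue A"
      unfolding pre[OF A'(1)] by (subst emeasure_lebesgue_affine) (use t in simp)
    also have "emeasure lebesgue A = emeasure ?M A"
      using emeasure_restrict_space[of "{0..1}" lebesgue A] A' by auto
    finally show "emeasure ?N (?g -` A \<inter> {0..t}) = ennreal t * emeasure ?M A" .
  qed
  have gm: "?g \<in> measurable ?N ?M"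
    using ms t by (intro measurableI) auto
  have eq: "distr ?N ?M ?g = scale_measure (ennreal t) ?M"
  proof (rule measure_eqI)
    fix A assume "A \<in> sets (distr ?N ?M ?g)"
    then show "emeasure (distr ?N ?M ?g) A = emeasure (scale_measure (ennreal t) ?M) A"
      using gm em by (simp add: emeasure_distr)
  qed simp
  have nn: "(\<integral>\<^sup>+ s. F (s / t) \<partial>?N) = ennreal t * (\<integral>\<^sup>+ r. F r \<partial>?M)" if "F \<in> borel_measurable ?M" for F
    using nn_integral_distr[OF gm, of F] that unfolding eq by (simp add: nn_integral_scale_measure)
  obtain s where f: "f \<in> borel_measurable ?M" and s: "\<And>i. sbi ?M (s i)"
    and l: "(\<lambda>i. \<integral>\<^sup>+ y. ennreal (norm (f y - s i y)) \<partial>?M) \<longlonglongrightarrow> 0"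
    and x: "(\<lambda>i. sbint ?M (s i)) \<longlonglongrightarrow> x"
    using h unfolding has_bochner_def by blast
  have sf: "simple_function ?M (s i)" for i using s by (auto elim: simple_bochner_integrable.cases)
  have im: "(\<lambda>s. s / t) ` {0..t} = {0..1}"
  proof -
    have "r \<in> (\<lambda>s. s / t) ` {0..t}" if "r \<in> {0..1}" for r
      using that t by (intro image_eqI[of _ _ "t * r"]) (auto simp: mult_le_cancel_left1)
    then show ?thesis using t by (auto simp: divide_le_eq)
  qed
  have sf': "simple_function ?N (\<lambda>y. s i (y / t))" for i
  proof -
    have "(\<lambda>y. s i (y / t)) -` {v} \<inter> space ?N = ?g -` (s i -` {v} \<inter> space ?M) \<inter> {0..t}" for v
      using t by (auto simp: divide_le_eq)
    moreover have "finite ((\<lambda>y. s i (y / t)) ` space ?N)"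
      using sf[of i] im unfolding simple_function_def space_restrict_space
      by (simp add: image_image[symmetric, of "s i" "\<lambda>y. y / t"])
    moreover have "s i -` {v} \<inter> space ?M \<in> sets ?M" for v using sf[of i]
      by (rule simple_functionD(2))
    ultimately show ?thesis using ms unfolding simple_function_def by metis
  qed
  have mt: "measure ?N {y \<in> space ?N. s i (y / t) = v} = t * measure ?M {y \<in> space ?M. s i y = v}"
    (is "?l i v = ?r i v") for i v
  proof -
    have e: "{y \<in> space ?N. s i (y / t) = v} = ?g -` (s i -` {v} \<inter> space ?M) \<inter> {0..t}"
      using t by (auto simp: divide_le_eq)
    have s': "s i -` {v} \<inter> space ?M \<in> sets ?M" using sf[of i] by (rule simple_functionD(2))
    have e': "{y \<in> space ?M. s i y = v} = s i -` {v} \<inter> space ?M" by auto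
    show ?thesis unfolding e e' measure_def em[OF s'] using t by (simp add: enn2real_mult)
  qed
  have fin: "emeasure ?N A \<noteq> \<infinity>" for A
  proof -
    have "finite_measure ?N" by (rule finite_measure_lebesgue_on) auto
    then show ?thesis by (simp add: finite_measure.emeasure_finite)
  qed
  have sb: "sbi ?N (\<lambda>y. s i (y / t))" for i
    by (rule simple_bochner_integrable.intros[OF sf' fin])
  have si: "sbint ?N (\<lambda>y. s i (y / t)) = t *\<^sub>R sbint ?M (s i)" for i
  proof -
    have "(\<lambda>y. s i (y / t)) ` space ?N = s i ` space ?M" using im by (auto simp: image_image[symmetric, of "s i" "\<lambda>y. y / t"])
    then show ?thesis unfolding simple_bochner_integral_def mt scaleR_sum_right
      by (intro sum.cong) auto
  qed
  have fm: "(\<lambda>y. norm (f y - s i y)) \<in> borel_measurable ?M" for i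
    by (rule measurable_simple_compose[where h = "\<lambda>v y. norm (f y - v)", OF sf],
        rule measurable_compose[OF f]) (intro borel_measurable_continuous_onI continuous_intros)
  have "(\<lambda>i. ennreal t * (\<integral>\<^sup>+ y. ennreal (norm (f y - s i y)) \<partial>?M)) \<longlonglongrightarrow> ennreal t * 0"
    by (intro tendsto_mult_ennreal tendsto_const l) auto
  then have "(\<lambda>i. \<integral>\<^sup>+ y. ennreal (norm (f (y / t) - s i (y / t))) \<partial>?N) \<longlonglongrightarrow> 0"
    using nn[of "\<lambda>y. ennreal (norm (f y - s i y))" for i] fm by simp
  moreover have "(\<lambda>y. f (y / t)) \<in> borel_measurable ?N" by (rule measurable_compose[OF gm f])
  moreover have "(\<lambda>i. sbint ?N (\<lambda>y. s i (y / t))) \<longlonglongrightarrow> t *\<^sub>R x"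
    unfolding si by (intro tendsto_intros x)
  ultimately show ?thesis unfolding has_bochner_def using sb
    by (intro conjI exI[of _ "\<lambda>i y. s i (y / t)"]) auto
qed

section \<open>Exponential decay of the Wright function\<close>

text \<open>The integrand of the Hankel representation, on the upper side of the negative real axis
  \<open>\<sigma> = -x\<close>, of \<open>M\<^sub>\<alpha>(\<theta>) = (1 / 2\<pi>i) \<integral> exp (\<sigma> - \<theta> \<sigma>\<^sup>\<alpha>) \<sigma>\<^sup>\<alpha>\<^sup>-\<^sup>1 d\<sigma>\<close>.\<close>

definition hankel_integrand :: "real \<Rightarrow> real \<Rightarrow> real \<Rightarrow> complex" where
  "hankel_integrand \<alpha> \<theta> x =
     exp (of_real (- x + (\<alpha> - 1) * ln x) + \<i> * of_real (pi * \<alpha>)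
       - of_real \<theta> * exp (of_real (\<alpha> * ln x) + \<i> * of_real (pi * \<alpha>)))"

lemma Gamma_lebesgue_integral:
  fixes s :: real
  assumes s: "s > 0"
  shows "integrable (lebesgue_on {0<..}) (\<lambda>x. exp (- x + (s - 1) * ln x))"
    and "(\<integral>x. exp (- x + (s - 1) * ln x) \<partial>lebesgue_on {0<..}) = Gamma s"
proof -
  have eq: "t powr (s - 1) / exp t = exp (- t + (s - 1) * ln t)" if "t > 0" for t :: real
  proof -
    have "exp (- t + (s - 1) * ln t) = exp ((s - 1) * ln t) * inverse (exp t)"
      unfolding exp_minus[symmetric] exp_add[symmetric] by simp
    moreover have "t \<noteq> 0" using that by simp
    ultimately show ?thesis by (simp add: powr_def divide_inverse)
  qed
  have h: "((\<lambda>t. t powr (s - 1) / exp t) has_integral Gamma s) {0<..}"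
  proof -
    have "((\<lambda>t. if t \<in> {0<..} then t powr (s - 1) / exp t else 0) has_integral Gamma s) {0..}"
      by (rule has_integral_spike[OF _ _ Gamma_integral_real[OF s], of "{0}"]) auto
    then show ?thesis by (subst (asm) has_integral_restrict) auto
  qed
  then have h': "((\<lambda>x. exp (- x + (s - 1) * ln x)) has_integral Gamma s) {0<..}"
    by (rule has_integral_eq[rotated]) (use eq in auto)
  have "(\<lambda>x. exp (- x + (s - 1) * ln x)) absolutely_integrable_on {0<..}"
    by (rule nonnegative_absolutely_integrable_1) (use h' in \<open>auto simp: has_integral_integrable\<close>)
  then show i: "integrable (lebesgue_on {0<..}) (\<lambda>x. exp (- x + (s - 1) * ln x))"
    by (rule absolutely_integrable_imp_integrable) auto
  show "(\<integral>x. exp (- x + (s - 1) * ln x) \<partial>lebesgue_on {0<..}) = Gamma s"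
    using lebesgue_integral_eq_integral[OF i] h' by (auto simp: integral_unique)
qed

lemma hankel_majorant_integrable:
  fixes \<alpha> \<theta> :: real
  assumes \<alpha>: "0 < \<alpha>" "\<alpha> < 1"
  shows "integrable (lebesgue_on {0<..}) (\<lambda>x. exp (- x + (\<alpha> - 1) * ln x + \<theta> * exp (\<alpha> * ln x)))"
proof -
  have "filterlim (\<lambda>x. \<bar>\<theta>\<bar> * x powr \<alpha> - x / 2) at_bot at_top" using \<alpha> by real_asymp
  then have "\<forall>\<^sub>F x in at_top. \<bar>\<theta>\<bar> * x powr \<alpha> - x / 2 \<le> 0" unfolding filterlim_at_bot by (rule spec)
  then obtain x0 where x0: "\<And>x. x \<ge> x0 \<Longrightarrow> \<bar>\<theta>\<bar> * x powr \<alpha> - x / 2 \<le> 0"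
    by (auto simp: eventually_at_top_linorder)
  define C where "C = \<bar>\<theta>\<bar> * (max x0 1) powr \<alpha>"
  have C: "\<theta> * exp (\<alpha> * ln x) - x / 2 \<le> C" if "x > 0" for x
  proof (cases "x \<ge> x0")
    case True
    have "\<theta> * exp (\<alpha> * ln x) \<le> \<bar>\<theta>\<bar> * x powr \<alpha>"
      using that by (auto simp: powr_def intro!: mult_right_mono)
    moreover have "0 \<le> C" by (simp add: C_def)
    ultimately show ?thesis using x0[OF True] by simp
  next
    case False
    have "\<theta> * exp (\<alpha> * ln x) \<le> \<bar>\<theta>\<bar> * x powr \<alpha>"
      using that by (auto simp: powr_def intro!: mult_right_mono)
    also have "\<dots> \<le> C" unfolding C_def
      using that False \<alpha> by (intro mult_left_mono powr_mono2) auto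
    finally show ?thesis using that by simp
  qed
  have ab: "(\<lambda>t. complex_of_real t powr (complex_of_real \<alpha> - 1) / of_real (exp (1 / 2 * t)))
             absolutely_integrable_on {0<..}"
    by (rule absolutely_integrable_Gamma_integral) (use \<alpha> in auto)
  have I: "integrable (lebesgue_on {0<..}) (\<lambda>t. norm (complex_of_real t powr (complex_of_real \<alpha> - 1) / of_real (exp (1 / 2 * t))))"
    by (intro integrable_norm absolutely_integrable_imp_integrable[OF ab]) auto
  have eq: "norm (complex_of_real t powr (complex_of_real \<alpha> - 1) / of_real (exp (1 / 2 * t)))
      = exp (- t / 2 + (\<alpha> - 1) * ln t)" if "t > 0" for t
  proof -
    have "complex_of_real t powr (complex_of_real \<alpha> - 1) = of_real (t powr (\<alpha> - 1))"
      using that by (simp add: powr_of_real[symmetric])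
    moreover have "norm (complex_of_real (t powr (\<alpha> - 1)) / of_real (exp (1 / 2 * t))) = t powr (\<alpha> - 1) / exp (t / 2)"
      unfolding norm_divide norm_of_real by simp
    moreover have "t powr (\<alpha> - 1) / exp (t / 2) = exp ((\<alpha> - 1) * ln t - t / 2)"
      using that by (simp add: powr_def exp_diff)
    ultimately show ?thesis by (simp only:) (simp add: algebra_simps)
  qed
  show ?thesis
  proof (rule Bochner_Integration.integrable_bound)
    show "integrable (lebesgue_on {0<..}) (\<lambda>t. exp C * norm (complex_of_real t powr (complex_of_real \<alpha> - 1) / of_real (exp (1 / 2 * t))))"
      by (intro integrable_mult_right I)
    show "(\<lambda>x. exp (- x + (\<alpha> - 1) * ln x + \<theta> * exp (\<alpha> * ln x))) \<in> borel_measurable (lebesgue_on {0<..})"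
      by (intro continuous_imp_measurable_on_sets_lebesgue continuous_intros) auto
    show "AE x in lebesgue_on {0<..}. norm (exp (- x + (\<alpha> - 1) * ln x + \<theta> * exp (\<alpha> * ln x)))
       \<le> norm (exp C * norm (complex_of_real x powr (complex_of_real \<alpha> - 1) / of_real (exp (1 / 2 * x))))"
    proof (rule AE_I2)
      fix x :: real assume "x \<in> space (lebesgue_on {0<..})"
      then have x: "x > 0" by auto
      show "norm (exp (- x + (\<alpha> - 1) * ln x + \<theta> * exp (\<alpha> * ln x)))
       \<le> norm (exp C * norm (complex_of_real x powr (complex_of_real \<alpha> - 1) / of_real (exp (1 / 2 * x))))"
        unfolding eq[OF x] using C[OF x] by (simp add: exp_add[symmetric])
    qed
  qed
qed

lemma exp_series_power:
  fixes x :: real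
  shows "(\<lambda>n. \<theta> ^ n / fact n * exp (- x + (\<alpha> * real (Suc n) - 1) * ln x)) sums
     exp (- x + (\<alpha> - 1) * ln x + \<theta> * exp (\<alpha> * ln x))"
proof -
  have "(\<lambda>n. exp (- x + (\<alpha> - 1) * ln x) * ((\<theta> * exp (\<alpha> * ln x)) ^ n /\<^sub>R fact n)) sums
     (exp (- x + (\<alpha> - 1) * ln x) * exp (\<theta> * exp (\<alpha> * ln x)))"
    by (intro sums_mult exp_converges)
  moreover have "exp (- x + (\<alpha> - 1) * ln x) * ((\<theta> * exp (\<alpha> * ln x)) ^ n /\<^sub>R fact n) =
     \<theta> ^ n / fact n * exp (- x + (\<alpha> * real (Suc n) - 1) * ln x)" for n
  proof -
    have "exp (- x + (\<alpha> * real (Suc n) - 1) * ln x) = exp (- x + (\<alpha> - 1) * ln x) * exp (\<alpha> * ln x) ^ n"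
      unfolding exp_of_nat_mult[symmetric] exp_add[symmetric] by (simp add: algebra_simps)
    then show ?thesis by (simp add: power_mult_distrib divide_inverse)
  qed
  ultimately show ?thesis by (simp add: exp_add[symmetric])
qed

text \<open>The partial sums are integrals of partial sums of an exponential series, hence bounded by the
  integral of the majorant.\<close>

lemma wright_coefficients_summable:
  assumes \<alpha>: "0 < \<alpha>" "\<alpha> < 1"
  shows "summable (\<lambda>n. \<bar>\<theta>\<bar> ^ n / fact n * Gamma (\<alpha> * real (Suc n)))"
proof (rule summableI_nonneg_bounded)
  let ?M = "lebesgue_on {0<..} :: real measure"
  let ?W = "\<lambda>x. exp (- x + (\<alpha> - 1) * ln x + \<bar>\<theta>\<bar> * exp (\<alpha> * ln x))"
  have pos: "\<alpha> * real (Suc n) > 0" for n using \<alpha> by simp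
  show "0 \<le> \<bar>\<theta>\<bar> ^ n / fact n * Gamma (\<alpha> * real (Suc n))" for n
    using Gamma_real_pos[OF pos, of n] by simp
  show "(\<Sum>i<N. \<bar>\<theta>\<bar> ^ i / fact i * Gamma (\<alpha> * real (Suc i))) \<le> (\<integral>x. ?W x \<partial>?M)" for N
  proof -
    let ?f = "\<lambda>i x. \<bar>\<theta>\<bar> ^ i / fact i * exp (- x + (\<alpha> * real (Suc i) - 1) * ln x)"
    have i: "integrable ?M (?f i)" for i
      by (intro integrable_mult_right Gamma_lebesgue_integral(1)[OF pos])
    have "(\<Sum>i<N. \<bar>\<theta>\<bar> ^ i / fact i * Gamma (\<alpha> * real (Suc i))) = (\<Sum>i<N. (\<integral>x. ?f i x \<partial>?M))"
      by (simp only: integral_mult_right_zero Gamma_lebesgue_integral(2)[OF pos])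
    also have "\<dots> = (\<integral>x. (\<Sum>i<N. ?f i x) \<partial>?M)"
      by (rule Bochner_Integration.integral_sum[symmetric]) (rule i)
    also have "\<dots> \<le> (\<integral>x. ?W x \<partial>?M)"
    proof (rule integral_mono[OF Bochner_Integration.integrable_sum[OF i] hankel_majorant_integrable[OF \<alpha>]])
      fix x :: real
      show "(\<Sum>i<N. ?f i x) \<le> ?W x"
        unfolding sums_unique[OF exp_series_power]
        by (rule sum_le_suminf[OF sums_summable[OF exp_series_power]]) auto
    qed
    finally show ?thesis .
  qed
qed

lemma rGamma_reflection_pos:
  assumes "z > 0" shows "rGamma (1 - z) = Gamma z * sin (pi * z) / (pi :: real)"
proof -
  have "complex_of_real (rGamma z * rGamma (1 - z)) = complex_of_real (sin (pi * z) / pi)"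
    using rGamma_reflection_complex[of "complex_of_real z"]
    by (simp add: rGamma_complex_of_real[symmetric] sin_of_real[symmetric])
  then have "rGamma z * rGamma (1 - z) = sin (pi * z) / pi" by (simp only: of_real_eq_iff)
  moreover have "rGamma z = inverse (Gamma z)" by (simp add: Gamma_def)
  moreover have "Gamma z > 0" using assms by (rule Gamma_real_pos)
  ultimately show ?thesis by (simp add: field_simps)
qed

lemma Im_hankel_integrand_series:
  "(\<lambda>n. (- \<theta>) ^ n / fact n * exp (- x + (\<alpha> * real (Suc n) - 1) * ln x) * sin (pi * (\<alpha> * real (Suc n))))
     sums Im (hankel_integrand \<alpha> \<theta> x)"
proof -
  define p where "p = exp (complex_of_real (- x + (\<alpha> - 1) * ln x) + \<i> * of_real (pi * \<alpha>))"
  define z where "z = exp (complex_of_real (\<alpha> * ln x) + \<i> * of_real (pi * \<alpha>))"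
  have "(\<lambda>n. p * ((- of_real \<theta> * z) ^ n /\<^sub>R fact n)) sums (p * exp (- of_real \<theta> * z))"
    by (intro sums_mult exp_converges)
  also have "p * exp (- of_real \<theta> * z) = hankel_integrand \<alpha> \<theta> x"
    by (simp add: hankel_integrand_def p_def z_def exp_add[symmetric])
  finally have *: "(\<lambda>n. Im (p * ((- of_real \<theta> * z) ^ n /\<^sub>R fact n))) sums Im (hankel_integrand \<alpha> \<theta> x)"
    by (simp add: sums_complex_iff)
  have "Im (p * ((- of_real \<theta> * z) ^ n /\<^sub>R fact n)) =
     (- \<theta>) ^ n / fact n * exp (- x + (\<alpha> * real (Suc n) - 1) * ln x) * sin (pi * (\<alpha> * real (Suc n)))" for n
  proof -
    have "p * z ^ n = exp (complex_of_real (- x + (\<alpha> * real (Suc n) - 1) * ln x) + \<i> * of_real (pi * (\<alpha> * real (Suc n))))"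
      unfolding p_def z_def exp_of_nat_mult[symmetric] exp_add[symmetric]
      by (rule arg_cong[of _ _ exp]) (simp add: algebra_simps)
    then have Im: "Im (p * z ^ n) = exp (- x + (\<alpha> * real (Suc n) - 1) * ln x) * sin (pi * (\<alpha> * real (Suc n)))"
      by (simp add: Im_exp)
    have "p * ((- of_real \<theta> * z) ^ n /\<^sub>R fact n) = of_real ((- \<theta>) ^ n / fact n) * (p * z ^ n)"
      by (simp only: power_mult_distrib scaleR_conv_of_real of_real_divide of_real_power of_real_minus
          of_real_inverse of_real_fact divide_inverse) (simp add: ac_simps)
    then have "Im (p * ((- of_real \<theta> * z) ^ n /\<^sub>R fact n)) = (- \<theta>) ^ n / fact n * Im (p * z ^ n)"
      by (simp only: times_complex.sel Re_complex_of_real Im_complex_of_real mult_zero_left add_0_right)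
    then show ?thesis unfolding Im by simp
  qed
  with * show ?thesis by simp
qed

text \<open>The Hankel representation collapsed onto the negative axis. Expanding the inner exponential and
  integrating term by term gives \<open>\<Gamma>(\<alpha> n) sin (\<pi> \<alpha> n)\<close>, which the reflection formula turns into
  \<open>\<pi> / \<Gamma>(1 - \<alpha> n)\<close>.\<close>

lemma wright_M_hankel:
  assumes \<alpha>: "0 < \<alpha>" "\<alpha> < 1"
  shows "integrable (lebesgue_on {0<..}) (\<lambda>x. Im (hankel_integrand \<alpha> \<theta> x))"
    and "pi * wright_M \<alpha> \<theta> = (\<integral>x. Im (hankel_integrand \<alpha> \<theta> x) \<partial>lebesgue_on {0<..})"
proof -
  let ?M = "lebesgue_on {0<..} :: real measure"
  let ?f = "\<lambda>n x. (- \<theta>) ^ n / fact n * exp (- x + (\<alpha> * real (Suc n) - 1) * ln x) * sin (pi * (\<alpha> * real (Suc n)))"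
  have pos: "\<alpha> * real (Suc n) > 0" for n using \<alpha> by simp
  have f1: "integrable ?M (?f n)" for n
    by (intro integrable_mult_left integrable_mult_right Gamma_lebesgue_integral(1)[OF pos])
  have le: "norm (?f n x) \<le> \<bar>\<theta>\<bar> ^ n / fact n * exp (- x + (\<alpha> * real (Suc n) - 1) * ln x)" for n x
  proof -
    have "norm (?f n x) = (\<bar>\<theta>\<bar> ^ n / fact n * exp (- x + (\<alpha> * real (Suc n) - 1) * ln x)) * \<bar>sin (pi * (\<alpha> * real (Suc n)))\<bar>"
      by (simp add: abs_mult power_abs)
    also have "\<dots> \<le> (\<bar>\<theta>\<bar> ^ n / fact n * exp (- x + (\<alpha> * real (Suc n) - 1) * ln x)) * 1"
      by (intro mult_left_mono abs_sin_le_one) auto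
    finally show ?thesis by simp
  qed
  have f2: "AE x in ?M. summable (\<lambda>n. norm (?f n x))"
    by (intro AE_I2 summable_comparison_test'[OF sums_summable[OF exp_series_power[of "\<bar>\<theta>\<bar>"]], of 0])
       (use le in auto)
  have f3: "summable (\<lambda>n. \<integral>x. norm (?f n x) \<partial>?M)"
  proof (rule summable_comparison_test'[OF wright_coefficients_summable[OF \<alpha>, of \<theta>], of 0])
    fix n :: nat
    have "(\<integral>x. norm (?f n x) \<partial>?M) \<le> (\<integral>x. \<bar>\<theta>\<bar> ^ n / fact n * exp (- x + (\<alpha> * real (Suc n) - 1) * ln x) \<partial>?M)"
      by (intro integral_mono integrable_norm f1 integrable_mult_right Gamma_lebesgue_integral(1)[OF pos] le)
    also have "\<dots> = \<bar>\<theta>\<bar> ^ n / fact n * Gamma (\<alpha> * real (Suc n))"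
      by (simp only: integral_mult_right_zero Gamma_lebesgue_integral(2)[OF pos])
    finally show "norm (\<integral>x. norm (?f n x) \<partial>?M) \<le> \<bar>\<theta>\<bar> ^ n / fact n * Gamma (\<alpha> * real (Suc n))"
      by (simp add: integral_nonneg_AE)
  qed
  have s: "(\<Sum>n. ?f n x) = Im (hankel_integrand \<alpha> \<theta> x)" for x
    by (rule sums_unique[OF Im_hankel_integrand_series, symmetric])
  show "integrable ?M (\<lambda>x. Im (hankel_integrand \<alpha> \<theta> x))"
    using integrable_suminf[OF f1 f2 f3] unfolding s .
  have "(\<lambda>n. \<integral>x. ?f n x \<partial>?M) sums (\<integral>x. Im (hankel_integrand \<alpha> \<theta> x) \<partial>?M)"
    using sums_integral[OF f1 f2 f3] unfolding s .
  moreover have "(\<integral>x. ?f n x \<partial>?M) = pi * ((- \<theta>) ^ n / fact n * rGamma (1 - \<alpha> * real (Suc n)))" for n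
    unfolding integral_mult_left_zero integral_mult_right_zero Gamma_lebesgue_integral(2)[OF pos]
      rGamma_reflection_pos[OF pos] by simp
  ultimately have "(\<lambda>n. pi * ((- \<theta>) ^ n / fact n * rGamma (1 - \<alpha> * real (Suc n)))) sums (\<integral>x. Im (hankel_integrand \<alpha> \<theta> x) \<partial>?M)"
    by (simp only:)
  from sums_divide[OF this, of pi]
  have "(\<lambda>n. (- \<theta>) ^ n / fact n * rGamma (1 - \<alpha> * real (Suc n))) sums ((\<integral>x. Im (hankel_integrand \<alpha> \<theta> x) \<partial>?M) / pi)"
    by simp
  then show "pi * wright_M \<alpha> \<theta> = (\<integral>x. Im (hankel_integrand \<alpha> \<theta> x) \<partial>?M)"
    unfolding wright_M_def by (simp add: sums_iff)
qed

lemma continuous_wright_M: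
  assumes \<alpha>: "0 < \<alpha>" "\<alpha> < 1"
  shows "continuous_on S (wright_M \<alpha>)"
proof -
  let ?c = "\<lambda>n. (- 1) ^ n / fact n * rGamma (1 - \<alpha> * real (Suc n))"
  have pos: "\<alpha> * real (Suc n) > 0" for n using \<alpha> by simp
  have "summable (\<lambda>n. ?c n * y ^ n)" for y :: real
  proof (rule summable_comparison_test'[OF wright_coefficients_summable[OF \<alpha>, of y], of 0])
    fix n
    have "norm (?c n * y ^ n) = (\<bar>y\<bar> ^ n / fact n * Gamma (\<alpha> * real (Suc n))) * (\<bar>sin (pi * (\<alpha> * real (Suc n)))\<bar> / pi)"
      using Gamma_real_pos[OF pos, of n] unfolding rGamma_reflection_pos[OF pos] by (simp add: abs_mult power_abs)
    also have "\<dots> \<le> (\<bar>y\<bar> ^ n / fact n * Gamma (\<alpha> * real (Suc n))) * 1"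
    proof (rule mult_left_mono)
      show "\<bar>sin (pi * (\<alpha> * real (Suc n)))\<bar> / pi \<le> 1"
      proof -
        have "\<bar>sin (pi * (\<alpha> * real (Suc n)))\<bar> \<le> 1" by (rule abs_sin_le_one)
        then have "\<bar>sin (pi * (\<alpha> * real (Suc n)))\<bar> \<le> 1 * pi" using pi_gt3 by linarith
        then show ?thesis by (subst pos_divide_le_eq) auto
      qed
    qed (use Gamma_real_pos[OF pos, of n] in simp)
    finally show "norm (?c n * y ^ n) \<le> \<bar>y\<bar> ^ n / fact n * Gamma (\<alpha> * real (Suc n))" by simp
  qed
  then have "isCont (\<lambda>x. \<Sum>n. ?c n * x ^ n) y" for y by (rule isCont_powser_converges_everywhere)
  moreover have "(\<lambda>x. \<Sum>n. ?c n * x ^ n) = wright_M \<alpha>"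
  proof
    fix x :: real
    have "?c n * x ^ n = (- x) ^ n / fact n * rGamma (1 - \<alpha> * real (Suc n))" for n
      using power_mult_distrib[of "-1" x n] by simp
    then show "(\<Sum>n. ?c n * x ^ n) = wright_M \<alpha> x" unfolding wright_M_def by presburger
  qed
  ultimately show ?thesis by (simp add: continuous_at_imp_continuous_on)
qed

text \<open>The contour is shifted in the coordinate \<open>\<tau> = -i \<sigma>\<close>, in which the closed upper half-plane becomes
  the right half-plane, so that the principal logarithm is holomorphic near the whole contour.\<close>

definition hankel_fun :: "real \<Rightarrow> real \<Rightarrow> complex \<Rightarrow> complex" where
  "hankel_fun \<alpha> \<theta> \<tau> = \<i> * exp (\<i> * \<tau> + of_real (\<alpha> - 1) * (Ln \<tau> + \<i> * of_real (pi / 2))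
      - of_real \<theta> * exp (of_real \<alpha> * (Ln \<tau> + \<i> * of_real (pi / 2))))"

lemma norm_hankel_fun:
  assumes "\<tau> \<noteq> 0"
  shows "norm (hankel_fun \<alpha> \<theta> \<tau>) = exp (- Im \<tau> + (\<alpha> - 1) * ln (norm \<tau>)
     - \<theta> * (exp (\<alpha> * ln (norm \<tau>)) * cos (\<alpha> * (Im (Ln \<tau>) + pi / 2))))"
  using assms unfolding hankel_fun_def norm_mult norm_ii norm_exp_eq_Re
  by (simp add: Re_exp)

lemma Im_eq_norm_cos:
  assumes "\<tau> \<noteq> 0"
  shows "- Im \<tau> = norm \<tau> * cos (Im (Ln \<tau>) + pi / 2)"
proof -
  have "Im \<tau> = Im (exp (Ln \<tau>))" using assms by simp
  also have "\<dots> = norm \<tau> * sin (Im (Ln \<tau>))" using assms by (simp only: Im_exp Re_Ln) simp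
  finally show ?thesis by (simp add: cos_add)
qed

locale wright_contour =
  fixes \<alpha> \<theta> :: real
  assumes \<alpha>: "1 / 2 < \<alpha>" "\<alpha> < 1" and \<theta>: "\<theta> > 0"
begin

text \<open>Up to the angle \<open>(\<pi>/4)(1 + 1/\<alpha>)\<close>, which is larger than \<open>\<pi>/2\<close>, the real part of \<open>\<sigma>\<^sup>\<alpha>\<close> is at
  least \<open>c \<bar>\<sigma>\<bar>\<^sup>\<alpha>\<close>; beyond it \<open>exp \<sigma>\<close> decays like \<open>exp (-k \<bar>\<sigma>\<bar>)\<close>.\<close>

definition "c = cos (pi / 4 * (1 + \<alpha>))"
definition "k = - cos (pi / 4 * (1 + 1 / \<alpha>))"

lemma c_pos: "c > 0"
proof -
  have "pi / 4 * 0 < pi / 4 * (1 + \<alpha>)" "pi / 4 * (1 + \<alpha>) < pi / 4 * 2"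
    using \<alpha> by (intro mult_strict_left_mono; simp)+
  then show ?thesis unfolding c_def by (intro cos_gt_zero) auto
qed

lemma angle_bounds: "pi / 2 < pi / 4 * (1 + 1 / \<alpha>)" "pi / 4 * (1 + 1 / \<alpha>) < pi"
proof -
  have "1 < 1 / \<alpha>" "1 / \<alpha> < 2" using \<alpha> by (auto simp: field_simps)
  then have "pi / 4 * 2 < pi / 4 * (1 + 1 / \<alpha>)" "pi / 4 * (1 + 1 / \<alpha>) < pi / 4 * 3"
    by (intro mult_strict_left_mono; simp)+
  then show "pi / 2 < pi / 4 * (1 + 1 / \<alpha>)" "pi / 4 * (1 + 1 / \<alpha>) < pi" using pi_gt_zero by auto
qed

lemma k_pos: "k > 0"
proof -
  have "cos (pi / 4 * (1 + 1 / \<alpha>)) < cos (pi / 2)"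
    using angle_bounds by (intro cos_monotone_0_pi) auto
  then show ?thesis by (simp add: k_def)
qed

lemma angle_range:
  assumes "\<tau> \<noteq> 0" "0 \<le> Re \<tau>"
  shows "0 \<le> Im (Ln \<tau>) + pi / 2" "Im (Ln \<tau>) + pi / 2 \<le> pi"
proof -
  have "\<bar>Im (Ln \<tau>)\<bar> \<le> pi / 2" using Re_Ln_pos_le[OF assms(1)] assms(2) by blast
  then show "0 \<le> Im (Ln \<tau>) + pi / 2" "Im (Ln \<tau>) + pi / 2 \<le> pi" by linarith+
qed

lemma cos_ge_c:
  assumes "0 \<le> \<phi>" "\<phi> \<le> pi / 4 * (1 + 1 / \<alpha>)"
  shows "cos (\<alpha> * \<phi>) \<ge> c"
  unfolding c_def
proof (rule cos_monotone_0_pi_le)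
  show "0 \<le> \<alpha> * \<phi>" using assms \<alpha> by simp
  have "\<alpha> * \<phi> \<le> \<alpha> * (pi / 4 * (1 + 1 / \<alpha>))" using assms \<alpha> by (intro mult_left_mono) auto
  also have "\<dots> = pi / 4 * (1 + \<alpha>)" using \<alpha> by (simp add: field_simps)
  finally show "\<alpha> * \<phi> \<le> pi / 4 * (1 + \<alpha>)" .
  have "pi / 4 * (1 + \<alpha>) \<le> pi / 4 * 2" using \<alpha> by (intro mult_left_mono) auto
  then show "pi / 4 * (1 + \<alpha>) \<le> pi" using pi_gt_zero by linarith
qed

lemma norm_hankel_fun_near:
  assumes "\<tau> \<noteq> 0"
  shows "norm (hankel_fun \<alpha> \<theta> \<tau>) \<le> exp (norm \<tau> + (\<alpha> - 1) * ln (norm \<tau>) + \<theta> * exp (\<alpha> * ln (norm \<tau>)))"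
proof -
  have "- (\<theta> * (exp (\<alpha> * ln (norm \<tau>)) * cos (\<alpha> * (Im (Ln \<tau>) + pi / 2)))) =
      (\<theta> * exp (\<alpha> * ln (norm \<tau>))) * (- cos (\<alpha> * (Im (Ln \<tau>) + pi / 2)))" by simp
  also have "\<dots> \<le> (\<theta> * exp (\<alpha> * ln (norm \<tau>))) * 1"
    using \<theta> by (intro mult_left_mono) (auto intro: minus_le_iff[THEN iffD1])
  moreover have "- Im \<tau> \<le> norm \<tau>" using abs_Im_le_cmod[of \<tau>] by linarith
  ultimately show ?thesis unfolding norm_hankel_fun[OF assms] by simp
qed

lemma norm_hankel_fun_right:
  assumes "\<tau> \<noteq> 0" "0 \<le> Re \<tau>" "Im \<tau> \<le> 0"
  shows "norm (hankel_fun \<alpha> \<theta> \<tau>) \<le> exp (- Im \<tau> + (\<alpha> - 1) * ln (norm \<tau>) - \<theta> * (exp (\<alpha> * ln (norm \<tau>)) * c))"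
proof -
  let ?\<phi> = "Im (Ln \<tau>) + pi / 2"
  have "?\<phi> \<le> pi / 2"
  proof (rule ccontr)
    assume "\<not> ?\<phi> \<le> pi / 2"
    then have "cos ?\<phi> < cos (pi / 2)"
      using angle_range[OF assms(1,2)] by (intro cos_monotone_0_pi) auto
    then have "norm \<tau> * cos ?\<phi> < 0" using assms(1) by (simp add: mult_less_0_iff)
    with Im_eq_norm_cos[OF assms(1)] assms(3) show False by linarith
  qed
  then have "cos (\<alpha> * ?\<phi>) \<ge> c"
    by (intro cos_ge_c angle_range[OF assms(1,2)] order_trans[OF _ less_imp_le[OF angle_bounds(1)]])
  then show ?thesis unfolding norm_hankel_fun[OF assms(1)] using \<theta> by simp
qed

lemma norm_hankel_fun_far:
  assumes "1 \<le> norm \<tau>" "0 \<le> Re \<tau>" "- Im \<tau> \<le> R"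
  shows "norm (hankel_fun \<alpha> \<theta> \<tau>) \<le> exp R * exp (- \<theta> * c * norm \<tau> powr \<alpha>)
     + exp (- k * norm \<tau> + \<theta> * norm \<tau> powr \<alpha>)"
proof -
  have nz: "\<tau> \<noteq> 0" using assms(1) by auto
  let ?\<phi> = "Im (Ln \<tau>) + pi / 2"
  have ln0: "(\<alpha> - 1) * ln (norm \<tau>) \<le> 0" using assms(1) \<alpha> by (intro mult_nonpos_nonneg) auto
  have pw: "exp (\<alpha> * ln (norm \<tau>)) = norm \<tau> powr \<alpha>" using nz by (simp add: powr_def)
  show ?thesis
  proof (cases "?\<phi> \<le> pi / 4 * (1 + 1 / \<alpha>)")
    case True
    then have "cos (\<alpha> * ?\<phi>) \<ge> c" using angle_range[OF nz assms(2)] by (intro cos_ge_c)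
    then have "\<theta> * (norm \<tau> powr \<alpha> * c) \<le> \<theta> * (norm \<tau> powr \<alpha> * cos (\<alpha> * ?\<phi>))"
      using \<theta> by (intro mult_left_mono) auto
    then have "norm (hankel_fun \<alpha> \<theta> \<tau>) \<le> exp (R + - \<theta> * c * norm \<tau> powr \<alpha>)"
      unfolding norm_hankel_fun[OF nz] pw using assms(3) ln0 by (simp add: mult_ac)
    also have "\<dots> = exp R * exp (- \<theta> * c * norm \<tau> powr \<alpha>)" by (rule exp_add)
    finally show ?thesis by (meson add_increasing2 exp_ge_zero)
  next
    case False
    then have "cos ?\<phi> \<le> - k" unfolding k_def
      using angle_range[OF nz assms(2)] angle_bounds by (auto intro!: cos_monotone_0_pi_le)
    then have 1: "- Im \<tau> \<le> - k * norm \<tau>" unfolding Im_eq_norm_cos[OF nz]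
      using mult_left_mono[of "cos ?\<phi>" "- k" "norm \<tau>"] by (simp add: mult.commute)
    have "\<theta> * (norm \<tau> powr \<alpha> * (- 1)) \<le> \<theta> * (norm \<tau> powr \<alpha> * cos (\<alpha> * ?\<phi>))"
      using \<theta> by (intro mult_left_mono) auto
    then have "norm (hankel_fun \<alpha> \<theta> \<tau>) \<le> exp (- k * norm \<tau> + \<theta> * norm \<tau> powr \<alpha>)"
      unfolding norm_hankel_fun[OF nz] pw using 1 ln0 by simp
    then show ?thesis by (meson add_increasing exp_ge_zero mult_nonneg_nonneg)
  qed
qed

lemma hankel_primitive:
  obtains \<Phi> where "\<And>\<tau>. \<tau> \<noteq> 0 \<Longrightarrow> 0 \<le> Re \<tau> \<Longrightarrow> (\<Phi> has_field_derivative hankel_fun \<alpha> \<theta> \<tau>) (at \<tau>)"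
proof -
  let ?S = "- (complex_of_real ` {..0})"
  have S: "?S = - \<real>\<^sub>\<le>\<^sub>0"
    by (auto simp: complex_nonpos_Reals_iff nonpos_Reals_def image_iff)
  have hol: "hankel_fun \<alpha> \<theta> field_differentiable at \<tau>" if "\<tau> \<in> - \<real>\<^sub>\<le>\<^sub>0" for \<tau>
  proof -
    have "hankel_fun \<alpha> \<theta> holomorphic_on (- \<real>\<^sub>\<le>\<^sub>0)"
      unfolding hankel_fun_def by (intro holomorphic_intros) auto
    then show ?thesis using that
      by (intro holomorphic_on_imp_differentiable_at[of _ "- \<real>\<^sub>\<le>\<^sub>0"]) (auto simp: open_Compl)
  qed
  have "\<exists>g. \<forall>x\<in>?S. (g has_field_derivative hankel_fun \<alpha> \<theta> x) (at x)"
  proof (rule holomorphic_starlike_primitive[of _ _ "{}"])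
    show "continuous_on ?S (hankel_fun \<alpha> \<theta>)" unfolding S
      using hol by (intro continuous_at_imp_continuous_on ballI field_differentiable_imp_continuous_at)
    show "open ?S" unfolding S by (auto simp: open_Compl)
    show "hankel_fun \<alpha> \<theta> field_differentiable at x" if "x \<in> ?S - {}" for x
      using hol that unfolding S by blast
  qed (auto intro: starlike_slotted_complex_plane_left)
  then obtain g where g: "\<And>x. x \<in> - \<real>\<^sub>\<le>\<^sub>0 \<Longrightarrow> (g has_field_derivative hankel_fun \<alpha> \<theta> x) (at x)"
    unfolding S by blast
  show thesis
  proof (rule that[of g])
    fix \<tau> :: complex assume "\<tau> \<noteq> 0" "0 \<le> Re \<tau>"
    then have "\<tau> \<in> - \<real>\<^sub>\<le>\<^sub>0" by (auto simp: complex_nonpos_Reals_iff complex_eq_iff)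
    then show "(g has_field_derivative hankel_fun \<alpha> \<theta> \<tau>) (at \<tau>)" by (rule g)
  qed
qed

lemma hankel_fun_imaginary_axis:
  assumes "x > 0"
  shows "\<i> * hankel_fun \<alpha> \<theta> (\<i> * of_real x) = hankel_integrand \<alpha> \<theta> x"
proof -
  have L: "Ln (\<i> * of_real x) + \<i> * of_real (pi / 2) = of_real (ln x) + \<i> * of_real pi"
    using assms by (simp add: Ln_times_ii Ln_of_real)
  define A where "A = \<i> * (\<i> * of_real x) + of_real (\<alpha> - 1) * (of_real (ln x) + \<i> * of_real pi)
      - of_real \<theta> * exp (of_real \<alpha> * (of_real (ln x) + \<i> * of_real pi))"
  have "\<i> * hankel_fun \<alpha> \<theta> (\<i> * of_real x) = - exp A"
  proof -
    have "\<i> * (\<i> * w) = - w" for w by (simp add: complex_eq_iff)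
    then show ?thesis unfolding hankel_fun_def L A_def .
  qed
  also have "\<dots> = exp (A + \<i> * of_real pi)"
    by (simp add: exp_add)
  also have "A + \<i> * of_real pi = of_real (- x + (\<alpha> - 1) * ln x) + \<i> * of_real (pi * \<alpha>)
       - of_real \<theta> * exp (of_real (\<alpha> * ln x) + \<i> * of_real (pi * \<alpha>))"
    unfolding A_def by (simp add: algebra_simps)
  finally show ?thesis unfolding hankel_integrand_def .
qed

lemma hankel_fun_real_axis:
  assumes "x > 0"
  shows "Im (hankel_fun \<alpha> \<theta> (- \<i> * of_real x) * - \<i>) = 0"
proof -
  have "Ln (- (\<i> * of_real x)) = Ln (of_real x) - \<i> * of_real (pi / 2)"
  proof (rule Ln_unique)
    have "exp (\<i> * complex_of_real (pi / 2)) = \<i>" using cis_pi_half by (simp add: cis_conv_exp)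
    then show "exp (Ln (of_real x) - \<i> * of_real (pi / 2)) = - (\<i> * of_real x)"
      unfolding exp_diff using assms by (simp add: divide_i)
    show "- pi < Im (Ln (of_real x) - \<i> * of_real (pi / 2))"
      using assms by (simp add: Ln_of_real)
    have "- (pi / 2) \<le> pi" using pi_gt_zero by linarith
    then show "Im (Ln (of_real x) - \<i> * of_real (pi / 2)) \<le> pi"
      using assms by (simp add: Ln_of_real)
  qed
  then have L: "Ln (- \<i> * of_real x) + \<i> * of_real (pi / 2) = of_real (ln x)"
    using assms by (simp add: Ln_of_real)
  have "hankel_fun \<alpha> \<theta> (- \<i> * of_real x) * - \<i> = exp (of_real (x + (\<alpha> - 1) * ln x - \<theta> * exp (\<alpha> * ln x)))"
  proof -
    have "\<i> * w * - \<i> = w" for w by (simp add: complex_eq_iff)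
    then have "hankel_fun \<alpha> \<theta> (- \<i> * of_real x) * - \<i> =
        exp (\<i> * (- \<i> * of_real x) + of_real (\<alpha> - 1) * of_real (ln x) - of_real \<theta> * exp (of_real \<alpha> * of_real (ln x)))"
      unfolding hankel_fun_def L .
    also have "exp (of_real \<alpha> * of_real (ln x)) = complex_of_real (exp (\<alpha> * ln x))"
      unfolding exp_of_real[symmetric] by simp
    also have "\<i> * (- \<i> * of_real x) + of_real (\<alpha> - 1) * of_real (ln x) - of_real \<theta> * complex_of_real (exp (\<alpha> * ln x))
       = of_real (x + (\<alpha> - 1) * ln x - \<theta> * exp (\<alpha> * ln x))"
      by simp
    finally show ?thesis .
  qed
  then show ?thesis by (simp only: exp_of_real Im_complex_of_real)
qed

text \<open>The contour runs along the positive real axis, where the integrand is real, from \<open>0\<close> to \<open>R\<close>, then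
  along the vertical line \<open>Re \<sigma> = R\<close>, and returns at infinity to the negative axis. Only the vertical
  line contributes to the imaginary part, and there \<open>Re \<sigma>\<^sup>\<alpha> \<ge> c (R\<^sup>\<alpha> + y\<^sup>\<alpha>) / 2\<close>.\<close>

lemma wright_M_bound:
  assumes R: "R \<ge> 1" and \<theta>1: "\<theta> \<ge> 1"
    and K: "\<And>y. y \<ge> 0 \<Longrightarrow> exp (- (c * y powr \<alpha> / 2)) \<le> K / (1 + y)\<^sup>2"
  shows "pi * \<bar>wright_M \<alpha> \<theta>\<bar> \<le> K * exp R * exp (- (\<theta> * c * R powr \<alpha> / 2))"
proof -
  obtain \<Phi> where \<Phi>: "\<And>\<tau>. \<tau> \<noteq> 0 \<Longrightarrow> 0 \<le> Re \<tau> \<Longrightarrow> (\<Phi> has_field_derivative hankel_fun \<alpha> \<theta> \<tau>) (at \<tau>)"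
    using hankel_primitive by blast
  have seg: "norm (\<Phi> q - \<Phi> p) \<le> B * norm (q - p)"
    if "\<And>z. z \<in> closed_segment p q \<Longrightarrow> z \<noteq> 0 \<and> 0 \<le> Re z \<and> norm (hankel_fun \<alpha> \<theta> z) \<le> B" for p q B
    by (rule field_differentiable_bound[of "closed_segment p q" _ "hankel_fun \<alpha> \<theta>"])
       (use that \<Phi> in \<open>auto intro: has_field_derivative_at_within\<close>)
  have nIm: "norm (Complex x y - Complex x y') = \<bar>y - y'\<bar>" for x y y' by (simp add: cmod_def)
  have nRe: "norm (Complex x y - Complex x' y) = \<bar>x - x'\<bar>" for x x' y by (simp add: cmod_def)
  have K0: "K \<ge> 0" using order_trans[OF exp_ge_zero K[of 0]] by simp

  \<comment> \<open>a detour around the origin along three sides of a rectangle; it vanishes with \<open>\<delta>\<close> as \<open>\<alpha> > 0\<close>\<close>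
  have near: "norm (\<Phi> (Complex 0 (-\<delta>)) - \<Phi> (Complex 0 \<delta>)) \<le> 4 * exp (2 + 2 * \<theta>) * \<delta> powr \<alpha>"
    if \<delta>: "0 < \<delta>" "\<delta> \<le> 1" for \<delta>
  proof -
    define B where "B = exp (2 + 2 * \<theta>) * exp ((\<alpha> - 1) * ln \<delta>)"
    have bd: "z \<noteq> 0 \<and> 0 \<le> Re z \<and> norm (hankel_fun \<alpha> \<theta> z) \<le> B"
      if z: "0 \<le> Re z" "Re z \<le> \<delta>" "\<bar>Im z\<bar> \<le> \<delta>" "Re z = \<delta> \<or> \<bar>Im z\<bar> = \<delta>" for z
    proof -
      have n1: "\<delta> \<le> norm z" using z(1,4) abs_Re_le_cmod[of z] abs_Im_le_cmod[of z] by auto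
      have n2: "norm z \<le> 2" using cmod_le[of z] z \<delta> by linarith
      have nz: "z \<noteq> 0" using n1 \<delta> by auto
      have "exp (\<alpha> * ln (norm z)) = norm z powr \<alpha>" using nz by (simp add: powr_def)
      also have "\<dots> \<le> 2 powr \<alpha>" using n2 \<alpha> by (intro powr_mono2) auto
      also have "\<dots> \<le> 2 powr 1" using \<alpha> by (intro powr_mono) auto
      finally have "\<theta> * exp (\<alpha> * ln (norm z)) \<le> \<theta> * 2" using \<theta> by (intro mult_left_mono) auto
      moreover have "(\<alpha> - 1) * ln (norm z) \<le> (\<alpha> - 1) * ln \<delta>"
        using n1 \<delta> \<alpha> by (intro mult_left_mono_neg iffD2[OF ln_le_cancel_iff]) linarith+
      ultimately have "norm z + (\<alpha> - 1) * ln (norm z) + \<theta> * exp (\<alpha> * ln (norm z)) \<le> (2 + 2 * \<theta>) + (\<alpha> - 1) * ln \<delta>"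
        using n2 by linarith
      then have "norm (hankel_fun \<alpha> \<theta> z) \<le> B"
        unfolding B_def exp_add[symmetric] by (intro order_trans[OF norm_hankel_fun_near[OF nz]]) simp
      then show ?thesis using nz z by blast
    qed
    have 1: "norm (\<Phi> (Complex \<delta> \<delta>) - \<Phi> (Complex 0 \<delta>)) \<le> B * norm (Complex \<delta> \<delta> - Complex 0 \<delta>)"
      by (intro seg bd) (use \<delta> in \<open>auto simp: closed_segment_same_Im closed_segment_eq_real_ivl\<close>)
    have 2: "norm (\<Phi> (Complex \<delta> (-\<delta>)) - \<Phi> (Complex \<delta> \<delta>)) \<le> B * norm (Complex \<delta> (-\<delta>) - Complex \<delta> \<delta>)"
      by (intro seg bd) (use \<delta> in \<open>auto simp: closed_segment_same_Re closed_segment_eq_real_ivl\<close>)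
    have 3: "norm (\<Phi> (Complex 0 (-\<delta>)) - \<Phi> (Complex \<delta> (-\<delta>))) \<le> B * norm (Complex 0 (-\<delta>) - Complex \<delta> (-\<delta>))"
      by (intro seg bd) (use \<delta> in \<open>auto simp: closed_segment_same_Im closed_segment_eq_real_ivl\<close>)
    have n: "norm (Complex \<delta> \<delta> - Complex 0 \<delta>) = \<delta>" "norm (Complex \<delta> (-\<delta>) - Complex \<delta> \<delta>) = 2 * \<delta>"
      "norm (Complex 0 (-\<delta>) - Complex \<delta> (-\<delta>)) = \<delta>"
      unfolding nIm nRe using \<delta> by auto
    have "\<Phi> (Complex 0 (-\<delta>)) - \<Phi> (Complex 0 \<delta>) = (\<Phi> (Complex 0 (-\<delta>)) - \<Phi> (Complex \<delta> (-\<delta>)))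
        + (\<Phi> (Complex \<delta> (-\<delta>)) - \<Phi> (Complex \<delta> \<delta>)) + (\<Phi> (Complex \<delta> \<delta>) - \<Phi> (Complex 0 \<delta>))" by simp
    then have "norm (\<Phi> (Complex 0 (-\<delta>)) - \<Phi> (Complex 0 \<delta>)) \<le> norm (\<Phi> (Complex 0 (-\<delta>)) - \<Phi> (Complex \<delta> (-\<delta>)))
        + norm (\<Phi> (Complex \<delta> (-\<delta>)) - \<Phi> (Complex \<delta> \<delta>)) + norm (\<Phi> (Complex \<delta> \<delta>) - \<Phi> (Complex 0 \<delta>))"
      by (metis norm_triangle_le norm_triangle_ineq add_right_mono)
    also have "\<dots> \<le> 4 * (B * \<delta>)" using 1 2 3 unfolding n by simp
    also have "B * \<delta> = exp (2 + 2 * \<theta>) * \<delta> powr \<alpha>"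
    proof -
      have "exp ((\<alpha> - 1) * ln \<delta>) * exp (ln \<delta>) = exp (\<alpha> * ln \<delta>)"
        unfolding exp_add[symmetric] by (simp add: algebra_simps)
      then show ?thesis unfolding B_def using \<delta> by (simp add: powr_def)
    qed
    finally show ?thesis by simp
  qed

  have "((\<lambda>\<rho>. \<rho>\<^sup>2 * (exp R * exp (- \<theta> * c * \<rho> powr \<alpha>) + exp (- k * \<rho> + \<theta> * \<rho> powr \<alpha>))) \<longlongrightarrow> 0) at_top"
    using \<alpha> \<theta> c_pos k_pos by real_asymp
  then have "\<forall>\<^sub>F \<rho> in at_top. \<rho>\<^sup>2 * (exp R * exp (- \<theta> * c * \<rho> powr \<alpha>) + exp (- k * \<rho> + \<theta> * \<rho> powr \<alpha>)) < 1"
    by (rule order_tendstoD) simp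
  then obtain L0 where L0: "\<And>\<rho>. \<rho> \<ge> L0 \<Longrightarrow>
      \<rho>\<^sup>2 * (exp R * exp (- \<theta> * c * \<rho> powr \<alpha>) + exp (- k * \<rho> + \<theta> * \<rho> powr \<alpha>)) < 1"
    by (auto simp: eventually_at_top_linorder)
  \<comment> \<open>the arc at infinity, along two sides of a large rectangle\<close>
  have far: "norm (\<Phi> (Complex L (-R)) - \<Phi> (Complex 0 L)) \<le> 3 / L" if L: "L \<ge> L0" "L \<ge> R" for L
  proof -
    have bd: "z \<noteq> 0 \<and> 0 \<le> Re z \<and> norm (hankel_fun \<alpha> \<theta> z) \<le> 1 / L\<^sup>2"
      if z: "0 \<le> Re z" "-R \<le> Im z" "Re z = L \<or> Im z = L" for z
    proof -
      have n1: "L \<le> norm z" using z(1,3) abs_Re_le_cmod[of z] abs_Im_le_cmod[of z] by auto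
      have n2: "1 \<le> norm z" using n1 L R by simp
      have "norm (hankel_fun \<alpha> \<theta> z) \<le> exp R * exp (- \<theta> * c * norm z powr \<alpha>) + exp (- k * norm z + \<theta> * norm z powr \<alpha>)"
        using z by (intro norm_hankel_fun_far n2) auto
      also have "\<dots> \<le> 1 / (norm z)\<^sup>2"
      proof -
        have "(norm z)\<^sup>2 > 0" using n2 by (intro zero_less_power) linarith
        then show ?thesis using L0[of "norm z"] n1 L by (simp add: pos_le_divide_eq mult.commute)
      qed
      also have "\<dots> \<le> 1 / L\<^sup>2"
        using n1 L R by (intro divide_left_mono power_mono mult_pos_pos zero_less_power) linarith+
      finally have "norm (hankel_fun \<alpha> \<theta> z) \<le> 1 / L\<^sup>2" .
      moreover have "z \<noteq> 0" using n2 by (metis norm_zero not_one_le_zero)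
      ultimately show ?thesis using z(1) by blast
    qed
    have 1: "norm (\<Phi> (Complex L L) - \<Phi> (Complex 0 L)) \<le> 1 / L\<^sup>2 * norm (Complex L L - Complex 0 L)"
      by (intro seg bd) (use L R in \<open>auto simp: closed_segment_same_Im closed_segment_eq_real_ivl\<close>)
    have 2: "norm (\<Phi> (Complex L (-R)) - \<Phi> (Complex L L)) \<le> 1 / L\<^sup>2 * norm (Complex L (-R) - Complex L L)"
      by (intro seg bd) (use L R in \<open>auto simp: closed_segment_same_Re closed_segment_eq_real_ivl\<close>)
    have n: "norm (Complex L L - Complex 0 L) = L" "norm (Complex L (-R) - Complex L L) = L + R"
      unfolding nIm nRe using L R by auto
    have "\<Phi> (Complex L (-R)) - \<Phi> (Complex 0 L) = (\<Phi> (Complex L (-R)) - \<Phi> (Complex L L)) + (\<Phi> (Complex L L) - \<Phi> (Complex 0 L))"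
      by simp
    then have "norm (\<Phi> (Complex L (-R)) - \<Phi> (Complex 0 L)) \<le> norm (\<Phi> (Complex L (-R)) - \<Phi> (Complex L L)) + norm (\<Phi> (Complex L L) - \<Phi> (Complex 0 L))"
      by (metis norm_triangle_ineq)
    also have "\<dots> \<le> 1 / L\<^sup>2 * (L + R) + 1 / L\<^sup>2 * L" using 1 2 unfolding n by linarith
    also have "\<dots> = 1 / L\<^sup>2 * (2 * L + R)"
      unfolding distrib_left[symmetric] by (intro arg_cong[where f = "\<lambda>w. 1 / L\<^sup>2 * w"]) simp
    also have "\<dots> \<le> 1 / L\<^sup>2 * (3 * L)" using L R by (intro mult_left_mono) auto
    also have "\<dots> = 3 / L" using L R by (simp add: power2_eq_square)
    finally show ?thesis .
  qed

  define D where "D = K * exp R * exp (- (\<theta> * c * R powr \<alpha> / 2))"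
  have D0: "D \<ge> 0" using K0 by (simp add: D_def)
  \<comment> \<open>the vertical line, the only part that contributes to the imaginary part in the limit\<close>
  have vert: "norm (\<Phi> (Complex L (-R)) - \<Phi> (Complex 0 (-R))) \<le> D" if L: "L \<ge> 0" for L
  proof -
    have bd: "norm (hankel_fun \<alpha> \<theta> (of_real y - \<i> * of_real R)) \<le> D / (1 + y)\<^sup>2" if y: "y \<ge> 0" for y
    proof -
      let ?z = "of_real y - \<i> * of_real R"
      have nR: "R \<le> norm ?z" using abs_Im_le_cmod[of ?z] R by simp
      have ny: "y \<le> norm ?z" using abs_Re_le_cmod[of ?z] y by simp
      have nz: "?z \<noteq> 0" using nR R by auto
      have pw: "exp (\<alpha> * ln (norm ?z)) = norm ?z powr \<alpha>" using nz by (simp add: powr_def)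
      have ln0: "(\<alpha> - 1) * ln (norm ?z) \<le> 0" using nR R \<alpha> by (intro mult_nonpos_nonneg) auto
      have "R powr \<alpha> \<le> norm ?z powr \<alpha>" "y powr \<alpha> \<le> norm ?z powr \<alpha>"
        using nR ny R y \<alpha> by (auto intro!: powr_mono2)
      then have h: "(R powr \<alpha> + y powr \<alpha>) / 2 \<le> norm ?z powr \<alpha>" by simp
      have "\<theta> * c * (R powr \<alpha> / 2) + c * (y powr \<alpha> / 2) \<le> \<theta> * c * (R powr \<alpha> / 2) + \<theta> * c * (y powr \<alpha> / 2)"
        using \<theta>1 c_pos by (intro add_left_mono mult_right_mono) auto
      also have "\<dots> = \<theta> * c * ((R powr \<alpha> + y powr \<alpha>) / 2)" by (simp add: algebra_simps)
      also have "\<dots> \<le> \<theta> * c * norm ?z powr \<alpha>" using h \<theta> c_pos by (intro mult_left_mono) auto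
      finally have e: "\<theta> * c * R powr \<alpha> / 2 + c * y powr \<alpha> / 2 \<le> \<theta> * (norm ?z powr \<alpha> * c)"
        by (simp add: mult_ac)
      have "norm (hankel_fun \<alpha> \<theta> ?z) \<le> exp (- Im ?z + (\<alpha> - 1) * ln (norm ?z) - \<theta> * (norm ?z powr \<alpha> * c))"
        using norm_hankel_fun_right[OF nz] y R unfolding pw by simp
      also have "\<dots> \<le> exp (R - \<theta> * c * R powr \<alpha> / 2 - c * y powr \<alpha> / 2)"
        using e ln0 by simp
      also have "\<dots> = exp R * exp (- (\<theta> * c * R powr \<alpha> / 2)) * exp (- (c * y powr \<alpha> / 2))"
        unfolding exp_add[symmetric] by simp
      also have "\<dots> \<le> exp R * exp (- (\<theta> * c * R powr \<alpha> / 2)) * (K / (1 + y)\<^sup>2)"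
        by (intro mult_left_mono K y) auto
      also have "\<dots> = D / (1 + y)\<^sup>2" by (simp add: D_def)
      finally show ?thesis .
    qed
    have "((\<lambda>z. \<Phi> (z - \<i> * of_real R)) has_field_derivative hankel_fun \<alpha> \<theta> (of_real y - \<i> * of_real R) * 1) (at (of_real y))"
      if "y \<ge> 0" for y
    proof (rule DERIV_chain2[of \<Phi> _ "\<lambda>z. z - \<i> * of_real R"])
      show "(\<Phi> has_field_derivative hankel_fun \<alpha> \<theta> (of_real y - \<i> * of_real R)) (at (of_real y - \<i> * of_real R))"
        by (rule \<Phi>) (use that R in \<open>auto simp: complex_eq_iff\<close>)
    qed (auto intro!: derivative_eq_intros)
    then have v: "((\<lambda>y. hankel_fun \<alpha> \<theta> (of_real y - \<i> * of_real R)) has_integral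
        (\<Phi> (of_real L - \<i> * of_real R) - \<Phi> (of_real 0 - \<i> * of_real R))) {0..L}"
      by (intro fundamental_theorem_of_calculus has_vector_derivative_real_field) (use L in auto)
    have w: "((\<lambda>y. D / (1 + y)\<^sup>2) has_integral (- D / (1 + L) - - D / (1 + 0))) {0..L}"
      by (intro fundamental_theorem_of_calculus)
         (use L in \<open>auto intro!: derivative_eq_intros simp: has_real_derivative_iff_has_vector_derivative[symmetric] power2_eq_square\<close>)
    have "norm (integral {0..L} (\<lambda>y. hankel_fun \<alpha> \<theta> (of_real y - \<i> * of_real R))) \<le> integral {0..L} (\<lambda>y. D / (1 + y)\<^sup>2)"
      using v w by (intro Henstock_Kurzweil_Integration.integral_norm_bound_integral bd) (auto simp: integrable_on_def)
    then have "norm (\<Phi> (of_real L - \<i> * of_real R) - \<Phi> (of_real 0 - \<i> * of_real R)) \<le> - D / (1 + L) - - D / (1 + 0)"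
      unfolding integral_unique[OF v] integral_unique[OF w] .
    also have "\<dots> \<le> D" using D0 L by simp
    finally show ?thesis by (simp add: complex_eq_iff[symmetric] Complex_eq)
  qed

  \<comment> \<open>the positive real axis, where the primitive changes by a real amount\<close>
  have real: "Im (\<Phi> (Complex 0 (-R))) = Im (\<Phi> (Complex 0 (-\<delta>)))" if \<delta>: "0 < \<delta>" "\<delta> \<le> 1" for \<delta>
  proof -
    have "((\<lambda>z. \<Phi> (- \<i> * z)) has_field_derivative hankel_fun \<alpha> \<theta> (- \<i> * of_real x) * - \<i>) (at (of_real x))"
      if "x > 0" for x
    proof (rule DERIV_chain2[of \<Phi> _ "\<lambda>z. - \<i> * z"])
      show "(\<Phi> has_field_derivative hankel_fun \<alpha> \<theta> (- \<i> * of_real x)) (at (- \<i> * of_real x))"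
        by (rule \<Phi>) (use that in auto)
    qed (auto intro!: derivative_eq_intros)
    then have "((\<lambda>x. Im (\<Phi> (- \<i> * of_real x))) has_vector_derivative Im (hankel_fun \<alpha> \<theta> (- \<i> * of_real x) * - \<i>)) (at x within {\<delta>..R})"
      if "x > 0" for x
      using that by (intro bounded_linear.has_vector_derivative[OF bounded_linear_Im] has_vector_derivative_real_field)
    then have "((\<lambda>x. Im (\<Phi> (- \<i> * of_real x))) has_vector_derivative 0) (at x within {\<delta>..R})" if "x > 0" for x
      using that hankel_fun_real_axis[OF that] by metis
    then have "((\<lambda>x. 0) has_integral Im (\<Phi> (- \<i> * of_real R)) - Im (\<Phi> (- \<i> * of_real \<delta>))) {\<delta>..R}"
      by (intro fundamental_theorem_of_calculus) (use \<delta> R in auto)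
    then have "Im (\<Phi> (- \<i> * of_real R)) - Im (\<Phi> (- \<i> * of_real \<delta>)) = 0"
      using has_integral_0 has_integral_unique by blast
    then show ?thesis by (simp add: Complex_eq)
  qed

  let ?G = "hankel_integrand \<alpha> \<theta>"
  let ?I = "\<lambda>n. {1 / real (Suc n)..real (Suc n)}"
  define S where "S = (\<lambda>n. \<Phi> (Complex 0 (real (Suc n))) - \<Phi> (Complex 0 (1 / real (Suc n))))"
  have SG: "((\<lambda>x. Im (?G x)) has_integral Im (S n)) (?I n)" for n
  proof -
    have "((\<lambda>z. \<Phi> (\<i> * z)) has_field_derivative hankel_fun \<alpha> \<theta> (\<i> * of_real x) * \<i>) (at (of_real x))"
      if "x > 0" for x
    proof (rule DERIV_chain2[of \<Phi> _ "\<lambda>z. \<i> * z"])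
      show "(\<Phi> has_field_derivative hankel_fun \<alpha> \<theta> (\<i> * of_real x)) (at (\<i> * of_real x))"
        by (rule \<Phi>) (use that in auto)
    qed (auto intro!: derivative_eq_intros)
    then have d: "((\<lambda>z. \<Phi> (\<i> * z)) has_field_derivative ?G x) (at (of_real x))" if "x > 0" for x
      using that hankel_fun_imaginary_axis[OF that] by (metis mult.commute)
    have "(?G has_integral \<Phi> (\<i> * of_real (real (Suc n))) - \<Phi> (\<i> * of_real (1 / real (Suc n)))) (?I n)"
    proof (intro fundamental_theorem_of_calculus has_vector_derivative_real_field d)
      have "1 / real (Suc n) \<le> 1" "1 \<le> real (Suc n)" by auto
      then show "1 / real (Suc n) \<le> real (Suc n)" by linarith
      show "0 < x" if "x \<in> ?I n" for x
      proof -
        have "0 < 1 / real (Suc n)" by simp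
        then show ?thesis using that by (meson atLeastAtMost_iff less_le_trans)
      qed
    qed
    from has_integral_linear[OF this bounded_linear_Im] show ?thesis
      by (simp add: o_def S_def Complex_eq)
  qed
  note hank = wright_M_hankel[of \<alpha> \<theta>]
  have \<alpha>0: "0 < \<alpha>" using \<alpha> by simp
  have ai: "(\<lambda>x. Im (?G x)) absolutely_integrable_on {0<..}"
    using hank(1)[OF \<alpha>0 \<alpha>(2)] unfolding set_integrable_def by (subst (asm) integrable_restrict_space) auto
  have "(\<lambda>n. integral {0<..} (\<lambda>x. if x \<in> ?I n then Im (?G x) else 0)) \<longlonglongrightarrow> integral {0<..} (\<lambda>x. Im (?G x))"
  proof (rule dominated_convergence(2)[where h = "\<lambda>x. \<bar>Im (?G x)\<bar>"])
    have sub: "?I n \<subseteq> {0<..}" for n by (auto intro: less_le_trans[rotated])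
    show "(\<lambda>x. if x \<in> ?I n then Im (?G x) else 0) integrable_on {0<..}" for n
      unfolding integrable_on_def using iffD2[OF has_integral_restrict[OF sub] SG[of n]] by (rule exI)
    show "(\<lambda>x. \<bar>Im (?G x)\<bar>) integrable_on {0<..}"
      using set_integrable_norm[OF ai] by (auto simp: set_lebesgue_integral_eq_integral)
    fix x :: real assume x: "x \<in> {0<..}"
    show "(\<lambda>n. if x \<in> ?I n then Im (?G x) else 0) \<longlonglongrightarrow> Im (?G x)"
    proof (rule tendsto_eventually)
      obtain N where N: "real N \<ge> max x (1 / x)" using real_arch_simple by blast
      have "x \<in> ?I n" if "n \<ge> N" for n
      proof -
        have "real (Suc n) \<ge> x" "real (Suc n) \<ge> 1 / x" using N that by linarith+
        then show ?thesis using x by (simp add: field_simps)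
      qed
      then show "\<forall>\<^sub>F n in sequentially. (if x \<in> ?I n then Im (?G x) else 0) = Im (?G x)"
        by (auto simp: eventually_sequentially)
    qed
  qed auto
  moreover have "integral {0<..} (\<lambda>x. if x \<in> ?I n then Im (?G x) else 0) = Im (S n)" for n
  proof (rule integral_unique)
    have sub: "?I n \<subseteq> {0<..}" by (auto intro: less_le_trans[rotated])
    show "((\<lambda>x. if x \<in> ?I n then Im (?G x) else 0) has_integral Im (S n)) {0<..}"
      by (rule iffD2[OF has_integral_restrict[OF sub] SG[of n]])
  qed
  moreover have "integral {0<..} (\<lambda>x. Im (?G x)) = pi * wright_M \<alpha> \<theta>"
    using hank[OF \<alpha>0 \<alpha>(2)] lebesgue_integral_eq_integral[OF hank(1)[OF \<alpha>0 \<alpha>(2)]] by simp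
  ultimately have lim: "(\<lambda>n. Im (S n)) \<longlonglongrightarrow> pi * wright_M \<alpha> \<theta>" by simp
  have up: "(\<lambda>n. 4 * exp (2 + 2 * \<theta>) * (1 / real (Suc n)) powr \<alpha> + D + 3 / real (Suc n)) \<longlonglongrightarrow> 4 * exp (2 + 2 * \<theta>) * 0 + D + 0"
    by (intro tendsto_intros) (use \<alpha> in real_asymp)+
  obtain N where N: "real N \<ge> max L0 R" using real_arch_simple by blast
  have "\<bar>Im (S n)\<bar> \<le> 4 * exp (2 + 2 * \<theta>) * (1 / real (Suc n)) powr \<alpha> + D + 3 / real (Suc n)" if "n \<ge> N" for n
  proof -
    let ?L = "real (Suc n)" and ?d = "1 / real (Suc n)"
    have L: "?L \<ge> L0" "?L \<ge> R" using N that by linarith+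
    have d: "0 < ?d" "?d \<le> 1" by auto
    have "Im (S n) = - Im (\<Phi> (Complex ?L (-R)) - \<Phi> (Complex 0 ?L)) + Im (\<Phi> (Complex ?L (-R)) - \<Phi> (Complex 0 (-R)))
       + Im (\<Phi> (Complex 0 (-?d)) - \<Phi> (Complex 0 ?d))"
      using real[OF d] by (simp add: S_def)
    then have "\<bar>Im (S n)\<bar> \<le> \<bar>Im (\<Phi> (Complex ?L (-R)) - \<Phi> (Complex 0 ?L))\<bar> + \<bar>Im (\<Phi> (Complex ?L (-R)) - \<Phi> (Complex 0 (-R)))\<bar>
       + \<bar>Im (\<Phi> (Complex 0 (-?d)) - \<Phi> (Complex 0 ?d))\<bar>" by linarith
    also have "\<dots> \<le> 3 / ?L + D + 4 * exp (2 + 2 * \<theta>) * ?d powr \<alpha>"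
      by (intro add_mono order_trans[OF abs_Im_le_cmod] far L vert near d) simp
    finally show ?thesis by simp
  qed
  then have "\<bar>pi * wright_M \<alpha> \<theta>\<bar> \<le> 4 * exp (2 + 2 * \<theta>) * 0 + D + 0"
    by (intro LIMSEQ_le[OF tendsto_rabs[OF lim] up]) blast
  then show ?thesis by (simp add: abs_mult D_def)
qed

end

text \<open>Choosing \<open>R\<close> large makes the rate arbitrary; this is what allows semigroups of any growth.\<close>

lemma wright_M_decay:
  assumes \<alpha>: "1 / 2 < \<alpha>" "\<alpha> < 1"
  obtains C where "\<And>\<theta>. \<theta> \<ge> 0 \<Longrightarrow> \<bar>wright_M \<alpha> \<theta>\<bar> \<le> C * exp (- \<mu> * \<theta>)"
proof -
  define c where "c = cos (pi / 4 * (1 + \<alpha>))"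
  interpret w1: wright_contour \<alpha> 1 by unfold_locales (use \<alpha> in auto)
  have c: "w1.c = c" unfolding w1.c_def c_def ..
  have cp: "c > 0" using w1.c_pos c by simp
  have "((\<lambda>y. (1 + y)\<^sup>2 * exp (- (c * y powr \<alpha> / 2))) \<longlongrightarrow> 0) at_top" using \<alpha> cp by real_asymp
  then have "\<forall>\<^sub>F y in at_top. (1 + y)\<^sup>2 * exp (- (c * y powr \<alpha> / 2)) < 1" by (rule order_tendstoD) simp
  then obtain y0 where y0: "\<And>y. y \<ge> y0 \<Longrightarrow> (1 + y)\<^sup>2 * exp (- (c * y powr \<alpha> / 2)) < 1"
    by (auto simp: eventually_at_top_linorder)
  define K where "K = 1 + (1 + \<bar>y0\<bar>)\<^sup>2"
  have K: "exp (- (c * y powr \<alpha> / 2)) \<le> K / (1 + y)\<^sup>2" if y: "y \<ge> 0" for y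
  proof -
    have "(1 + y)\<^sup>2 * exp (- (c * y powr \<alpha> / 2)) \<le> K"
    proof (cases "y \<ge> y0")
      case True then show ?thesis using y0[OF True] by (simp add: K_def add_increasing2 less_imp_le)
    next
      case False
      have "(1 + y)\<^sup>2 * exp (- (c * y powr \<alpha> / 2)) \<le> (1 + \<bar>y0\<bar>)\<^sup>2 * 1"
        using False y cp by (intro mult_mono power_mono) auto
      then show ?thesis by (simp add: K_def)
    qed
    moreover have "(1 + y)\<^sup>2 > 0" using y by simp
    ultimately show ?thesis by (simp add: pos_le_divide_eq mult.commute)
  qed
  \<comment> \<open>makes the exponent \<open>c R\<^sup>\<alpha> / 2\<close> of the contour bound at least \<open>\<bar>\<mu>\<bar>\<close>\<close>
  define R where "R = max 1 ((2 * \<bar>\<mu>\<bar> / c) powr (1 / \<alpha>))"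
  have R: "R \<ge> 1" "\<bar>\<mu>\<bar> \<le> c * R powr \<alpha> / 2"
  proof -
    have "2 * \<bar>\<mu>\<bar> / c = ((2 * \<bar>\<mu>\<bar> / c) powr (1 / \<alpha>)) powr \<alpha>"
      using cp \<alpha> by (simp add: powr_powr)
    also have "\<dots> \<le> R powr \<alpha>" unfolding R_def using \<alpha> by (intro powr_mono2) auto
    finally show "\<bar>\<mu>\<bar> \<le> c * R powr \<alpha> / 2" using cp by (simp add: field_simps)
  qed (simp add: R_def)
  have big: "\<bar>wright_M \<alpha> \<theta>\<bar> \<le> K * exp R * exp (- \<mu> * \<theta>)" if \<theta>: "\<theta> \<ge> 1" for \<theta>
  proof -
    interpret w: wright_contour \<alpha> \<theta> by unfold_locales (use \<alpha> \<theta> in auto)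
    have c': "w.c = c" unfolding w.c_def c_def ..
    have "1 * \<bar>wright_M \<alpha> \<theta>\<bar> \<le> pi * \<bar>wright_M \<alpha> \<theta>\<bar>" using pi_gt3 by (intro mult_right_mono) auto
    also have "\<dots> \<le> K * exp R * exp (- (\<theta> * c * R powr \<alpha> / 2))"
      using w.wright_M_bound[OF R(1) \<theta>, of K] K unfolding c' by blast
    also have "\<dots> \<le> K * exp R * exp (- \<mu> * \<theta>)"
    proof (intro mult_left_mono)
      have "\<mu> * \<theta> \<le> (c * R powr \<alpha> / 2) * \<theta>" using R(2) \<theta> by (intro mult_right_mono) auto
      then show "exp (- (\<theta> * c * R powr \<alpha> / 2)) \<le> exp (- \<mu> * \<theta>)" by (simp add: mult_ac)
    qed (auto simp: K_def)
    finally show ?thesis by simp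
  qed
  have "compact (wright_M \<alpha> ` {0..1})"
    using \<alpha> by (intro compact_continuous_image continuous_wright_M) auto
  then obtain B where B: "\<And>\<theta>. \<theta> \<in> {0..1} \<Longrightarrow> \<bar>wright_M \<alpha> \<theta>\<bar> \<le> B"
    using compact_imp_bounded bounded_iff by (metis (no_types, lifting) imageI real_norm_def)
  have B0: "B \<ge> 0" using B[of 0] by simp
  show thesis
  proof (rule that[of "K * exp R + B * exp \<bar>\<mu>\<bar>"])
    fix \<theta> :: real assume \<theta>: "\<theta> \<ge> 0"
    show "\<bar>wright_M \<alpha> \<theta>\<bar> \<le> (K * exp R + B * exp \<bar>\<mu>\<bar>) * exp (- \<mu> * \<theta>)"
    proof (cases "\<theta> \<ge> 1")
      case True
      have "0 \<le> B * exp \<bar>\<mu>\<bar> * exp (- \<mu> * \<theta>)" using B0 by simp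
      then show ?thesis using big[OF True] by (simp add: distrib_right)
    next
      case False
      have "\<mu> * \<theta> \<le> \<bar>\<mu>\<bar> * 1" using False \<theta> by (intro mult_mono) auto
      then have "1 \<le> exp \<bar>\<mu>\<bar> * exp (- \<mu> * \<theta>)" unfolding exp_add[symmetric] by simp
      then have "B * 1 \<le> B * (exp \<bar>\<mu>\<bar> * exp (- \<mu> * \<theta>))" using B0 by (intro mult_left_mono)
      moreover have "0 \<le> K * exp R * exp (- \<mu> * \<theta>)" by (simp add: K_def)
      ultimately show ?thesis using B[of \<theta>] False \<theta> by (simp add: distrib_right mult.assoc)
    qed
  qed
qed

section \<open>Compact semigroups\<close>

text \<open>The uniform boundedness principle, by Baire category: one of the closed sets on which all \<open>L n\<close> are
  bounded by a given constant has interior points.\<close>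

lemma uniform_boundedness:
  fixes L :: "nat \<Rightarrow> 'x::banach \<Rightarrow>\<^sub>L 'z::real_normed_vector"
  assumes b: "\<And>x. bounded (range (\<lambda>n. blinfun_apply (L n) x))"
  obtains K where "\<And>n. norm (L n) \<le> K"
proof -
  define F where "F = (\<lambda>k::nat. {x. \<forall>n. norm (L n x) \<le> real k})"
  have cl: "closed (F k)" for k
    unfolding F_def by (intro closed_Collect_all closed_Collect_le continuous_intros)
  have un: "(\<Union>k. F k) = UNIV"
  proof -
    have "x \<in> (\<Union>k. F k)" for x
    proof -
      obtain B where B: "\<And>n. norm (L n x) \<le> B" using b[of x] unfolding bounded_iff by blast
      obtain k :: nat where "B \<le> real k" using real_arch_simple by blast
      then have "x \<in> F k" unfolding F_def using B order_trans by blast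
      then show ?thesis by blast
    qed
    then show ?thesis by blast
  qed
  obtain k where k: "interior (F k) \<noteq> {}"
  proof (rule ccontr)
    assume "\<not> thesis"
    then have e: "interior (F k) = {}" for k using that by blast
    have "euclidean interior_of (\<Union>(range F)) = {}"
    proof (rule Baire_category_alt)
      show "closedin euclidean S \<and> euclidean interior_of S = {}" if "S \<in> range F" for S
        using that cl e by auto
    qed (rule disjI1, rule completely_metrizable_space_euclidean, rule countable_image[OF countableI_type])
    then show False unfolding un by simp
  qed
  then obtain x0 where "x0 \<in> interior (F k)" by blast
  then obtain e where e: "e > 0" "ball x0 e \<subseteq> F k" unfolding mem_interior by blast
  have le: "norm (L n) \<le> 4 * real k / e" for n
  proof (rule norm_blinfun_bound)
    show "0 \<le> 4 * real k / e" using e by simp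
    fix x
    show "norm (L n x) \<le> 4 * real k / e * norm x"
    proof (cases "x = 0")
      case False
      define y where "y = (e / (2 * norm x)) *\<^sub>R x"
      have "norm y < e" unfolding y_def using False e(1) by simp
      then have "x0 + y \<in> F k" "x0 \<in> F k" using e by (auto simp: dist_norm subset_iff)
      then have "norm (L n (x0 + y)) \<le> k" "norm (L n x0) \<le> k" unfolding F_def by blast+
      moreover have "norm (L n y) \<le> norm (L n (x0 + y)) + norm (L n x0)"
        using norm_triangle_ineq4[of "L n (x0 + y)" "L n x0"] by (simp add: blinfun.add_right)
      ultimately have "norm (L n y) \<le> 2 * real k" by linarith
      then have "(e / (2 * norm x)) * norm (L n x) \<le> 2 * real k"
        unfolding y_def using e by (simp add: blinfun.scaleR_right)
      then show ?thesis using False e by (simp add: field_simps)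
    qed simp
  qed
  show thesis by (rule that[OF le])
qed

lemma norm_blinfun_le_unit_ball:
  fixes L :: "'x::real_normed_vector \<Rightarrow>\<^sub>L 'z::real_normed_vector"
  assumes "\<And>x. norm x \<le> 1 \<Longrightarrow> norm (L x) \<le> b" "0 \<le> b"
  shows "norm L \<le> b"
proof (rule norm_blinfun_bound[OF assms(2)])
  fix x
  show "norm (L x) \<le> b * norm x"
  proof (cases "x = 0")
    case False
    have "norm (L ((1 / norm x) *\<^sub>R x)) \<le> b" by (rule assms(1)) (use False in simp)
    then show ?thesis using False by (simp add: blinfun.scaleR_right field_simps)
  qed simp
qed

lemma compact_imp_countable_dense:
  fixes S :: "'a::metric_space set"
  assumes "compact S"
  obtains D where "countable D" "S \<subseteq> closure D"
proof -
  have "\<exists>k. finite k \<and> S \<subseteq> (\<Union>x\<in>k. ball x (1 / real (Suc n)))" for n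
    using assms unfolding compact_eq_totally_bounded by simp
  then obtain k where k: "\<And>n. finite (k n)" "\<And>n. S \<subseteq> (\<Union>x\<in>k n. ball x (1 / real (Suc n)))" by metis
  have "x \<in> closure (\<Union>n. k n)" if "x \<in> S" for x
    unfolding closure_approachable
  proof (intro allI impI)
    fix e :: real assume "e > 0"
    then obtain n where n: "1 / real (Suc n) < e" using nat_approx_posE by metis
    from that k(2)[of n] obtain y where "y \<in> k n" "dist y x < 1 / real (Suc n)" by auto
    with n show "\<exists>y\<in>\<Union> (range k). dist y x < e" by (intro bexI[of _ y]) auto
  qed
  moreover have "countable (\<Union>n. k n)" using k(1) by (auto intro: countable_finite)
  ultimately show thesis using that by blast
qed

locale compact_semigroup =
  fixes T :: "real \<Rightarrow> 'x::banach \<Rightarrow>\<^sub>L 'x"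
  assumes C0: "C0_semigroup T" and T_compact: "\<And>t. t > 0 \<Longrightarrow> compact_operator (T t)"
begin

lemma T_0: "T 0 = id_blinfun" using C0 unfolding C0_semigroup_def by blast

lemma T_add: "0 \<le> s \<Longrightarrow> 0 \<le> t \<Longrightarrow> T (s + t) x = T s (T t x)"
proof -
  assume "0 \<le> s" "0 \<le> t"
  then have "T (s + t) = T s o\<^sub>L T t" using C0 unfolding C0_semigroup_def by blast
  then show ?thesis by simp
qed

lemma T_tendsto_0: "((\<lambda>t. T t x) \<longlongrightarrow> x) (at_right 0)"
  using C0 unfolding C0_semigroup_def by blast

text \<open>Otherwise there would be \<open>t\<^sub>n \<rightarrow> 0\<close> with \<open>\<parallel>T t\<^sub>n\<parallel> \<rightarrow> \<infinity>\<close> although \<open>T t\<^sub>n x\<close> converges for every \<open>x\<close>.\<close>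

lemma T_bounded_near_0:
  obtains \<delta> K where "\<delta> > 0" "\<And>t. 0 \<le> t \<Longrightarrow> t \<le> \<delta> \<Longrightarrow> norm (T t) \<le> K"
proof (rule ccontr)
  assume "\<not> thesis"
  then have "\<exists>t. 0 \<le> t \<and> t \<le> 1 / real (Suc n) \<and> \<not> norm (T t) \<le> real n" for n
    using that[of "1 / real (Suc n)" "real n"] by auto
  then obtain t where t: "\<And>n. 0 \<le> t n" "\<And>n. t n \<le> 1 / real (Suc n)" "\<And>n. \<not> norm (T (t n)) \<le> real n" by metis
  have t_pos: "t n > 0" if "n > 0" for n
  proof (rule ccontr)
    assume "\<not> t n > 0"
    then have "t n = 0" using t(1)[of n] by simp
    then have "norm (T (t n)) \<le> 1" using norm_blinfun_id_le by (simp add: T_0)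
    then show False using t(3)[of n] that by simp
  qed
  have t0: "t \<longlonglongrightarrow> 0"
    by (rule tendsto_sandwich[of "\<lambda>_. 0" _ _ "\<lambda>n. 1 / real (Suc n)"])
       (use t in \<open>simp_all only: LIMSEQ_Suc[OF lim_1_over_n] always_eventually tendsto_const eventually_True\<close>)
  have tr: "filterlim t (at_right 0) sequentially"
    unfolding filterlim_at
  proof (intro conjI t0 eventually_sequentiallyI[of 1])
    show "t n \<in> {0<..}" "t n \<noteq> 0" if "1 \<le> n" for n using t_pos[of n] that by auto
  qed
  have "bounded (range (\<lambda>n. blinfun_apply (T (t n)) x))" for x
    by (rule convergent_imp_bounded[OF filterlim_compose[OF T_tendsto_0 tr]])
  then obtain K where K: "\<And>n. norm (T (t n)) \<le> K" using uniform_boundedness[of "\<lambda>n. T (t n)"] by blast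
  obtain n :: nat where "K \<le> real n" using real_arch_simple by blast
  then show False using K[of n] t(3)[of n] by linarith
qed

lemma T_exp_bound:
  obtains K \<omega> where "K \<ge> 1" "\<omega> \<ge> 0" "\<And>t. 0 \<le> t \<Longrightarrow> norm (T t) \<le> K * exp (\<omega> * t)"
proof -
  obtain \<delta> K0 where \<delta>: "\<delta> > 0" "\<And>t. 0 \<le> t \<Longrightarrow> t \<le> \<delta> \<Longrightarrow> norm (T t) \<le> K0"
    using T_bounded_near_0 by blast
  define K where "K = max 1 K0"
  have K: "K \<ge> 1" "\<And>t. 0 \<le> t \<Longrightarrow> t \<le> \<delta> \<Longrightarrow> norm (T t) \<le> K"
    unfolding K_def using \<delta>(2) by (auto intro: max.coboundedI2)
  have ind: "norm (T t) \<le> K ^ Suc n" if "0 \<le> t" "t \<le> real (Suc n) * \<delta>" for n t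
    using that
  proof (induction n arbitrary: t)
    case 0 then show ?case using K(2)[of t] by simp
  next
    case (Suc n)
    have KK: "K * 1 \<le> K * K ^ Suc n" using K(1) one_le_power[OF K(1), of "Suc n"] by (intro mult_left_mono) auto
    show ?case
    proof (cases "t \<le> \<delta>")
      case True
      then show ?thesis using K(2)[OF Suc.prems(1) True] KK by simp
    next
      case False
      have "T t = T \<delta> o\<^sub>L T (t - \<delta>)"
        using T_add[of \<delta> "t - \<delta>"] False \<delta>(1) by (intro blinfun_eqI) simp
      then have "norm (T t) \<le> norm (T \<delta>) * norm (T (t - \<delta>))"
        by (simp add: norm_blinfun_compose)
      also have "\<dots> \<le> K * K ^ Suc n"
        using False Suc.prems \<delta>(1) K(1) by (intro mult_mono K(2) Suc.IH) (auto simp: algebra_simps)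
      finally show ?thesis by simp
    qed
  qed
  show thesis
  proof (rule that[of K "ln K / \<delta>"])
    fix t :: real assume t: "0 \<le> t"
    define n where "n = nat \<lfloor>t / \<delta>\<rfloor>"
    have td: "t / \<delta> \<ge> 0" using t \<delta> by simp
    have n: "real n \<le> t / \<delta>" "t / \<delta> \<le> real (Suc n)" unfolding n_def using td by linarith+
    have "norm (T t) \<le> K ^ Suc n" using n \<delta>(1) t by (intro ind) (auto simp: field_simps)
    also have "\<dots> = K * exp (ln K * real n)" using K(1) by (simp add: exp_of_nat2_mult)
    also have "\<dots> \<le> K * exp (ln K / \<delta> * t)"
    proof -
      have "ln K * real n \<le> ln K * (t / \<delta>)" using n K(1) by (intro mult_left_mono) auto
      then show ?thesis using K(1) by simp
    qed
    finally show "norm (T t) \<le> K * exp (ln K / \<delta> * t)" .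
  qed (use K(1) \<delta>(1) in auto)
qed

lemma T_locally_bounded:
  obtains M where "M \<ge> 1" "\<And>t. 0 \<le> t \<Longrightarrow> t \<le> L \<Longrightarrow> norm (T t) \<le> M"
proof -
  obtain K \<omega> where K: "K \<ge> 1" "\<omega> \<ge> 0" "\<And>t. 0 \<le> t \<Longrightarrow> norm (T t) \<le> K * exp (\<omega> * t)"
    using T_exp_bound by blast
  show thesis
  proof (rule that[of "K * exp (\<omega> * \<bar>L\<bar>)"])
    have "1 * 1 \<le> K * exp (\<omega> * \<bar>L\<bar>)" using K by (intro mult_mono) auto
    then show "1 \<le> K * exp (\<omega> * \<bar>L\<bar>)" by simp
    fix t :: real assume t: "0 \<le> t" "t \<le> L"
    then have "\<omega> * t \<le> \<omega> * \<bar>L\<bar>" using K(2) by (intro mult_left_mono) auto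
    then have "K * exp (\<omega> * t) \<le> K * exp (\<omega> * \<bar>L\<bar>)" using K(1) by (intro mult_left_mono) auto
    then show "norm (T t) \<le> K * exp (\<omega> * \<bar>L\<bar>)" using K(3)[OF t(1)] by linarith
  qed
qed

lemma T_diff_bound:
  assumes M: "\<And>t. 0 \<le> t \<Longrightarrow> t \<le> L \<Longrightarrow> norm (T t) \<le> M"
    and st: "0 \<le> s" "0 \<le> t" "s \<le> L" "t \<le> L"
  shows "norm (T t x - T s x) \<le> M * norm (T \<bar>t - s\<bar> x - x)"
proof -
  have *: "norm (T t x - T s x) \<le> M * norm (T (t - s) x - x)"
    if st: "0 \<le> s" "s \<le> t" "t \<le> L" for s t
  proof -
    have "T t x - T s x = T s (T (t - s) x - x)"
      using T_add[of s "t - s" x] st by (simp add: blinfun.diff_right)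
    then have "norm (T t x - T s x) \<le> norm (T s) * norm (T (t - s) x - x)"
      by (simp add: norm_blinfun)
    also have "\<dots> \<le> M * norm (T (t - s) x - x)" using st by (intro mult_right_mono M) auto
    finally show ?thesis .
  qed
  show ?thesis
  proof (cases "s \<le> t")
    case True then show ?thesis using *[of s t] st by simp
  next
    case False then show ?thesis using *[of t s] st by (simp add: norm_minus_commute abs_if)
  qed
qed

text \<open>Strong continuity at \<open>0\<close> on a finite net of \<open>C\<close>, extended to \<open>C\<close> by local boundedness.\<close>

lemma T_near_identity:
  assumes C: "compact C" and e: "e > 0"
  obtains d where "d > 0" "\<And>h y. 0 \<le> h \<Longrightarrow> h < d \<Longrightarrow> y \<in> C \<Longrightarrow> norm (T h y - y) < e"
proof -
  obtain M where M: "M \<ge> 1" "\<And>t. 0 \<le> t \<Longrightarrow> t \<le> 1 \<Longrightarrow> norm (T t) \<le> M"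
    using T_locally_bounded[of 1] by blast
  define r where "r = e / (4 * M)"
  have r: "r > 0" using e M by (simp add: r_def)
  obtain k where k: "finite k" "C \<subseteq> (\<Union>x\<in>k. ball x r)"
    using C r unfolding compact_eq_totally_bounded by blast
  have "\<forall>\<^sub>F h in at_right 0. dist (T h z) z < e / 2" for z
    by (rule tendstoD[OF T_tendsto_0]) (use e in simp)
  then have "\<forall>\<^sub>F h in at_right 0. \<forall>z\<in>k. dist (T h z) z < e / 2"
    by (intro eventually_ball_finite k(1)) blast
  then obtain d where d: "d > 0" "\<And>h z. 0 < h \<Longrightarrow> h < d \<Longrightarrow> z \<in> k \<Longrightarrow> dist (T h z) z < e / 2"
    unfolding eventually_at_right_field by auto
  show thesis
  proof (rule that[of "min d 1"])
    show "min d 1 > 0" using d by simp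
    fix h y assume h: "0 \<le> h" "h < min d 1" and y: "y \<in> C"
    show "norm (T h y - y) < e"
    proof (cases "h = 0")
      case True then show ?thesis using e by (simp add: T_0)
    next
      case False
      obtain z where z: "z \<in> k" "dist z y < r" using k(2) y by auto
      have 1: "norm (T h z - z) < e / 2" using d(2)[of h z] h False z by (simp add: dist_norm)
      have "norm (T h (y - z)) \<le> norm (T h) * norm (y - z)" by (rule norm_blinfun)
      also have "\<dots> \<le> M * r" using z(2) M h r
        by (intro mult_mono M) (auto simp: dist_norm norm_minus_commute)
      also have "M * r = e / 4" using M by (simp add: r_def)
      finally have 2: "norm (T h (y - z)) \<le> e / 4" .
      have "r \<le> e / 4" unfolding r_def using M e by (intro divide_left_mono) auto
      then have 3: "norm (z - y) < e / 4" using z(2) by (simp add: dist_norm)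
      have "T h y - y = T h (y - z) + ((T h z - z) + (z - y))" by (simp add: blinfun.diff_right)
      then have "norm (T h y - y) \<le> norm (T h (y - z)) + (norm (T h z - z) + norm (z - y))"
        by (metis norm_triangle_ineq norm_triangle_mono order_refl)
      then show ?thesis using 1 2 3 by linarith
    qed
  qed
qed

lemma continuous_T_apply: "continuous_on {0..} (\<lambda>t. T t x)"
  unfolding continuous_on_iff
proof (intro ballI allI impI)
  fix t e :: real assume t: "t \<in> {0..}" and e: "e > 0"
  obtain M where M: "M \<ge> 1" "\<And>s. 0 \<le> s \<Longrightarrow> s \<le> t + 1 \<Longrightarrow> norm (T s) \<le> M"
    using T_locally_bounded[of "t + 1"] by blast
  have "e / M > 0" using e M by simp
  then obtain d where d: "d > 0" "\<And>h. 0 \<le> h \<Longrightarrow> h < d \<Longrightarrow> norm (T h x - x) < e / M"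
    using T_near_identity[of "{x}" "e / M"] by (metis compact_sing singletonI)
  show "\<exists>d>0. \<forall>x'\<in>{0..}. dist x' t < d \<longrightarrow> dist (T x' x) (T t x) < e"
  proof (intro exI[of _ "min d 1"] conjI ballI impI)
    fix s assume s: "s \<in> {0..}" "dist s t < min d 1"
    have "norm (T s x - T t x) \<le> M * norm (T \<bar>s - t\<bar> x - x)"
      using s t by (intro T_diff_bound[OF M(2)]) (auto simp: dist_real_def)
    also have "\<dots> < M * (e / M)" using s M by (intro mult_strict_left_mono d) (auto simp: dist_real_def)
    finally show "dist (T s x) (T t x) < e" using M by (simp add: dist_norm)
  qed (use d(1) in simp)
qed

text \<open>For \<open>t > s > 0\<close> write \<open>T t = T (t - s) T s\<close>: the image of the unit ball under \<open>T s\<close> is relatively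
  compact, and strong continuity is uniform on compact sets.\<close>

lemma continuous_T_norm: "continuous_on {0<..} T"
  unfolding continuous_on_iff
proof (intro ballI allI impI)
  fix t e :: real assume t: "t \<in> {0<..}" and e: "e > 0"
  define s where "s = t / 2"
  have s: "0 < s" "s < t" using t by (auto simp: s_def)
  define C where "C = closure (T s ` cball 0 1)"
  have C: "compact C" using T_compact[OF s(1)] unfolding C_def compact_operator_def by auto
  obtain M where M: "M \<ge> 1" "\<And>s. 0 \<le> s \<Longrightarrow> s \<le> t + 1 \<Longrightarrow> norm (T s) \<le> M"
    using T_locally_bounded[of "t + 1"] by blast
  have "e / (2 * M) > 0" using e M by simp
  then obtain d where d: "d > 0" "\<And>h y. 0 \<le> h \<Longrightarrow> h < d \<Longrightarrow> y \<in> C \<Longrightarrow> norm (T h y - y) < e / (2 * M)"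
    using T_near_identity[OF C] by blast
  show "\<exists>d>0. \<forall>x'\<in>{0<..}. dist x' t < d \<longrightarrow> dist (T x') (T t) < e"
  proof (intro exI[of _ "min d (min s 1)"] conjI ballI impI)
    fix r assume r: "r \<in> {0<..}" "dist r t < min d (min s 1)"
    then have "\<bar>r - t\<bar> < s" "\<bar>r - t\<bar> < 1" "\<bar>r - t\<bar> < d" by (auto simp: dist_real_def)
    moreover have "t = 2 * s" by (simp add: s_def)
    ultimately have rs: "s \<le> r" "r \<le> t + 1" "\<bar>r - t\<bar> < d" by linarith+
    have "norm (T r - T t) \<le> e / 2"
    proof (rule norm_blinfun_le_unit_ball)
      fix x :: 'x assume "norm x \<le> 1"
      then have y: "T s x \<in> C" unfolding C_def by (intro subsetD[OF closure_subset]) auto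
      have "T r x - T t x = T (r - s) (T s x) - T (t - s) (T s x)"
        using T_add[of "r - s" s x] T_add[of "t - s" s x] rs s by simp
      then have "norm (T r x - T t x) \<le> M * norm (T \<bar>(r - s) - (t - s)\<bar> (T s x) - T s x)"
        using rs s by (simp only:) (intro T_diff_bound[OF M(2)], auto)
      also have "\<dots> \<le> M * (e / (2 * M))"
        using M rs y by (intro mult_left_mono less_imp_le[OF d(2)]) auto
      also have "\<dots> = e / 2" using M by simp
      finally show "norm ((T r - T t) x) \<le> e / 2" by (simp add: blinfun.diff_left)
    qed (use e in simp)
    then show "dist (T r) (T t) < e" using e by (simp add: dist_norm)
  qed (use d(1) s in simp)
qed

text \<open>The operators \<open>T (1 / n)\<close> map balls to relatively compact, hence separable, sets, and
  \<open>T (1 / n) x\<close> tends to \<open>x\<close>.\<close>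

lemma separable: "\<exists>D :: 'x set. separable_banach D"
proof -
  let ?S = "\<lambda>(n, m). closure (T (1 / real (Suc n)) ` cball 0 (real m))"
  have "\<exists>D. countable D \<and> ?S p \<subseteq> closure D" for p :: "nat \<times> nat"
  proof -
    have "compact (?S p)"
      using T_compact unfolding compact_operator_def by (auto split: prod.split)
    from compact_imp_countable_dense[OF this] obtain D where "countable D" "?S p \<subseteq> closure D" .
    then show ?thesis by (intro exI conjI)
  qed
  then obtain D where D: "\<And>p. countable (D p)" "\<And>p. ?S p \<subseteq> closure (D p)" by metis
  have "x \<in> closure (\<Union>p. D p)" for x
  proof -
    have lim: "(\<lambda>n. T (1 / real (Suc n)) x) \<longlonglongrightarrow> x"
    proof (rule filterlim_compose[OF T_tendsto_0])
      show "filterlim (\<lambda>n. 1 / real (Suc n)) (at_right 0) sequentially"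
        unfolding filterlim_at by (intro conjI LIMSEQ_Suc[OF lim_1_over_n]) simp_all
    qed
    obtain m :: nat where m: "norm x \<le> real m" using real_arch_simple by blast
    have "T (1 / real (Suc n)) x \<in> closure (\<Union>p. D p)" for n
    proof -
      have "T (1 / real (Suc n)) x \<in> ?S (n, m)"
        using m by (auto intro!: subsetD[OF closure_subset])
      also have "\<dots> \<subseteq> closure (D (n, m))" by (rule D(2))
      also have "\<dots> \<subseteq> closure (\<Union>p. D p)" by (intro closure_mono) blast
      finally show ?thesis .
    qed
    then show ?thesis by (rule closed_sequentially[OF closed_closure _ lim])
  qed
  then have "closure (\<Union>p. D p) = UNIV" by blast
  moreover have "countable (\<Union>p. D p)" using D(1) by auto
  ultimately show ?thesis unfolding separable_banach_def by blast
qed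

end

text \<open>Total boundedness is inherited from the approximating compact sets.\<close>

lemma compact_closure_if_near_compact:
  fixes S :: "'a::banach set"
  assumes near: "\<And>e. e > 0 \<Longrightarrow> \<exists>C. compact C \<and> S \<subseteq> (\<Union>c\<in>C. ball c e)"
  shows "compact (closure S)"
  unfolding compact_eq_totally_bounded
proof (intro conjI allI impI)
  show "complete (closure S)" by (simp add: complete_eq_closed)
  fix e :: real assume e: "e > 0"
  obtain C where C: "compact C" "S \<subseteq> (\<Union>c\<in>C. ball c (e / 4))" using near[of "e / 4"] e by auto
  obtain k where k: "finite k" "C \<subseteq> (\<Union>x\<in>k. ball x (e / 4))"
    using C(1) e unfolding compact_eq_totally_bounded by (metis divide_pos_pos zero_less_numeral)
  have "S \<subseteq> (\<Union>x\<in>k. cball x (e / 2))"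
  proof
    fix s assume "s \<in> S"
    with C(2) obtain c where c: "c \<in> C" "dist c s < e / 4" by auto
    with k(2) obtain x where "x \<in> k" "dist x c < e / 4" by auto
    with c have "dist x s \<le> e / 2" using dist_triangle[of x s c] by simp
    then show "s \<in> (\<Union>x\<in>k. cball x (e / 2))" using \<open>x \<in> k\<close> by auto
  qed
  moreover have "closed (\<Union>x\<in>k. cball x (e / 2))" using k(1) by (intro closed_UN) auto
  ultimately have "closure S \<subseteq> (\<Union>x\<in>k. cball x (e / 2))" by (rule closure_minimal)
  also have "\<dots> \<subseteq> (\<Union>x\<in>k. ball x e)" using e by auto
  finally show "\<exists>k. finite k \<and> closure S \<subseteq> (\<Union>x\<in>k. ball x e)" using k(1) by blast
qed

lemma measurable_continuous_off_point:
  fixes f :: "real \<Rightarrow> 'b::topological_space"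
  assumes c: "continuous_on (S - {a}) f" and S: "S \<in> sets lebesgue"
  shows "f \<in> borel_measurable (lebesgue_on S)"
proof (rule borel_measurableI)
  fix W :: "'b set" assume W: "open W"
  have "f \<in> borel_measurable (lebesgue_on (S - {a}))"
    using S by (intro continuous_imp_measurable_on_sets_lebesgue c) auto
  then have "f -` W \<inter> space (lebesgue_on (S - {a})) \<in> sets (lebesgue_on (S - {a}))"
    using W by (intro measurable_sets[of _ _ borel]) auto
  moreover have "S - {a} \<in> sets lebesgue" using S by (intro sets.Diff) auto
  ultimately have 1: "f -` W \<inter> (S - {a}) \<in> sets lebesgue"
    by (subst (asm) sets_restrict_space_iff) auto
  have eq: "f -` W \<inter> S = (f -` W \<inter> (S - {a})) \<union> (f -` W \<inter> S \<inter> {a})" by auto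
  have 2: "f -` W \<inter> S \<inter> {a} \<in> sets lebesgue"
    by (rule negligible_imp_sets) (rule negligible_subset[of "{a}"], auto)
  have "f -` W \<inter> S \<in> sets lebesgue" by (subst eq) (rule sets.Un[OF 1 2])
  then show "f -` W \<inter> space (lebesgue_on S) \<in> sets (lebesgue_on S)"
    using S by (auto simp: sets_restrict_space)
qed

context compact_semigroup begin

text \<open>An operator family as needed for the solution operator: bounded and strongly continuous up to
  \<open>0\<close>, compact and norm continuous away from \<open>0\<close>.\<close>

definition regular_family :: "(real \<Rightarrow> 'x \<Rightarrow>\<^sub>L 'x) \<Rightarrow> bool" where
  "regular_family P \<longleftrightarrow> (\<forall>x. continuous_on {0..} (\<lambda>r. P r x)) \<and>
     (\<forall>L. \<exists>C. \<forall>r. 0 \<le> r \<longrightarrow> r \<le> L \<longrightarrow> norm (P r) \<le> C) \<and>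
     (\<forall>r>0. compact_operator (P r)) \<and> continuous_on {0<..} P"

lemma regular_family_T: "regular_family T"
  unfolding regular_family_def
proof (intro conjI allI impI continuous_T_apply continuous_T_norm T_compact)
  fix L
  obtain M where "\<And>t. 0 \<le> t \<Longrightarrow> t \<le> L \<Longrightarrow> norm (T t) \<le> M" using T_locally_bounded[of L] by metis
  then show "\<exists>C. \<forall>r. 0 \<le> r \<longrightarrow> r \<le> L \<longrightarrow> norm (T r) \<le> C" by (intro exI allI impI)
qed

end

text \<open>For \<open>\<alpha> < 1\<close> the operators \<open>P\<^sub>\<alpha>\<close> are means of the semigroup with respect to the Wright function.\<close>

locale subordinated_semigroup = compact_semigroup T + separable_banach D
  for T :: "real \<Rightarrow> 'x::banach \<Rightarrow>\<^sub>L 'x" and D :: "'x set" +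
  fixes \<alpha> :: real
  assumes \<alpha>: "1 / 2 < \<alpha>" "\<alpha> < 1"
begin

abbreviation (input) "HL \<equiv> lebesgue_on {0::real..}"

definition weight :: "real \<Rightarrow> real" where "weight \<theta> = \<alpha> * \<theta> * wright_M \<alpha> \<theta>"

definition integrand :: "real \<Rightarrow> 'x \<Rightarrow> real \<Rightarrow> 'x" where
  "integrand r x \<theta> = weight \<theta> *\<^sub>R T (r powr \<alpha> * \<theta>) x"

lemma continuous_weight: "continuous_on S weight"
  unfolding weight_def using \<alpha> by (intro continuous_intros continuous_wright_M) auto

text \<open>The weight beats the exponential growth of the semigroup.\<close>

lemma weight_dominates_below:
  obtains w where "integrable HL w" "\<And>\<theta>. \<theta> \<ge> 0 \<Longrightarrow> w \<theta> \<ge> 0"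
    "\<And>\<tau> \<theta>. 0 \<le> \<tau> \<Longrightarrow> \<tau> \<le> \<bar>L\<bar> powr \<alpha> * \<theta> \<Longrightarrow> 0 \<le> \<theta> \<Longrightarrow> \<bar>weight \<theta>\<bar> * norm (T \<tau>) \<le> w \<theta>"
proof -
  obtain K \<omega> where K: "K \<ge> 1" "\<omega> \<ge> 0" "\<And>t. 0 \<le> t \<Longrightarrow> norm (T t) \<le> K * exp (\<omega> * t)"
    using T_exp_bound by blast
  \<comment> \<open>one unit of the rate absorbs the factor \<open>\<theta>\<close>, another remains for integrability\<close>
  define \<mu> where "\<mu> = \<omega> * \<bar>L\<bar> powr \<alpha> + 2"
  obtain C where C: "\<And>\<theta>. \<theta> \<ge> 0 \<Longrightarrow> \<bar>wright_M \<alpha> \<theta>\<bar> \<le> C * exp (- \<mu> * \<theta>)"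
    using wright_M_decay[OF \<alpha>] by blast
  have C0: "C \<ge> 0" using C[of 0] by simp
  have "(\<lambda>x. exp (- 1 * x)) integrable_on {0::real..}"
    by (rule integrable_on_exp_minus_to_infinity) simp
  then have "(\<lambda>x. exp (- 1 * x)) absolutely_integrable_on {0::real..}"
    by (intro nonnegative_absolutely_integrable_1) auto
  then have "integrable HL (\<lambda>x. exp (- 1 * x))" by (intro absolutely_integrable_imp_integrable) auto
  then have I: "integrable HL (\<lambda>x. K * C * exp (- x))" by simp
  show thesis
  proof (rule that[OF I])
    show "0 \<le> K * C * exp (- \<theta>)" for \<theta> using K C0 by simp
    fix \<tau> \<theta> :: real assume \<tau>: "0 \<le> \<tau>" "\<tau> \<le> \<bar>L\<bar> powr \<alpha> * \<theta>" and \<theta>: "0 \<le> \<theta>"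
    have "\<omega> * \<tau> \<le> \<omega> * (\<bar>L\<bar> powr \<alpha> * \<theta>)" using \<tau> K by (intro mult_left_mono) auto
    then have "K * exp (\<omega> * \<tau>) \<le> K * exp (\<omega> * (\<bar>L\<bar> powr \<alpha> * \<theta>))" using K by simp
    then have T': "norm (T \<tau>) \<le> K * exp (\<omega> * (\<bar>L\<bar> powr \<alpha> * \<theta>))" using K(3)[OF \<tau>(1)] by linarith
    have "\<bar>weight \<theta>\<bar> = (\<alpha> * \<theta>) * \<bar>wright_M \<alpha> \<theta>\<bar>" using \<theta> \<alpha> by (simp add: weight_def abs_mult)
    also have "\<dots> \<le> exp \<theta> * (C * exp (- \<mu> * \<theta>))"
    proof (intro mult_mono C \<theta>)
      have "\<alpha> * \<theta> \<le> 1 * \<theta>" using \<alpha> \<theta> by (intro mult_right_mono) auto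
      also have "\<dots> \<le> exp \<theta>" using exp_ge_add_one_self[of \<theta>] by linarith
      finally show "\<alpha> * \<theta> \<le> exp \<theta>" .
    qed auto
    finally have "\<bar>weight \<theta>\<bar> * norm (T \<tau>)
        \<le> (exp \<theta> * (C * exp (- \<mu> * \<theta>))) * (K * exp (\<omega> * (\<bar>L\<bar> powr \<alpha> * \<theta>)))"
      using T' C0 by (intro mult_mono) auto
    also have "\<dots> = K * C * (exp \<theta> * exp (- \<mu> * \<theta>) * exp (\<omega> * (\<bar>L\<bar> powr \<alpha> * \<theta>)))" by simp
    also have "exp \<theta> * exp (- \<mu> * \<theta>) * exp (\<omega> * (\<bar>L\<bar> powr \<alpha> * \<theta>)) = exp (- \<theta>)"
      unfolding exp_add[symmetric] \<mu>_def by (simp add: algebra_simps)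
    finally show "\<bar>weight \<theta>\<bar> * norm (T \<tau>) \<le> K * C * exp (- \<theta>)" .
  qed
qed

lemma weight_dominates:
  obtains w where "integrable HL w" "\<And>\<theta>. \<theta> \<ge> 0 \<Longrightarrow> w \<theta> \<ge> 0"
    "\<And>r \<theta>. 0 \<le> r \<Longrightarrow> r \<le> L \<Longrightarrow> 0 \<le> \<theta> \<Longrightarrow> \<bar>weight \<theta>\<bar> * norm (T (r powr \<alpha> * \<theta>)) \<le> w \<theta>"
proof -
  obtain w where w: "integrable HL w" "\<And>\<theta>. \<theta> \<ge> 0 \<Longrightarrow> w \<theta> \<ge> 0"
    "\<And>\<tau> \<theta>. 0 \<le> \<tau> \<Longrightarrow> \<tau> \<le> \<bar>L\<bar> powr \<alpha> * \<theta> \<Longrightarrow> 0 \<le> \<theta> \<Longrightarrow> \<bar>weight \<theta>\<bar> * norm (T \<tau>) \<le> w \<theta>"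
    using weight_dominates_below[of L] by blast
  show thesis
  proof (rule that[OF w(1,2)])
    fix r \<theta> :: real assume r: "0 \<le> r" "r \<le> L" and \<theta>: "0 \<le> \<theta>"
    show "\<bar>weight \<theta>\<bar> * norm (T (r powr \<alpha> * \<theta>)) \<le> w \<theta>"
      using r \<theta> \<alpha> by (intro w(3) mult_right_mono powr_mono2) auto
  qed
qed

lemma integrand_measurable:
  shows "integrand r x \<in> borel_measurable HL"
proof -
  have "continuous_on {0..} (\<lambda>\<theta>. T (r powr \<alpha> * \<theta>) x)"
    by (rule continuous_on_compose2[OF continuous_T_apply]) (auto intro!: continuous_intros)
  then have "continuous_on {0..} (integrand r x)"
    unfolding integrand_def by (intro continuous_on_scaleR continuous_weight)
  then show ?thesis by (rule continuous_imp_measurable_on_sets_lebesgue) auto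
qed

lemma norm_integrand_le: "norm (integrand r x \<theta>) \<le> (\<bar>weight \<theta>\<bar> * norm (T (r powr \<alpha> * \<theta>))) * norm x"
  unfolding integrand_def using norm_blinfun[of "T (r powr \<alpha> * \<theta>)" x]
  by (simp add: mult.assoc mult_left_mono)

lemma abs_int_integrand:
  assumes "0 \<le> r" shows "abs_int HL (integrand r x)"
proof -
  obtain w where w: "integrable HL w" "\<And>\<theta>. 0 \<le> \<theta> \<Longrightarrow> \<bar>weight \<theta>\<bar> * norm (T (r powr \<alpha> * \<theta>)) \<le> w \<theta>"
    using weight_dominates[of r] assms by (metis order_refl)
  show ?thesis
  proof (rule abs_int_bound[OF integrand_measurable, of "\<lambda>\<theta>. w \<theta> * norm x"])
    show "integrable HL (\<lambda>\<theta>. w \<theta> * norm x)" using w(1) by simp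
    show "AE \<theta> in HL. norm (integrand r x \<theta>) \<le> w \<theta> * norm x"
      by (rule AE_I2) (use w(2) in \<open>auto intro!: order_trans[OF norm_integrand_le] mult_right_mono\<close>)
  qed
qed

definition P :: "real \<Rightarrow> 'x \<Rightarrow>\<^sub>L 'x" where
  "P r = Blinfun (\<lambda>x. bochner HL (integrand r x))"

lemma P_apply:
  assumes r: "0 \<le> r" shows "P r x = bochner HL (integrand r x)"
proof -
  obtain w where w: "integrable HL w" "\<And>\<theta>. 0 \<le> \<theta> \<Longrightarrow> \<bar>weight \<theta>\<bar> * norm (T (r powr \<alpha> * \<theta>)) \<le> w \<theta>"
    using weight_dominates[of r] assms by (metis order_refl)
  have "bounded_linear (\<lambda>x. bochner HL (integrand r x))"
  proof (rule bounded_linear_intro)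
    show "bochner HL (integrand r (x + y)) = bochner HL (integrand r x) + bochner HL (integrand r y)" for x y
      using bochner_add[OF abs_int_integrand abs_int_integrand, OF r r, of x y]
      unfolding integrand_def[abs_def] blinfun.add_right scaleR_add_right .
    show "bochner HL (integrand r (c *\<^sub>R x)) = c *\<^sub>R bochner HL (integrand r x)" for c x
      using bochner_scaleR[OF abs_int_integrand, OF r, of c x]
      unfolding integrand_def[abs_def] blinfun.scaleR_right by (simp add: mult.commute)
    show "norm (bochner HL (integrand r x)) \<le> norm x * (\<integral>\<theta>. w \<theta> \<partial>HL)" for x
    proof -
      have "norm (bochner HL (integrand r x)) \<le> (\<integral>\<theta>. norm (integrand r x \<theta>) \<partial>HL)"
        by (rule norm_bochner_le[OF abs_int_integrand[OF r]])
      also have "\<dots> \<le> (\<integral>\<theta>. w \<theta> * norm x \<partial>HL)"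
        using abs_int_integrand[OF r, of x] w
        by (intro integral_mono) (auto simp: abs_int_def intro!: order_trans[OF norm_integrand_le] mult_right_mono)
      finally show ?thesis by (simp add: mult.commute)
    qed
  qed
  then show ?thesis unfolding P_def by (simp add: bounded_linear_Blinfun_apply)
qed

lemma P_op_eq: "0 \<le> r \<Longrightarrow> P_op T \<alpha> r x = P r x"
  using \<alpha> unfolding P_op_def P_apply integrand_def[abs_def] weight_def by simp

lemma P_bounded: "\<exists>C. \<forall>r. 0 \<le> r \<longrightarrow> r \<le> L \<longrightarrow> norm (P r) \<le> C"
proof -
  obtain w where w: "integrable HL w" "\<And>\<theta>. \<theta> \<ge> 0 \<Longrightarrow> w \<theta> \<ge> 0"
    "\<And>r \<theta>. 0 \<le> r \<Longrightarrow> r \<le> L \<Longrightarrow> 0 \<le> \<theta> \<Longrightarrow> \<bar>weight \<theta>\<bar> * norm (T (r powr \<alpha> * \<theta>)) \<le> w \<theta>"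
    using weight_dominates[of L] by blast
  have "norm (P r) \<le> (\<integral>\<theta>. w \<theta> \<partial>HL)" if r: "0 \<le> r" "r \<le> L" for r
  proof (rule norm_blinfun_bound)
    show "0 \<le> (\<integral>\<theta>. w \<theta> \<partial>HL)" by (rule integral_nonneg_AE) (rule AE_I2, use w(2) in auto)
    fix x
    have "norm (P r x) \<le> (\<integral>\<theta>. norm (integrand r x \<theta>) \<partial>HL)"
      unfolding P_apply[OF r(1)] by (rule norm_bochner_le[OF abs_int_integrand[OF r(1)]])
    also have "\<dots> \<le> (\<integral>\<theta>. w \<theta> * norm x \<partial>HL)"
      using abs_int_integrand[OF r(1), of x] w(1) w(3)[OF r]
      by (intro integral_mono) (auto simp: abs_int_def intro!: order_trans[OF norm_integrand_le] mult_right_mono)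
    finally show "norm (P r x) \<le> (\<integral>\<theta>. w \<theta> \<partial>HL) * norm x" by simp
  qed
  then show ?thesis by blast
qed

lemma tendsto_powr_nonneg:
  assumes "X \<longlonglongrightarrow> r" "\<And>n. 0 \<le> X n"
  shows "(\<lambda>n. X n powr \<alpha>) \<longlonglongrightarrow> r powr \<alpha>"
  using assms \<alpha> by (intro tendsto_powr' tendsto_const) auto

lemma sequence_bound:
  assumes "X \<longlonglongrightarrow> (r :: real)"
  obtains L where "\<And>n. X n \<le> L" "r \<le> L"
proof -
  obtain B where B: "\<And>n. norm (X n) \<le> B"
    using convergent_imp_bounded[OF assms] unfolding bounded_iff by blast
  have "X n \<le> max B r" for n using B[of n] by (auto simp: abs_le_iff)
  then show thesis using that[of "max B r"] by auto
qed

lemma continuous_P_apply: "continuous_on {0..} (\<lambda>r. P r x)"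
  unfolding continuous_on_sequentially
proof (intro allI ballI impI, elim conjE)
  fix X r assume r: "r \<in> {0::real..}" and X: "\<forall>n. X n \<in> {0..}" and lim: "X \<longlonglongrightarrow> r"
  obtain L where L: "\<And>n. X n \<le> L" "r \<le> L" using sequence_bound[OF lim] by blast
  obtain w where w: "integrable HL w" and "\<And>\<theta>. \<theta> \<ge> 0 \<Longrightarrow> w \<theta> \<ge> 0"
    and w2: "\<And>r \<theta>. 0 \<le> r \<Longrightarrow> r \<le> L \<Longrightarrow> 0 \<le> \<theta> \<Longrightarrow> \<bar>weight \<theta>\<bar> * norm (T (r powr \<alpha> * \<theta>)) \<le> w \<theta>"
    using weight_dominates[of L] by blast
  have "(\<lambda>n. bochner HL (integrand (X n) x)) \<longlonglongrightarrow> bochner HL (integrand r x)"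
  proof (rule bochner_dominated_convergence[where w = "\<lambda>\<theta>. w \<theta> * norm x"])
    show "integrable HL (\<lambda>\<theta>. w \<theta> * norm x)" using w by simp
    show "AE \<theta> in HL. (\<lambda>n. integrand (X n) x \<theta>) \<longlonglongrightarrow> integrand r x \<theta>"
    proof (rule AE_I2)
      fix \<theta> assume "\<theta> \<in> space HL"
      then have \<theta>: "\<theta> \<ge> 0" by simp
      have "(\<lambda>n. X n powr \<alpha> * \<theta>) \<longlonglongrightarrow> r powr \<alpha> * \<theta>"
        using X by (intro tendsto_mult tendsto_const tendsto_powr_nonneg lim) auto
      then have "(\<lambda>n. T (X n powr \<alpha> * \<theta>) x) \<longlonglongrightarrow> T (r powr \<alpha> * \<theta>) x"
        by (rule continuous_on_tendsto_compose[OF continuous_T_apply]) (use \<theta> in auto)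
      then show "(\<lambda>n. integrand (X n) x \<theta>) \<longlonglongrightarrow> integrand r x \<theta>"
        unfolding integrand_def by (intro tendsto_scaleR tendsto_const)
    qed
    show "AE \<theta> in HL. norm (integrand (X n) x \<theta>) \<le> w \<theta> * norm x" for n
      by (rule AE_I2, rule order_trans[OF norm_integrand_le], rule mult_right_mono)
         (use w2[of "X n"] X L in auto)
  qed (rule integrand_measurable)+
  moreover have "P (X n) x = bochner HL (integrand (X n) x)" for n using X by (intro P_apply) auto
  moreover have "P r x = bochner HL (integrand r x)" using r by (intro P_apply) auto
  ultimately show "((\<lambda>r. P r x) \<circ> X) \<longlonglongrightarrow> P r x" by (simp add: o_def)
qed

text \<open>Dominated convergence of the operator norms of differences, as \<open>T\<close> is norm continuous away
  from \<open>0\<close>; the single point \<open>\<theta> = 0\<close> does not contribute because the weight vanishes there.\<close>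

lemma continuous_P_norm: "continuous_on {0<..} P"
  unfolding continuous_on_sequentially
proof (intro allI ballI impI, elim conjE)
  fix X r assume r: "r \<in> {0::real<..}" and X: "\<forall>n. X n \<in> {0<..}" and lim: "X \<longlonglongrightarrow> r"
  have X0: "X n > 0" for n using X by auto
  have r0: "r > 0" using r by simp
  obtain L where L: "\<And>n. X n \<le> L" "r \<le> L" using sequence_bound[OF lim] by blast
  obtain w where w: "integrable HL w" and "\<And>\<theta>. \<theta> \<ge> 0 \<Longrightarrow> w \<theta> \<ge> 0"
    and w2: "\<And>r \<theta>. 0 \<le> r \<Longrightarrow> r \<le> L \<Longrightarrow> 0 \<le> \<theta> \<Longrightarrow> \<bar>weight \<theta>\<bar> * norm (T (r powr \<alpha> * \<theta>)) \<le> w \<theta>"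
    using weight_dominates[of L] by blast
  define g where "g = (\<lambda>n \<theta>. \<bar>weight \<theta>\<bar> * norm (T (X n powr \<alpha> * \<theta>) - T (r powr \<alpha> * \<theta>)))"
  have gm: "g n \<in> borel_measurable HL" for n
  proof (rule measurable_continuous_off_point[of _ 0])
    have "continuous_on ({0..} - {0}) (\<lambda>\<theta>. T (s powr \<alpha> * \<theta>))" if "s > 0" for s
      by (rule continuous_on_compose2[OF continuous_T_norm])
         (use that in \<open>auto intro!: continuous_intros mult_pos_pos\<close>)
    then show "continuous_on ({0..} - {0}) (g n)" unfolding g_def using X0 r0
      by (intro continuous_intros continuous_weight) auto
  qed auto
  have gb: "norm (g n \<theta>) \<le> 2 * w \<theta>" if "\<theta> \<ge> 0" for n \<theta>
  proof -
    have "norm (g n \<theta>) \<le> \<bar>weight \<theta>\<bar> * (norm (T (X n powr \<alpha> * \<theta>)) + norm (T (r powr \<alpha> * \<theta>)))"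
      unfolding g_def by (simp add: abs_mult mult_left_mono norm_triangle_ineq4)
    also have "\<dots> \<le> w \<theta> + w \<theta>" unfolding distrib_left
      using X0[of n] r0 L that by (intro add_mono w2) (auto intro: less_imp_le)
    finally show ?thesis by simp
  qed
  have gi: "integrable HL (g n)" for n
    by (rule Bochner_Integration.integrable_bound[of _ "\<lambda>\<theta>. 2 * w \<theta>"])
       (use w gm in simp, rule gm, rule AE_I2, rule order_trans[OF gb], auto)
  have "(\<lambda>n. \<integral>\<theta>. g n \<theta> \<partial>HL) \<longlonglongrightarrow> (\<integral>\<theta>. 0 \<partial>HL)"
  proof (rule integral_dominated_convergence[where w = "\<lambda>\<theta>. 2 * w \<theta>"])
    show "AE \<theta> in HL. (\<lambda>n. g n \<theta>) \<longlonglongrightarrow> 0"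
    proof (rule AE_I2)
      fix \<theta> assume "\<theta> \<in> space HL"
      then have \<theta>: "\<theta> \<ge> 0" by simp
      show "(\<lambda>n. g n \<theta>) \<longlonglongrightarrow> 0"
      proof (cases "\<theta> = 0")
        case True then show ?thesis by (simp add: g_def weight_def)
      next
        case False
        with \<theta> have \<theta>: "\<theta> > 0" by simp
        have "(\<lambda>n. X n powr \<alpha> * \<theta>) \<longlonglongrightarrow> r powr \<alpha> * \<theta>"
          using X0 by (intro tendsto_mult tendsto_const tendsto_powr_nonneg lim) (auto intro: less_imp_le)
        moreover have "0 < s powr \<alpha> * \<theta>" if "s > 0" for s
          using that by (intro mult_pos_pos \<theta>) simp
        ultimately have "(\<lambda>n. T (X n powr \<alpha> * \<theta>)) \<longlonglongrightarrow> T (r powr \<alpha> * \<theta>)"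
          using X0 r0 by (intro continuous_on_tendsto_compose[OF continuous_T_norm]) (auto intro!: always_eventually)
        then have "(\<lambda>n. norm (T (X n powr \<alpha> * \<theta>) - T (r powr \<alpha> * \<theta>))) \<longlonglongrightarrow> 0"
          by (intro tendsto_norm_zero LIM_zero)
        then show ?thesis unfolding g_def by (rule tendsto_mult_right_zero)
      qed
    qed
    show "AE \<theta> in HL. norm (g n \<theta>) \<le> 2 * w \<theta>" for n by (rule AE_I2, rule gb) auto
  qed (use gm w in auto)
  then have lim0: "(\<lambda>n. \<integral>\<theta>. g n \<theta> \<partial>HL) \<longlonglongrightarrow> 0" by simp
  have le: "norm (P (X n) - P r) \<le> (\<integral>\<theta>. g n \<theta> \<partial>HL)" for n
  proof (rule norm_blinfun_bound)
    show "0 \<le> (\<integral>\<theta>. g n \<theta> \<partial>HL)" by (rule integral_nonneg_AE) (simp add: g_def)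
    fix x
    have Xn: "0 \<le> X n" "0 \<le> r" using X0[of n] r0 by auto
    have d: "abs_int HL (\<lambda>\<theta>. integrand (X n) x \<theta> - integrand r x \<theta>)"
      by (intro abs_int_diff abs_int_integrand Xn)
    have "norm ((P (X n) - P r) x) \<le> (\<integral>\<theta>. norm (integrand (X n) x \<theta> - integrand r x \<theta>) \<partial>HL)"
      unfolding blinfun.diff_left P_apply[OF Xn(1)] P_apply[OF Xn(2)]
      by (intro norm_bochner_diff_le abs_int_integrand Xn)
    also have "\<dots> \<le> (\<integral>\<theta>. g n \<theta> * norm x \<partial>HL)"
    proof (rule integral_mono)
      fix \<theta>
      have "integrand (X n) x \<theta> - integrand r x \<theta> = weight \<theta> *\<^sub>R ((T (X n powr \<alpha> * \<theta>) - T (r powr \<alpha> * \<theta>)) x)"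
        by (simp add: integrand_def blinfun.diff_left scaleR_diff_right)
      then have "norm (integrand (X n) x \<theta> - integrand r x \<theta>) = \<bar>weight \<theta>\<bar> * norm ((T (X n powr \<alpha> * \<theta>) - T (r powr \<alpha> * \<theta>)) x)"
        by (simp only: norm_scaleR)
      also have "\<dots> \<le> \<bar>weight \<theta>\<bar> * (norm (T (X n powr \<alpha> * \<theta>) - T (r powr \<alpha> * \<theta>)) * norm x)"
        by (intro mult_left_mono norm_blinfun) auto
      finally show "norm (integrand (X n) x \<theta> - integrand r x \<theta>) \<le> g n \<theta> * norm x"
        by (simp add: g_def mult.assoc)
    qed (use gi d in \<open>auto simp: abs_int_def\<close>)
    finally show "norm ((P (X n) - P r) x) \<le> (\<integral>\<theta>. g n \<theta> \<partial>HL) * norm x" by simp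
  qed
  have "(\<lambda>n. norm (P (X n) - P r)) \<longlonglongrightarrow> 0"
    by (rule tendsto_sandwich[OF _ _ tendsto_const lim0]) (auto intro!: always_eventually le)
  then have "(\<lambda>n. P (X n)) \<longlonglongrightarrow> P r" by (rule LIM_zero_cancel[OF tendsto_norm_zero_cancel])
  then show "(P \<circ> X) \<longlonglongrightarrow> P r" by (simp add: o_def)
qed

text \<open>The part of the integral over \<open>\<theta> \<ge> \<delta>\<close> factors through \<open>T (r\<^sup>\<alpha> \<delta>)\<close>, which is compact, and the rest
  is small.\<close>

lemma compact_P:
  assumes r: "r > 0" shows "compact_operator (P r)"
  unfolding compact_operator_def
proof (intro allI impI)
  fix S :: "'x set" assume "bounded S"
  then obtain B where B: "B > 0" "\<And>x. x \<in> S \<Longrightarrow> norm x \<le> B" using bounded_pos by metis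
  have r0: "0 \<le> r" using r by simp
  obtain w where w: "integrable HL w" "\<And>\<theta>. \<theta> \<ge> 0 \<Longrightarrow> w \<theta> \<ge> 0"
    "\<And>\<tau> \<theta>. 0 \<le> \<tau> \<Longrightarrow> \<tau> \<le> r powr \<alpha> * \<theta> \<Longrightarrow> 0 \<le> \<theta> \<Longrightarrow> \<bar>weight \<theta>\<bar> * norm (T \<tau>) \<le> w \<theta>"
    using weight_dominates_below[of r] r0 by (metis abs_of_nonneg)
  show "compact (closure (P r ` S))"
  proof (rule compact_closure_if_near_compact)
    fix e :: real assume e: "e > 0"
    let ?\<delta> = "\<lambda>n. 1 / real (Suc n)"
    have "(\<lambda>n. \<integral>\<theta>. indicator {..< ?\<delta> n} \<theta> * w \<theta> \<partial>HL) \<longlonglongrightarrow> (\<integral>\<theta>. 0 \<partial>HL)"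
    proof (rule integral_dominated_convergence[where w = w])
      have null: "AE \<theta> in HL. \<theta> \<noteq> 0"
      proof (rule AE_I')
        show "{0} \<in> null_sets HL" by (auto simp: null_sets_restrict_space)
      qed auto
      show "AE \<theta> in HL. (\<lambda>n. indicator {..< ?\<delta> n} \<theta> * w \<theta>) \<longlonglongrightarrow> 0"
        using null AE_space
      proof eventually_elim
        case (elim \<theta>)
        then have "\<theta> > 0" by auto
        then obtain N where N: "?\<delta> N < \<theta>" using nat_approx_posE by metis
        have "indicator {..< ?\<delta> n} \<theta> * w \<theta> = 0" if "n \<ge> N" for n
        proof -
          have "?\<delta> n \<le> ?\<delta> N" using that by (intro divide_left_mono) auto
          then show ?thesis using N by (simp add: indicator_def)
        qed
        then show ?case by (intro tendsto_eventually eventually_sequentiallyI[of N])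
      qed
      show "AE \<theta> in HL. norm (indicator {..< ?\<delta> n} \<theta> * w \<theta>) \<le> w \<theta>" for n
        by (rule AE_I2) (use w(2) in \<open>auto simp: indicator_def\<close>)
      have [measurable]: "w \<in> borel_measurable HL" using w(1) by auto
      have [measurable]: "(\<lambda>\<theta>. indicator {..< c} \<theta> :: real) \<in> borel_measurable HL" for c :: real
        by (intro measurable_restrict_space1 borel_measurable_indicator) simp
      show "(\<lambda>\<theta>. indicator {..< ?\<delta> n} \<theta> * w \<theta>) \<in> borel_measurable HL" for n by measurable
    qed (use w(1) in auto)
    then have "(\<lambda>n. \<integral>\<theta>. indicator {..< ?\<delta> n} \<theta> * w \<theta> \<partial>HL) \<longlonglongrightarrow> 0" by simp
    then have "\<forall>\<^sub>F n in sequentially. (\<integral>\<theta>. indicator {..< ?\<delta> n} \<theta> * w \<theta> \<partial>HL) < e / B"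
      by (rule order_tendstoD) (use e B in simp)
    then obtain n where n: "(\<integral>\<theta>. indicator {..< ?\<delta> n} \<theta> * w \<theta> \<partial>HL) < e / B"
      by (auto simp: eventually_sequentially)
    define d where "d = ?\<delta> n"
    have d: "d > 0" "(\<integral>\<theta>. indicator {..< d} \<theta> * w \<theta> \<partial>HL) * B < e"
      using n B by (auto simp: d_def field_simps)
    have indm: "(\<lambda>\<theta>. indicator {d..} \<theta> :: real) \<in> borel_measurable HL"
       "(\<lambda>\<theta>. indicator {..< d} \<theta> :: real) \<in> borel_measurable HL"
      by (intro measurable_restrict_space1 borel_measurable_indicator, simp)+
    define F where "F = (\<lambda>x \<theta>. indicator {d..} \<theta> *\<^sub>R integrand r x \<theta>)"
    define G where "G = (\<lambda>x \<theta>. (indicator {d..} \<theta> * weight \<theta>) *\<^sub>R T (r powr \<alpha> * \<bar>\<theta> - d\<bar>) x)"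
    have FG: "F x \<theta> = T (r powr \<alpha> * d) (G x \<theta>)" for x \<theta>
    proof (cases "\<theta> \<ge> d")
      case True
      have "r powr \<alpha> * d + r powr \<alpha> * (\<theta> - d) = r powr \<alpha> * \<theta>" by (simp add: algebra_simps)
      then have "T (r powr \<alpha> * \<theta>) x = T (r powr \<alpha> * d) (T (r powr \<alpha> * (\<theta> - d)) x)"
        using T_add[of "r powr \<alpha> * d" "r powr \<alpha> * (\<theta> - d)" x] True d(1) by simp
      then show ?thesis using True by (simp add: F_def G_def integrand_def blinfun.scaleR_right)
    qed (simp add: F_def G_def)
    have Gm: "G x \<in> borel_measurable HL" for x
    proof -
      have "continuous_on {0..} (\<lambda>\<theta>. T (r powr \<alpha> * \<bar>\<theta> - d\<bar>) x)"
        by (rule continuous_on_compose2[OF continuous_T_apply]) (auto intro!: continuous_intros)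
      then show ?thesis unfolding G_def
        by (intro measurable_scaleR borel_measurable_times indm
            continuous_imp_measurable_on_sets_lebesgue continuous_weight) auto
    qed
    have Gb: "norm (G x \<theta>) \<le> w \<theta> * norm x" if "0 \<le> \<theta>" for x \<theta>
    proof (cases "\<theta> \<ge> d")
      case True
      have "norm (G x \<theta>) = \<bar>weight \<theta>\<bar> * norm (T (r powr \<alpha> * (\<theta> - d)) x)"
        using True by (simp add: G_def)
      also have "\<dots> \<le> \<bar>weight \<theta>\<bar> * (norm (T (r powr \<alpha> * (\<theta> - d))) * norm x)"
        by (intro mult_left_mono norm_blinfun) auto
      also have "\<dots> \<le> w \<theta> * norm x"
        unfolding mult.assoc[symmetric]
        using True d that by (intro mult_right_mono w(3) mult_nonneg_nonneg mult_left_mono) auto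
      finally show ?thesis .
    next
      case False then show ?thesis using w(2)[OF that] by (simp add: G_def)
    qed
    have Gi: "abs_int HL (G x)" for x
      by (rule abs_int_bound[OF Gm, of "\<lambda>\<theta>. w \<theta> * norm x"]) (use w(1) Gb in auto)
    have Fi: "abs_int HL (F x)" for x
    proof (rule abs_int_bound[of _ _ "\<lambda>\<theta>. norm (integrand r x \<theta>)"])
      show "F x \<in> borel_measurable HL"
        unfolding F_def by (intro measurable_scaleR indm integrand_measurable)
      show "integrable HL (\<lambda>\<theta>. norm (integrand r x \<theta>))"
        using abs_int_integrand[OF r0] by (simp add: abs_int_def)
    qed (auto simp: F_def indicator_def)
    define W where "W = (\<integral>\<theta>. w \<theta> \<partial>HL)"
    have W: "W \<ge> 0" unfolding W_def by (rule integral_nonneg_AE) (rule AE_I2, use w(2) in auto)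
    let ?C = "closure (T (r powr \<alpha> * d) ` cball 0 (W * B))"
    have "compact ?C"
      using T_compact[of "r powr \<alpha> * d"] r d unfolding compact_operator_def by auto
    moreover have "P r ` S \<subseteq> (\<Union>c\<in>?C. ball c e)"
    proof
      fix y assume "y \<in> P r ` S"
      then obtain x where x: "x \<in> S" "y = P r x" by blast
      let ?z = "bochner HL (G x)"
      have "norm ?z \<le> (\<integral>\<theta>. norm (G x \<theta>) \<partial>HL)" by (rule norm_bochner_le[OF Gi])
      also have "\<dots> \<le> (\<integral>\<theta>. w \<theta> * norm x \<partial>HL)"
        using Gi[of x] w(1) Gb by (intro integral_mono) (auto simp: abs_int_def)
      also have "\<dots> \<le> W * B" using B(2)[OF x(1)] W by (simp add: W_def[symmetric] mult_left_mono)
      finally have "T (r powr \<alpha> * d) ?z \<in> ?C" by (intro subsetD[OF closure_subset] imageI) simp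
      moreover have "dist (T (r powr \<alpha> * d) ?z) y < e"
      proof -
        have "has_bochner HL (F x) (T (r powr \<alpha> * d) ?z)"
          unfolding FG[abs_def]
          by (rule has_bochner_linear[OF blinfun.bounded_linear_right has_bochner_bochner[OF Gi]])
        then have Tz: "T (r powr \<alpha> * d) ?z = bochner HL (F x)" by (rule bochner_eqI[symmetric])
        have iw: "integrable HL (\<lambda>\<theta>. indicator {..<d} \<theta> * w \<theta>)"
          by (rule Bochner_Integration.integrable_bound[OF w(1)])
             (use indm(2) w(1) in \<open>auto intro!: borel_measurable_times simp: indicator_def\<close>)
        have "norm (P r x - bochner HL (F x)) \<le> (\<integral>\<theta>. norm (integrand r x \<theta> - F x \<theta>) \<partial>HL)"
          unfolding P_apply[OF r0] by (rule norm_bochner_diff_le[OF abs_int_integrand[OF r0] Fi])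
        also have "\<dots> \<le> (\<integral>\<theta>. (indicator {..<d} \<theta> * w \<theta>) * norm x \<partial>HL)"
        proof (rule integral_mono)
          show "integrable HL (\<lambda>\<theta>. norm (integrand r x \<theta> - F x \<theta>))"
            using abs_int_diff[OF abs_int_integrand[OF r0] Fi] by (simp add: abs_int_def)
          show "integrable HL (\<lambda>\<theta>. (indicator {..<d} \<theta> * w \<theta>) * norm x)" using iw by simp
          fix \<theta> assume "\<theta> \<in> space HL"
          then have \<theta>: "\<theta> \<ge> 0" by simp
          show "norm (integrand r x \<theta> - F x \<theta>) \<le> (indicator {..<d} \<theta> * w \<theta>) * norm x"
          proof (cases "\<theta> < d")
            case True
            have "norm (integrand r x \<theta>) \<le> w \<theta> * norm x"
              using \<theta> by (intro order_trans[OF norm_integrand_le] mult_right_mono w(3)) auto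
            then show ?thesis using True by (simp add: F_def)
          qed (simp add: F_def)
        qed
        also have "\<dots> = (\<integral>\<theta>. indicator {..<d} \<theta> * w \<theta> \<partial>HL) * norm x" by simp
        also have "\<dots> \<le> (\<integral>\<theta>. indicator {..<d} \<theta> * w \<theta> \<partial>HL) * B"
          by (intro mult_left_mono B(2) x(1) integral_nonneg_AE AE_I2) (use w(2) in auto)
        also have "\<dots> < e" by (rule d(2))
        finally show ?thesis unfolding Tz x(2) by (simp add: dist_norm norm_minus_commute)
      qed
      ultimately show "y \<in> (\<Union>c\<in>?C. ball c e)" by auto
    qed
    ultimately show "\<exists>C. compact C \<and> P r ` S \<subseteq> (\<Union>c\<in>C. ball c e)" by blast
  qed
qed

lemma regular_family_P: "regular_family P"
  unfolding regular_family_def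
  by (intro conjI allI impI continuous_P_apply P_bounded compact_P continuous_P_norm)

end

lemma (in compact_semigroup) P_op_regular:
  assumes "1 / 2 < \<alpha>" "\<alpha> \<le> 1"
  obtains P where "regular_family P" "\<And>r x. 0 \<le> r \<Longrightarrow> P_op T \<alpha> r x = P r x"
proof (cases "\<alpha> = 1")
  case True
  then show thesis using regular_family_T by (intro that[of T]) (simp_all add: P_op_def)
next
  case False
  obtain D :: "'x set" where "separable_banach D" using separable by blast
  then interpret separable_banach D .
  interpret subordinated_semigroup T D \<alpha> by unfold_locales (use assms False in auto)
  show thesis by (rule that[OF regular_family_P P_op_eq])
qed

section \<open>Integral operators with a weakly singular compact kernel\<close>

lemma Cauchy_Schwarz_integral:
  fixes f g :: "'a \<Rightarrow> real"
  assumes m: "f \<in> borel_measurable M" "g \<in> borel_measurable M"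
    and i: "integrable M (\<lambda>x. (f x)\<^sup>2)" "integrable M (\<lambda>x. (g x)\<^sup>2)"
  shows "integrable M (\<lambda>x. f x * g x)"
    and "(\<integral>x. \<bar>f x * g x\<bar> \<partial>M)\<^sup>2 \<le> (\<integral>x. (f x)\<^sup>2 \<partial>M) * (\<integral>x. (g x)\<^sup>2 \<partial>M)"
proof -
  note [measurable] = m
  show I: "integrable M (\<lambda>x. f x * g x)"
  proof (rule Bochner_Integration.integrable_bound[of _ "\<lambda>x. (f x)\<^sup>2 + (g x)\<^sup>2"])
    show "AE x in M. norm (f x * g x) \<le> norm ((f x)\<^sup>2 + (g x)\<^sup>2)"
    proof (rule AE_I2)
      fix x
      have "0 \<le> (\<bar>f x\<bar> - \<bar>g x\<bar>)\<^sup>2" by simp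
      then have "2 * (\<bar>f x\<bar> * \<bar>g x\<bar>) \<le> (f x)\<^sup>2 + (g x)\<^sup>2" by (simp add: power2_diff)
      moreover have "0 \<le> \<bar>f x\<bar> * \<bar>g x\<bar>" by simp
      ultimately have "\<bar>f x\<bar> * \<bar>g x\<bar> \<le> (f x)\<^sup>2 + (g x)\<^sup>2" by linarith
      then show "norm (f x * g x) \<le> norm ((f x)\<^sup>2 + (g x)\<^sup>2)" by (simp add: abs_mult)
    qed
  qed (use i in auto)
  have e: "(\<integral>\<^sup>+ x. (ennreal \<bar>f x\<bar>)\<^sup>2 \<partial>M) = ennreal (\<integral>x. (f x)\<^sup>2 \<partial>M)" if "integrable M (\<lambda>x. (f x)\<^sup>2)" for f :: "'a \<Rightarrow> real"
    using that by (simp add: ennreal_power nn_integral_eq_integral)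
  have "ennreal ((\<integral>x. \<bar>f x * g x\<bar> \<partial>M)\<^sup>2) = (\<integral>\<^sup>+ x. ennreal \<bar>f x\<bar> * ennreal \<bar>g x\<bar> \<partial>M)\<^sup>2"
  proof -
    have "(\<integral>\<^sup>+ x. ennreal \<bar>f x\<bar> * ennreal \<bar>g x\<bar> \<partial>M) = (\<integral>\<^sup>+ x. ennreal \<bar>f x * g x\<bar> \<partial>M)"
      by (simp add: ennreal_mult[symmetric] abs_mult)
    also have "\<dots> = ennreal (\<integral>x. \<bar>f x * g x\<bar> \<partial>M)" using I by (intro nn_integral_eq_integral) auto
    finally show ?thesis by (simp add: ennreal_power)
  qed
  also have "\<dots> \<le> (\<integral>\<^sup>+ x. (ennreal \<bar>f x\<bar>)\<^sup>2 \<partial>M) * (\<integral>\<^sup>+ x. (ennreal \<bar>g x\<bar>)\<^sup>2 \<partial>M)"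
    by (rule Cauchy_Schwarz_nn_integral) auto
  also have "\<dots> = ennreal ((\<integral>x. (f x)\<^sup>2 \<partial>M) * (\<integral>x. (g x)\<^sup>2 \<partial>M))"
    unfolding e[OF i(1)] e[OF i(2)] by (simp add: ennreal_mult)
  finally show "(\<integral>x. \<bar>f x * g x\<bar> \<partial>M)\<^sup>2 \<le> (\<integral>x. (f x)\<^sup>2 \<partial>M) * (\<integral>x. (g x)\<^sup>2 \<partial>M)"
    by (subst (asm) ennreal_le_iff) (auto intro!: mult_nonneg_nonneg integral_nonneg_AE)
qed

text \<open>In an infinite-dimensional space pointwise boundedness has to be replaced by pointwise relative
  compactness; the diagonal subsequence is the usual one.\<close>

lemma Arzela_Ascoli_compact_values:
  fixes f :: "nat \<Rightarrow> real \<Rightarrow> 'b::banach"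
  assumes S: "compact S"
    and c: "\<And>x. x \<in> S \<Longrightarrow> \<exists>K. compact K \<and> (\<forall>n. f n x \<in> K)"
    and eq: "\<And>e. 0 < e \<Longrightarrow> \<exists>d>0. \<forall>n. \<forall>x\<in>S. \<forall>y\<in>S. dist x y < d \<longrightarrow> dist (f n x) (f n y) < e"
  obtains g k where "strict_mono (k :: nat \<Rightarrow> nat)" "continuous_on S g"
    "uniform_limit S (\<lambda>n. f (k n)) g sequentially"
proof -
  obtain R where R: "countable R" "R \<subseteq> S" "S \<subseteq> closure R" using separable[of S] by metis
  obtain k where k: "strict_mono (k :: nat \<Rightarrow> nat)" "\<And>x. x \<in> R \<Longrightarrow> convergent (\<lambda>n. f (k n) x)"
  proof (cases "R = {}")
    case True then show ?thesis using that[of id] by (auto simp: strict_mono_def)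
  next
    case False
    obtain k where k: "strict_mono (k :: nat \<Rightarrow> nat)"
      "\<And>i. convergent (\<lambda>n. (f \<circ> k) n (from_nat_into R i))"
    proof (rule subsequence_diagonalization_lemma
      [of "\<lambda>i r. convergent (\<lambda>n. (f \<circ> r) n (from_nat_into R i))" id])
      show "\<exists>k::nat\<Rightarrow>nat. strict_mono k \<and> convergent (\<lambda>n. (f \<circ> (r \<circ> k)) n (from_nat_into R i))" for i r
      proof -
        have "from_nat_into R i \<in> S" using from_nat_into[OF False] R(2) by blast
        then obtain K where K: "compact K" "\<And>n. f n (from_nat_into R i) \<in> K" using c by blast
        then have "seq_compact K" by (simp add: compact_eq_seq_compact_metric)
        moreover have "\<forall>n. (\<lambda>n. f (r n) (from_nat_into R i)) n \<in> K" using K(2) by blast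
        ultimately obtain l k where "strict_mono (k :: nat \<Rightarrow> nat)" "((\<lambda>n. f (r n) (from_nat_into R i)) \<circ> k) \<longlonglongrightarrow> l"
          unfolding seq_compact_def by metis
        then show ?thesis by (intro exI[of _ k]) (auto simp: o_def convergent_def)
      qed
      show "convergent (\<lambda>n. (f \<circ> (r \<circ> k2)) n (from_nat_into R i))"
        if h: "convergent (\<lambda>n. (f \<circ> (r \<circ> k1)) n (from_nat_into R i))" "\<And>j. N \<le> j \<Longrightarrow> \<exists>j'\<ge>j. k2 j = k1 j'"
        for i N and r k1 k2 :: "nat \<Rightarrow> nat"
      proof -
        obtain l where l: "(\<lambda>n. (f \<circ> (r \<circ> k1)) n (from_nat_into R i)) \<longlonglongrightarrow> l"
          using h(1) unfolding convergent_def by blast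
        have "(\<lambda>n. (f \<circ> (r \<circ> k2)) n (from_nat_into R i)) \<longlonglongrightarrow> l"
        proof (rule metric_LIMSEQ_I)
          fix e :: real assume "0 < e"
          then obtain n0 where n0: "\<And>n. n \<ge> n0 \<Longrightarrow> dist ((f \<circ> (r \<circ> k1)) n (from_nat_into R i)) l < e"
            using metric_LIMSEQ_D[OF l] by blast
          have "dist ((f \<circ> (r \<circ> k2)) n (from_nat_into R i)) l < e" if "n \<ge> max n0 N" for n
          proof -
            have "N \<le> n" using that by simp
            from h(2)[OF this] obtain j where "j \<ge> n" "k2 n = k1 j" by blast
            then show ?thesis using n0[of j] that by simp
          qed
          then show "\<exists>no. \<forall>n\<ge>no. dist ((f \<circ> (r \<circ> k2)) n (from_nat_into R i)) l < e" by blast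
        qed
        then show ?thesis unfolding convergent_def by blast
      qed
    qed auto
    show ?thesis
    proof (rule that[OF k(1)])
      fix x assume "x \<in> R"
      then obtain i where "from_nat_into R i = x" using from_nat_into_surj[OF R(1)] by metis
      then show "convergent (\<lambda>n. f (k n) x)" using k(2)[of i] by (simp add: o_def)
    qed
  qed
  have "uniformly_Cauchy_on S (\<lambda>n. f (k n))"
    unfolding uniformly_Cauchy_on_def
  proof (intro allI impI)
    fix e :: real assume e: "0 < e"
    then obtain d where d: "d > 0" "\<And>n x y. x \<in> S \<Longrightarrow> y \<in> S \<Longrightarrow> dist x y < d \<Longrightarrow> dist (f n x) (f n y) < e / 3"
      using eq[of "e / 3"] by auto
    obtain F where F: "F \<subseteq> R" "finite F" "S \<subseteq> (\<Union>c\<in>F. ball c d)"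
    proof (rule compactE_image[OF S, of R "\<lambda>x. ball x d"])
      have "closure R \<subseteq> (\<Union>c\<in>R. ball c d)" using d(1) by (auto simp: closure_approachable)
      with R show "S \<subseteq> (\<Union>c\<in>R. ball c d)" by auto
    qed auto
    have "\<exists>N. \<forall>m\<ge>N. \<forall>n\<ge>N. dist (f (k m) x) (f (k n) x) < e / 3" if "x \<in> R" for x
    proof -
      have "Cauchy (\<lambda>n. f (k n) x)" using k(2)[OF that] by (rule convergent_Cauchy)
      moreover have "e / 3 > 0" using e by simp
      ultimately show ?thesis unfolding Cauchy_def by blast
    qed
    then obtain N where N: "\<And>x m n. x \<in> R \<Longrightarrow> m \<ge> N x \<Longrightarrow> n \<ge> N x \<Longrightarrow> dist (f (k m) x) (f (k n) x) < e / 3"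
      by metis
    have "dist (f (k m) x) (f (k n) x) < e" if x: "x \<in> S" and mn: "m \<ge> Max (insert 0 (N ` F))" "n \<ge> Max (insert 0 (N ` F))" for x m n
    proof -
      obtain y where y: "y \<in> F" "dist y x < d" using x F(3) by auto
      have yS: "y \<in> S" "y \<in> R" using y F R by auto
      have "N y \<le> Max (insert 0 (N ` F))" using y F(2) by (intro Max_ge) auto
      then have "dist (f (k m) y) (f (k n) y) < e / 3" using mn by (intro N yS) auto
      moreover have "dist (f (k m) y) (f (k m) x) < e / 3" "dist (f (k n) y) (f (k n) x) < e / 3"
        by (intro d(2) yS x y(2))+
      ultimately show ?thesis
        using dist_triangle[of "f (k m) x" "f (k n) x" "f (k m) y"] dist_triangle[of "f (k m) y" "f (k n) x" "f (k n) y"]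
        by (simp add: dist_commute)
    qed
    then show "\<exists>M. \<forall>x\<in>S. \<forall>m\<ge>M. \<forall>n\<ge>M. dist (f (k m) x) (f (k n) x) < e" by blast
  qed
  then obtain g where g: "uniform_limit S (\<lambda>n. f (k n)) g sequentially"
    using Cauchy_uniformly_convergent unfolding uniformly_convergent_on_def by blast
  have "continuous_on S (f n)" for n
    unfolding continuous_on_iff using eq by (metis dist_commute)
  then have "continuous_on S g"
    by (intro uniform_limit_theorem[OF _ g]) auto
  then show thesis using that k(1) g by blast
qed

lemma compact_sum_set:
  fixes K :: "'i \<Rightarrow> 'b::real_normed_vector set"
  assumes "finite I" "\<And>i. i \<in> I \<Longrightarrow> compact (K i)"
  shows "compact {(\<Sum>i\<in>I. f i) | f. \<forall>i\<in>I. f i \<in> K i}"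
  using assms
proof (induction I rule: finite_induct)
  case empty
  then show ?case by simp
next
  case (insert j I)
  have "{(\<Sum>i\<in>insert j I. f i) | f. \<forall>i\<in>insert j I. f i \<in> K i} =
      {x + y | x y. x \<in> K j \<and> y \<in> {(\<Sum>i\<in>I. f i) | f. \<forall>i\<in>I. f i \<in> K i}}" (is "?L = ?R")
  proof
    show "?L \<subseteq> ?R" using insert.hyps by fastforce
    show "?R \<subseteq> ?L"
    proof
      fix z assume "z \<in> ?R"
      then obtain x f where z: "z = x + (\<Sum>i\<in>I. f i)" "x \<in> K j" "\<forall>i\<in>I. f i \<in> K i" by blast
      have "(\<Sum>i\<in>insert j I. (f(j := x)) i) = z" using insert.hyps z(1) by (simp cong: sum.cong) (intro sum.cong, auto)
      moreover have "\<forall>i\<in>insert j I. (f(j := x)) i \<in> K i" using z by auto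
      ultimately show "z \<in> ?L" by blast
    qed
  qed
  moreover have "compact ?R" using insert by (intro compact_sums) auto
  ultimately show ?case by simp
qed

lemma powr_integral_bound:
  assumes q: "q > -1" and e: "e > 0" and S: "S \<in> sets lebesgue"
  shows "(\<integral>\<^sup>+ s. ennreal (if t - e \<le> s \<and> s \<le> t then (t - s) powr q else 0) \<partial>lebesgue_on S) \<le> ennreal (e powr (q + 1) / (q + 1))"
proof -
  have "((\<lambda>s. (t - s) powr q) has_integral (- ((t - t) powr (q + 1)) / (q + 1) - (- ((t - (t - e)) powr (q + 1)) / (q + 1)))) {t - e..t}"
  proof (rule fundamental_theorem_of_calculus_interior)
    show "continuous_on {t - e..t} (\<lambda>s. - ((t - s) powr (q + 1)) / (q + 1))"
      using q by (intro continuous_intros continuous_on_powr') auto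
    show "((\<lambda>s. - ((t - s) powr (q + 1)) / (q + 1)) has_vector_derivative (t - x) powr q) (at x)" if "x \<in> {t - e<..<t}" for x
      using that q unfolding has_real_derivative_iff_has_vector_derivative[symmetric]
      by (auto intro!: derivative_eq_intros)
  qed (use e in simp)
  then have h: "((\<lambda>s. (t - s) powr q) has_integral (e powr (q + 1) / (q + 1))) {t - e..t}" by simp
  have "(\<integral>\<^sup>+ s. ennreal (if t - e \<le> s \<and> s \<le> t then (t - s) powr q else 0) \<partial>lebesgue_on S)
      = (\<integral>\<^sup>+ s. ennreal (if t - e \<le> s \<and> s \<le> t then (t - s) powr q else 0) * indicator S s \<partial>lebesgue)"
    using S by (intro nn_integral_restrict_space) auto
  also have "\<dots> \<le> (\<integral>\<^sup>+ s. ennreal (indicator {t - e..t} s * (t - s) powr q) \<partial>lebesgue)"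
    by (intro nn_integral_mono) (auto simp: indicator_def)
  also have "\<dots> = (\<integral>\<^sup>+ s. ennreal (indicator {t - e..t} s * (t - s) powr q) \<partial>lborel)"
    by (rule nn_integral_completion)
  also have "\<dots> = ennreal (e powr (q + 1) / (q + 1))"
    by (rule nn_integral_has_integral_lebesgue[OF _ h]) auto
  finally show ?thesis .
qed

lemma L2_diff:
  assumes "u \<in> L2 a b" "v \<in> L2 a b" shows "(\<lambda>s. u s - v s) \<in> L2 a b"
proof -
  have [measurable]: "u \<in> borel_measurable (lebesgue_on {a..b})" "v \<in> borel_measurable (lebesgue_on {a..b})"
    using assms by (auto simp: L2_def)
  have "integrable (lebesgue_on {a..b}) (\<lambda>s. (norm (u s - v s))\<^sup>2)"
  proof (rule Bochner_Integration.integrable_bound)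
    show "integrable (lebesgue_on {a..b}) (\<lambda>s. 2 * (norm (u s))\<^sup>2 + 2 * (norm (v s))\<^sup>2)"
      using assms by (auto simp: L2_def)
    show "AE s in lebesgue_on {a..b}. norm ((norm (u s - v s))\<^sup>2) \<le> norm (2 * (norm (u s))\<^sup>2 + 2 * (norm (v s))\<^sup>2)"
    proof (rule AE_I2)
      fix s
      have "(norm (u s - v s))\<^sup>2 \<le> (norm (u s) + norm (v s))\<^sup>2"
        by (intro power_mono norm_triangle_ineq4) auto
      also have "\<dots> \<le> 2 * (norm (u s))\<^sup>2 + 2 * (norm (v s))\<^sup>2"
        using zero_le_power2[of "norm (u s) - norm (v s)"] by (simp add: power2_sum power2_diff)
      finally show "norm ((norm (u s - v s))\<^sup>2) \<le> norm (2 * (norm (u s))\<^sup>2 + 2 * (norm (v s))\<^sup>2)" by simp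
    qed
  qed measurable
  then show ?thesis unfolding L2_def by auto
qed

lemma L2_bounded:
  assumes g: "g \<in> L2 a b" and u: "u \<in> borel_measurable (lebesgue_on {a..b})"
    and le: "AE s in lebesgue_on {a..b}. norm (u s) \<le> g s"
  shows "u \<in> L2 a b" "(\<integral>s. (norm (u s))\<^sup>2 \<partial>lebesgue_on {a..b}) \<le> (\<integral>s. (g s)\<^sup>2 \<partial>lebesgue_on {a..b})"
proof -
  have gi: "integrable (lebesgue_on {a..b}) (\<lambda>s. (g s)\<^sup>2)" using g by (simp add: L2_def)
  have le2: "AE s in lebesgue_on {a..b}. (norm (u s))\<^sup>2 \<le> (g s)\<^sup>2"
    using le by eventually_elim (intro power_mono, auto)
  have ui: "integrable (lebesgue_on {a..b}) (\<lambda>s. (norm (u s))\<^sup>2)"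
    by (rule Bochner_Integration.integrable_bound[OF gi]) (use u le2 in auto)
  then show "u \<in> L2 a b" using u by (simp add: L2_def)
  show "(\<integral>s. (norm (u s))\<^sup>2 \<partial>lebesgue_on {a..b}) \<le> (\<integral>s. (g s)\<^sup>2 \<partial>lebesgue_on {a..b})"
    by (rule integral_mono_AE[OF ui gi le2])
qed

text \<open>Since \<open>2 p > - 1\<close>, the kernel is square integrable in \<open>s\<close>, uniformly in \<open>t\<close>; therefore the operator
  acts from \<open>L\<^sup>2\<close> to the continuous functions.\<close>

locale singular_kernel = separable_banach D
  for D :: "'x::banach set" +
  fixes a b p C :: real
    and k :: "real \<Rightarrow> real \<Rightarrow> ('y::{banach, second_countable_topology} \<Rightarrow>\<^sub>L 'x)"
  assumes ab: "a < b" and p: "- 1 / 2 < p" "p \<le> 0" and C: "C \<ge> 0"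
    and k_bound: "\<And>t s. a \<le> s \<Longrightarrow> s < t \<Longrightarrow> t \<le> b \<Longrightarrow> norm (k t s) \<le> C * (t - s) powr p"
    and k_zero: "\<And>t s. t \<le> s \<Longrightarrow> k t s = 0"
    and k_cont: "continuous_on {z. a \<le> snd z \<and> snd z < fst z \<and> fst z \<le> b} (\<lambda>z. k (fst z) (snd z))"
    and k_compact: "\<And>t s. a \<le> s \<Longrightarrow> s < t \<Longrightarrow> t \<le> b \<Longrightarrow> compact_operator (k t s)"
begin

abbreviation (input) "MI \<equiv> lebesgue_on {a..b}"

abbreviation (input) "sqnorm u \<equiv> (\<integral>s. (norm (u s))\<^sup>2 \<partial>MI)"

definition Q :: "(real \<Rightarrow> 'y) \<Rightarrow> real \<Rightarrow> 'x" where
  "Q u t = bochner MI (\<lambda>s. k t s (u s))"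

lemma finite_MI: "finite_measure MI" by (rule finite_measure_lebesgue_on) auto

lemma measurable_kernel:
  fixes l :: "real \<Rightarrow> ('y \<Rightarrow>\<^sub>L 'x)"
  assumes l: "continuous_on ({a..b} - {t}) l" and u: "u \<in> borel_measurable MI"
  shows "(\<lambda>s. l s (u s)) \<in> borel_measurable MI"
proof -
  obtain D' :: "'y set" where "separable_banach D'" using second_countable_separable_banach by blast
  then interpret Y: separable_banach D' .
  show ?thesis
  proof (rule Y.caratheodory_measurable[OF u, where h = "\<lambda>v s. l s v"])
    show "(\<lambda>s. l s v) \<in> borel_measurable MI" for v
      by (rule measurable_continuous_off_point[of _ t]) (intro continuous_intros l, auto)
    show "continuous_on UNIV (\<lambda>v. l s v)" for s by (intro continuous_intros)
  qed
qed

lemma continuous_k_second: 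
  assumes t: "t \<in> {a..b}" shows "continuous_on ({a..b} - {t}) (k t)"
proof -
  have 1: "continuous_on {a..<t} (k t)"
    by (rule continuous_on_compose2[OF k_cont, of _ "\<lambda>s. (t, s)", simplified])
       (use t in \<open>auto intro!: continuous_intros\<close>)
  have 2: "continuous_on {t<..b} (k t)"
    by (rule continuous_on_eq[of _ "\<lambda>_. 0"]) (auto simp: k_zero)
  have eq: "{a..b} - {t} = {a..<t} \<union> {t<..b}" using t by auto
  show ?thesis unfolding eq
  proof (rule continuous_on_Un_local_open[OF _ _ 1 2])
    show "openin (top_of_set ({a..<t} \<union> {t<..b})) {a..<t}"
      unfolding openin_open by (intro exI[of _ "{..<t}"]) auto
    show "openin (top_of_set ({a..<t} \<union> {t<..b})) {t<..b}"
      unfolding openin_open by (intro exI[of _ "{t<..}"]) auto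
  qed
qed

lemma measurable_k: "t \<in> {a..b} \<Longrightarrow> u \<in> borel_measurable MI \<Longrightarrow> (\<lambda>s. k t s (u s)) \<in> borel_measurable MI"
  by (rule measurable_kernel[OF continuous_k_second])

text \<open>The majorant of \<open>\<parallel>k t s\<parallel>\<close> restricted to \<open>t - e \<le> s < t\<close>; it is square integrable because
  \<open>2 p > -1\<close>, with an integral that does not depend on \<open>t\<close> and tends to \<open>0\<close> with \<open>e\<close>.\<close>

definition maj :: "real \<Rightarrow> real \<Rightarrow> real \<Rightarrow> real" where
  "maj e t s = (if t - e \<le> s \<and> s < t then C * (t - s) powr p else 0)"

definition mass :: "real \<Rightarrow> real" where "mass e = C\<^sup>2 * (e powr (2 * p + 1) / (2 * p + 1))"

lemma maj_nonneg: "0 \<le> maj e t s" using C by (simp add: maj_def)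

lemma maj_measurable: "maj e t \<in> borel_measurable MI"
proof -
  have "maj e t \<in> borel_measurable borel" unfolding maj_def by measurable
  then show ?thesis by (intro measurable_restrict_space1 measurable_completion) auto
qed

lemma maj_square:
  assumes "e > 0"
  shows "integrable MI (\<lambda>s. (maj e t s)\<^sup>2)" "(\<integral>s. (maj e t s)\<^sup>2 \<partial>MI) \<le> mass e"
proof -
  have [measurable]: "maj e t \<in> borel_measurable MI" by (rule maj_measurable)
  have "(\<integral>\<^sup>+ s. ennreal ((maj e t s)\<^sup>2) \<partial>MI) \<le>
     (\<integral>\<^sup>+ s. ennreal (C\<^sup>2) * ennreal (if t - e \<le> s \<and> s \<le> t then (t - s) powr (2 * p) else 0) \<partial>MI)"
  proof (rule nn_integral_mono)
    fix s
    have "(maj e t s)\<^sup>2 \<le> C\<^sup>2 * (if t - e \<le> s \<and> s \<le> t then (t - s) powr (2 * p) else 0)"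
    proof -
      have "((t - s) powr p)\<^sup>2 = (t - s) powr (2 * p)"
        unfolding power2_eq_square powr_add[symmetric] by simp
      then have "(C * (t - s) powr p)\<^sup>2 = C\<^sup>2 * (t - s) powr (2 * p)" by (simp only: power_mult_distrib)
      then show ?thesis unfolding maj_def by auto
    qed
    then show "ennreal ((maj e t s)\<^sup>2) \<le> ennreal (C\<^sup>2) * ennreal (if t - e \<le> s \<and> s \<le> t then (t - s) powr (2 * p) else 0)"
      by (subst ennreal_mult[symmetric]) (auto intro!: ennreal_leI)
  qed
  also have "\<dots> = ennreal (C\<^sup>2) * (\<integral>\<^sup>+ s. ennreal (if t - e \<le> s \<and> s \<le> t then (t - s) powr (2 * p) else 0) \<partial>MI)"
  proof (rule nn_integral_cmult)
    have "(\<lambda>s. ennreal (if t - e \<le> s \<and> s \<le> t then (t - s) powr (2 * p) else 0)) \<in> borel_measurable borel"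
      by measurable
    then show "(\<lambda>s. ennreal (if t - e \<le> s \<and> s \<le> t then (t - s) powr (2 * p) else 0)) \<in> borel_measurable MI"
      by (intro measurable_restrict_space1 measurable_completion) auto
  qed
  also have "\<dots> \<le> ennreal (C\<^sup>2) * ennreal (e powr (2 * p + 1) / (2 * p + 1))"
    using p assms by (intro mult_left_mono powr_integral_bound) auto
  also have "\<dots> = ennreal (mass e)"
    unfolding mass_def using p by (subst ennreal_mult) auto
  finally have le: "(\<integral>\<^sup>+ s. ennreal ((maj e t s)\<^sup>2) \<partial>MI) \<le> ennreal (mass e)" .
  show i: "integrable MI (\<lambda>s. (maj e t s)\<^sup>2)"
    using le by (subst integrable_iff_bounded) (auto intro: le_less_trans)
  have "ennreal (\<integral>s. (maj e t s)\<^sup>2 \<partial>MI) \<le> ennreal (mass e)"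
    using le i by (simp add: nn_integral_eq_integral)
  moreover have "mass e \<ge> 0" using p by (simp add: mass_def)
  ultimately show "(\<integral>s. (maj e t s)\<^sup>2 \<partial>MI) \<le> mass e" by (simp add: ennreal_le_iff)
qed

lemma mass_nonneg: "mass e \<ge> 0" using p by (simp add: mass_def)

lemma norm_k_le_maj:
  assumes t: "t \<in> {a..b}" and s: "s \<in> {a..b}" shows "norm (k t s) \<le> maj (b - a) t s"
proof (cases "s < t")
  case True then show ?thesis using k_bound[of s t] t s by (auto simp: maj_def)
next
  case False then show ?thesis using k_zero[of t s] maj_nonneg by simp
qed

text \<open>Cauchy's inequality for operator-valued kernels dominated by \<open>maj\<close>.\<close>

lemma dominated_kernel:
  fixes l :: "real \<Rightarrow> ('y \<Rightarrow>\<^sub>L 'x)"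
  assumes m: "(\<lambda>s. l s (u s)) \<in> borel_measurable MI" and u: "u \<in> L2 a b" and e: "e > 0"
    and l: "\<And>s. s \<in> {a..b} \<Longrightarrow> norm (l s) \<le> maj e t s"
  shows "abs_int MI (\<lambda>s. l s (u s))"
    and "(norm (bochner MI (\<lambda>s. l s (u s))))\<^sup>2 \<le> mass e * (\<integral>s. (indicator {..<t} s * norm (u s))\<^sup>2 \<partial>MI)"
proof -
  have [measurable]: "u \<in> borel_measurable MI" using u by (simp add: L2_def)
  have [measurable]: "maj e t \<in> borel_measurable MI" by (rule maj_measurable)
  define n where "n = (\<lambda>s. indicator {..<t} s * norm (u s))"
  have [measurable]: "(\<lambda>s. indicator {..<t} s :: real) \<in> borel_measurable MI"
    by (intro measurable_restrict_space1 borel_measurable_indicator) simp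
  have nm: "n \<in> borel_measurable MI" unfolding n_def by measurable
  have ni: "integrable MI (\<lambda>s. (n s)\<^sup>2)"
    by (rule Bochner_Integration.integrable_bound[of _ "\<lambda>s. (norm (u s))\<^sup>2"])
       (use u nm in \<open>auto simp: L2_def n_def indicator_def\<close>)
  note CS = Cauchy_Schwarz_integral[OF maj_measurable nm maj_square(1)[OF e] ni]
  have le: "norm (l s (u s)) \<le> maj e t s * n s" if "s \<in> {a..b}" for s
  proof -
    have "norm (l s (u s)) \<le> norm (l s) * norm (u s)" by (rule norm_blinfun)
    also have "\<dots> \<le> maj e t s * norm (u s)" by (intro mult_right_mono l that) auto
    also have "\<dots> = maj e t s * n s" by (simp add: n_def maj_def)
    finally show ?thesis .
  qed
  show ai: "abs_int MI (\<lambda>s. l s (u s))"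
    by (rule abs_int_bound[OF m CS(1)]) (rule AE_I2, use le in auto)
  have "norm (bochner MI (\<lambda>s. l s (u s))) \<le> (\<integral>s. norm (l s (u s)) \<partial>MI)" by (rule norm_bochner_le[OF ai])
  also have "\<dots> \<le> (\<integral>s. \<bar>maj e t s * n s\<bar> \<partial>MI)"
    using ai CS(1) by (intro integral_mono) (auto simp: abs_int_def intro: order_trans[OF le])
  finally have "(norm (bochner MI (\<lambda>s. l s (u s))))\<^sup>2 \<le> (\<integral>s. \<bar>maj e t s * n s\<bar> \<partial>MI)\<^sup>2"
    by (intro power_mono) auto
  also have "\<dots> \<le> (\<integral>s. (maj e t s)\<^sup>2 \<partial>MI) * (\<integral>s. (n s)\<^sup>2 \<partial>MI)" by (rule CS(2))
  also have "\<dots> \<le> mass e * (\<integral>s. (n s)\<^sup>2 \<partial>MI)"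
    by (intro mult_right_mono maj_square(2)[OF e] integral_nonneg_AE) auto
  finally show "(norm (bochner MI (\<lambda>s. l s (u s))))\<^sup>2 \<le> mass e * (\<integral>s. (indicator {..<t} s * norm (u s))\<^sup>2 \<partial>MI)"
    by (simp add: n_def)
qed

lemma indicator_sqnorm_le:
  assumes "u \<in> L2 a b" shows "(\<integral>s. (indicator {..<t} s * norm (u s))\<^sup>2 \<partial>MI) \<le> sqnorm u"
proof (rule integral_mono)
  have [measurable]: "u \<in> borel_measurable MI" using assms by (simp add: L2_def)
  have [measurable]: "(\<lambda>s. indicator {..<t} s :: real) \<in> borel_measurable MI"
    by (intro measurable_restrict_space1 borel_measurable_indicator) simp
  show i: "integrable MI (\<lambda>s. (norm (u s))\<^sup>2)" using assms by (simp add: L2_def)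
  have m: "(\<lambda>s. (indicator {..<t} s * norm (u s))\<^sup>2) \<in> borel_measurable MI" by measurable
  show "integrable MI (\<lambda>s. (indicator {..<t} s * norm (u s))\<^sup>2)"
    by (rule Bochner_Integration.integrable_bound[OF i m]) (auto simp: indicator_def)
qed (simp add: indicator_def)

lemma abs_int_k:
  assumes t: "t \<in> {a..b}" and u: "u \<in> L2 a b"
  shows "abs_int MI (\<lambda>s. k t s (u s))"
  by (rule dominated_kernel(1)[OF measurable_k[OF t] u, of "b - a" t])
     (use t u ab norm_k_le_maj in \<open>auto simp: L2_def\<close>)

lemma Q_causal_bound:
  assumes t: "t \<in> {a..b}" and u: "u \<in> L2 a b"
  shows "(norm (Q u t))\<^sup>2 \<le> mass (b - a) * (\<integral>s. (indicator {..<t} s * norm (u s))\<^sup>2 \<partial>MI)"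
  unfolding Q_def
  by (rule dominated_kernel(2)[OF measurable_k[OF t] u, of "b - a" t])
     (use t u ab norm_k_le_maj in \<open>auto simp: L2_def\<close>)

lemma Q_bound:
  assumes t: "t \<in> {a..b}" and u: "u \<in> L2 a b"
  shows "(norm (Q u t))\<^sup>2 \<le> mass (b - a) * sqnorm u"
  by (rule order_trans[OF Q_causal_bound[OF t u] mult_left_mono[OF indicator_sqnorm_le[OF u] mass_nonneg]])

lemma Q_diff:
  assumes t: "t \<in> {a..b}" and u: "u \<in> L2 a b" and v: "v \<in> L2 a b"
  shows "Q (\<lambda>s. u s - v s) t = Q u t - Q v t"
proof -
  have "Q u t = Q (\<lambda>s. u s - v s) t + Q v t"
    using bochner_add[OF abs_int_k[OF t L2_diff[OF u v]] abs_int_k[OF t v]]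
    by (simp add: Q_def blinfun.diff_right)
  then show ?thesis by simp
qed

lemma Q_initial: "Q u a = 0"
proof -
  have "bochner MI (\<lambda>s. k a s (u s)) = bochner MI (\<lambda>s. 0)"
    by (rule bochner_cong_AE[OF abs_int_zero, symmetric])
       (use measurable_cong[of MI "\<lambda>s. k a s (u s)" "\<lambda>s. 0"] k_zero in \<open>auto simp: AE_I2\<close>)
  then show ?thesis by (simp add: Q_def bochner_zero)
qed

lemma Q_cong:
  assumes t: "t \<in> {a..b}" and u: "u \<in> L2 a b" and v: "v \<in> borel_measurable MI"
    and e: "AE s in MI. s < t \<longrightarrow> u s = v s"
  shows "Q u t = Q v t"
  unfolding Q_def
proof (rule bochner_cong_AE[OF abs_int_k[OF t u] measurable_k[OF t v]])
  show "AE s in MI. k t s (u s) = k t s (v s)"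
    using e by eventually_elim (metis k_zero not_less blinfun.zero_left)
qed

lemma Q_sum:
  assumes t: "t \<in> {a..b}" and I: "finite I" and u: "\<And>i. i \<in> I \<Longrightarrow> u i \<in> L2 a b"
  shows "abs_int MI (\<lambda>s. k t s (\<Sum>i\<in>I. c i *\<^sub>R u i s)) \<and> Q (\<lambda>s. \<Sum>i\<in>I. c i *\<^sub>R u i s) t = (\<Sum>i\<in>I. c i *\<^sub>R Q (u i) t)"
  using I u
proof (induction I rule: finite_induct)
  case empty
  then show ?case by (simp add: Q_def bochner_zero abs_int_zero)
next
  case (insert j I)
  have e: "(\<lambda>s. k t s (\<Sum>i\<in>insert j I. c i *\<^sub>R u i s)) = (\<lambda>s. c j *\<^sub>R k t s (u j s) + k t s (\<Sum>i\<in>I. c i *\<^sub>R u i s))"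
    using insert.hyps by (simp add: blinfun.add_right blinfun.scaleR_right)
  have 1: "abs_int MI (\<lambda>s. c j *\<^sub>R k t s (u j s))" by (intro abs_int_scaleR abs_int_k t insert.prems) simp
  have 2: "abs_int MI (\<lambda>s. k t s (\<Sum>i\<in>I. c i *\<^sub>R u i s))"
    "Q (\<lambda>s. \<Sum>i\<in>I. c i *\<^sub>R u i s) t = (\<Sum>i\<in>I. c i *\<^sub>R Q (u i) t)" using insert by auto
  have "Q (\<lambda>s. \<Sum>i\<in>insert j I. c i *\<^sub>R u i s) t = c j *\<^sub>R Q (u j) t + Q (\<lambda>s. \<Sum>i\<in>I. c i *\<^sub>R u i s) t"
    unfolding Q_def e bochner_add[OF 1 2(1)]
    by (subst bochner_scaleR[OF abs_int_k]) (use t insert.prems in auto)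
  then show ?case unfolding e using abs_int_add[OF 1 2(1)] 2 insert.hyps by simp
qed

text \<open>The kernel cut off near the diagonal is continuous on the whole square.\<close>

definition cutoff :: "real \<Rightarrow> real \<Rightarrow> real" where
  "cutoff e r = min 1 (max 0 (r / e - 1))"

definition kc :: "real \<Rightarrow> real \<Rightarrow> real \<Rightarrow> ('y \<Rightarrow>\<^sub>L 'x)" where
  "kc e t s = cutoff e (t - s) *\<^sub>R k t s"

lemma cutoff_range: "0 \<le> cutoff e r" "cutoff e r \<le> 1" by (auto simp: cutoff_def)

lemma cutoff_small: "e > 0 \<Longrightarrow> r \<le> e \<Longrightarrow> cutoff e r = 0"
  by (auto simp: cutoff_def field_simps)

lemma cutoff_large: "e > 0 \<Longrightarrow> 2 * e \<le> r \<Longrightarrow> cutoff e r = 1"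
  by (auto simp: cutoff_def field_simps)

lemma continuous_kc:
  assumes e: "e > 0" shows "continuous_on ({a..b} \<times> {a..b}) (\<lambda>z. kc e (fst z) (snd z))"
proof -
  let ?S = "{a..b} \<times> {a..b}"
  let ?A = "?S \<inter> {z. snd z < fst z}" and ?B = "?S \<inter> {z. fst z - snd z < e}"
  have cut: "continuous_on A (\<lambda>z. cutoff e (fst z - snd z))" for A :: "(real \<times> real) set"
    unfolding cutoff_def using e by (intro continuous_intros) auto
  have 1: "continuous_on ?A (\<lambda>z. kc e (fst z) (snd z))"
    unfolding kc_def by (intro continuous_on_scaleR cut continuous_on_subset[OF k_cont]) auto
  have 2: "continuous_on ?B (\<lambda>z. kc e (fst z) (snd z))"
    by (rule continuous_on_eq[of _ "\<lambda>_. 0"]) (use e in \<open>auto simp: kc_def cutoff_small\<close>)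
  have eq: "?S = ?A \<union> ?B" using e by auto
  have oA: "open {z :: real \<times> real. snd z < fst z}" by (intro open_Collect_less continuous_intros)
  have oB: "open {z :: real \<times> real. fst z - snd z < e}" by (intro open_Collect_less continuous_intros)
  show ?thesis
    apply (subst eq)
    apply (rule continuous_on_Un_local_open[OF _ _ 1 2])
    unfolding eq[symmetric] openin_open using oA oB by blast+
qed

lemma kc_uniformly_continuous:
  assumes e: "e > 0" and \<eta>: "\<eta> > 0"
  obtains d where "d > 0" "\<And>t s t' s'. t \<in> {a..b} \<Longrightarrow> s \<in> {a..b} \<Longrightarrow> t' \<in> {a..b} \<Longrightarrow> s' \<in> {a..b} \<Longrightarrow>
    \<bar>t - t'\<bar> + \<bar>s - s'\<bar> < d \<Longrightarrow> norm (kc e t s - kc e t' s') < \<eta>"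
proof -
  have "uniformly_continuous_on ({a..b} \<times> {a..b}) (\<lambda>z. kc e (fst z) (snd z))"
    by (intro compact_uniformly_continuous continuous_kc e compact_Times) auto
  then obtain d where d: "d > 0" "\<And>z z'. z \<in> {a..b} \<times> {a..b} \<Longrightarrow> z' \<in> {a..b} \<times> {a..b} \<Longrightarrow> dist z' z < d \<Longrightarrow>
      dist (kc e (fst z') (snd z')) (kc e (fst z) (snd z)) < \<eta>"
    unfolding uniformly_continuous_on_def using \<eta> by metis
  show thesis
  proof (rule that[OF d(1)])
    fix t s t' s' assume h: "t \<in> {a..b}" "s \<in> {a..b}" "t' \<in> {a..b}" "s' \<in> {a..b}" "\<bar>t - t'\<bar> + \<bar>s - s'\<bar> < d"
    have "dist (t, s) (t', s') \<le> \<bar>t - t'\<bar> + \<bar>s - s'\<bar>"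
      unfolding dist_Pair_Pair dist_real_def using sqrt_sum_squares_le_sum_abs by auto
    then show "norm (kc e t s - kc e t' s') < \<eta>"
      using d(2)[of "(t', s')" "(t, s)"] h by (auto simp: dist_norm)
  qed
qed

lemma norm_kc_diff:
  assumes e: "e > 0" and t: "t \<in> {a..b}" and s: "s \<in> {a..b}"
  shows "norm (k t s - kc e t s) \<le> maj (2 * e) t s"
proof (cases "s < t \<and> t - 2 * e \<le> s")
  case True
  have "norm (k t s - kc e t s) = norm ((1 - cutoff e (t - s)) *\<^sub>R k t s)" by (simp add: kc_def scaleR_diff_left)
  also have "\<dots> = (1 - cutoff e (t - s)) * norm (k t s)" using cutoff_range[of e "t - s"] by simp
  also have "\<dots> \<le> 1 * norm (k t s)" using cutoff_range[of e "t - s"] by (intro mult_right_mono) auto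
  also have "\<dots> \<le> C * (t - s) powr p" using k_bound[of s t] True t s by simp
  finally show ?thesis using True by (simp add: maj_def)
next
  case False
  then have "s \<ge> t \<or> 2 * e \<le> t - s" by auto
  then have "k t s - kc e t s = 0"
    using e k_zero[of t s] cutoff_large[of e "t - s"] by (auto simp: kc_def)
  then show ?thesis using maj_nonneg by simp
qed

definition Qc :: "real \<Rightarrow> (real \<Rightarrow> 'y) \<Rightarrow> real \<Rightarrow> 'x" where
  "Qc e u t = bochner MI (\<lambda>s. kc e t s (u s))"

lemma L1_L2:
  fixes u :: "real \<Rightarrow> 'y"
  assumes u: "u \<in> L2 a b"
  shows "integrable MI u" "(\<integral>s. norm (u s) \<partial>MI)\<^sup>2 \<le> (b - a) * sqnorm u"
proof -
  have [measurable]: "u \<in> borel_measurable MI" using u by (simp add: L2_def)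
  interpret finite_measure MI by (rule finite_MI)
  have i: "integrable MI (\<lambda>s. (norm (u s))\<^sup>2)" using u by (simp add: L2_def)
  have CS: "integrable MI (\<lambda>s. 1 * norm (u s))" "(\<integral>s. \<bar>1 * norm (u s)\<bar> \<partial>MI)\<^sup>2 \<le> (\<integral>s. 1\<^sup>2 \<partial>MI) * sqnorm u"
    by (rule Cauchy_Schwarz_integral; use i in simp)+
  have "(\<integral>s. 1\<^sup>2 \<partial>MI) = b - a" using ab by (simp add: measure_restrict_space)
  with CS(2) show "(\<integral>s. norm (u s) \<partial>MI)\<^sup>2 \<le> (b - a) * sqnorm u" by simp
  show "integrable MI u" using CS(1) integrable_norm_iff[of u MI] by simp
qed

lemma L1_bound:
  fixes u :: "real \<Rightarrow> 'y"
  assumes u: "u \<in> L2 a b" "sqnorm u \<le> \<rho>"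
  shows "(\<integral>s. norm (u s) \<partial>MI) \<le> sqrt ((b - a) * \<rho>)"
proof -
  have "(\<integral>s. norm (u s) \<partial>MI)\<^sup>2 \<le> (b - a) * \<rho>"
    using ab by (intro order_trans[OF L1_L2(2)[OF u(1)] mult_left_mono[OF u(2)]]) simp
  then show ?thesis by (rule real_le_rsqrt)
qed

lemma abs_int_kc:
  assumes e: "e > 0" and t: "t \<in> {a..b}" and u: "u \<in> L2 a b"
  shows "abs_int MI (\<lambda>s. kc e t s (u s))"
proof (rule abs_int_bound[of _ _ "\<lambda>s. norm (k t s (u s))"])
  have "continuous_on {a..b} (kc e t)"
    by (rule continuous_on_compose2[OF continuous_kc[OF e], of _ "\<lambda>s. (t, s)", simplified])
       (use t in \<open>auto intro!: continuous_intros\<close>)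
  then have "continuous_on ({a..b} - {t}) (kc e t)" by (rule continuous_on_subset) auto
  then show "(\<lambda>s. kc e t s (u s)) \<in> borel_measurable MI"
    using u by (intro measurable_kernel) (auto simp: L2_def)
  show "integrable MI (\<lambda>s. norm (k t s (u s)))" using abs_int_k[OF t u] by (simp add: abs_int_def)
  show "AE s in MI. norm (kc e t s (u s)) \<le> norm (k t s (u s))"
    by (rule AE_I2) (use cutoff_range in \<open>auto simp: kc_def blinfun.scaleR_left intro!: mult_left_le_one_le\<close>)
qed

lemma Q_Qc:
  assumes e: "e > 0" and t: "t \<in> {a..b}" and u: "u \<in> L2 a b"
  shows "(norm (Q u t - Qc e u t))\<^sup>2 \<le> mass (2 * e) * sqnorm u"
proof -
  have d: "(\<lambda>s. (k t s - kc e t s) (u s)) = (\<lambda>s. k t s (u s) - kc e t s (u s))" by (simp add: blinfun.diff_left)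
  have ai: "abs_int MI (\<lambda>s. (k t s - kc e t s) (u s))"
    unfolding d by (intro abs_int_diff abs_int_k abs_int_kc e t u)
  have "Q u t = bochner MI (\<lambda>s. (k t s - kc e t s) (u s)) + Qc e u t"
    unfolding Q_def Qc_def using bochner_add[OF ai abs_int_kc[OF e t u]] by (simp add: blinfun.diff_left)
  then have eq: "Q u t - Qc e u t = bochner MI (\<lambda>s. (k t s - kc e t s) (u s))" by simp
  have bd: "(norm (bochner MI (\<lambda>s. (k t s - kc e t s) (u s))))\<^sup>2
      \<le> mass (2 * e) * (\<integral>s. (indicator {..<t} s * norm (u s))\<^sup>2 \<partial>MI)"
    using ai e by (intro dominated_kernel(2) u norm_kc_diff t) (auto simp: abs_int_def)
  show ?thesis unfolding eq
    by (rule order_trans[OF bd mult_left_mono[OF indicator_sqnorm_le[OF u] mass_nonneg]])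
qed

lemma Q_approximation:
  assumes \<eta>: "\<eta> > 0" and \<rho>: "\<rho> \<ge> 0"
  obtains e where "e > 0" "\<And>u t. t \<in> {a..b} \<Longrightarrow> u \<in> L2 a b \<Longrightarrow> sqnorm u \<le> \<rho> \<Longrightarrow> norm (Q u t - Qc e u t) < \<eta>"
proof -
  have "((\<lambda>e. mass (2 * e) * \<rho>) \<longlongrightarrow> 0) (at_right 0)"
    unfolding mass_def using p by real_asymp
  then have "\<forall>\<^sub>F e in at_right 0. mass (2 * e) * \<rho> < \<eta>\<^sup>2"
    by (rule order_tendstoD) (use \<eta> in simp)
  then obtain d where d: "d > 0" "\<And>e. 0 < e \<Longrightarrow> e < d \<Longrightarrow> mass (2 * e) * \<rho> < \<eta>\<^sup>2"
    unfolding eventually_at_right_field by auto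
  show thesis
  proof (rule that[of "d / 2"])
    show "d / 2 > 0" using d by simp
    fix u :: "real \<Rightarrow> 'y" and t assume h: "t \<in> {a..b}" "u \<in> L2 a b" "sqnorm u \<le> \<rho>"
    have "(norm (Q u t - Qc (d / 2) u t))\<^sup>2 \<le> mass (2 * (d / 2)) * sqnorm u"
      using d h by (intro Q_Qc) auto
    also have "\<dots> \<le> mass (2 * (d / 2)) * \<rho>" by (intro mult_left_mono h mass_nonneg)
    also have "\<dots> < \<eta>\<^sup>2" using d by (intro d(2)) auto
    finally show "norm (Q u t - Qc (d / 2) u t) < \<eta>" using \<eta> by (simp add: power_less_imp_less_base)
  qed
qed

text \<open>The operator is uniformly close to the one with the cut-off kernel, which is uniformly continuous.\<close>

lemma Q_equicontinuous:
  assumes \<eta>: "\<eta> > 0" and \<rho>: "\<rho> \<ge> 0"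
  obtains d where "d > 0" "\<And>u t t'. u \<in> L2 a b \<Longrightarrow> sqnorm u \<le> \<rho> \<Longrightarrow> t \<in> {a..b} \<Longrightarrow> t' \<in> {a..b} \<Longrightarrow>
    \<bar>t - t'\<bar> < d \<Longrightarrow> norm (Q u t - Q u t') < \<eta>"
proof -
  obtain e where e: "e > 0" "\<And>u t. t \<in> {a..b} \<Longrightarrow> u \<in> L2 a b \<Longrightarrow> sqnorm u \<le> \<rho> \<Longrightarrow> norm (Q u t - Qc e u t) < \<eta> / 3"
    using Q_approximation[of "\<eta> / 3" \<rho>] \<eta> \<rho> by auto
  define R where "R = sqrt ((b - a) * \<rho>) + 1"
  have R: "R > 0" using ab \<rho> by (simp add: R_def add_nonneg_pos)
  obtain d where d: "d > 0" "\<And>t s t' s'. t \<in> {a..b} \<Longrightarrow> s \<in> {a..b} \<Longrightarrow> t' \<in> {a..b} \<Longrightarrow> s' \<in> {a..b} \<Longrightarrow>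
    \<bar>t - t'\<bar> + \<bar>s - s'\<bar> < d \<Longrightarrow> norm (kc e t s - kc e t' s') < \<eta> / (3 * R)"
    using kc_uniformly_continuous[OF e(1), of "\<eta> / (3 * R)"] \<eta> R by auto
  show thesis
  proof (rule that[OF d(1)])
    fix u :: "real \<Rightarrow> 'y" and t t' assume u: "u \<in> L2 a b" "sqnorm u \<le> \<rho>" and t: "t \<in> {a..b}" "t' \<in> {a..b}" "\<bar>t - t'\<bar> < d"
    have L1: "(\<integral>s. norm (u s) \<partial>MI) \<le> R"
      using L1_bound[OF u] by (simp add: R_def)
    have "norm (Qc e u t - Qc e u t') \<le> (\<integral>s. norm (kc e t s (u s) - kc e t' s (u s)) \<partial>MI)"
      unfolding Qc_def by (intro norm_bochner_diff_le abs_int_kc e u t)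
    also have "\<dots> \<le> (\<integral>s. \<eta> / (3 * R) * norm (u s) \<partial>MI)"
    proof (rule integral_mono)
      show "integrable MI (\<lambda>s. norm (kc e t s (u s) - kc e t' s (u s)))"
        using abs_int_diff[OF abs_int_kc[OF e(1) t(1) u(1)] abs_int_kc[OF e(1) t(2) u(1)]] by (simp add: abs_int_def)
      show "integrable MI (\<lambda>s. \<eta> / (3 * R) * norm (u s))" using L1_L2(1)[OF u(1)] by simp
      fix s assume "s \<in> space MI"
      then have s: "s \<in> {a..b}" by simp
      have "norm (kc e t s (u s) - kc e t' s (u s)) \<le> norm (kc e t s - kc e t' s) * norm (u s)"
        unfolding blinfun.diff_left[symmetric] by (rule norm_blinfun)
      also have "\<dots> \<le> \<eta> / (3 * R) * norm (u s)"
        using d(2)[of t s t' s] t s by (intro mult_right_mono norm_ge_zero less_imp_le) auto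
      finally show "norm (kc e t s (u s) - kc e t' s (u s)) \<le> \<eta> / (3 * R) * norm (u s)" .
    qed
    also have "\<dots> = \<eta> / (3 * R) * (\<integral>s. norm (u s) \<partial>MI)" by simp
    also have "\<dots> \<le> \<eta> / (3 * R) * R" using \<eta> R by (intro mult_left_mono L1) auto
    also have "\<dots> = \<eta> / 3" using R by simp
    finally have "norm (Qc e u t - Qc e u t') \<le> \<eta> / 3" .
    moreover have eq: "Q u t - Q u t' = (Q u t - Qc e u t) + (Qc e u t - Qc e u t') - (Q u t' - Qc e u t')" by simp
    have "norm (Q u t - Q u t') \<le> norm (Q u t - Qc e u t) + norm (Qc e u t - Qc e u t') + norm (Q u t' - Qc e u t')"
      by (subst eq) (rule order_trans[OF norm_triangle_ineq4 add_right_mono[OF norm_triangle_ineq]])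
    ultimately show "norm (Q u t - Q u t') < \<eta>" using e(2)[OF t(1) u] e(2)[OF t(2) u] by linarith
  qed
qed

lemma continuous_Q:
  assumes u: "u \<in> L2 a b" shows "continuous_on {a..b} (Q u)"
  unfolding continuous_on_iff
proof (intro ballI allI impI)
  fix t e :: real assume t: "t \<in> {a..b}" and e: "e > 0"
  have "0 \<le> sqnorm u" by (rule integral_nonneg_AE) simp
  from Q_equicontinuous[OF e this] obtain d where d: "d > 0"
    "\<And>v t t'. v \<in> L2 a b \<Longrightarrow> sqnorm v \<le> sqnorm u \<Longrightarrow> t \<in> {a..b} \<Longrightarrow> t' \<in> {a..b} \<Longrightarrow> \<bar>t - t'\<bar> < d \<Longrightarrow> norm (Q v t - Q v t') < e"
    by blast
  show "\<exists>d>0. \<forall>x'\<in>{a..b}. dist x' t < d \<longrightarrow> dist (Q u x') (Q u t) < e"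
    using d(1) d(2)[OF u order_refl _ t] by (intro exI[of _ d]) (auto simp: dist_norm)
qed

lemma has_bochner_sum:
  fixes f :: "'i \<Rightarrow> 'c \<Rightarrow> 'x"
  assumes "finite I" "\<And>i. i \<in> I \<Longrightarrow> has_bochner M (f i) (z i)"
  shows "has_bochner M (\<lambda>x. \<Sum>i\<in>I. f i x) (\<Sum>i\<in>I. z i)"
  using assms
proof (induction I rule: finite_induct)
  case empty
  then show ?case using has_bochner_bochner[OF abs_int_zero, of M] by (simp add: bochner_zero)
next
  case (insert j I)
  then show ?case using has_bochner_add[of M "f j" "z j" "\<lambda>x. \<Sum>i\<in>I. f i x"] by simp
qed

text \<open>After cutting off the diagonal and replacing the kernel by a step function in \<open>s\<close>, the value at
  \<open>t\<close> is a finite sum of values of compact operators.\<close>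

lemma compact_Q_values:
  assumes t: "t \<in> {a..b}" and \<rho>: "\<rho> \<ge> 0"
  shows "compact (closure {Q u t | u. u \<in> L2 a b \<and> sqnorm u \<le> \<rho>})"
proof (rule compact_closure_if_near_compact)
  fix \<eta> :: real assume \<eta>: "\<eta> > 0"
  obtain e where e: "e > 0" "\<And>u t. t \<in> {a..b} \<Longrightarrow> u \<in> L2 a b \<Longrightarrow> sqnorm u \<le> \<rho> \<Longrightarrow> norm (Q u t - Qc e u t) < \<eta> / 2"
    using Q_approximation[of "\<eta> / 2" \<rho>] \<eta> \<rho> by auto
  define R where "R = sqrt ((b - a) * \<rho>) + 1"
  have R: "R > 0" using ab \<rho> by (simp add: R_def add_nonneg_pos)
  obtain d0 where d0: "d0 > 0" "\<And>t s t' s'. t \<in> {a..b} \<Longrightarrow> s \<in> {a..b} \<Longrightarrow> t' \<in> {a..b} \<Longrightarrow> s' \<in> {a..b} \<Longrightarrow>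
    \<bar>t - t'\<bar> + \<bar>s - s'\<bar> < d0 \<Longrightarrow> norm (kc e t s - kc e t' s') < \<eta> / (3 * R)"
    using kc_uniformly_continuous[OF e(1), of "\<eta> / (3 * R)"] \<eta> R by auto
  define d where "d = d0 / 2"
  have d: "d > 0" "d < d0" using d0(1) by (auto simp: d_def)
  define j where "j = (\<lambda>s. nat \<lfloor>(s - a) / d\<rfloor>)"
  define N where "N = j b"
  define \<sigma> where "\<sigma> = (\<lambda>i::nat. min b (a + real i * d))"
  have \<sigma>: "\<sigma> i \<in> {a..b}" for i using ab d by (auto simp: \<sigma>_def)
  have jN: "j s \<le> N" if "s \<in> {a..b}" for s
    unfolding N_def j_def using that d by (intro nat_mono floor_mono divide_right_mono) auto
  have near: "\<bar>s - \<sigma> (j s)\<bar> < d0" if s: "s \<in> {a..b}" for s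
  proof -
    have "(s - a) / d \<ge> 0" using s d by simp
    then have "real (j s) \<le> (s - a) / d" "(s - a) / d < real (j s) + 1" unfolding j_def by linarith+
    then have "real (j s) * d \<le> s - a" "s - a < (real (j s) + 1) * d"
      using d by (simp_all add: pos_le_divide_eq pos_divide_less_eq)
    then have "a + real (j s) * d \<le> s" "s < a + real (j s) * d + d" by (simp_all add: algebra_simps)
    then show ?thesis using s d by (auto simp: \<sigma>_def)
  qed
  let ?K = "\<lambda>i. closure (k t (\<sigma> i) ` cball 0 R)"
  have K: "compact (?K i)" for i
  proof (cases "\<sigma> i < t")
    case True
    then show ?thesis using k_compact[of "\<sigma> i" t] \<sigma>[of i] t unfolding compact_operator_def by auto
  next
    case False
    then have k0: "k t (\<sigma> i) = 0" by (intro k_zero) simp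
    have "k t (\<sigma> i) ` cball 0 R = {0}" unfolding k0 using R by (auto simp: image_iff intro!: exI[of _ 0])
    then show ?thesis by simp
  qed
  let ?C = "{(\<Sum>i\<in>{..N}. f i) | f. \<forall>i\<in>{..N}. f i \<in> ?K i}"
  have "compact ?C" by (intro compact_sum_set K) auto
  moreover have "{Q u t | u. u \<in> L2 a b \<and> sqnorm u \<le> \<rho>} \<subseteq> (\<Union>c\<in>?C. ball c \<eta>)"
  proof
    fix y assume "y \<in> {Q u t | u. u \<in> L2 a b \<and> sqnorm u \<le> \<rho>}"
    then obtain u where u: "y = Q u t" "u \<in> L2 a b" "sqnorm u \<le> \<rho>" by blast
    have [measurable]: "u \<in> borel_measurable MI" using u by (simp add: L2_def)
    have L1: "(\<integral>s. norm (u s) \<partial>MI) \<le> R" using L1_bound[OF u(2,3)] by (simp add: R_def)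
    have ui: "integrable MI u" by (rule L1_L2(1)[OF u(2)])
    have [measurable]: "j \<in> measurable MI (count_space UNIV)"
    proof -
      have "j \<in> measurable borel (count_space UNIV)" unfolding j_def by measurable
      then show ?thesis by (intro measurable_restrict_space1 measurable_completion) auto
    qed
    define v where "v = (\<lambda>i s. if j s = i then u s else 0)"
    have vm: "v i \<in> borel_measurable MI" for i unfolding v_def by measurable
    have vi: "integrable MI (v i)" for i
      by (rule Bochner_Integration.integrable_bound[OF ui vm]) (auto simp: v_def)
    define z where "z = (\<lambda>i. integral\<^sup>L MI (v i))"
    have zR: "norm (z i) \<le> R" for i
    proof -
      have "norm (z i) \<le> (\<integral>s. norm (v i s) \<partial>MI)" unfolding z_def by (rule integral_norm_bound)
      also have "\<dots> \<le> (\<integral>s. norm (u s) \<partial>MI)"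
        using vi ui by (intro integral_mono) (auto simp: v_def)
      finally show ?thesis using L1 by simp
    qed
    define F where "F = (\<lambda>s. \<Sum>i\<in>{..N}. kc e t (\<sigma> i) (v i s))"
    have F: "has_bochner MI F (\<Sum>i\<in>{..N}. kc e t (\<sigma> i) (z i))"
      unfolding F_def
    proof (rule has_bochner_sum)
      fix i
      have "has_bochner MI (v i) (z i)"
        unfolding has_bochner_eq_library z_def using vi by (rule has_bochner_integral_integrable)
      then show "has_bochner MI (\<lambda>x. kc e t (\<sigma> i) (v i x)) (kc e t (\<sigma> i) (z i))"
        by (rule has_bochner_linear[OF blinfun.bounded_linear_right])
    qed simp
    have Feq: "F s = kc e t (\<sigma> (j s)) (u s)" if "s \<in> {a..b}" for s
    proof -
      have "F s = (\<Sum>i\<in>{..N}. if i = j s then kc e t (\<sigma> (j s)) (u s) else 0)"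
        unfolding F_def v_def by (intro sum.cong) auto
      then show ?thesis using jN[OF that] by simp
    qed
    have diff: "norm (kc e t s (u s) - F s) \<le> \<eta> / (3 * R) * norm (u s)" if s: "s \<in> {a..b}" for s
    proof -
      have "norm (kc e t s (u s) - F s) \<le> norm (kc e t s - kc e t (\<sigma> (j s))) * norm (u s)"
        unfolding Feq[OF s] blinfun.diff_left[symmetric] by (rule norm_blinfun)
      also have "\<dots> \<le> \<eta> / (3 * R) * norm (u s)"
        using d0(2)[of t s t "\<sigma> (j s)"] t s \<sigma> near[OF s] by (intro mult_right_mono norm_ge_zero less_imp_le) auto
      finally show ?thesis .
    qed
    have Fm: "F \<in> borel_measurable MI" using F by (simp add: has_bochner_def)
    have Fi: "abs_int MI F"
    proof (rule abs_int_bound[OF Fm, of "\<lambda>s. norm (kc e t s (u s)) + \<eta> / (3 * R) * norm (u s)"])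
      show "integrable MI (\<lambda>s. norm (kc e t s (u s)) + \<eta> / (3 * R) * norm (u s))"
        using abs_int_kc[OF e(1) t u(2)] ui by (auto simp: abs_int_def)
      show "AE s in MI. norm (F s) \<le> norm (kc e t s (u s)) + \<eta> / (3 * R) * norm (u s)"
      proof (rule AE_I2)
        fix s assume "s \<in> space MI"
        then have "norm (kc e t s (u s) - F s) \<le> \<eta> / (3 * R) * norm (u s)" by (intro diff) simp
        then show "norm (F s) \<le> norm (kc e t s (u s)) + \<eta> / (3 * R) * norm (u s)"
          using norm_triangle_ineq2[of "F s" "kc e t s (u s)"] norm_minus_commute[of "F s" "kc e t s (u s)"] by linarith
      qed
    qed
    have "norm (Qc e u t - (\<Sum>i\<in>{..N}. kc e t (\<sigma> i) (z i))) \<le> (\<integral>s. norm (kc e t s (u s) - F s) \<partial>MI)"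
      unfolding Qc_def bochner_eqI[OF F, symmetric]
      by (rule norm_bochner_diff_le[OF abs_int_kc[OF e(1) t u(2)] Fi])
    also have "\<dots> \<le> (\<integral>s. \<eta> / (3 * R) * norm (u s) \<partial>MI)"
      using abs_int_diff[OF abs_int_kc[OF e(1) t u(2)] Fi] ui diff
      by (intro integral_mono) (auto simp: abs_int_def)
    also have "\<dots> = \<eta> / (3 * R) * (\<integral>s. norm (u s) \<partial>MI)" by simp
    also have "\<dots> \<le> \<eta> / (3 * R) * R" using \<eta> R by (intro mult_left_mono L1) auto
    also have "\<dots> = \<eta> / 3" using R by simp
    finally have 1: "norm (Qc e u t - (\<Sum>i\<in>{..N}. kc e t (\<sigma> i) (z i))) \<le> \<eta> / 3" .
    have 2: "norm (Q u t - Qc e u t) < \<eta> / 2" by (rule e(2)[OF t u(2,3)])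
    have eq: "Q u t - (\<Sum>i\<in>{..N}. kc e t (\<sigma> i) (z i)) = (Q u t - Qc e u t) + (Qc e u t - (\<Sum>i\<in>{..N}. kc e t (\<sigma> i) (z i)))"
      by simp
    have "norm (Q u t - (\<Sum>i\<in>{..N}. kc e t (\<sigma> i) (z i))) < \<eta>"
      using 1 2 \<eta> norm_triangle_ineq[of "Q u t - Qc e u t" "Qc e u t - (\<Sum>i\<in>{..N}. kc e t (\<sigma> i) (z i))"]
      unfolding eq by linarith
    moreover have "(\<Sum>i\<in>{..N}. kc e t (\<sigma> i) (z i)) \<in> ?C"
    proof -
      have "kc e t (\<sigma> i) (z i) \<in> ?K i" for i
      proof -
        have "kc e t (\<sigma> i) (z i) = k t (\<sigma> i) (cutoff e (t - \<sigma> i) *\<^sub>R z i)"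
          by (simp add: kc_def blinfun.scaleR_left blinfun.scaleR_right)
        moreover have "norm (cutoff e (t - \<sigma> i) *\<^sub>R z i) \<le> 1 * R"
          unfolding norm_scaleR using cutoff_range[of e "t - \<sigma> i"] zR[of i] by (intro mult_mono) auto
        ultimately show ?thesis by (intro subsetD[OF closure_subset]) auto
      qed
      then show ?thesis by blast
    qed
    ultimately show "y \<in> (\<Union>c\<in>?C. ball c \<eta>)"
      unfolding u(1) by (intro UN_I[of "\<Sum>i\<in>{..N}. kc e t (\<sigma> i) (z i)"]) (auto simp: dist_norm norm_minus_commute)
  qed
  ultimately show "\<exists>C'. compact C' \<and> {Q u t | u. u \<in> L2 a b \<and> sqnorm u \<le> \<rho>} \<subseteq> (\<Union>c\<in>C'. ball c \<eta>)" by blast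
qed

text \<open>Compactness of the operator from \<open>L\<^sup>2\<close> to the continuous functions.\<close>

lemma Q_subsequence:
  fixes u :: "nat \<Rightarrow> real \<Rightarrow> 'y"
  assumes u: "\<And>n. u n \<in> L2 a b" "\<And>n. sqnorm (u n) \<le> \<rho>"
  obtains \<phi> r where "strict_mono (\<phi> :: nat \<Rightarrow> nat)" "continuous_on {a..b} r"
    "uniform_limit {a..b} (\<lambda>n. Q (u (\<phi> n))) r sequentially"
proof -
  have \<rho>: "\<rho> \<ge> 0" by (rule order_trans[OF _ u(2)[of 0]], rule integral_nonneg_AE) simp
  show thesis
  proof (rule Arzela_Ascoli_compact_values[of "{a..b}" "\<lambda>n. Q (u n)"])
    show "\<exists>K. compact K \<and> (\<forall>n. Q (u n) t \<in> K)" if t: "t \<in> {a..b}" for t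
    proof (intro exI conjI allI)
      show "compact (closure {Q v t | v. v \<in> L2 a b \<and> sqnorm v \<le> \<rho>})" by (rule compact_Q_values[OF t \<rho>])
      show "Q (u n) t \<in> closure {Q v t | v. v \<in> L2 a b \<and> sqnorm v \<le> \<rho>}" for n
        by (rule subsetD[OF closure_subset]) (use u in blast)
    qed
    show "\<exists>d>0. \<forall>n. \<forall>x\<in>{a..b}. \<forall>y\<in>{a..b}. dist x y < d \<longrightarrow> dist (Q (u n) x) (Q (u n) y) < e" if e: "0 < e" for e
    proof -
      from Q_equicontinuous[OF e \<rho>] obtain d where d: "d > 0"
        "\<And>v t t'. v \<in> L2 a b \<Longrightarrow> sqnorm v \<le> \<rho> \<Longrightarrow> t \<in> {a..b} \<Longrightarrow> t' \<in> {a..b} \<Longrightarrow> \<bar>t - t'\<bar> < d \<Longrightarrow> norm (Q v t - Q v t') < e"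
        by blast
      then show ?thesis using u by (intro exI[of _ d]) (auto simp: dist_norm)
    qed
  qed (use that in auto)
qed

end

section \<open>Mild solutions as a singular integral equation\<close>

lemma has_bochner_cong:
  assumes h: "has_bochner M f x" and eq: "\<And>s. s \<in> space M \<Longrightarrow> f s = g s"
  shows "has_bochner M g x"
proof -
  have "g \<in> borel_measurable M"
    using h measurable_cong[of M f g, OF eq] by (simp add: has_bochner_def)
  moreover have "(\<integral>\<^sup>+ y. ennreal (norm (f y - s y)) \<partial>M) = (\<integral>\<^sup>+ y. ennreal (norm (g y - s y)) \<partial>M)" for s
    by (intro nn_integral_cong) (simp add: eq)
  ultimately show ?thesis using h unfolding has_bochner_def by simp
qed

locale fractional_setting = compact_semigroup T + separable_banach D
  for T :: "real \<Rightarrow> 'x::banach \<Rightarrow>\<^sub>L 'x" and D :: "'x set" +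
  fixes a b \<alpha> \<beta> \<gamma> :: real and \<psi> \<psi>' :: "real \<Rightarrow> real"
    and B :: "'y::{banach, second_countable_topology} \<Rightarrow>\<^sub>L 'x" and x0 :: 'x
  assumes ab: "a < b" and \<alpha>: "1 / 2 < \<alpha>" "\<alpha> \<le> 1" and \<beta>: "0 \<le> \<beta>" "\<beta> \<le> 1"
    and \<gamma>: "\<gamma> = \<alpha> + \<beta> * (1 - \<alpha>)"
    and psi_deriv: "\<And>t. t \<in> {a..b} \<Longrightarrow> (\<psi> has_real_derivative \<psi>' t) (at t within {a..b})"
    and psi_C1: "continuous_on {a..b} \<psi>'"
    and psi_incr: "mono_on {a..b} \<psi>"
    and psi_nz: "\<And>t. t \<in> {a..b} \<Longrightarrow> \<psi>' t \<noteq> 0"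
begin

abbreviation (input) "MI \<equiv> lebesgue_on {a..b}"

lemma gamma_le_1: "\<gamma> \<le> 1"
proof -
  have "\<beta> * (1 - \<alpha>) \<le> 1 * (1 - \<alpha>)" using \<alpha> \<beta> by (intro mult_right_mono) auto
  then show ?thesis by (simp add: \<gamma>)
qed

lemma continuous_psi: "continuous_on {a..b} \<psi>"
  by (rule DERIV_continuous_on[OF psi_deriv])

lemma psi'_pos: assumes t: "t \<in> {a..b}" shows "\<psi>' t > 0"
proof -
  have "((\<lambda>y. (\<psi> y - \<psi> t) / (y - t)) \<longlongrightarrow> \<psi>' t) (at t within {a..b})"
    using psi_deriv[OF t] by (simp add: has_field_derivative_iff)
  moreover have "\<forall>\<^sub>F y in at t within {a..b}. 0 \<le> (\<psi> y - \<psi> t) / (y - t)"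
    unfolding eventually_at_filter
  proof (intro always_eventually allI impI)
    fix y assume "y \<noteq> t" "y \<in> {a..b}"
    then show "0 \<le> (\<psi> y - \<psi> t) / (y - t)"
      using mono_onD[OF psi_incr, of y t] mono_onD[OF psi_incr, of t y] t
      by (cases "y \<le> t") (auto intro!: divide_nonneg_nonneg divide_nonpos_nonpos)
  qed
  moreover have "at t within {a..b} \<noteq> bot"
    using ab t by (simp add: trivial_limit_within islimpt_Icc)
  ultimately have "0 \<le> \<psi>' t" by (rule tendsto_lowerbound)
  with psi_nz[OF t] show ?thesis by simp
qed

lemma psi'_bounds:
  obtains m M where "m > 0" "\<And>t. t \<in> {a..b} \<Longrightarrow> m \<le> \<psi>' t" "\<And>t. t \<in> {a..b} \<Longrightarrow> \<psi>' t \<le> M"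
proof -
  obtain x where x: "x \<in> {a..b}" "\<And>t. t \<in> {a..b} \<Longrightarrow> \<psi>' x \<le> \<psi>' t"
    using continuous_attains_inf[of "{a..b}" \<psi>'] psi_C1 ab by auto
  obtain y where "y \<in> {a..b}" "\<And>t. t \<in> {a..b} \<Longrightarrow> \<psi>' t \<le> \<psi>' y"
    using continuous_attains_sup[of "{a..b}" \<psi>'] psi_C1 ab by auto
  with x psi'_pos[OF x(1)] show thesis using that[of "\<psi>' x" "\<psi>' y"] by blast
qed

lemma psi_diff_lower:
  assumes m: "\<And>t. t \<in> {a..b} \<Longrightarrow> m \<le> \<psi>' t" and st: "a \<le> s" "s \<le> t" "t \<le> b"
  shows "m * (t - s) \<le> \<psi> t - \<psi> s"
proof -
  have "\<exists>x\<in>{s..t}. \<psi> t - \<psi> s = (\<lambda>h. h * \<psi>' x) (t - s)"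
  proof (rule mvt_very_simple[OF st(2)])
    fix x assume "s \<le> x" "x \<le> t"
    then have "(\<psi> has_real_derivative \<psi>' x) (at x within {s..t})"
      using psi_deriv[of x] st by (auto intro: has_field_derivative_subset)
    then show "(\<psi> has_derivative (\<lambda>h. h * \<psi>' x)) (at x within {s..t})"
      by (simp add: has_field_derivative_def mult_commute_abs)
  qed
  then obtain x where x: "x \<in> {s..t}" "\<psi> t - \<psi> s = (t - s) * \<psi>' x" by blast
  have "(t - s) * m \<le> (t - s) * \<psi>' x" using x st by (intro mult_left_mono m) auto
  then show ?thesis using x by (simp add: mult.commute)
qed

lemma psi_strict: assumes "a \<le> s" "s < t" "t \<le> b" shows "\<psi> s < \<psi> t"
proof -
  obtain m M where m: "m > 0" "\<And>t. t \<in> {a..b} \<Longrightarrow> m \<le> \<psi>' t" "\<And>t. t \<in> {a..b} \<Longrightarrow> \<psi>' t \<le> M"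
    using psi'_bounds by blast
  have "0 < m * (t - s)" using m assms by simp
  then show ?thesis using psi_diff_lower[OF m(2), of s t] assms by simp
qed

lemma psi_range: assumes "a \<le> s" "s \<le> t" "t \<le> b" shows "0 \<le> \<psi> t - \<psi> s" "\<psi> t - \<psi> s \<le> \<psi> b - \<psi> a"
  using mono_onD[OF psi_incr, of s t] mono_onD[OF psi_incr, of a s] mono_onD[OF psi_incr, of t b] assms by auto

text \<open>A regular family that represents \<open>P\<^sub>\<alpha>\<close>.\<close>

definition P :: "real \<Rightarrow> 'x \<Rightarrow>\<^sub>L 'x" where
  "P = (SOME P. regular_family P \<and> (\<forall>r x. 0 \<le> r \<longrightarrow> P_op T \<alpha> r x = P r x))"

lemma P: "regular_family P" "\<And>r x. 0 \<le> r \<Longrightarrow> P_op T \<alpha> r x = P r x"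
proof -
  have "\<exists>P. regular_family P \<and> (\<forall>r x. 0 \<le> r \<longrightarrow> P_op T \<alpha> r x = P r x)"
    using P_op_regular[OF \<alpha>] by metis
  from someI_ex[OF this] show "regular_family P" "\<And>r x. 0 \<le> r \<Longrightarrow> P_op T \<alpha> r x = P r x"
    unfolding P_def[symmetric] by blast+
qed

lemma P_cont_apply: "continuous_on {0..} (\<lambda>r. P r x)"
  and P_cont: "continuous_on {0<..} P"
  and P_compact: "r > 0 \<Longrightarrow> compact_operator (P r)"
  using P(1) unfolding regular_family_def by blast+

lemma P_bound:
  obtains CP where "CP \<ge> 0" "\<And>r. 0 \<le> r \<Longrightarrow> r \<le> \<psi> b - \<psi> a \<Longrightarrow> norm (P r) \<le> CP"
proof -
  obtain C where C: "\<And>r. 0 \<le> r \<Longrightarrow> r \<le> \<psi> b - \<psi> a \<Longrightarrow> norm (P r) \<le> C"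
    using P(1) unfolding regular_family_def by blast
  then show thesis using that[of "max C 0"] by (meson max.cobounded2 max.coboundedI1)
qed

lemma K_op_eq: "0 \<le> r \<Longrightarrow> K_op T \<alpha> r x = r powr (\<alpha> - 1) *\<^sub>R P r x"
  by (simp add: K_op_def P)

text \<open>The kernel of the mild solution formula, extended by \<open>0\<close> to \<open>s \<ge> t\<close>, so that all integrals can be
  taken over the whole interval.\<close>

definition k :: "real \<Rightarrow> real \<Rightarrow> 'y \<Rightarrow>\<^sub>L 'x" where
  "k t s = (if s < t then (\<psi>' s * (\<psi> t - \<psi> s) powr (\<alpha> - 1)) *\<^sub>R (P (\<psi> t - \<psi> s) o\<^sub>L B) else 0)"

lemma k_norm_bound: obtains C where "C \<ge> 0"
  "\<And>t s. a \<le> s \<Longrightarrow> s < t \<Longrightarrow> t \<le> b \<Longrightarrow> norm (k t s) \<le> C * (t - s) powr (\<alpha> - 1)"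
proof -
  obtain m M where m: "m > 0" "\<And>t. t \<in> {a..b} \<Longrightarrow> m \<le> \<psi>' t" "\<And>t. t \<in> {a..b} \<Longrightarrow> \<psi>' t \<le> M"
    using psi'_bounds by blast
  obtain CP where CP: "CP \<ge> 0" "\<And>r. 0 \<le> r \<Longrightarrow> r \<le> \<psi> b - \<psi> a \<Longrightarrow> norm (P r) \<le> CP"
    using P_bound by blast
  have M: "M \<ge> 0" using m(1) m(2)[of a] m(3)[of a] ab by auto
  show thesis
  proof (rule that[of "M * m powr (\<alpha> - 1) * (CP * norm B)"])
    show "0 \<le> M * m powr (\<alpha> - 1) * (CP * norm B)" using M CP by simp
    fix t s assume st: "a \<le> s" "s < t" "t \<le> b"
    have s: "s \<in> {a..b}" using st by auto
    have "m * (t - s) > 0" using m st by simp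
    then have "(\<psi> t - \<psi> s) powr (\<alpha> - 1) \<le> (m * (t - s)) powr (\<alpha> - 1)"
      using psi_diff_lower[OF m(2), of s t] st \<alpha> by (intro powr_mono2') auto
    also have "\<dots> = m powr (\<alpha> - 1) * (t - s) powr (\<alpha> - 1)" using m st by (simp add: powr_mult)
    finally have 1: "\<psi>' s * (\<psi> t - \<psi> s) powr (\<alpha> - 1) \<le> M * (m powr (\<alpha> - 1) * (t - s) powr (\<alpha> - 1))"
      using m(3)[OF s] M by (intro mult_mono) auto
    have 2: "norm (P (\<psi> t - \<psi> s) o\<^sub>L B) \<le> CP * norm B"
      using psi_range[of s t] st
      by (intro order_trans[OF norm_blinfun_compose] mult_right_mono CP) auto
    have "norm (k t s) = (\<psi>' s * (\<psi> t - \<psi> s) powr (\<alpha> - 1)) * norm (P (\<psi> t - \<psi> s) o\<^sub>L B)"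
      using st psi'_pos[OF s] by (simp add: k_def)
    also have "\<dots> \<le> (M * (m powr (\<alpha> - 1) * (t - s) powr (\<alpha> - 1))) * (CP * norm B)"
      by (rule mult_mono[OF 1 2]) (use M in auto)
    finally show "norm (k t s) \<le> M * m powr (\<alpha> - 1) * (CP * norm B) * (t - s) powr (\<alpha> - 1)"
      by (simp add: mult_ac)
  qed
qed

lemma k_singular_kernel:
  obtains C where "singular_kernel D a b (\<alpha> - 1) C k"
proof -
  obtain C where C: "C \<ge> 0" "\<And>t s. a \<le> s \<Longrightarrow> s < t \<Longrightarrow> t \<le> b \<Longrightarrow> norm (k t s) \<le> C * (t - s) powr (\<alpha> - 1)"
    using k_norm_bound by blast
  have "singular_kernel D a b (\<alpha> - 1) C k"
  proof unfold_locales
    show "norm (k t s) \<le> C * (t - s) powr (\<alpha> - 1)" if "a \<le> s" "s < t" "t \<le> b" for t s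
      using that by (rule C(2))
    let ?Z = "{z. a \<le> snd z \<and> snd z < fst z \<and> fst z \<le> b} :: (real \<times> real) set"
    have pf: "continuous_on ?Z (\<lambda>z. \<psi> (fst z))" "continuous_on ?Z (\<lambda>z. \<psi> (snd z))"
      "continuous_on ?Z (\<lambda>z. \<psi>' (snd z))"
      by (auto intro!: continuous_on_compose2[OF continuous_psi] continuous_on_compose2[OF psi_C1] continuous_intros)
    have pos: "0 < \<psi> (fst z) - \<psi> (snd z)" if "z \<in> ?Z" for z using that psi_strict[of "snd z" "fst z"] by auto
    have P': "continuous_on ?Z (\<lambda>z. P (\<psi> (fst z) - \<psi> (snd z)))"
      by (rule continuous_on_compose2[OF P_cont]) (use pos in \<open>auto intro!: continuous_intros pf\<close>)
    have "continuous_on ?Z (\<lambda>z. (\<psi>' (snd z) * (\<psi> (fst z) - \<psi> (snd z)) powr (\<alpha> - 1)) *\<^sub>R (P (\<psi> (fst z) - \<psi> (snd z)) o\<^sub>L B))"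
      using pos by (intro continuous_on_scaleR continuous_on_mult continuous_on_powr continuous_on_diff pf continuous_on_const
         bounded_bilinear.continuous_on[OF bounded_bilinear_blinfun_compose] P') fastforce
    then show "continuous_on ?Z (\<lambda>z. k (fst z) (snd z))"
      by (rule continuous_on_eq) (auto simp: k_def)
    show "compact_operator (k t s)" if st: "a \<le> s" "s < t" "t \<le> b" for t s
      unfolding compact_operator_def
    proof (intro allI impI)
      fix S :: "'y set" assume S: "bounded S"
      define c where "c = \<psi>' s * (\<psi> t - \<psi> s) powr (\<alpha> - 1)"
      have "bounded ((\<lambda>y. c *\<^sub>R B y) ` S)"
        by (intro bounded_linear_image[OF S] bounded_linear_intros)
      then have "compact (closure (P (\<psi> t - \<psi> s) ` ((\<lambda>y. c *\<^sub>R B y) ` S)))"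
        using P_compact[of "\<psi> t - \<psi> s"] psi_strict[OF st] unfolding compact_operator_def by auto
      moreover have "k t s ` S = P (\<psi> t - \<psi> s) ` ((\<lambda>y. c *\<^sub>R B y) ` S)"
        unfolding image_image using st
        by (intro image_cong) (auto simp: k_def c_def blinfun.scaleR_left blinfun.scaleR_right)
      ultimately show "compact (closure (k t s ` S))" by simp
    qed
  qed (use ab \<alpha> C in \<open>auto simp: k_def\<close>)
  then show thesis by (rule that)
qed

lemma mild_integral:
  assumes t: "t \<in> {a<..b}" and f: "abs_int MI (\<lambda>s. k t s (u s))"
  shows "bochner (lebesgue_on {a..t}) (\<lambda>s. \<psi>' s *\<^sub>R K_op T \<alpha> (\<psi> t - \<psi> s) (B (u s)))
       = bochner MI (\<lambda>s. k t s (u s))"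
proof -
  have int: "{a..b} \<inter> {a..t} = {a..t}" using t by auto
  have "{a..b} \<inter> {a..t} \<in> sets MI" unfolding sets_restrict_space by (rule imageI) simp
  then have at: "{a..t} \<in> sets MI" unfolding int .
  have \<Omega>: "{a..t} \<inter> space MI \<in> sets MI" using at by (rule sets.Int) simp
  have rs: "restrict_space MI {a..t} = lebesgue_on {a..t}"
    by (subst restrict_restrict_space) (simp_all only: int, simp_all)
  have m: "(\<lambda>s. k t s (u s)) \<in> borel_measurable (lebesgue_on {a..t})"
    unfolding rs[symmetric] by (rule measurable_restrict_space1) (use f in \<open>simp add: abs_int_def\<close>)
  have "integrable MI (\<lambda>s. indicator {a..t} s *\<^sub>R norm (k t s (u s)))"
    using f at by (intro integrable_mult_indicator) (simp_all add: abs_int_def)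
  then have "integrable (lebesgue_on {a..t}) (\<lambda>s. norm (k t s (u s)))"
    unfolding rs[symmetric] by (subst integrable_restrict_space[OF \<Omega>])
  then have ai: "abs_int (lebesgue_on {a..t}) (\<lambda>s. k t s (u s))" using m by (simp add: abs_int_def)
  have "has_bochner (restrict_space MI {a..t}) (\<lambda>s. k t s (u s)) (bochner (lebesgue_on {a..t}) (\<lambda>s. k t s (u s)))"
    unfolding rs by (rule has_bochner_bochner[OF ai])
  from has_bochner_restrict_space[OF \<Omega> this]
  have "has_bochner MI (\<lambda>s. indicator {a..t} s *\<^sub>R k t s (u s)) (bochner (lebesgue_on {a..t}) (\<lambda>s. k t s (u s)))" .
  from bochner_eqI[OF this]
  have "bochner (lebesgue_on {a..t}) (\<lambda>s. k t s (u s)) = bochner MI (\<lambda>s. indicator {a..t} s *\<^sub>R k t s (u s))" by simp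
  also have "\<dots> = bochner MI (\<lambda>s. k t s (u s))"
  proof (rule bochner_cong_AE[OF f, symmetric])
    show "(\<lambda>s. indicator {a..t} s *\<^sub>R k t s (u s)) \<in> borel_measurable MI"
      using m unfolding rs[symmetric] by (subst (asm) borel_measurable_restrict_space_iff[OF \<Omega>])
    show "AE s in MI. k t s (u s) = indicator {a..t} s *\<^sub>R k t s (u s)"
      by (rule AE_I2) (auto simp: indicator_def k_def)
  qed
  finally have 1: "bochner (lebesgue_on {a..t}) (\<lambda>s. k t s (u s)) = bochner MI (\<lambda>s. k t s (u s))" .
  have eq: "\<psi>' s *\<^sub>R K_op T \<alpha> (\<psi> t - \<psi> s) (B (u s)) = k t s (u s)" if "s \<in> {a..t}" for s
  proof (cases "s < t")
    case True
    then show ?thesis using that t psi_range(1)[of s t] by (simp add: K_op_eq k_def blinfun.scaleR_left)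
  next
    case False
    then have "s = t" using that by auto
    then show ?thesis by (simp add: k_def K_op_def)
  qed
  have "bochner (lebesgue_on {a..t}) (\<lambda>s. k t s (u s)) = bochner (lebesgue_on {a..t}) (\<lambda>s. \<psi>' s *\<^sub>R K_op T \<alpha> (\<psi> t - \<psi> s) (B (u s)))"
  proof (rule bochner_cong_AE[OF ai])
    show "(\<lambda>s. \<psi>' s *\<^sub>R K_op T \<alpha> (\<psi> t - \<psi> s) (B (u s))) \<in> borel_measurable (lebesgue_on {a..t})"
      using m by (rule measurable_cong[THEN iffD1, rotated]) (simp add: eq)
    show "AE s in lebesgue_on {a..t}. k t s (u s) = \<psi>' s *\<^sub>R K_op T \<alpha> (\<psi> t - \<psi> s) (B (u s))"
      by (rule AE_I2) (simp add: eq)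
  qed
  then show ?thesis using 1 by simp
qed

text \<open>In the variable \<open>\<rho> = s / r\<close> the integral defining \<open>r\<^sup>1\<^sup>-\<^sup>\<gamma> S r x0\<close> has the fixed Beta weight, so that
  it depends continuously on \<open>r\<close>, also at \<open>r = 0\<close>.\<close>

lemma S_op_regularized:
  obtains G where "continuous_on {0..\<psi> b - \<psi> a} G"
    "\<And>r. 0 < r \<Longrightarrow> r \<le> \<psi> b - \<psi> a \<Longrightarrow> S_op T \<alpha> \<beta> r x0 = r powr (\<gamma> - 1) *\<^sub>R G r"
proof (cases "\<gamma> = \<alpha>")
  case True
  have "continuous_on {0..\<psi> b - \<psi> a} (\<lambda>r. P r x0)" by (rule continuous_on_subset[OF P_cont_apply]) auto
  moreover have "S_op T \<alpha> \<beta> r x0 = r powr (\<gamma> - 1) *\<^sub>R P r x0" if "0 < r" for r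
    using True that unfolding S_op_def Let_def \<gamma>[symmetric] by (simp add: K_op_eq)
  ultimately show thesis using that by blast
next
  case False
  define \<mu> where "\<mu> = \<gamma> - \<alpha>"
  have "\<mu> \<ge> 0" unfolding \<mu>_def \<gamma> using \<alpha> \<beta> by simp
  then have \<mu>: "\<mu> > 0" using False by (simp add: \<mu>_def)
  let ?M = "lebesgue_on {0..1::real}"
  define w where "w = (\<lambda>\<rho>::real. \<rho> powr (\<alpha> - 1) * (1 - \<rho>) powr (\<mu> - 1))"
  define f where "f = (\<lambda>r \<rho>. w \<rho> *\<^sub>R P (r * \<rho>) x0)"
  have wi: "integrable ?M w"
  proof -
    have "set_integrable lborel {0..1} w" unfolding w_def by (rule integrable_Beta) (use \<alpha> \<mu> in auto)
    then have "set_integrable lebesgue {0..1} w"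
      unfolding set_integrable_def by (subst integrable_completion) (auto simp: w_def)
    then show ?thesis unfolding set_integrable_def by (subst integrable_restrict_space) auto
  qed
  have wm: "w \<in> borel_measurable ?M" using wi by auto
  have w0: "w \<rho> \<ge> 0" for \<rho> by (simp add: w_def)
  obtain CP where CP: "CP \<ge> 0" "\<And>r. 0 \<le> r \<Longrightarrow> r \<le> \<psi> b - \<psi> a \<Longrightarrow> norm (P r) \<le> CP"
    using P_bound by blast
  have fm: "f r \<in> borel_measurable ?M" if "0 \<le> r" for r
  proof -
    have "continuous_on {0..1} (\<lambda>\<rho>. P (r * \<rho>) x0)"
      by (rule continuous_on_compose2[OF P_cont_apply]) (use that in \<open>auto intro!: continuous_intros\<close>)
    then show ?thesis unfolding f_def
      by (intro measurable_scaleR wm continuous_imp_measurable_on_sets_lebesgue) auto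
  qed
  have fb: "norm (f r \<rho>) \<le> w \<rho> * (CP * norm x0)" if r: "0 \<le> r" "r \<le> \<psi> b - \<psi> a" and \<rho>: "\<rho> \<in> {0..1}" for r \<rho>
  proof -
    have "r * \<rho> \<le> r * 1" using r \<rho> by (intro mult_left_mono) auto
    then have "norm (P (r * \<rho>) x0) \<le> CP * norm x0"
      using r \<rho> by (intro order_trans[OF norm_blinfun] mult_right_mono CP) auto
    then show ?thesis unfolding f_def using w0 by (simp add: mult_left_mono)
  qed
  have wi': "integrable ?M (\<lambda>\<rho>. w \<rho> * (CP * norm x0))" using wi by simp
  have fi: "abs_int ?M (f r)" if "0 \<le> r" "r \<le> \<psi> b - \<psi> a" for r
    by (rule abs_int_bound[OF fm wi']) (use that fb in auto)
  define H where "H = (\<lambda>r. bochner ?M (f r))"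
  have "continuous_on {0..\<psi> b - \<psi> a} H"
    unfolding continuous_on_sequentially
  proof (intro allI ballI impI, elim conjE)
    fix X r assume r: "r \<in> {0..\<psi> b - \<psi> a}" and X: "\<forall>n. X n \<in> {0..\<psi> b - \<psi> a}" and lim: "X \<longlonglongrightarrow> r"
    have "(\<lambda>n. bochner ?M (f (X n))) \<longlonglongrightarrow> bochner ?M (f r)"
    proof (rule bochner_dominated_convergence[OF _ _ wi'])
      show "f (X n) \<in> borel_measurable ?M" for n using X by (intro fm) auto
      show "f r \<in> borel_measurable ?M" using r by (intro fm) auto
      show "AE \<rho> in ?M. norm (f (X n) \<rho>) \<le> w \<rho> * (CP * norm x0)" for n
        by (rule AE_I2, rule fb) (use X in auto)
      show "AE \<rho> in ?M. (\<lambda>n. f (X n) \<rho>) \<longlonglongrightarrow> f r \<rho>"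
      proof (rule AE_I2)
        fix \<rho> assume "\<rho> \<in> space ?M"
        then have \<rho>: "0 \<le> \<rho>" by simp
        have "(\<lambda>n. X n * \<rho>) \<longlonglongrightarrow> r * \<rho>" by (intro tendsto_intros lim)
        then have "(\<lambda>n. P (X n * \<rho>) x0) \<longlonglongrightarrow> P (r * \<rho>) x0"
          by (rule continuous_on_tendsto_compose[OF P_cont_apply]) (use X r \<rho> in auto)
        then show "(\<lambda>n. f (X n) \<rho>) \<longlonglongrightarrow> f r \<rho>" unfolding f_def by (intro tendsto_scaleR tendsto_const)
      qed
    qed
    then show "(H \<circ> X) \<longlonglongrightarrow> H r" by (simp add: H_def o_def)
  qed
  then have cont: "continuous_on {0..\<psi> b - \<psi> a} (\<lambda>r. (1 / Gamma \<mu>) *\<^sub>R H r)" by (intro continuous_intros)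
  show thesis
  proof (rule that[OF cont])
    fix r assume r: "0 < r" "r \<le> \<psi> b - \<psi> a"
    have "has_bochner (lebesgue_on {0..r}) (\<lambda>s. f r (s / r)) (r *\<^sub>R H r)"
      unfolding H_def using r by (intro has_bochner_scale_interval has_bochner_bochner fi) auto
    from has_bochner_linear[OF bounded_linear_scaleR_right this, of "r powr (\<gamma> - 2)"]
    have h: "has_bochner (lebesgue_on {0..r}) (\<lambda>s. r powr (\<gamma> - 2) *\<^sub>R f r (s / r)) (r powr (\<gamma> - 2) *\<^sub>R r *\<^sub>R H r)" .
    have eq: "(r - s) powr (\<mu> - 1) *\<^sub>R K_op T \<alpha> s x0 = r powr (\<gamma> - 2) *\<^sub>R f r (s / r)" if s: "s \<in> {0..r}" for s
    proof -
      have "r * (1 - s / r) = r - s" using r by (simp add: right_diff_distrib)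
      then have "(r - s) powr (\<mu> - 1) = (r * (1 - s / r)) powr (\<mu> - 1)" by simp
      also have "\<dots> = r powr (\<mu> - 1) * (1 - s / r) powr (\<mu> - 1)"
        by (rule powr_mult)
      finally have 1: "(r - s) powr (\<mu> - 1) = r powr (\<mu> - 1) * (1 - s / r) powr (\<mu> - 1)" .
      have "s powr (\<alpha> - 1) = (r * (s / r)) powr (\<alpha> - 1)" using r by simp
      also have "\<dots> = r powr (\<alpha> - 1) * (s / r) powr (\<alpha> - 1)" by (rule powr_mult)
      finally have 2: "s powr (\<alpha> - 1) = r powr (\<alpha> - 1) * (s / r) powr (\<alpha> - 1)" .
      have 3: "r powr (\<mu> - 1) * r powr (\<alpha> - 1) = r powr (\<gamma> - 2)"
        unfolding powr_add[symmetric] by (simp add: \<mu>_def)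
      have "(r - s) powr (\<mu> - 1) *\<^sub>R K_op T \<alpha> s x0 = ((r powr (\<mu> - 1) * r powr (\<alpha> - 1)) * w (s / r)) *\<^sub>R P s x0"
        using s by (simp add: K_op_eq 1 2 w_def mult_ac)
      then show ?thesis unfolding 3 f_def using r by simp
    qed
    have "has_bochner (lebesgue_on {0..r}) (\<lambda>s. (r - s) powr (\<mu> - 1) *\<^sub>R K_op T \<alpha> s x0) (r powr (\<gamma> - 2) *\<^sub>R r *\<^sub>R H r)"
      by (rule has_bochner_cong[OF h]) (use eq in simp)
    then have "bochner (lebesgue_on {0..r}) (\<lambda>s. (r - s) powr (\<mu> - 1) *\<^sub>R K_op T \<alpha> s x0) = (r powr (\<gamma> - 2) * r) *\<^sub>R H r"
      using bochner_eqI by fastforce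
    also have "r powr (\<gamma> - 2) * r = r powr (\<gamma> - 1)"
      using r powr_add[of r "\<gamma> - 2" 1] by simp
    finally show "S_op T \<alpha> \<beta> r x0 = r powr (\<gamma> - 1) *\<^sub>R (1 / Gamma \<mu>) *\<^sub>R H r"
      unfolding S_op_def Let_def \<gamma>[symmetric] \<mu>_def[symmetric] using False by simp
  qed
qed

definition s0 :: "real \<Rightarrow> 'x" where "s0 t = S_op T \<alpha> \<beta> (\<psi> t - \<psi> a) x0"

definition w :: "real \<Rightarrow> real" where "w t = (\<psi> t - \<psi> a) powr (1 - \<gamma>)"

lemma s0_regularized:
  obtains g where "continuous_on {a..b} g" "\<And>t. t \<in> {a<..b} \<Longrightarrow> g t = w t *\<^sub>R s0 t"
proof -
  obtain G where G: "continuous_on {0..\<psi> b - \<psi> a} G"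
    "\<And>r. 0 < r \<Longrightarrow> r \<le> \<psi> b - \<psi> a \<Longrightarrow> S_op T \<alpha> \<beta> r x0 = r powr (\<gamma> - 1) *\<^sub>R G r"
    using S_op_regularized by blast
  show thesis
  proof (rule that[of "\<lambda>t. G (\<psi> t - \<psi> a)"])
    show "continuous_on {a..b} (\<lambda>t. G (\<psi> t - \<psi> a))"
      by (rule continuous_on_compose2[OF G(1)]) (use psi_range in \<open>auto intro!: continuous_intros continuous_psi\<close>)
    fix t assume t: "t \<in> {a<..b}"
    then have p: "0 < \<psi> t - \<psi> a" "\<psi> t - \<psi> a \<le> \<psi> b - \<psi> a"
      using psi_strict[of a t] psi_range(2)[of a t] by auto
    have "(\<psi> t - \<psi> a) powr (1 - \<gamma>) * (\<psi> t - \<psi> a) powr (\<gamma> - 1) = 1"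
      unfolding powr_add[symmetric] using p by simp
    then show "G (\<psi> t - \<psi> a) = w t *\<^sub>R s0 t" unfolding s0_def w_def G(2)[OF p] by simp
  qed
qed

lemma w_pos: "t \<in> {a<..b} \<Longrightarrow> w t > 0"
  using psi_strict[of a t] by (auto simp: w_def)

lemma w_continuous: "continuous_on {a<..b} w"
  unfolding w_def using psi_strict[of a]
  by (intro continuous_intros continuous_on_subset[OF continuous_psi]) force+

lemma s0_continuous: "continuous_on {a<..b} s0"
proof -
  obtain g where g: "continuous_on {a..b} g" "\<And>t. t \<in> {a<..b} \<Longrightarrow> g t = w t *\<^sub>R s0 t"
    using s0_regularized by blast
  have "continuous_on {a<..b} (\<lambda>t. (1 / w t) *\<^sub>R g t)"
    using w_pos by (intro continuous_intros w_continuous continuous_on_subset[OF g(1)]) force+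
  then show ?thesis by (rule continuous_on_eq) (use g(2) w_pos in force)
qed

lemma w_bounded: obtains Cw where "Cw \<ge> 0" "\<And>t. t \<in> {a..b} \<Longrightarrow> w t \<le> Cw"
proof (rule that[of "(\<psi> b - \<psi> a) powr (1 - \<gamma>)"])
  show "w t \<le> (\<psi> b - \<psi> a) powr (1 - \<gamma>)" if "t \<in> {a..b}" for t
    unfolding w_def using that psi_range[of a t] gamma_le_1 by (intro powr_mono2) auto
qed simp

lemma w_s0_bounded: obtains C where "C \<ge> 0" "\<And>t. t \<in> {a<..b} \<Longrightarrow> w t * norm (s0 t) \<le> C"
proof -
  obtain g where g: "continuous_on {a..b} g" "\<And>t. t \<in> {a<..b} \<Longrightarrow> g t = w t *\<^sub>R s0 t"
    using s0_regularized by blast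
  have "bounded (g ` {a..b})" by (intro compact_imp_bounded compact_continuous_image g) auto
  then obtain C where C: "\<And>t. t \<in> {a..b} \<Longrightarrow> norm (g t) \<le> C" unfolding bounded_iff by (metis imageI)
  have "w t * norm (s0 t) \<le> max C 0" if t: "t \<in> {a<..b}" for t
  proof -
    have "w t * norm (s0 t) = norm (g t)" using g(2)[OF t] w_pos[OF t] by simp
    then show ?thesis using C[of t] t by simp
  qed
  then show thesis using that[of "max C 0"] by auto
qed

text \<open>For \<open>\<gamma> = 1\<close> the weight is \<open>1\<close> on \<open>(a, b]\<close> but, by the convention \<open>0 powr 0 = 0\<close>, it is \<open>0\<close> at
  \<open>t = a\<close>; the condition \<open>r a = 0\<close> makes \<open>w t *\<^sub>R r t\<close> continuous in this case as well.\<close>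

lemma s0_plus_C_weighted:
  assumes r: "continuous_on {a..b} r" and r0: "r a = 0"
  shows "(\<lambda>t. s0 t + r t) \<in> C_weighted a b \<psi> \<gamma>"
proof -
  obtain g where g: "continuous_on {a..b} g" "\<And>t. t \<in> {a<..b} \<Longrightarrow> g t = w t *\<^sub>R s0 t"
    using s0_regularized by blast
  have "continuous_on {a..b} (\<lambda>t. w t *\<^sub>R r t)"
  proof (cases "\<gamma> = 1")
    case True
    have "r t = w t *\<^sub>R r t" if "t \<in> {a..b}" for t
      unfolding w_def using that r0 psi_strict[of a t] True by (cases "t = a") auto
    with r show ?thesis by (rule continuous_on_eq)
  next
    case False
    then have "\<gamma> < 1" using gamma_le_1 by simp
    then have "continuous_on {a..b} w" unfolding w_def
      using psi_range[of a] by (intro continuous_on_powr' continuous_intros continuous_psi) auto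
    then show ?thesis by (intro continuous_intros r)
  qed
  then have c: "continuous_on {a..b} (\<lambda>t. g t + w t *\<^sub>R r t)" by (rule continuous_on_add[OF g(1)])
  have "g t + w t *\<^sub>R r t = (\<psi> t - \<psi> a) powr (1 - \<gamma>) *\<^sub>R (s0 t + r t)" if "t \<in> {a<..b}" for t
    using g(2)[OF that] by (simp add: w_def scaleR_add_right)
  moreover have "continuous_on {a<..b} (\<lambda>t. s0 t + r t)"
    by (intro continuous_intros s0_continuous continuous_on_subset[OF r]) auto
  ultimately show ?thesis unfolding C_weighted_def using c by blast
qed

end

section \<open>Convexity in Hilbert spaces: selections and convex combinations\<close>

lemma parallelogram_midpoint:
  fixes x y :: "'y::real_inner"
  shows "(norm (x - y))\<^sup>2 = 2 * (norm x)\<^sup>2 + 2 * (norm y)\<^sup>2 - 4 * (norm ((1 / 2) *\<^sub>R (x + y)))\<^sup>2"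
  unfolding power2_norm_eq_inner by (simp add: inner_simps inner_commute algebra_simps)

text \<open>A minimizing sequence is a Cauchy sequence by the parallelogram law.\<close>

lemma min_norm_ex1:
  fixes V :: "'y::{real_inner, banach} set"
  assumes V: "closed V" "convex V" "V \<noteq> {}"
  shows "\<exists>!y. y \<in> V \<and> (\<forall>z\<in>V. norm y \<le> norm z)"
proof (rule ex_ex1I)
  define d where "d = Inf (norm ` V)"
  have bd: "bdd_below (norm ` V)" by (intro bdd_belowI[of _ 0]) auto
  have d: "d \<le> norm z" if "z \<in> V" for z unfolding d_def using that bd by (intro cInf_lower) auto
  have d0: "0 \<le> d" unfolding d_def using V(3) by (intro cInf_greatest) auto
  have "\<exists>y\<in>V. norm y < d + 1 / real (Suc n)" for n
    using cInf_lessD[of "norm ` V" "d + 1 / real (Suc n)"] V(3) by (auto simp: d_def)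
  then obtain y where y: "\<And>n. y n \<in> V" "\<And>n. norm (y n) < d + 1 / real (Suc n)" by metis
  define \<delta> where "\<delta> = (\<lambda>n. (d + 1 / real (Suc n))\<^sup>2 - d\<^sup>2)"
  have \<delta>: "\<delta> \<longlonglongrightarrow> 0"
  proof -
    have "\<delta> \<longlonglongrightarrow> (d + 0)\<^sup>2 - d\<^sup>2" unfolding \<delta>_def by (intro tendsto_intros LIMSEQ_Suc[OF lim_1_over_n])
    then show ?thesis by simp
  qed
  have dist2: "(norm (y m - y n))\<^sup>2 \<le> 2 * \<delta> m + 2 * \<delta> n" for m n
  proof -
    have "(1 / 2) *\<^sub>R (y m + y n) \<in> V"
      using convexD[OF V(2) y(1)[of m] y(1)[of n], of "1/2" "1/2"] by (simp add: scaleR_add_right)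
    then have "d\<^sup>2 \<le> (norm ((1 / 2) *\<^sub>R (y m + y n)))\<^sup>2" using d0 by (intro power_mono d)
    moreover have "(norm (y m))\<^sup>2 \<le> (d + 1 / real (Suc m))\<^sup>2" "(norm (y n))\<^sup>2 \<le> (d + 1 / real (Suc n))\<^sup>2"
      by (intro power_mono less_imp_le[OF y(2)] norm_ge_zero)+
    moreover have "2 * A + 2 * A' - 4 * N \<le> 2 * (P - D) + 2 * (P' - D)" if "D \<le> N" "A \<le> P" "A' \<le> P'"
      for A A' N P P' D :: real using that by (simp add: algebra_simps)
    ultimately show ?thesis unfolding parallelogram_midpoint[of "y m"] \<delta>_def by blast
  qed
  have "Cauchy y"
  proof (rule CauchyI)
    fix e :: real assume e: "e > 0"
    then have "\<forall>\<^sub>F n in sequentially. \<delta> n < e\<^sup>2 / 4" using \<delta> by (intro order_tendstoD) auto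
    then obtain N where N: "\<And>n. n \<ge> N \<Longrightarrow> \<delta> n < e\<^sup>2 / 4" by (auto simp: eventually_sequentially)
    have "norm (y m - y n) < e" if "m \<ge> N" "n \<ge> N" for m n
    proof -
      have "(norm (y m - y n))\<^sup>2 < e\<^sup>2" using dist2[of m n] N[OF that(1)] N[OF that(2)] by linarith
      then show ?thesis using e by (simp add: power_less_imp_less_base)
    qed
    then show "\<exists>N. \<forall>m\<ge>N. \<forall>n\<ge>N. norm (y m - y n) < e" by blast
  qed
  then obtain l where l: "y \<longlonglongrightarrow> l" using Cauchy_convergent convergent_def by blast
  have "l \<in> V" using closed_sequentially[OF V(1) y(1) l] .
  moreover have "norm l \<le> d"
  proof (rule LIMSEQ_le[OF tendsto_norm[OF l]])
    show "(\<lambda>n. d + 1 / real (Suc n)) \<longlonglongrightarrow> d"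
      using tendsto_add[OF tendsto_const LIMSEQ_Suc[OF lim_1_over_n], of d] by simp
  qed (use y(2) less_imp_le in blast)
  ultimately show "\<exists>y. y \<in> V \<and> (\<forall>z\<in>V. norm y \<le> norm z)" using d order_trans by blast
next
  fix y z assume yz: "y \<in> V \<and> (\<forall>z\<in>V. norm y \<le> norm z)" "z \<in> V \<and> (\<forall>x\<in>V. norm z \<le> norm x)"
  then have eq: "norm y = norm z" by (meson order_antisym)
  have "(1 / 2) *\<^sub>R (y + z) \<in> V"
    using convexD[OF V(2), of y z "1/2" "1/2"] yz by (simp add: scaleR_add_right)
  then have "(norm y)\<^sup>2 \<le> (norm ((1 / 2) *\<^sub>R (y + z)))\<^sup>2" using yz by (intro power_mono) auto
  then have "(norm (y - z))\<^sup>2 \<le> 0" unfolding parallelogram_midpoint[of y z] eq by linarith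
  then show "y = z" by simp
qed

definition min_norm :: "'y::{real_inner, banach} set \<Rightarrow> 'y" where
  "min_norm V = (THE y. y \<in> V \<and> (\<forall>z\<in>V. norm y \<le> norm z))"

lemma min_norm:
  assumes "closed V" "convex V" "V \<noteq> {}"
  shows "min_norm V \<in> V" "z \<in> V \<Longrightarrow> norm (min_norm V) \<le> norm z"
  using theI'[OF min_norm_ex1[OF assms]] unfolding min_norm_def[symmetric] by blast+

lemma min_norm_unique:
  assumes V: "closed V" "convex V" "V \<noteq> {}" and z: "z \<in> V" "norm z \<le> norm (min_norm V)"
  shows "z = min_norm V"
proof -
  have "z \<in> V \<and> (\<forall>x\<in>V. norm z \<le> norm x)" using z min_norm(2)[OF V] order_trans by blast
  moreover have "min_norm V \<in> V \<and> (\<forall>x\<in>V. norm (min_norm V) \<le> norm x)" using min_norm[OF V] by blast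
  ultimately show ?thesis using min_norm_ex1[OF V] by blast
qed

text \<open>The element of minimal norm is a measurable selection: it lies in a closed ball \<open>C\<close> if and only if
  \<open>V x\<close> meets \<open>C \<inter> cball 0 q\<close> for every rational \<open>q\<close> above the minimal norm.\<close>

lemma measurable_min_norm:
  fixes V :: "'a \<Rightarrow> 'y::{real_inner, banach, second_countable_topology} set"
  assumes V: "\<And>x. x \<in> space M \<Longrightarrow> closed (V x) \<and> convex (V x) \<and> V x \<noteq> {}"
    and meas: "\<And>C. closed C \<Longrightarrow> {x \<in> space M. V x \<inter> C \<noteq> {}} \<in> sets M"
  shows "(\<lambda>x. min_norm (V x)) \<in> borel_measurable M"
proof -
  let ?f = "\<lambda>x. min_norm (V x)"
  have \<mu>: "(\<lambda>x. norm (?f x)) \<in> borel_measurable M"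
  proof (subst borel_measurable_iff_le, intro allI)
    fix c
    have "{x \<in> space M. norm (?f x) \<le> c} = {x \<in> space M. V x \<inter> cball 0 c \<noteq> {}}"
    proof (intro Collect_cong conj_cong refl iffI)
      fix x assume x: "x \<in> space M"
      note Vx = V[OF x, THEN conjunct1] V[OF x, THEN conjunct2, THEN conjunct1] V[OF x, THEN conjunct2, THEN conjunct2]
      show "V x \<inter> cball 0 c \<noteq> {}" if "norm (?f x) \<le> c" using that min_norm(1)[OF Vx] by auto
      show "norm (?f x) \<le> c" if "V x \<inter> cball 0 c \<noteq> {}"
        using that min_norm(2)[OF Vx] by (force intro: order_trans)
    qed
    then show "{w \<in> space M. norm (?f w) \<le> c} \<in> sets M" using meas[of "cball 0 c"] by simp
  qed
  have ball: "{x \<in> space M. ?f x \<in> cball d r} \<in> sets M" for d r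
  proof -
    have eq: "{x \<in> space M. ?f x \<in> cball d r} =
       (\<Inter>q\<in>\<rat>. {x \<in> space M. q \<le> norm (?f x)} \<union> {x \<in> space M. V x \<inter> (cball d r \<inter> cball 0 q) \<noteq> {}})" (is "?L = ?R")
    proof (intro equalityI subsetI)
      fix x assume "x \<in> ?L"
      then have x: "x \<in> space M" "?f x \<in> cball d r" by auto
      note Vx = V[OF x(1), THEN conjunct1] V[OF x(1), THEN conjunct2, THEN conjunct1] V[OF x(1), THEN conjunct2, THEN conjunct2]
      have "q \<le> norm (?f x) \<or> V x \<inter> (cball d r \<inter> cball 0 q) \<noteq> {}" for q
      proof (cases "q \<le> norm (?f x)")
        case False
        then have "?f x \<in> V x \<inter> (cball d r \<inter> cball 0 q)" using x(2) min_norm(1)[OF Vx] by auto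
        then show ?thesis by blast
      qed simp
      then show "x \<in> ?R" using x(1) by blast
    next
      fix x assume xR: "x \<in> ?R"
      then have x: "x \<in> space M" by (auto intro: Rats_0)
      note Vx = V[OF x, THEN conjunct1] V[OF x, THEN conjunct2, THEN conjunct1] V[OF x, THEN conjunct2, THEN conjunct2]
      have ne: "V x \<inter> (cball d r \<inter> cball 0 q) \<noteq> {}" if "q \<in> \<rat>" "norm (?f x) < q" for q
        using xR that by force
      let ?W = "V x \<inter> cball d r"
      obtain q0 where "q0 \<in> \<rat>" "norm (?f x) < q0" using Rats_dense_in_real[of "norm (?f x)" "norm (?f x) + 1"] by auto
      then have W: "closed ?W" "convex ?W" "?W \<noteq> {}" using ne[of q0] Vx by (auto intro: closed_Int convex_Int)
      have "norm (min_norm ?W) \<le> norm (?f x)"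
      proof (rule ccontr)
        assume "\<not> norm (min_norm ?W) \<le> norm (?f x)"
        then obtain q where q: "q \<in> \<rat>" "norm (?f x) < q" "q < norm (min_norm ?W)"
          using Rats_dense_in_real[of "norm (?f x)" "norm (min_norm ?W)"] by auto
        obtain z where z: "z \<in> V x \<inter> (cball d r \<inter> cball 0 q)" using ne[OF q(1,2)] by blast
        then have "z \<in> ?W" by blast
        then have "norm (min_norm ?W) \<le> norm z" by (rule min_norm(2)[OF W])
        moreover have "norm z \<le> q" using z by simp
        ultimately show False using q(3) by linarith
      qed
      then have "min_norm ?W = ?f x" using min_norm(1)[OF W] by (intro min_norm_unique[OF Vx]) auto
      then show "x \<in> ?L" using min_norm(1)[OF W] x by simp
    qed
    have 1: "{x \<in> space M. q \<le> norm (?f x)} \<in> sets M" for q using \<mu> by measurable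
    have "{x \<in> space M. q \<le> norm (?f x)} \<union> {x \<in> space M. V x \<inter> (cball d r \<inter> cball 0 q) \<noteq> {}} \<in> sets M" for q
      by (rule sets.Un[OF 1 meas]) (simp add: closed_Int)
    then have "?R \<in> sets M"
      by (intro sets.countable_INT') (use countable_rat Rats_0 in blast)+
    then show ?thesis unfolding eq .
  qed
  obtain D :: "'y set" where D: "countable D" "\<And>X. open X \<Longrightarrow> X \<noteq> {} \<Longrightarrow> \<exists>d\<in>D. d \<in> X"
    using countable_dense_exists[where 'a = 'y] by auto
  show ?thesis
  proof (rule borel_measurableI)
    fix W :: "'y set" assume W: "open W"
    let ?I = "{(d, n :: nat). d \<in> D \<and> cball d (1 / real (Suc n)) \<subseteq> W}"
    have eq: "W = (\<Union>(d, n)\<in>?I. cball d (1 / real (Suc n)))"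
    proof (intro equalityI subsetI)
      fix z assume "z \<in> W"
      then obtain e where e: "e > 0" "ball z e \<subseteq> W" using W open_contains_ball by blast
      obtain n where n: "1 / real (Suc n) < e / 2" using nat_approx_posE[of "e / 2"] e by auto
      obtain d where d: "d \<in> D" "d \<in> ball z (1 / real (Suc n))" using D(2)[of "ball z (1 / real (Suc n))"] by auto
      have "cball d (1 / real (Suc n)) \<subseteq> W"
      proof
        fix y assume "y \<in> cball d (1 / real (Suc n))"
        then have "dist z y < e" using d(2) n dist_triangle[of z y d] by (simp add: dist_commute)
        then show "y \<in> W" using e(2) by auto
      qed
      moreover have "z \<in> cball d (1 / real (Suc n))" using d(2) by (simp add: dist_commute less_imp_le)
      ultimately show "z \<in> (\<Union>(d, n)\<in>?I. cball d (1 / real (Suc n)))" using d(1) by blast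
    qed auto
    have "?f -` (\<Union>(d, n)\<in>?I. cball d (1 / real (Suc n))) \<inter> space M =
        (\<Union>z\<in>?I. {x \<in> space M. ?f x \<in> cball (fst z) (1 / real (Suc (snd z)))})"
      unfolding case_prod_beta vimage_UN by blast
    also have "\<dots> \<in> sets M"
    proof (rule sets.countable_UN')
      show "countable ?I" by (rule countable_subset[of _ "D \<times> UNIV"]) (use D(1) in auto)
      show "(\<lambda>z. {x \<in> space M. ?f x \<in> cball (fst z) (1 / real (Suc (snd z)))}) ` ?I \<subseteq> sets M"
        using ball by blast
    qed
    finally show "?f -` W \<inter> space M \<in> sets M" unfolding eq[symmetric] .
  qed
qed

text \<open>Weights of convex combinations of the terms with index at least \<open>n\<close>.\<close>

definition tail_weights :: "nat \<Rightarrow> (nat \<Rightarrow> real) set" where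
  "tail_weights n = {c. (\<forall>k. 0 \<le> c k) \<and> (\<exists>N. (\<forall>k. k \<notin> {n..<N} \<longrightarrow> c k = 0) \<and> (\<Sum>k\<in>{n..<N}. c k) = 1)}"

definition comb :: "(nat \<Rightarrow> 'a \<Rightarrow> 'y::real_vector) \<Rightarrow> (nat \<Rightarrow> real) \<Rightarrow> 'a \<Rightarrow> 'y" where
  "comb u c t = (\<Sum>k\<in>{k. c k \<noteq> 0}. c k *\<^sub>R u k t)"

lemma comb_eq: "(\<And>k. k \<notin> I \<Longrightarrow> c k = 0) \<Longrightarrow> finite I \<Longrightarrow> comb u c t = (\<Sum>k\<in>I. c k *\<^sub>R u k t)"
  unfolding comb_def by (rule sum.mono_neutral_left) auto

lemma tail_weightsE:
  assumes "c \<in> tail_weights n"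
  obtains N where "\<And>k. 0 \<le> c k" "\<And>k. k \<notin> {n..<N} \<Longrightarrow> c k = 0" "(\<Sum>k\<in>{n..<N}. c k) = 1"
    "\<And>u t. comb u c t = (\<Sum>k\<in>{n..<N}. c k *\<^sub>R u k t)"
  using assms unfolding tail_weights_def
proof (elim CollectE conjE exE)
  fix N assume h: "\<forall>k. 0 \<le> c k" "\<forall>k. k \<notin> {n..<N} \<longrightarrow> c k = 0" "(\<Sum>k\<in>{n..<N}. c k) = 1"
  show thesis by (rule that[of N]) (use h in \<open>auto intro!: comb_eq\<close>)
qed

lemma tail_weights_mono: "m \<le> n \<Longrightarrow> tail_weights n \<subseteq> tail_weights m"
proof
  fix c assume mn: "m \<le> n" and "c \<in> tail_weights n"
  then obtain N where N: "\<forall>k. 0 \<le> c k" "\<forall>k. k \<notin> {n..<N} \<longrightarrow> c k = 0" "(\<Sum>k\<in>{n..<N}. c k) = 1"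
    unfolding tail_weights_def by blast
  have "(\<Sum>k\<in>{m..<N}. c k) = (\<Sum>k\<in>{n..<N}. c k)"
    by (rule sum.mono_neutral_right) (use N mn in auto)
  then show "c \<in> tail_weights m" unfolding tail_weights_def using N mn by (auto intro!: exI[of _ N])
qed

lemma tail_weights_unit: "(\<lambda>k. if k = n then 1 else 0) \<in> tail_weights n"
  unfolding tail_weights_def by (auto intro!: exI[of _ "Suc n"])

lemma tail_weights_midpoint:
  assumes "c \<in> tail_weights n" "d \<in> tail_weights n"
  shows "(\<lambda>k. (c k + d k) / 2) \<in> tail_weights n"
    "comb u (\<lambda>k. (c k + d k) / 2) t = (1 / 2) *\<^sub>R (comb u c t + comb u d t)"
proof -
  obtain N where N: "\<forall>k. 0 \<le> c k" "\<forall>k. k \<notin> {n..<N} \<longrightarrow> c k = 0" "(\<Sum>k\<in>{n..<N}. c k) = 1"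
    using assms(1) unfolding tail_weights_def by blast
  obtain N' where N': "\<forall>k. 0 \<le> d k" "\<forall>k. k \<notin> {n..<N'} \<longrightarrow> d k = 0" "(\<Sum>k\<in>{n..<N'}. d k) = 1"
    using assms(2) unfolding tail_weights_def by blast
  define L where "L = max N N'"
  have c: "(\<Sum>k\<in>{n..<L}. c k) = 1" using N(3)
    by (subst sum.mono_neutral_right[of "{n..<L}" "{n..<N}"]) (use N in \<open>auto simp: L_def\<close>)
  have d: "(\<Sum>k\<in>{n..<L}. d k) = 1" using N'(3)
    by (subst sum.mono_neutral_right[of "{n..<L}" "{n..<N'}"]) (use N' in \<open>auto simp: L_def\<close>)
  have z: "c k = 0" "d k = 0" if "k \<notin> {n..<L}" for k
  proof -
    have "k \<notin> {n..<N}" "k \<notin> {n..<N'}" using that by (auto simp: L_def)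
    then show "c k = 0" "d k = 0" using N(2) N'(2) by blast+
  qed
  have "(\<Sum>k\<in>{n..<L}. (c k + d k) / 2) = 1"
    unfolding sum_divide_distrib[symmetric] sum.distrib c d by simp
  then show "(\<lambda>k. (c k + d k) / 2) \<in> tail_weights n"
    unfolding tail_weights_def using N(1) N'(1) z by (auto intro!: exI[of _ L] simp: add_nonneg_nonneg)
  have "comb u (\<lambda>k. (c k + d k) / 2) t = (\<Sum>k\<in>{n..<L}. ((c k + d k) / 2) *\<^sub>R u k t)"
    by (rule comb_eq) (use z in auto)
  also have "\<dots> = (1 / 2) *\<^sub>R ((\<Sum>k\<in>{n..<L}. c k *\<^sub>R u k t) + (\<Sum>k\<in>{n..<L}. d k *\<^sub>R u k t))"
    unfolding sum.distrib[symmetric] scaleR_sum_right by (intro sum.cong) (auto simp: scaleR_add_left[symmetric])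
  also have "\<dots> = (1 / 2) *\<^sub>R (comb u c t + comb u d t)"
    by (subst (1 2) comb_eq[symmetric, of "{n..<L}"]) (use z in auto)
  finally show "comb u (\<lambda>k. (c k + d k) / 2) t = (1 / 2) *\<^sub>R (comb u c t + comb u d t)" .
qed

lemma norm_comb_le:
  fixes u :: "nat \<Rightarrow> 'a \<Rightarrow> 'y::real_normed_vector"
  assumes c: "c \<in> tail_weights n" and b: "\<And>k. n \<le> k \<Longrightarrow> norm (u k t) \<le> B"
  shows "norm (comb u c t) \<le> B"
proof -
  obtain N where N: "\<And>k. 0 \<le> c k" "(\<Sum>k\<in>{n..<N}. c k) = 1"
    "comb u c t = (\<Sum>k\<in>{n..<N}. c k *\<^sub>R u k t)"
    using tail_weightsE[OF c] by metis
  have "norm (comb u c t) \<le> (\<Sum>k\<in>{n..<N}. c k * norm (u k t))"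
    unfolding N(3) by (rule order_trans[OF norm_sum]) (use N(1) in simp)
  also have "\<dots> \<le> (\<Sum>k\<in>{n..<N}. c k * B)" by (intro sum_mono mult_left_mono b N) auto
  also have "\<dots> = B" using N(2) by (simp add: sum_distrib_right[symmetric])
  finally show ?thesis .
qed

text \<open>Mazur's lemma for a dominated sequence, without weak convergence: convex combinations of the
  \<open>n\<close>-th tail whose \<open>L\<^sup>2\<close> norm is almost minimal form a Cauchy sequence, by the parallelogram law.\<close>

lemma Mazur_dominated:
  fixes u :: "nat \<Rightarrow> real \<Rightarrow> 'y::{real_inner, banach, second_countable_topology}"
  assumes g: "g \<in> L2 a b"
    and um: "\<And>n. u n \<in> borel_measurable (lebesgue_on {a..b})"
    and ub: "\<And>n. AE t in lebesgue_on {a..b}. norm (u n t) \<le> g t"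
  obtains c v where "\<And>n. c n \<in> tail_weights n" "v \<in> borel_measurable (lebesgue_on {a..b})"
    "AE t in lebesgue_on {a..b}. norm (v t) \<le> g t"
    "AE t in lebesgue_on {a..b}. (\<lambda>n. comb u (c n) t) \<longlonglongrightarrow> v t"
    "(\<lambda>n. \<integral>t. (norm (comb u (c n) t - v t))\<^sup>2 \<partial>lebesgue_on {a..b}) \<longlonglongrightarrow> 0"
proof -
  let ?M = "lebesgue_on {a..b}"
  interpret finite_measure ?M by (rule finite_measure_lebesgue_on, metis lmeasurable_cbox cbox_interval)
  have gi: "integrable ?M (\<lambda>t. (g t)\<^sup>2)" and gm: "g \<in> borel_measurable ?M" using g by (auto simp: L2_def)
  have ub': "AE t in ?M. \<forall>n. norm (u n t) \<le> g t" using ub by (simp add: AE_all_countable)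
  have cm: "comb u c \<in> borel_measurable ?M" for c
    unfolding comb_def[abs_def] using um by measurable
  have cb: "AE t in ?M. norm (comb u c t) \<le> g t" if "c \<in> tail_weights n" for c n
    using ub' by eventually_elim (rule norm_comb_le[OF that], blast)
  have cL2: "comb u c \<in> L2 a b" if "c \<in> tail_weights n" for c n
    by (rule L2_bounded(1)[OF g cm cb[OF that]])
  define E where "E = (\<lambda>c. \<integral>t. (norm (comb u c t))\<^sup>2 \<partial>?M)"
  have E0: "0 \<le> E c" for c unfolding E_def by (rule integral_nonneg_AE) simp
  have EG: "E c \<le> (\<integral>t. (g t)\<^sup>2 \<partial>?M)" if "c \<in> tail_weights n" for c n
    unfolding E_def by (rule L2_bounded(2)[OF g cm cb[OF that]])
  define d where "d = (\<lambda>n. Inf (E ` tail_weights n))"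
  have bdd: "bdd_below (E ` tail_weights n)" for n using E0 by (intro bdd_belowI[of _ 0]) auto
  have ne: "tail_weights n \<noteq> {}" for n using tail_weights_unit by blast
  have dle: "d n \<le> E c" if "c \<in> tail_weights n" for c n
    unfolding d_def using that bdd by (intro cInf_lower) auto
  have "incseq d"
    unfolding d_def by (intro monoI cInf_superset_mono image_mono tail_weights_mono bdd) (use ne in auto)
  moreover have "d n \<le> (\<integral>t. (g t)\<^sup>2 \<partial>?M)" for n
    using dle[OF tail_weights_unit] EG[OF tail_weights_unit] order_trans by blast
  ultimately obtain l where l: "d \<longlonglongrightarrow> l" using incseq_convergent by blast
  have "\<exists>c\<in>tail_weights n. E c < d n + 1 / real (Suc n)" for n
    using cInf_lessD[of "E ` tail_weights n" "d n + 1 / real (Suc n)"] ne[of n] by (auto simp: d_def)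
  then obtain c where c: "\<And>n. c n \<in> tail_weights n" "\<And>n. E (c n) < d n + 1 / real (Suc n)" by metis
  define v where "v = (\<lambda>n. comb u (c n))"
  have vL2: "v n \<in> L2 a b" for n unfolding v_def by (rule cL2[OF c(1)])
  have dist: "(\<integral>t. (norm (v m t - v n t))\<^sup>2 \<partial>?M) \<le> 2 * \<bar>d m - d n\<bar> + 2 / real (Suc m) + 2 / real (Suc n)" for m n
  proof -
    define p where "p = min m n"
    have cp: "c m \<in> tail_weights p" "c n \<in> tail_weights p"
      using c(1)[of m] c(1)[of n] tail_weights_mono[of p m] tail_weights_mono[of p n] by (auto simp: p_def)
    let ?h = "\<lambda>k. (c m k + c n k) / 2"
    have h: "?h \<in> tail_weights p" by (rule tail_weights_midpoint(1)[OF cp])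
    have i: "integrable ?M (\<lambda>t. (norm (comb u e t))\<^sup>2)" if "e \<in> tail_weights q" for e q
      using cL2[OF that] by (simp add: L2_def)
    have "(\<integral>t. (norm (v m t - v n t))\<^sup>2 \<partial>?M) = (\<integral>t. 2 * (norm (comb u (c m) t))\<^sup>2 + 2 * (norm (comb u (c n) t))\<^sup>2
        - 4 * (norm (comb u ?h t))\<^sup>2 \<partial>?M)"
      unfolding v_def parallelogram_midpoint tail_weights_midpoint(2)[OF cp] ..
    also have "\<dots> = 2 * E (c m) + 2 * E (c n) - 4 * E ?h"
      unfolding E_def using i[OF cp(1)] i[OF cp(2)] i[OF h] by simp
    also have "\<dots> \<le> 2 * (d m + 1 / real (Suc m)) + 2 * (d n + 1 / real (Suc n)) - 4 * d p"
      by (intro diff_mono add_mono mult_left_mono less_imp_le[OF c(2)] dle[OF h]) auto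
    also have "\<dots> \<le> 2 * \<bar>d m - d n\<bar> + 2 / real (Suc m) + 2 / real (Suc n)"
    proof -
      have "2 * d m + 2 * d n - 4 * d p \<le> 2 * \<bar>d m - d n\<bar>" 
        using abs_ge_self[of "d m - d n"] abs_ge_minus_self[of "d m - d n"] by (cases "m \<le> n") (simp_all add: p_def)
      moreover have "2 / real (Suc m) = 2 * (1 / real (Suc m))" "2 / real (Suc n) = 2 * (1 / real (Suc n))" by simp_all
      ultimately show ?thesis unfolding distrib_left by linarith
    qed
    finally show ?thesis .
  qed
  have L1: "\<exists>N. \<forall>i\<ge>N. \<forall>j\<ge>N. (\<integral>t. norm (v i t - v j t) \<partial>?M) < e" if e: "e > 0" for e
  proof -
    define \<eta> where "\<eta> = e\<^sup>2 / (measure ?M (space ?M) + 1)"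
    have \<eta>: "\<eta> > 0" using e by (simp add: \<eta>_def add_nonneg_pos)
    have "\<exists>N. \<forall>n\<ge>N. norm (d n - l) < \<eta> / 8" using LIMSEQ_D[OF l, of "\<eta> / 8"] \<eta> by simp
    then obtain N1 where N1: "\<And>n. n \<ge> N1 \<Longrightarrow> \<bar>d n - l\<bar> < \<eta> / 8" by (metis real_norm_def)
    obtain N2 where N2: "1 / real (Suc N2) < \<eta> / 8" using nat_approx_posE[of "\<eta> / 8"] \<eta> by auto
    have "(\<integral>t. norm (v i t - v j t) \<partial>?M) < e" if ij: "i \<ge> max N1 N2" "j \<ge> max N1 N2" for i j
    proof -
      have small: "2 / real (Suc n) < \<eta> / 4" if "n \<ge> N2" for n
      proof -
        have "2 / real (Suc n) \<le> 2 / real (Suc N2)" using that by (intro divide_left_mono) auto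
        also have "\<dots> = 2 * (1 / real (Suc N2))" by simp
        also have "\<dots> < 2 * (\<eta> / 8)" using N2 by (intro mult_strict_left_mono) auto
        finally show ?thesis by simp
      qed
      have "i \<ge> N1" "j \<ge> N1" "i \<ge> N2" "j \<ge> N2" using ij by auto
      note bnds = N1[OF this(1)] N1[OF this(2)] small[OF this(3)] small[OF this(4)]
      have "\<bar>d i - d j\<bar> < \<eta> / 4" using bnds by linarith
      moreover have "A < \<eta>" if "A \<le> 2 * p + q + r" "p < \<eta> / 4" "q < \<eta> / 4" "r < \<eta> / 4" for A p q r
        using that by linarith
      ultimately have lt: "(\<integral>t. (norm (v i t - v j t))\<^sup>2 \<partial>?M) < \<eta>" using dist[of i j] bnds(3,4) by blast
      have m: "(\<lambda>t. norm (v i t - v j t)) \<in> borel_measurable ?M" using cm unfolding v_def by measurable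
      have "(\<lambda>t. v i t - v j t) \<in> L2 a b" by (intro L2_diff vL2)
      then have i2: "integrable ?M (\<lambda>t. (norm (v i t - v j t))\<^sup>2)" by (simp add: L2_def)
      have CS: "(\<integral>t. \<bar>1 * norm (v i t - v j t)\<bar> \<partial>?M)\<^sup>2 \<le> (\<integral>t. 1\<^sup>2 \<partial>?M) * (\<integral>t. (norm (v i t - v j t))\<^sup>2 \<partial>?M)"
        by (rule Cauchy_Schwarz_integral(2)) (use m i2 in auto)
      have "(\<integral>t. norm (v i t - v j t) \<partial>?M)\<^sup>2 \<le> measure ?M (space ?M) * (\<integral>t. (norm (v i t - v j t))\<^sup>2 \<partial>?M)"
        using CS by simp
      also have "\<dots> \<le> measure ?M (space ?M) * \<eta>" using lt by (intro mult_left_mono) auto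
      also have "\<dots> < (measure ?M (space ?M) + 1) * \<eta>" using \<eta> by simp
      also have "\<dots> = e\<^sup>2" unfolding \<eta>_def by (simp add: add_nonneg_eq_0_iff)
      finally show ?thesis using e by (simp add: power_less_imp_less_base)
    qed
    then show ?thesis by blast
  qed
  have vi: "integrable ?M (v n)" for n
  proof -
    have "integrable ?M (\<lambda>t. 1 * norm (v n t))"
      by (rule Cauchy_Schwarz_integral(1)) (use vL2[of n] in \<open>auto simp: L2_def\<close>)
    then have "integrable ?M (\<lambda>t. norm (v n t))" by simp
    moreover have "v n \<in> borel_measurable ?M" unfolding v_def by (rule cm)
    ultimately show ?thesis by (simp only: integrable_norm_iff)
  qed
  obtain r where r: "strict_mono r" "AE t in ?M. Cauchy (\<lambda>i. v (r i) t)"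
    using cauchy_L1_AE_cauchy_subseq[of ?M v, OF vi L1] by blast
  define V where "V = (\<lambda>t. lim (\<lambda>i. v (r i) t))"
  have conv: "AE t in ?M. (\<lambda>i. v (r i) t) \<longlonglongrightarrow> V t"
    using r(2) by eventually_elim (simp add: V_def Cauchy_convergent convergent_LIMSEQ_iff[symmetric])
  have Vm: "V \<in> borel_measurable ?M"
    unfolding V_def by (rule borel_measurable_lim_metric) (simp add: v_def cm)
  have vb: "AE t in ?M. \<forall>i. norm (v (r i) t) \<le> g t"
    unfolding AE_all_countable v_def using cb[OF c(1)] by blast
  have Vb: "AE t in ?M. norm (V t) \<le> g t"
    using conv vb
  proof eventually_elim
    case (elim t)
    show ?case by (rule LIMSEQ_le_const2[OF tendsto_norm[OF elim(1)]]) (use elim(2) in blast)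
  qed
  have "(\<lambda>i. \<integral>t. (norm (v (r i) t - V t))\<^sup>2 \<partial>?M) \<longlonglongrightarrow> (\<integral>t. 0 \<partial>?M)"
  proof (rule integral_dominated_convergence[where w = "\<lambda>t. 4 * (g t)\<^sup>2"])
    show "AE t in ?M. (\<lambda>i. (norm (v (r i) t - V t))\<^sup>2) \<longlonglongrightarrow> 0"
      using conv
    proof eventually_elim
      case (elim t)
      have "(\<lambda>i. (norm (v (r i) t - V t))\<^sup>2) \<longlonglongrightarrow> 0\<^sup>2"
        by (intro tendsto_power tendsto_norm_zero LIM_zero elim)
      then show ?case by simp
    qed
    show "AE t in ?M. norm ((norm (v (r i) t - V t))\<^sup>2) \<le> 4 * (g t)\<^sup>2" for i
      using vb Vb
    proof eventually_elim
      case (elim t)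
      have "norm (v (r i) t - V t) \<le> 2 * g t"
        using norm_triangle_ineq4[of "v (r i) t" "V t"] elim by (smt (verit))
      then have "(norm (v (r i) t - V t))\<^sup>2 \<le> (2 * g t)\<^sup>2" by (intro power_mono) auto
      then show ?case by (simp add: power_mult_distrib)
    qed
    show "(\<lambda>t. (norm (v (r i) t - V t))\<^sup>2) \<in> borel_measurable ?M" for i
      using cm Vm unfolding v_def by measurable
  qed (use gi in auto)
  then have L2c: "(\<lambda>i. \<integral>t. (norm (v (r i) t - V t))\<^sup>2 \<partial>?M) \<longlonglongrightarrow> 0" by simp
  show thesis
  proof (rule that[of "\<lambda>i. c (r i)" V])
    show "c (r i) \<in> tail_weights i" for i
      using c(1)[of "r i"] tail_weights_mono[OF seq_suble[OF r(1), of i]] by blast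
  qed (use Vm Vb conv L2c in \<open>simp_all add: v_def\<close>)
qed

section \<open>Existence and closedness of feedback solutions\<close>

lemma AE_off_point: "AE t in lebesgue_on {a..b}. (t::real) \<noteq> c"
proof -
  have "{c} \<in> null_sets lebesgue" using negligible_iff_null_sets[of "{c}"] by simp
  then have "AE t in lebesgue. t \<noteq> c" using AE_not_in[of "{c}" lebesgue] by simp
  then show ?thesis by (subst AE_restrict_space_iff) (auto elim: eventually_mono)
qed

lemma AE_half_open: "AE t in lebesgue_on {a..b}. (t::real) \<in> {a<..b}"
proof -
  have "AE t in lebesgue_on {a..b}. t \<in> {a..b}" using AE_space[of "lebesgue_on {a..b}"] by simp
  then show ?thesis using AE_off_point[where a = a and b = b and c = a] by eventually_elim auto
qed

lemma integral_exp_le: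
  assumes l: "\<mu> > 0" and t: "t \<in> {a..b}"
  shows "integrable (lebesgue_on {a..b}) (\<lambda>s. indicator {..<t} s * exp (\<mu> * (s - a)) :: real)"
    "(\<integral>s. indicator {..<t} s * exp (\<mu> * (s - a)) \<partial>lebesgue_on {a..b}) \<le> exp (\<mu> * (t - a)) / \<mu>"
proof -
  let ?M = "lebesgue_on {a..b}"
  let ?e = "\<lambda>s. exp (\<mu> * (s - a))"
  interpret finite_measure ?M by (rule finite_measure_lebesgue_on, metis lmeasurable_cbox cbox_interval)
  have em: "?e \<in> borel_measurable ?M"
    by (rule continuous_imp_measurable_on_sets_lebesgue) (auto intro!: continuous_intros)
  have im: "(\<lambda>s. if s \<in> S then ?e s else 0) \<in> borel_measurable ?M" if "S \<in> sets borel" for S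
    using em that by (intro measurable_If_set measurable_const) (auto simp: sets_restrict_space)
  have bd: "norm (if s \<in> S then ?e s else 0) \<le> ?e b" if "s \<in> {a..b}" for s S
    using that l by auto
  have int: "integrable ?M (\<lambda>s. if s \<in> S then ?e s else 0)" if "S \<in> sets borel" for S
    by (rule integrable_const_bound[of _ "?e b"]) (rule AE_I2, rule bd, simp, rule im[OF that])
  have eq: "(\<lambda>s. indicator {..<t} s * ?e s) = (\<lambda>s. if s \<in> {..<t} then ?e s else 0)" by (auto simp: indicator_def)
  show i1: "integrable ?M (\<lambda>s. indicator {..<t} s * ?e s)" unfolding eq by (rule int) simp
  have i2: "integrable ?M (\<lambda>s. if s \<in> {a..t} then ?e s else 0)" by (rule int) simp
  have "(?e has_integral (?e t / \<mu> - ?e a / \<mu>)) {a..t}"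
    by (rule fundamental_theorem_of_calculus)
      (use t l in \<open>auto intro!: derivative_eq_intros simp: has_real_derivative_iff_has_vector_derivative[symmetric]\<close>)
  then have "((\<lambda>s. if s \<in> {a..t} then ?e s else 0) has_integral (?e t / \<mu> - ?e a / \<mu>)) {a..b}"
    by (subst has_integral_restrict) (use t in auto)
  then have v: "(\<integral>s. (if s \<in> {a..t} then ?e s else 0) \<partial>?M) = ?e t / \<mu> - ?e a / \<mu>"
    using lebesgue_integral_eq_integral[OF i2] by (simp add: integral_unique)
  have "(\<integral>s. indicator {..<t} s * ?e s \<partial>?M) \<le> (\<integral>s. (if s \<in> {a..t} then ?e s else 0) \<partial>?M)"
    by (rule integral_mono[OF i1 i2]) (auto simp: indicator_def)
  also have "\<dots> \<le> ?e t / \<mu>" unfolding v using l by simp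
  finally show "(\<integral>s. indicator {..<t} s * ?e s \<partial>?M) \<le> ?e t / \<mu>" .
qed

text \<open>A Volterra inequality, by absorption: in the norm weighted by \<open>exp (- 2 c (t - a))\<close> the integral
  operator has norm at most \<open>1 / 2\<close>.\<close>

lemma Volterra_inequality:
  fixes y A :: "real \<Rightarrow> real"
  assumes ab: "a < b" and c: "c > 0" and y: "integrable (lebesgue_on {a..b}) y" "\<And>s. 0 \<le> y s"
    and A: "integrable (lebesgue_on {a..b}) A" "\<And>s. 0 \<le> A s"
    and le: "AE t in lebesgue_on {a..b}. y t \<le> A t + c * (\<integral>s. indicator {..<t} s * y s \<partial>lebesgue_on {a..b})"
    and t: "t \<in> {a..b}"
  shows "(\<integral>s. indicator {..<t} s * y s \<partial>lebesgue_on {a..b})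
    \<le> 2 * (\<integral>s. A s \<partial>lebesgue_on {a..b}) * exp (2 * c * (b - a))"
proof -
  let ?M = "lebesgue_on {a..b}"
  define \<mu> where "\<mu> = 2 * c"
  have \<mu>: "\<mu> > 0" using c by (simp add: \<mu>_def)
  define F where "F = (\<lambda>t. \<integral>s. indicator {..<t} s * y s \<partial>?M)"
  define I where "I = (\<integral>s. A s \<partial>?M)"
  have ind: "{..<t} \<inter> space ?M \<in> sets ?M" for t
    unfolding sets_restrict_space by (auto intro!: image_eqI[of _ _ "{..<t}"])
  have yi: "integrable ?M (\<lambda>s. indicator {..<t} s * y s)" for t
    using integrable_mult_indicator[of "{..<t} \<inter> space ?M" ?M y] ind y(1)
    by (auto intro: Bochner_Integration.integrable_cong[THEN iffD1, rotated 2] simp: indicator_def)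
  have F: "0 \<le> F t" "F t \<le> (\<integral>s. y s \<partial>?M)" for t
    unfolding F_def using y yi by (auto intro!: integral_nonneg_AE integral_mono AE_I2 simp: indicator_def)
  have I0: "0 \<le> I" unfolding I_def using A by (intro integral_nonneg_AE) simp
  define N where "N = (SUP t\<in>{a..b}. exp (- \<mu> * (t - a)) * F t)"
  have bdd: "bdd_above ((\<lambda>t. exp (- \<mu> * (t - a)) * F t) ` {a..b})"
  proof (rule bdd_aboveI2)
    fix t assume "t \<in> {a..b}"
    then have "exp (- \<mu> * (t - a)) \<le> 1" using \<mu> by (simp add: mult_nonneg_nonneg)
    then have "exp (- \<mu> * (t - a)) * F t \<le> 1 * F t" by (intro mult_right_mono F)
    then show "exp (- \<mu> * (t - a)) * F t \<le> (\<integral>s. y s \<partial>?M)" using F(2)[of t] by simp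
  qed
  have up: "exp (- \<mu> * (t - a)) * F t \<le> N" if "t \<in> {a..b}" for t
    unfolding N_def by (rule cSUP_upper[OF that bdd])
  have FN: "F t \<le> N * exp (\<mu> * (t - a))" if "t \<in> {a..b}" for t
  proof -
    have "F t = (exp (- \<mu> * (t - a)) * F t) * exp (\<mu> * (t - a))"
      by (simp add: exp_minus mult.commute)
    also have "\<dots> \<le> N * exp (\<mu> * (t - a))" by (intro mult_right_mono up[OF that]) simp
    finally show ?thesis .
  qed
  have N0: "0 \<le> N" using order_trans[OF _ up[of a]] F(1)[of a] ab by simp
  have main: "F t \<le> I + N / 2 * exp (\<mu> * (t - a))" if t: "t \<in> {a..b}" for t
  proof -
    have e: "integrable ?M (\<lambda>s. A s + c * N * (indicator {..<t} s * exp (\<mu> * (s - a))))"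
      using A(1) integral_exp_le(1)[OF \<mu> t] by simp
    have "F t \<le> (\<integral>s. A s + c * N * (indicator {..<t} s * exp (\<mu> * (s - a))) \<partial>?M)"
      unfolding F_def
    proof (rule integral_mono_AE[OF yi e])
      show "AE s in ?M. indicator {..<t} s * y s \<le> A s + c * N * (indicator {..<t} s * exp (\<mu> * (s - a)))"
        using le AE_half_open
      proof eventually_elim
        case (elim s)
        have "c * F s \<le> c * (N * exp (\<mu> * (s - a)))" using c elim(2) by (intro mult_left_mono FN) auto
        then have "y s \<le> A s + c * N * exp (\<mu> * (s - a))" using elim(1) unfolding F_def by simp
        then show ?case using A(2)[of s] by (simp add: indicator_def)
      qed
    qed
    also have "\<dots> = I + c * N * (\<integral>s. indicator {..<t} s * exp (\<mu> * (s - a)) \<partial>?M)"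
      unfolding I_def using A(1) integral_exp_le(1)[OF \<mu> t] by simp
    also have "\<dots> \<le> I + c * N * (exp (\<mu> * (t - a)) / \<mu>)"
      using c N0 by (intro add_left_mono mult_left_mono integral_exp_le(2)[OF \<mu> t]) auto
    also have "c * N * (exp (\<mu> * (t - a)) / \<mu>) = N / 2 * exp (\<mu> * (t - a))" using c by (simp add: \<mu>_def)
    finally show ?thesis .
  qed
  have "N \<le> I + N / 2" unfolding N_def
  proof (rule cSUP_least)
    fix t assume t: "t \<in> {a..b}"
    have e1: "exp (- \<mu> * (t - a)) \<le> 1" using \<mu> t by (simp add: mult_nonneg_nonneg)
    have "exp (- \<mu> * (t - a)) * F t \<le> exp (- \<mu> * (t - a)) * (I + N / 2 * exp (\<mu> * (t - a)))"
      by (intro mult_left_mono main[OF t]) simp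
    also have "\<dots> = exp (- \<mu> * (t - a)) * I + N / 2 * (exp (- \<mu> * (t - a)) * exp (\<mu> * (t - a)))"
      by (simp add: algebra_simps)
    also have "exp (- \<mu> * (t - a)) * exp (\<mu> * (t - a)) = 1" by (simp add: exp_minus)
    also have "exp (- \<mu> * (t - a)) * I + N / 2 * 1 \<le> I + N / 2"
      using mult_right_mono[OF e1 I0] by simp
    finally show "exp (- \<mu> * (t - a)) * F t \<le> I + (SUP t\<in>{a..b}. exp (- \<mu> * (t - a)) * F t) / 2"
      unfolding N_def .
  qed (use ab in auto)
  then have N: "N \<le> 2 * I" by simp
  have "F t \<le> N * exp (\<mu> * (t - a))" by (rule FN[OF t])
  also have "\<dots> \<le> 2 * I * exp (\<mu> * (b - a))"
    using N I0 t \<mu> by (intro mult_mono) auto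
  finally show ?thesis unfolding F_def I_def \<mu>_def .
qed

text \<open>The feedback problem for a state of the form \<open>s0 + Q u\<close>. The free motion \<open>s0\<close> may be unbounded
  near \<open>a\<close>, as long as \<open>w t *\<^sub>R s0 t\<close> is bounded.\<close>

locale feedback = singular_kernel D a b p C k
  for D :: "'x::banach set" and a b p C :: real
    and k :: "real \<Rightarrow> real \<Rightarrow> ('y::{real_inner, banach, second_countable_topology} \<Rightarrow>\<^sub>L 'x)" +
  fixes s0 :: "real \<Rightarrow> 'x" and w :: "real \<Rightarrow> real" and Cw Cs cU :: real
    and U :: "real \<Rightarrow> 'x \<Rightarrow> 'y set" and aU k4 :: "real \<Rightarrow> real"
  assumes s0: "continuous_on {a<..b} s0"
    and w: "\<And>t. t \<in> {a<..b} \<Longrightarrow> 0 \<le> w t \<and> w t \<le> Cw"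
    and w_s0: "\<And>t. t \<in> {a<..b} \<Longrightarrow> w t * norm (s0 t) \<le> Cs"
    and U_values: "\<And>t x. t \<in> {a..b} \<Longrightarrow> U t x \<noteq> {} \<and> closed (U t x)"
    and U_meas: "\<And>V. closed V \<Longrightarrow>
          {(t, x). t \<in> {a..b} \<and> U t x \<inter> V \<noteq> {}} \<in> sets (lebesgue_on {a..b} \<Otimes>\<^sub>M borel)"
    and U_convex: "\<And>t x. t \<in> {a..b} \<Longrightarrow> convex (U t x)"
    and aU: "L2_nonneg a b aU" and cU: "cU \<ge> 0"
    and U_growth: "AE t in lebesgue_on {a..b}. \<forall>x. set_norm (U t x) \<le> ereal (aU t + cU * w t * norm x)"
    and U_lip: "AE t in lebesgue_on {a..b}. \<forall>x y.
             hausdorff_dist (U t x) (U t y) \<le> ereal (k4 t * w t * norm (x - y))"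
begin

definition admissible :: "(real \<Rightarrow> 'y) \<Rightarrow> bool" where
  "admissible u \<longleftrightarrow> u \<in> L2 a b \<and> (AE t in MI. u t \<in> U t (s0 t + Q u t))"

lemma Cw_nonneg: "0 \<le> Cw" using w[of b] ab by force

lemma measurable_selection:
  assumes x: "continuous_on {a<..b} x"
  shows "(\<lambda>t. min_norm (U t (x t))) \<in> borel_measurable MI"
proof (rule measurable_min_norm)
  have eq: "{a..b} - {a} = {a<..b}" using ab by auto
  have xm: "x \<in> borel_measurable MI" by (rule measurable_continuous_off_point[of _ a]) (use x in \<open>simp_all add: eq\<close>)
  have pm: "(\<lambda>t. (t, x t)) \<in> MI \<rightarrow>\<^sub>M (MI \<Otimes>\<^sub>M borel)" by (rule measurable_Pair[OF measurable_ident_sets[OF refl] xm])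
  show "{t \<in> space MI. U t (x t) \<inter> V \<noteq> {}} \<in> sets MI" if V: "closed V" for V
  proof -
    have "(\<lambda>t. (t, x t)) -` {(t, x). t \<in> {a..b} \<and> U t x \<inter> V \<noteq> {}} \<inter> space MI = {t \<in> space MI. U t (x t) \<inter> V \<noteq> {}}"
      by auto
    then show ?thesis using measurable_sets[OF pm U_meas[OF V]] by simp
  qed
qed (use U_values U_convex in auto)

lemma U_norm_le: "AE t in MI. \<forall>x. \<forall>v\<in>U t x. norm v \<le> aU t + cU * w t * norm x"
  using U_growth
proof eventually_elim
  case (elim t)
  show ?case
  proof (intro allI ballI)
    fix x v assume v: "v \<in> U t x"
    have "ereal (norm v) \<le> set_norm (U t x)" unfolding set_norm_def by (rule SUP_upper[OF v])
    also have "\<dots> \<le> ereal (aU t + cU * w t * norm x)" using elim by blast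
    finally show "norm v \<le> aU t + cU * w t * norm x" by simp
  qed
qed

text \<open>The part of the growth bound on \<open>U\<close> that is due to the free motion.\<close>

definition A :: "real \<Rightarrow> real" where "A t = aU t + cU * Cs"

lemma U_norm_le': "AE t in MI. \<forall>z. \<forall>v\<in>U t (s0 t + z). norm v \<le> A t + cU * Cw * norm z"
  using U_norm_le AE_half_open
proof eventually_elim
  case (elim t)
  show ?case
  proof (intro allI ballI)
    fix z v assume "v \<in> U t (s0 t + z)"
    then have "norm v \<le> aU t + cU * w t * norm (s0 t + z)" using elim(1) by blast
    also have "\<dots> \<le> aU t + cU * w t * (norm (s0 t) + norm z)"
      using cU w[OF elim(2)] by (intro add_left_mono mult_left_mono norm_triangle_ineq mult_nonneg_nonneg) auto
    also have "\<dots> = aU t + cU * (w t * norm (s0 t)) + cU * (w t * norm z)" by (simp add: algebra_simps)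
    also have "\<dots> \<le> aU t + cU * Cs + cU * (Cw * norm z)"
      using cU w[OF elim(2)] w_s0[OF elim(2)] by (intro add_mono mult_left_mono mult_right_mono) auto
    finally show "norm v \<le> A t + cU * Cw * norm z" by (simp add: A_def)
  qed
qed

lemma L2_A: "(\<lambda>t. A t + c) \<in> L2 a b"
proof -
  interpret finite_measure MI by (rule finite_MI)
  have m[measurable]: "aU \<in> borel_measurable MI" and i: "integrable MI (\<lambda>t. (norm (aU t))\<^sup>2)"
    using aU by (auto simp: L2_nonneg_def L2_def)
  have "integrable MI (\<lambda>t. (norm (A t + c))\<^sup>2)"
  proof (rule Bochner_Integration.integrable_bound)
    show "integrable MI (\<lambda>t. 2 * (norm (aU t))\<^sup>2 + 2 * (cU * Cs + c)\<^sup>2)" using i by simp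
    show "AE t in MI. norm ((norm (A t + c))\<^sup>2) \<le> norm (2 * (norm (aU t))\<^sup>2 + 2 * (cU * Cs + c)\<^sup>2)"
    proof (rule AE_I2)
      fix t
      have "(x + z)\<^sup>2 \<le> 2 * x\<^sup>2 + 2 * z\<^sup>2" for x z :: real
        using zero_le_power2[of "x - z"] by (simp add: power2_sum power2_diff)
      from this[of "aU t" "cU * Cs + c"] show "norm ((norm (A t + c))\<^sup>2) \<le> norm (2 * (norm (aU t))\<^sup>2 + 2 * (cU * Cs + c)\<^sup>2)"
        by (simp add: A_def add.assoc)
    qed
  qed (unfold A_def, measurable)
  then show ?thesis unfolding L2_def by (auto simp: A_def)
qed

definition controlled :: "(real \<Rightarrow> 'x) \<Rightarrow> (real \<Rightarrow> 'y) \<Rightarrow> bool" where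
  "controlled R u \<longleftrightarrow> u \<in> L2 a b \<and> (\<forall>t\<in>{a..b}.
     (norm (R t))\<^sup>2 \<le> mass (b - a) * (\<integral>s. (indicator {..<t} s * norm (u s))\<^sup>2 \<partial>MI))"

text \<open>It suffices that the state at time \<open>t\<close> is controlled by the \<open>L\<^sup>2\<close> norm of the control before \<open>t\<close>;
  so the bound covers the solutions of the feedback problem and also those of the delayed problem by
  which they are approximated.\<close>

lemma a_priori_bound:
  "\<exists>g. g \<in> L2 a b \<and> (\<forall>u R. controlled R u \<longrightarrow> (AE t in MI. u t \<in> U t (s0 t + R t)) \<longrightarrow>
     (AE t in MI. norm (u t) \<le> g t))"
proof -
  define K where "K = cU * Cw"
  \<comment> \<open>the summand \<open>1\<close> only serves to make \<open>c\<close> positive\<close>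
  define c where "c = 2 * K\<^sup>2 * mass (b - a) + 1"
  define F0 where "F0 = 2 * (\<integral>s. 2 * (A s)\<^sup>2 \<partial>MI) * exp (2 * c * (b - a))"
  have K: "0 \<le> K" unfolding K_def using cU Cw_nonneg by simp
  have c: "c > 0" unfolding c_def using mass_nonneg by (intro add_nonneg_pos mult_nonneg_nonneg) auto
  have Ai: "integrable MI (\<lambda>s. 2 * (A s)\<^sup>2)" using L2_A[of 0] by (simp add: L2_def)
  show ?thesis
  proof (intro exI[of _ "\<lambda>t. A t + K * sqrt (mass (b - a) * F0)"] conjI allI impI)
    show "(\<lambda>t. A t + K * sqrt (mass (b - a) * F0)) \<in> L2 a b" by (rule L2_A)
    fix u R assume contr: "controlled R u"
      and uU: "AE t in MI. u t \<in> U t (s0 t + R t)"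
    have R: "(norm (R t))\<^sup>2 \<le> mass (b - a) * (\<integral>s. (indicator {..<t} s * norm (u s))\<^sup>2 \<partial>MI)"
      if "t \<in> {a..b}" for t using contr that ab unfolding controlled_def by auto
    have u: "u \<in> L2 a b" using contr unfolding controlled_def by blast
    define F where "F = (\<lambda>t. \<integral>s. indicator {..<t} s * (norm (u s))\<^sup>2 \<partial>MI)"
    have Feq: "(\<integral>s. (indicator {..<t} s * norm (u s))\<^sup>2 \<partial>MI) = F t" for t
      unfolding F_def by (intro Bochner_Integration.integral_cong) (auto simp: indicator_def)
    have F0': "0 \<le> F t" for t unfolding F_def by (rule integral_nonneg_AE) simp
    have u1: "AE t in MI. norm (u t) \<le> A t + K * norm (R t)"
      using uU U_norm_le' by eventually_elim (auto simp: K_def)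
    have "AE t in MI. (norm (u t))\<^sup>2 \<le> 2 * (A t)\<^sup>2 + c * F t"
      using u1 AE_half_open
    proof eventually_elim
      case (elim t)
      have t: "t \<in> {a..b}" using elim(2) by auto
      have "(norm (u t))\<^sup>2 \<le> (A t + K * norm (R t))\<^sup>2" by (intro power_mono elim) auto
      also have "\<dots> \<le> 2 * (A t)\<^sup>2 + 2 * (K * norm (R t))\<^sup>2"
        using zero_le_power2[of "A t - K * norm (R t)"] by (simp add: power2_sum power2_diff)
      also have "2 * (K * norm (R t))\<^sup>2 = 2 * K\<^sup>2 * (norm (R t))\<^sup>2" by (simp add: power_mult_distrib)
      also have "2 * K\<^sup>2 * (norm (R t))\<^sup>2 \<le> 2 * K\<^sup>2 * (mass (b - a) * F t)"
        using R[OF t] unfolding Feq by (intro mult_left_mono) auto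
      also have "2 * K\<^sup>2 * (mass (b - a) * F t) \<le> c * F t"
        using F0'[of t] by (simp add: c_def algebra_simps)
      finally show ?case by simp
    qed
    then have FF: "F t \<le> F0" if "t \<in> {a..b}" for t
      unfolding F_def F0_def by (intro Volterra_inequality[OF ab c _ _ Ai _ _ that]) (use u in \<open>auto simp: L2_def\<close>)
    show "AE t in MI. norm (u t) \<le> A t + K * sqrt (mass (b - a) * F0)"
      using u1 AE_half_open
    proof eventually_elim
      case (elim t)
      have t: "t \<in> {a..b}" using elim(2) by auto
      have "(norm (R t))\<^sup>2 \<le> mass (b - a) * F0"
        using R[OF t] mult_left_mono[OF FF[OF t] mass_nonneg[of "b - a"]] unfolding Feq by linarith
      then have "norm (R t) \<le> sqrt (mass (b - a) * F0)" by (rule real_le_rsqrt)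
      then have "K * norm (R t) \<le> K * sqrt (mass (b - a) * F0)" using K by (rule mult_left_mono)
      then show ?case using elim(1) by linarith
    qed
  qed
qed

text \<open>Solutions of the delayed problem: the control at time \<open>t\<close> is selected from the state at time
  \<open>t - \<delta>\<close>, so by causality the iteration started at \<open>0\<close> is stationary after finitely many steps.\<close>

lemma delayed_solution:
  assumes \<delta>: "\<delta> > 0"
  obtains u where "u \<in> L2 a b" "\<And>t. t \<in> {a..b} \<Longrightarrow> u t \<in> U t (s0 t + Q u (max a (t - \<delta>)))"
proof -
  define \<Phi> where "\<Phi> = (\<lambda>u t. min_norm (U t (s0 t + Q u (max a (t - \<delta>)))))"
  have mem: "\<Phi> u t \<in> U t (s0 t + Q u (max a (t - \<delta>)))" if "t \<in> {a..b}" for u t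
    unfolding \<Phi>_def using U_values[OF that] U_convex[OF that] by (intro min_norm(1)) auto
  have L: "\<Phi> u \<in> L2 a b" if u: "u \<in> L2 a b" for u
  proof (rule L2_bounded(1)[OF L2_A])
    have "continuous_on {a<..b} (\<lambda>t. Q u (max a (t - \<delta>)))"
      by (rule continuous_on_compose2[OF continuous_Q[OF u]]) (use \<delta> in \<open>auto intro!: continuous_intros\<close>)
    then show "\<Phi> u \<in> borel_measurable MI"
      unfolding \<Phi>_def by (intro measurable_selection continuous_intros s0)
    show "AE t in MI. norm (\<Phi> u t) \<le> A t + cU * Cw * sqrt (mass (b - a) * sqnorm u)"
      using U_norm_le' AE_half_open
    proof eventually_elim
      case (elim t)
      have "norm (\<Phi> u t) \<le> A t + cU * Cw * norm (Q u (max a (t - \<delta>)))"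
        using elim(1) mem[of t u] elim(2) by auto
      moreover have "norm (Q u (max a (t - \<delta>))) \<le> sqrt (mass (b - a) * sqnorm u)"
        using \<delta> elim(2) by (intro real_le_rsqrt Q_bound u) auto
      ultimately show ?case
        using mult_left_mono[of "norm (Q u (max a (t - \<delta>)))" "sqrt (mass (b - a) * sqnorm u)" "cU * Cw"]
          cU Cw_nonneg by fastforce
    qed
  qed
  define v where "v = (\<lambda>j. (\<Phi> ^^ j) (\<lambda>_. 0))"
  have v_Suc: "v (Suc j) = \<Phi> (v j)" for j by (simp add: v_def)
  have vL: "v j \<in> L2 a b" for j
  proof (induction j)
    case 0 show ?case by (simp add: v_def L2_def)
  next
    case (Suc j) then show ?case unfolding v_Suc by (rule L)
  qed
  have stat: "v j s = v (Suc j) s" if "s \<in> {a..b}" "s < a + real j * \<delta>" for s j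
    using that
  proof (induction j arbitrary: s)
    case (Suc j)
    let ?\<tau> = "max a (s - \<delta>)"
    have "Q (v j) ?\<tau> = Q (v (Suc j)) ?\<tau>"
    proof (rule Q_cong)
      show "AE s' in MI. s' < ?\<tau> \<longrightarrow> v j s' = v (Suc j) s'"
      proof (rule AE_I2, intro impI)
        fix s' assume s': "s' \<in> space MI" "s' < ?\<tau>"
        then have "s' < a + real j * \<delta>" using Suc.prems by (auto simp: algebra_simps)
        then show "v j s' = v (Suc j) s'" using s'(1) by (intro Suc.IH) auto
      qed
    qed (use vL Suc.prems \<delta> in \<open>auto simp: L2_def\<close>)
    then have "\<Phi> (v j) s = \<Phi> (v (Suc j)) s" unfolding \<Phi>_def by simp
    then show ?case by (simp add: v_Suc)
  qed auto
  obtain n where n: "(b - a) / \<delta> < real n" using reals_Archimedean2 by blast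
  then have "b < a + real n * \<delta>" using \<delta> by (simp add: field_simps)
  then have fixp: "v n t = \<Phi> (v n) t" if "t \<in> {a..b}" for t using stat[OF that, of n] that by (simp add: v_Suc)
  show thesis
  proof (rule that[of "v n"])
    show "v n t \<in> U t (s0 t + Q (v n) (max a (t - \<delta>)))" if t: "t \<in> {a..b}" for t
      by (subst fixp[OF t]) (rule mem[OF t])
  qed (rule vL)
qed


text \<open>The set of solutions is closed. Compactness of \<open>Q\<close> makes the states converge uniformly; a limit
  of convex combinations of the controls still selects from \<open>U\<close>, since by the Lipschitz condition the
  controls approach the convex set \<open>U t (s0 t + Q v t)\<close>.\<close>

lemma solutions_closed:
  fixes u :: "nat \<Rightarrow> real \<Rightarrow> 'y"
  assumes g: "g \<in> L2 a b" and um: "\<And>n. u n \<in> borel_measurable MI"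
    and ub: "\<And>n. AE t in MI. norm (u n t) \<le> g t"
    and R: "\<And>t. t \<in> {a..b} \<Longrightarrow> (\<lambda>n. R n t - Q (u n) t) \<longlonglongrightarrow> 0"
    and uU: "\<And>n. AE t in MI. u n t \<in> U t (s0 t + R n t)"
  obtains \<phi> :: "nat \<Rightarrow> nat" and c v where "strict_mono \<phi>" "\<And>n. c n \<in> tail_weights n" "admissible v"
    "AE t in MI. norm (v t) \<le> g t"
    "uniform_limit {a..b} (\<lambda>n. Q (u (\<phi> n))) (Q v) sequentially"
    "AE t in MI. (\<lambda>n. comb (\<lambda>i. u (\<phi> i)) (c n) t) \<longlonglongrightarrow> v t"
proof -
  have uL: "u n \<in> L2 a b" and un: "sqnorm (u n) \<le> (\<integral>s. (g s)\<^sup>2 \<partial>MI)" for n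
    using L2_bounded[OF g um ub] by auto
  obtain \<phi> r where \<phi>: "strict_mono (\<phi> :: nat \<Rightarrow> nat)" and r: "continuous_on {a..b} r"
    and lim: "uniform_limit {a..b} (\<lambda>n. Q (u (\<phi> n))) r sequentially"
    by (rule Q_subsequence[OF uL un]) (rule that)
  define z where "z = (\<lambda>i. u (\<phi> i))"
  have zm: "z n \<in> borel_measurable MI" and zb: "AE t in MI. norm (z n t) \<le> g t" and zL: "z n \<in> L2 a b" for n
    unfolding z_def by (rule um ub uL)+
  obtain c v where c: "\<And>n. c n \<in> tail_weights n" and vm: "v \<in> borel_measurable MI"
    and vb: "AE t in MI. norm (v t) \<le> g t"
    and vlim: "AE t in MI. (\<lambda>n. comb z (c n) t) \<longlonglongrightarrow> v t"
    and v2: "(\<lambda>n. \<integral>t. (norm (comb z (c n) t - v t))\<^sup>2 \<partial>MI) \<longlonglongrightarrow> 0"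
    by (rule Mazur_dominated[OF g zm zb]) (rule that)
  have vL: "v \<in> L2 a b" by (rule L2_bounded(1)[OF g vm vb])
  have cL: "comb z (c n) \<in> L2 a b" for n
  proof (rule L2_bounded(1)[OF g])
    show "comb z (c n) \<in> borel_measurable MI" unfolding comb_def[abs_def] using zm by measurable
    have "AE t in MI. \<forall>i. norm (z i t) \<le> g t" using zb by (simp add: AE_all_countable)
    then show "AE t in MI. norm (comb z (c n) t) \<le> g t"
      by eventually_elim (rule norm_comb_le[OF c], blast)
  qed
  have rt: "(\<lambda>n. Q (z n) t) \<longlonglongrightarrow> r t" if "t \<in> {a..b}" for t
    using tendsto_uniform_limitI[OF lim that] by (simp add: z_def)
  have Qv: "Q v t = r t" if t: "t \<in> {a..b}" for t
  proof -
    have 1: "(\<lambda>n. Q (comb z (c n)) t) \<longlonglongrightarrow> Q v t"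
    proof (rule LIM_zero_cancel, rule Lim_null_comparison[OF always_eventually])
      show "\<forall>n. norm (Q (comb z (c n)) t - Q v t) \<le> sqrt (mass (b - a) * (\<integral>s. (norm (comb z (c n) s - v s))\<^sup>2 \<partial>MI))"
        unfolding Q_diff[OF t cL vL, symmetric] by (intro allI real_le_rsqrt Q_bound[OF t] L2_diff cL vL)
      have "(\<lambda>n. sqrt (mass (b - a) * (\<integral>s. (norm (comb z (c n) s - v s))\<^sup>2 \<partial>MI))) \<longlonglongrightarrow> sqrt (mass (b - a) * 0)"
        by (intro tendsto_intros v2)
      then show "(\<lambda>n. sqrt (mass (b - a) * (\<integral>s. (norm (comb z (c n) s - v s))\<^sup>2 \<partial>MI))) \<longlonglongrightarrow> 0" by simp
    qed
    have 2: "(\<lambda>n. Q (comb z (c n)) t) \<longlonglongrightarrow> r t"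
    proof (rule LIMSEQ_I)
      fix e :: real assume e: "e > 0"
      obtain N where N: "\<And>n. n \<ge> N \<Longrightarrow> norm (Q (z n) t - r t) < e / 2"
        using LIMSEQ_D[OF rt[OF t], of "e / 2"] e by auto
      have "norm (Q (comb z (c n)) t - r t) < e" if n: "n \<ge> N" for n
      proof -
        obtain L where L: "\<And>k. 0 \<le> c n k" "\<And>k. k \<notin> {n..<L} \<Longrightarrow> c n k = 0" "(\<Sum>k\<in>{n..<L}. c n k) = 1"
          using c[of n] unfolding tail_weights_def by blast
        have "comb z (c n) = (\<lambda>s. \<Sum>i\<in>{n..<L}. c n i *\<^sub>R z i s)" by (rule ext, rule comb_eq) (use L in auto)
        then have Qc: "Q (comb z (c n)) t = (\<Sum>i\<in>{n..<L}. c n i *\<^sub>R Q (z i) t)"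
          using Q_sum[OF t, of "{n..<L}" z "c n"] zL by simp
        have "Q (comb z (c n)) t - r t = (\<Sum>i\<in>{n..<L}. c n i *\<^sub>R Q (z i) t) - (\<Sum>i\<in>{n..<L}. c n i) *\<^sub>R r t" unfolding L(3) Qc by simp
        also have "\<dots> = (\<Sum>i\<in>{n..<L}. c n i *\<^sub>R (Q (z i) t - r t))"
          unfolding scaleR_sum_left sum_subtractf[symmetric] by (simp add: scaleR_diff_right)
        also have "\<dots> = comb (\<lambda>i t. Q (z i) t - r t) (c n) t" by (rule comb_eq[symmetric]) (use L in auto)
        also have "norm \<dots> \<le> e / 2" by (rule norm_comb_le[OF c]) (use N n less_imp_le le_trans in blast)
        finally show ?thesis using e by simp
      qed
      then show "\<exists>N. \<forall>n\<ge>N. norm (Q (comb z (c n)) t - r t) < e" by blast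
    qed
    show ?thesis by (rule LIMSEQ_unique[OF 1 2])
  qed
  have zU: "AE t in MI. \<forall>i. z i t \<in> U t (s0 t + R (\<phi> i) t)"
    unfolding AE_all_countable z_def using uU by blast
  have "AE t in MI. v t \<in> U t (s0 t + Q v t)"
    using zU vlim U_lip AE_half_open
  proof eventually_elim
    case (elim t)
    have t: "t \<in> {a..b}" using elim(4) by auto
    let ?W = "U t (s0 t + Q v t)"
    have W: "?W \<noteq> {}" "closed ?W" "convex ?W" using U_values[OF t] U_convex[OF t] by auto
    have "(\<lambda>i. (R (\<phi> i) t - Q (u (\<phi> i)) t) + Q (z i) t) \<longlonglongrightarrow> 0 + r t"
      using LIMSEQ_subseq_LIMSEQ[OF R[OF t] \<phi>] by (intro tendsto_add rt t) (simp add: o_def)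
    then have Rlim: "(\<lambda>i. R (\<phi> i) t) \<longlonglongrightarrow> Q v t" by (simp add: z_def Qv[OF t])
    then have "(\<lambda>i. k4 t * w t * norm ((s0 t + R (\<phi> i) t) - (s0 t + Q v t))) \<longlonglongrightarrow> k4 t * w t * norm ((s0 t + Q v t) - (s0 t + Q v t))"
      by (intro tendsto_intros)
    then have small: "(\<lambda>i. k4 t * w t * norm ((s0 t + R (\<phi> i) t) - (s0 t + Q v t))) \<longlonglongrightarrow> 0" by simp
    have near: "infdist (z i t) ?W \<le> k4 t * w t * norm ((s0 t + R (\<phi> i) t) - (s0 t + Q v t))" for i
    proof -
      have "ereal (infdist (z i t) ?W) \<le> hausdorff_dist (U t (s0 t + R (\<phi> i) t)) ?W"
        unfolding hausdorff_dist_def using elim(1) by (intro max.coboundedI1 SUP_upper) blast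
      also have "\<dots> \<le> ereal (k4 t * w t * norm ((s0 t + R (\<phi> i) t) - (s0 t + Q v t)))" using elim(3) by blast
      finally show ?thesis by simp
    qed
    have "infdist (v t) ?W \<le> e" if e: "e > 0" for e
    proof -
      have "\<forall>\<^sub>F i in sequentially. k4 t * w t * norm ((s0 t + R (\<phi> i) t) - (s0 t + Q v t)) < e"
        by (rule order_tendstoD(2)[OF small e])
      then obtain N where N: "\<And>i. i \<ge> N \<Longrightarrow> infdist (z i t) ?W < e"
        unfolding eventually_sequentially using near le_less_trans by blast
      have "\<exists>y\<in>?W. dist (z i t) y < e" if "i \<ge> N" for i
      proof -
        have "(INF y\<in>?W. dist (z i t) y) < e" using N[OF that] W(1) by (simp add: infdist_def)
        then show ?thesis using cInf_lessD[of "(\<lambda>y. dist (z i t) y) ` ?W" e] W(1) by auto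
      qed
      then obtain y where y: "\<And>i. i \<ge> N \<Longrightarrow> y i \<in> ?W" "\<And>i. i \<ge> N \<Longrightarrow> dist (z i t) (y i) < e" by metis
      have close: "infdist (comb z (c n) t) ?W \<le> e" if n: "n \<ge> N" for n
      proof -
        obtain L where L: "\<And>k. 0 \<le> c n k" "\<And>k. k \<notin> {n..<L} \<Longrightarrow> c n k = 0" "(\<Sum>k\<in>{n..<L}. c n k) = 1"
          using c[of n] unfolding tail_weights_def by blast
        have "(\<Sum>i\<in>{n..<L}. c n i *\<^sub>R y i) \<in> ?W"
          by (rule convex_sum[OF _ W(3) L(3)]) (use L(1) y(1) n in auto)
        moreover have "comb z (c n) t - (\<Sum>i\<in>{n..<L}. c n i *\<^sub>R y i) = comb (\<lambda>i t. z i t - y i) (c n) t"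
          by (subst (1 2) comb_eq[of "{n..<L}"]) (use L in \<open>auto simp: sum_subtractf[symmetric] scaleR_diff_right\<close>)
        moreover have "norm (comb (\<lambda>i t. z i t - y i) (c n) t) \<le> e"
          by (rule norm_comb_le[OF c]) (use y(2) n in \<open>auto simp: dist_norm intro: less_imp_le\<close>)
        ultimately show ?thesis using infdist_le2 by (metis dist_norm)
      qed
      have "(\<lambda>n. infdist (comb z (c n) t) ?W) \<longlonglongrightarrow> infdist (v t) ?W" by (rule tendsto_infdist[OF elim(2)])
      then show ?thesis by (rule LIMSEQ_le_const2) (use close in blast)
    qed
    then have "infdist (v t) ?W \<le> 0" by (rule field_le_epsilon[of _ 0, simplified])
    then have "infdist (v t) ?W = 0" using infdist_nonneg[of "v t" ?W] by simp
    then show ?case using in_closed_iff_infdist_zero[OF W(2,1)] by blast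
  qed
  then have adm: "admissible v" using vL by (simp add: admissible_def)
  have "uniform_limit {a..b} (\<lambda>n. Q (u (\<phi> n))) (Q v) sequentially"
    using lim Qv by (simp add: uniform_limit_iff)
  then show thesis using that[OF \<phi> c adm vb] vlim by (simp add: z_def)
qed

lemma admissible_bound:
  obtains g where "g \<in> L2 a b" "\<And>u. admissible u \<Longrightarrow> AE t in MI. norm (u t) \<le> g t"
proof -
  obtain g where g': "g \<in> L2 a b \<and> (\<forall>u R. controlled R u \<longrightarrow> (AE t in MI. u t \<in> U t (s0 t + R t)) \<longrightarrow>
     (AE t in MI. norm (u t) \<le> g t))" using a_priori_bound ..
  note g = g'[THEN conjunct1] g'[THEN conjunct2, rule_format]
  have "AE t in MI. norm (u t) \<le> g t" if "admissible u" for u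
    by (rule g(2)[of "Q u"]) (use that in \<open>auto simp: admissible_def controlled_def intro!: Q_causal_bound\<close>)
  then show thesis by (rule that[OF g(1)])
qed

text \<open>Solutions with delay \<open>1 / n\<close> satisfy the inclusion for a state that differs little from
  \<open>s0 + Q u\<close>, by equicontinuity; so closedness applies.\<close>

lemma admissible_exists: "\<exists>u. admissible u"
proof -
  obtain g where g': "g \<in> L2 a b \<and> (\<forall>u R. controlled R u \<longrightarrow> (AE t in MI. u t \<in> U t (s0 t + R t)) \<longrightarrow>
     (AE t in MI. norm (u t) \<le> g t))" using a_priori_bound ..
  note g = g'[THEN conjunct1] g'[THEN conjunct2, rule_format]
  define \<delta> where "\<delta> = (\<lambda>n. 1 / real (Suc n))"
  have \<delta>: "\<delta> n > 0" for n by (simp add: \<delta>_def)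
  have "\<exists>u. u \<in> L2 a b \<and> (\<forall>t\<in>{a..b}. u t \<in> U t (s0 t + Q u (max a (t - \<delta> n))))" for n
    by (rule delayed_solution[OF \<delta>[of n]]) blast
  then obtain u where u: "\<And>n. u n \<in> L2 a b"
    "\<And>n t. t \<in> {a..b} \<Longrightarrow> u n t \<in> U t (s0 t + Q (u n) (max a (t - \<delta> n)))" by metis
  have uU: "AE t in MI. u n t \<in> U t (s0 t + Q (u n) (max a (t - \<delta> n)))" for n
    using u(2) by (intro AE_I2) simp
  have ub: "AE t in MI. norm (u n t) \<le> g t" for n
  proof (rule g(2)[OF _ uU], unfold controlled_def, intro conjI ballI u(1))
    fix t assume t: "t \<in> {a..b}"
    let ?\<tau> = "max a (t - \<delta> n)"
    have \<tau>: "?\<tau> \<in> {a..b}" "?\<tau> \<le> t" using t \<delta>[of n] by auto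
    have i: "integrable MI (\<lambda>s. (indicator {..<x} s * norm (u n s))\<^sup>2)" for x
    proof (rule Bochner_Integration.integrable_bound)
      show "integrable MI (\<lambda>s. (norm (u n s))\<^sup>2)" using u(1) by (simp add: L2_def)
      have "(\<lambda>s. indicator {..<x} s :: real) \<in> borel_measurable MI"
        by (intro borel_measurable_indicator') (auto simp: sets_restrict_space)
      then show "(\<lambda>s. (indicator {..<x} s * norm (u n s))\<^sup>2) \<in> borel_measurable MI"
        using u(1)[of n] unfolding L2_def by auto
    qed (auto simp: indicator_def)
    have "(norm (Q (u n) ?\<tau>))\<^sup>2 \<le> mass (b - a) * (\<integral>s. (indicator {..<?\<tau>} s * norm (u n s))\<^sup>2 \<partial>MI)"
      by (rule Q_causal_bound[OF \<tau>(1) u(1)])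
    also have "\<dots> \<le> mass (b - a) * (\<integral>s. (indicator {..<t} s * norm (u n s))\<^sup>2 \<partial>MI)"
      using \<tau>(2) by (intro mult_left_mono mass_nonneg integral_mono i) (auto simp: indicator_def)
    finally show "(norm (Q (u n) ?\<tau>))\<^sup>2 \<le> mass (b - a) * (\<integral>s. (indicator {..<t} s * norm (u n s))\<^sup>2 \<partial>MI)" .
  qed
  have um: "u n \<in> borel_measurable MI" for n using u(1) by (simp add: L2_def)
  define \<rho> where "\<rho> = (\<integral>s. (g s)\<^sup>2 \<partial>MI)"
  have \<rho>: "0 \<le> \<rho>" "sqnorm (u n) \<le> \<rho>" for n
    unfolding \<rho>_def using L2_bounded(2)[OF g(1) um ub] by (auto intro: integral_nonneg_AE)
  have R: "(\<lambda>n. Q (u n) (max a (t - \<delta> n)) - Q (u n) t) \<longlonglongrightarrow> 0" if t: "t \<in> {a..b}" for t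
  proof (rule LIMSEQ_I)
    fix e :: real assume e: "e > 0"
    from Q_equicontinuous[OF e \<rho>(1)] obtain d where d: "d > 0" "\<And>v t t'. v \<in> L2 a b \<Longrightarrow> sqnorm v \<le> \<rho> \<Longrightarrow> t \<in> {a..b} \<Longrightarrow> t' \<in> {a..b} \<Longrightarrow>
      \<bar>t - t'\<bar> < d \<Longrightarrow> norm (Q v t - Q v t') < e" by blast
    obtain N where N: "1 / real (Suc N) < d" using nat_approx_posE[OF d(1)] by auto
    have "norm (Q (u n) (max a (t - \<delta> n)) - Q (u n) t - 0) < e" if "n \<ge> N" for n
    proof -
      have "\<delta> n \<le> 1 / real (Suc N)" using that unfolding \<delta>_def by (intro divide_left_mono) auto
      then have "\<bar>max a (t - \<delta> n) - t\<bar> < d" using N t \<delta>[of n] by auto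
      then show ?thesis using d(2)[OF u(1) \<rho>(2), of "max a (t - \<delta> n)" t n] t \<delta>[of n] by simp
    qed
    then show "\<exists>N. \<forall>n\<ge>N. norm (Q (u n) (max a (t - \<delta> n)) - Q (u n) t - 0) < e" by blast
  qed
  show ?thesis by (rule solutions_closed[OF g(1) um ub R uU], assumption, rule exI)
qed

end

section \<open>Lower semicontinuity of the cost\<close>

lemma borel_Int_sets: "S \<in> sets borel \<Longrightarrow> S \<inter> space (lebesgue_on {a..b}) \<in> sets (lebesgue_on {a..(b::real)})"
  unfolding sets_restrict_space by (rule image_eqI[of _ _ S]) auto

lemma integrable_indicator_times:
  fixes f :: "real \<Rightarrow> real"
  assumes f: "integrable (lebesgue_on {a..b}) f" and S: "S \<in> sets borel"
  shows "integrable (lebesgue_on {a..b}) (\<lambda>t. indicator S t * f t)"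
proof (rule Bochner_Integration.integrable_bound[OF f])
  have "(indicator S :: real \<Rightarrow> real) \<in> borel_measurable (lebesgue_on {a..b})"
    using borel_Int_sets[OF S] by (simp only: borel_measurable_indicator_iff)
  then show "(\<lambda>t. indicator S t * f t) \<in> borel_measurable (lebesgue_on {a..b})"
    using f by (intro borel_measurable_times) auto
qed (auto simp: indicator_def)

lemma small_initial_integral:
  fixes f :: "real \<Rightarrow> real"
  assumes f: "integrable (lebesgue_on {a..b}) f" and \<eta>: "\<eta> > 0"
  obtains e where "e > 0" "\<And>e'. e' \<le> e \<Longrightarrow> (\<integral>t. indicator {..a + e'} t * \<bar>f t\<bar> \<partial>lebesgue_on {a..b}) < \<eta>"
proof -
  let ?M = "lebesgue_on {a..b}"
  have i: "integrable ?M (\<lambda>t. indicator {..x} t * \<bar>f t\<bar>)" for x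
    using f by (intro integrable_indicator_times) auto
  have "(\<lambda>n. \<integral>t. indicator {..a + 1 / real (Suc n)} t * \<bar>f t\<bar> \<partial>?M) \<longlonglongrightarrow> (\<integral>t. 0 \<partial>?M)"
  proof (rule integral_dominated_convergence[where w = "\<lambda>t. \<bar>f t\<bar>"])
    show "AE t in ?M. (\<lambda>n. indicator {..a + 1 / real (Suc n)} t * \<bar>f t\<bar>) \<longlonglongrightarrow> 0"
      using AE_half_open
    proof eventually_elim
      case (elim t)
      then obtain N where N: "1 / real (Suc N) < t - a" using nat_approx_posE[of "t - a"] by auto
      have "indicator {..a + 1 / real (Suc n)} t * \<bar>f t\<bar> = 0" if "n \<ge> N" for n
      proof -
        have "1 / real (Suc n) \<le> 1 / real (Suc N)" using that by (intro divide_left_mono) auto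
        then have "t \<notin> {..a + 1 / real (Suc n)}" using N by simp
        then show ?thesis by simp
      qed
      then show ?case by (intro tendsto_eventually) (auto simp: eventually_sequentially)
    qed
  qed (use f i in \<open>auto simp: indicator_def\<close>)
  then have "(\<lambda>n. \<integral>t. indicator {..a + 1 / real (Suc n)} t * \<bar>f t\<bar> \<partial>?M) \<longlonglongrightarrow> 0" by simp
  from order_tendstoD(2)[OF this \<eta>] obtain n
    where n: "(\<integral>t. indicator {..a + 1 / real (Suc n)} t * \<bar>f t\<bar> \<partial>?M) < \<eta>"
    by (auto simp: eventually_sequentially)
  show thesis
  proof (rule that[of "1 / real (Suc n)"])
    show "(\<integral>t. indicator {..a + e'} t * \<bar>f t\<bar> \<partial>?M) < \<eta>" if "e' \<le> 1 / real (Suc n)" for e'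
    proof (rule le_less_trans[OF _ n], rule integral_mono[OF i i])
      show "indicator {..a + e'} t * \<bar>f t\<bar> \<le> indicator {..a + 1 / real (Suc n)} t * \<bar>f t\<bar>" for t
        using that by (auto simp: indicator_def)
    qed
  qed simp
qed

definition bump :: "real \<Rightarrow> real \<Rightarrow> real \<Rightarrow> real \<Rightarrow> real" where
  "bump p q \<sigma> t = max 0 (min 1 (1 - max (p - t) (t - q) / \<sigma>))"

lemma bump_range: "0 \<le> bump p q \<sigma> t" "bump p q \<sigma> t \<le> 1" by (auto simp: bump_def)

lemma continuous_bump: "\<sigma> > 0 \<Longrightarrow> continuous_on S (bump p q \<sigma>)"
  unfolding bump_def by (intro continuous_intros) auto

lemma bump_inside: "\<sigma> > 0 \<Longrightarrow> t \<in> {p..q} \<Longrightarrow> bump p q \<sigma> t = 1"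
proof -
  assume \<sigma>: "\<sigma> > 0" and "t \<in> {p..q}"
  then have "max (p - t) (t - q) / \<sigma> \<le> 0" by (intro divide_nonpos_pos) auto
  then show ?thesis by (simp add: bump_def)
qed

lemma bump_outside: "\<sigma> > 0 \<Longrightarrow> t \<le> p - \<sigma> \<or> q + \<sigma> \<le> t \<Longrightarrow> bump p q \<sigma> t = 0"
proof -
  assume \<sigma>: "\<sigma> > 0" and "t \<le> p - \<sigma> \<or> q + \<sigma> \<le> t"
  then have "\<sigma> \<le> max (p - t) (t - q)" by auto
  then have "1 \<le> max (p - t) (t - q) / \<sigma>" using \<sigma> by simp
  then show ?thesis by (simp add: bump_def)
qed

text \<open>Pieces on disjoint intervals that shrink to \<open>a\<close> are glued to one continuous function when their
  sizes are summable.\<close>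

lemma glue_pieces:
  fixes d :: "nat \<Rightarrow> real \<Rightarrow> 'x::banach"
  assumes e: "\<And>j. 0 < e' j" "\<And>j. e' j < e j" "\<And>j. e (Suc j) \<le> e' j / 2"
    and d: "\<And>j. continuous_on {a..b} (d j)" "\<And>j t. t \<in> {a..b} \<Longrightarrow> norm (d j t) \<le> (1 / 2) ^ j"
  obtains G where "continuous_on {a..b} G" "G a = 0"
    "\<And>j t. t \<in> {a + e' j..a + e j} \<Longrightarrow> G t = d j t"
proof -
  have dec: "e i \<le> e' j / 2" if "j < i" for i j
    using that
  proof (induction i)
    case (Suc i)
    show ?case
    proof (cases "j = i")
      case False
      then have "e i \<le> e' j / 2" using Suc by simp
      then show ?thesis using e(3)[of i] e(2)[of i] e(1)[of i] by linarith
    qed (use e(3) in simp)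
  qed simp
  define \<phi> where "\<phi> = (\<lambda>j. bump (a + e' j) (a + e j) (e' j / 4))"
  have \<sigma>: "e' j / 4 > 0" for j using e(1) by simp
  have \<phi>a: "\<phi> j a = 0" for j unfolding \<phi>_def by (rule bump_outside[OF \<sigma>]) (use e(1)[of j] in simp)
  have \<phi>1: "\<phi> j t = 1" if "t \<in> {a + e' j..a + e j}" for j t
    unfolding \<phi>_def by (rule bump_inside[OF \<sigma> that])
  have \<phi>0: "\<phi> i t = 0" if t: "t \<in> {a + e' j..a + e j}" and ij: "i \<noteq> j" for i j t
  proof -
    have "t \<le> (a + e' i) - e' i / 4 \<or> (a + e i) + e' i / 4 \<le> t"
    proof (cases "i < j")
      case True
      then have "e j \<le> e' i / 2" by (rule dec)
      then have "t \<le> (a + e' i) - e' i / 4" using t e(1)[of i] by simp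
      then show ?thesis ..
    next
      case False
      then have "e i \<le> e' j / 2" using ij by (intro dec) simp
      then have "(a + e i) + e' i / 4 \<le> t" using t e(2)[of i] e(1)[of j] e(1)[of i] by simp
      then show ?thesis ..
    qed
    then show ?thesis unfolding \<phi>_def by (rule bump_outside[OF \<sigma>])
  qed
  define G where "G = (\<lambda>t. suminf (\<lambda>j. \<phi> j t *\<^sub>R d j t))"
  have "uniform_limit {a..b} (\<lambda>n t. \<Sum>j<n. \<phi> j t *\<^sub>R d j t) G sequentially"
    unfolding G_def
  proof (rule Weierstrass_m_test[where M = "\<lambda>j. (1 / 2) ^ j"])
    show "norm (\<phi> j t *\<^sub>R d j t) \<le> (1 / 2) ^ j" if "t \<in> {a..b}" for j t
    proof -
      have "norm (\<phi> j t *\<^sub>R d j t) = \<phi> j t * norm (d j t)" using bump_range(1) by (simp add: \<phi>_def)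
      also have "\<dots> \<le> 1 * (1 / 2) ^ j"
        by (intro mult_mono d that) (auto simp: \<phi>_def bump_range)
      finally show ?thesis by simp
    qed
    show "summable (\<lambda>j. (1 / 2) ^ j :: real)" by (rule summable_geometric) simp
  qed
  moreover have "continuous_on {a..b} (\<lambda>t. \<Sum>j<n. \<phi> j t *\<^sub>R d j t)" for n
    unfolding \<phi>_def by (intro continuous_intros continuous_bump \<sigma> d)
  ultimately have "continuous_on {a..b} G"
    by (intro uniform_limit_theorem[where F = sequentially and f = "\<lambda>n t. \<Sum>j<n. \<phi> j t *\<^sub>R d j t"]) auto
  moreover have "G a = 0" by (simp add: G_def \<phi>a)
  moreover have "G t = d j t" if t: "t \<in> {a + e' j..a + e j}" for j t
  proof -
    have "G t = (\<Sum>i\<in>{j}. \<phi> i t *\<^sub>R d i t)"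
      unfolding G_def by (rule suminf_finite) (use \<phi>0[OF t] in auto)
    then show ?thesis using \<phi>1[OF t] by simp
  qed
  ultimately show thesis by (rule that)
qed

text \<open>In this form lower semicontinuity can be combined with dominated convergence.\<close>

lemma lower_semicontinuous_min_limit:
  fixes f :: "'a::topological_space \<Rightarrow> real"
  assumes f: "lower_semicontinuous f" and x: "x \<longlonglongrightarrow> l"
  shows "(\<lambda>n. min (f (x n)) (f l)) \<longlonglongrightarrow> f l"
proof (rule LIMSEQ_I)
  fix e :: real assume e: "e > 0"
  have "\<forall>\<^sub>F y in nhds l. f l - e < f y" using f e unfolding lower_semicontinuous_def by simp
  from eventually_compose_filterlim[OF this x] obtain N where "\<And>n. n \<ge> N \<Longrightarrow> f l - e < f (x n)"
    by (auto simp: eventually_sequentially)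
  then have "norm (min (f (x n)) (f l) - f l) < e" if "n \<ge> N" for n
    using e that by (fastforce simp: min_def)
  then show "\<exists>N. \<forall>n\<ge>N. norm (min (f (x n)) (f l) - f l) < e" by blast
qed

locale feedback_cost = feedback D a b p C k s0 w Cw Cs cU U aU k4
  for D :: "'x::banach set" and a b p C :: real
    and k :: "real \<Rightarrow> real \<Rightarrow> ('y::{real_inner, banach, second_countable_topology} \<Rightarrow>\<^sub>L 'x)"
    and s0 :: "real \<Rightarrow> 'x" and w :: "real \<Rightarrow> real" and Cw Cs cU :: real
    and U :: "real \<Rightarrow> 'x \<Rightarrow> 'y set" and aU k4 :: "real \<Rightarrow> real" +
  fixes h :: "real \<Rightarrow> 'x \<Rightarrow> 'y \<Rightarrow> real" and k1 k2 :: "real \<Rightarrow> real" and ch :: real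
  assumes k12: "L1_nonneg a b k1" "L1_nonneg a b k2" and ch: "ch \<ge> 0"
    and h_growth: "AE t in lebesgue_on {a..b}. \<forall>x u. \<bar>h t x u\<bar> \<le> k1 t + k2 t * norm x + ch * norm u"
    and h_convex: "AE t in lebesgue_on {a..b}. \<forall>x.
          lower_semicontinuous (\<lambda>u. h t x u) \<and> convex_on UNIV (\<lambda>u. h t x u)"
    and h_lip: "\<And>E. bounded E \<Longrightarrow> \<exists>aE. L2_nonneg a b aE \<and>
          (AE t in lebesgue_on {a..b}. \<forall>x y. \<forall>u\<in>E. \<bar>h t x u - h t y u\<bar> \<le> aE t * norm (x - y))"
    and h_integrable: "\<And>r u. continuous_on {a..b} r \<Longrightarrow> r a = 0 \<Longrightarrow> u \<in> L2 a b \<Longrightarrow>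
          integrable (lebesgue_on {a..b}) (\<lambda>t. h t (s0 t + r t) (u t))"
begin

text \<open>The functions \<open>h t (s0 t + R n t) (u n t)\<close> have uniformly small integrals near \<open>a\<close>, although the
  growth condition gives no integrable majorant there. Otherwise infinitely many
  of them have an integral bounded below over disjoint intervals shrinking to \<open>a\<close>; the states and
  controls on these intervals can be glued to one state and one control, whose cost would not be
  integrable.\<close>

lemma uniformly_small_near_start:
  fixes u :: "nat \<Rightarrow> real \<Rightarrow> 'y"
  assumes g: "g \<in> L2 a b" and um: "\<And>n. u n \<in> borel_measurable MI"
    and ub: "\<And>n. AE t in MI. norm (u n t) \<le> g t"
    and R: "\<And>n. continuous_on {a..b} (R n)" "\<And>n. R n a = 0"
    and r: "continuous_on {a..b} r" "r a = 0"
    and lim: "uniform_limit {a..b} R r sequentially" and \<eta>: "\<eta> > 0"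
  shows "\<exists>e>0. \<exists>K. \<forall>n\<ge>K. (\<integral>t. indicator {..a + e} t * \<bar>h t (s0 t + R n t) (u n t)\<bar> \<partial>MI) \<le> \<eta>"
proof (rule ccontr)
  assume neg: "\<not> ?thesis"
  define f where "f = (\<lambda>n t. h t (s0 t + R n t) (u n t))"
  have uL: "u n \<in> L2 a b" for n by (rule L2_bounded(1)[OF g um ub])
  have fi: "integrable MI (f n)" for n unfolding f_def by (rule h_integrable[OF R uL])
  have fa: "integrable MI (\<lambda>t. indicator S t * \<bar>f n t\<bar>)" if "S \<in> sets borel" for n S
    using fi that by (intro integrable_indicator_times) auto
  have big: "\<exists>n\<ge>K. \<eta> < (\<integral>t. indicator {..a + e} t * \<bar>f n t\<bar> \<partial>MI)" if "e > 0" for e K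
    using neg that unfolding f_def not_le[symmetric] by blast
  define P where "P = (\<lambda>(j::nat) (x :: nat \<times> real \<times> real). case x of (n, e, e') \<Rightarrow> 0 < e' \<and> e' < e \<and>
     (\<forall>t\<in>{a..b}. norm (R n t - r t) \<le> (1 / 2) ^ j) \<and> \<eta> / 2 < (\<integral>t. indicator {a + e'..a + e} t * \<bar>f n t\<bar> \<partial>MI))"
  have ex: "\<exists>n e'. P j (n, e, e')" if e: "e > 0" for j e
  proof -
    have "\<forall>\<^sub>F n in sequentially. \<forall>t\<in>{a..b}. dist (R n t) (r t) < (1 / 2) ^ j"
      using uniform_limitD[OF lim, of "(1 / 2) ^ j"] by simp
    then obtain K where K: "\<And>n t. n \<ge> K \<Longrightarrow> t \<in> {a..b} \<Longrightarrow> dist (R n t) (r t) < (1 / 2) ^ j"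
      unfolding eventually_sequentially by blast
    obtain n where n: "n \<ge> K" "\<eta> < (\<integral>t. indicator {..a + e} t * \<bar>f n t\<bar> \<partial>MI)" using big[OF e, of K] by blast
    obtain e0 where e0: "e0 > 0" "\<And>e'. e' \<le> e0 \<Longrightarrow> (\<integral>t. indicator {..a + e'} t * \<bar>f n t\<bar> \<partial>MI) < \<eta> / 2"
      using small_initial_integral[OF fi, of "\<eta> / 2" n] \<eta> by auto
    define e' where "e' = min e0 (e / 2)"
    have e': "0 < e'" "e' < e" "e' \<le> e0" using e e0(1) by (auto simp: e'_def)
    have "(\<integral>t. indicator {..a + e} t * \<bar>f n t\<bar> \<partial>MI)
        \<le> (\<integral>t. indicator {..a + e'} t * \<bar>f n t\<bar> + indicator {a + e'..a + e} t * \<bar>f n t\<bar> \<partial>MI)"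
      by (intro integral_mono Bochner_Integration.integrable_add fa) (auto simp: indicator_def)
    also have "\<dots> = (\<integral>t. indicator {..a + e'} t * \<bar>f n t\<bar> \<partial>MI) + (\<integral>t. indicator {a + e'..a + e} t * \<bar>f n t\<bar> \<partial>MI)"
      by (intro Bochner_Integration.integral_add fa) auto
    finally have "\<eta> / 2 < (\<integral>t. indicator {a + e'..a + e} t * \<bar>f n t\<bar> \<partial>MI)"
      using n(2) e0(2)[OF e'(3)] by linarith
    moreover have "norm (R n t - r t) \<le> (1 / 2) ^ j" if "t \<in> {a..b}" for t
      using K[OF n(1) that] by (simp add: dist_norm)
    ultimately have "P j (n, e, e')" using e' unfolding P_def by simp
    then show ?thesis by blast
  qed
  have "\<exists>F. \<forall>j. P j (F j) \<and> fst (snd (F (Suc j))) \<le> snd (snd (F j)) / 2"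
  proof (rule dependent_nat_choice)
    show "\<exists>x. P 0 x" using ex[of 1 0] by auto
    fix x j assume "P j x"
    then have "snd (snd x) / 2 > 0" by (auto simp: P_def split: prod.splits)
    from ex[OF this, of "Suc j"] obtain n e' where "P (Suc j) (n, snd (snd x) / 2, e')" by blast
    then show "\<exists>y. P (Suc j) y \<and> fst (snd y) \<le> snd (snd x) / 2"
      by (intro exI[of _ "(n, snd (snd x) / 2, e')"]) simp
  qed
  then obtain F where F: "\<And>j. P j (F j)" "\<And>j. fst (snd (F (Suc j))) \<le> snd (snd (F j)) / 2" by blast
  define \<kappa> e e' where "\<kappa> = (\<lambda>j. fst (F j))" and "e = (\<lambda>j. fst (snd (F j)))" and "e' = (\<lambda>j. snd (snd (F j)))"
  have "P j (\<kappa> j, e j, e' j)" for j using F(1)[of j] by (simp add: \<kappa>_def e_def e'_def)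
  then have e: "0 < e' j" "e' j < e j" and close: "\<And>t. t \<in> {a..b} \<Longrightarrow> norm (R (\<kappa> j) t - r t) \<le> (1 / 2) ^ j"
    and large: "\<eta> / 2 < (\<integral>t. indicator {a + e' j..a + e j} t * \<bar>f (\<kappa> j) t\<bar> \<partial>MI)" for j
    unfolding P_def by auto
  have e_Suc: "e (Suc j) \<le> e' j / 2" for j using F(2)[of j] by (simp add: e_def e'_def)
  obtain G where G: "continuous_on {a..b} G" "G a = 0"
    "\<And>j t. t \<in> {a + e' j..a + e j} \<Longrightarrow> G t = R (\<kappa> j) t - r t"
    by (rule glue_pieces[of e' e a b "\<lambda>j t. R (\<kappa> j) t - r t", OF e e_Suc])
      (use close R r in \<open>auto intro!: continuous_intros\<close>)
  have dec: "e j \<le> e' i / 2" if "i < j" for i j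
    using that
  proof (induction j)
    case (Suc j)
    show ?case
    proof (cases "i = j")
      case False
      then have "e j \<le> e' i / 2" using Suc by simp
      then show ?thesis using e_Suc[of j] e(2)[of j] e(1)[of j] by linarith
    qed (use e_Suc in simp)
  qed simp
  define J where "J = (\<lambda>t. LEAST j. t \<in> {a + e' j..a + e j})"
  have J: "J t = j" if t: "t \<in> {a + e' j..a + e j}" for t j
    unfolding J_def
  proof (rule Least_equality[where P = "\<lambda>j. t \<in> {a + e' j..a + e j}", OF t], rule ccontr)
    fix i assume i: "t \<in> {a + e' i..a + e i}" and "\<not> j \<le> i"
    then have "e j \<le> e' i / 2" by (intro dec) simp
    then show False using i t e(1)[of i] by simp
  qed
  have Jm: "J \<in> MI \<rightarrow>\<^sub>M count_space UNIV"
    unfolding J_def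
  proof (rule measurable_Least)
    show "(\<lambda>t. t \<in> {a + e' j..a + e j}) \<in> MI \<rightarrow>\<^sub>M count_space UNIV" for j
      using borel_Int_sets[of "{a + e' j..a + e j}" a b]
      unfolding pred_def by (simp add: Int_def conj_commute)
  qed
  define v where "v = (\<lambda>t. u (\<kappa> (J t)) t)"
  have vm: "v \<in> borel_measurable MI"
    unfolding v_def by (rule measurable_compose_countable[OF _ Jm, where f = "\<lambda>j. u (\<kappa> j)"]) (rule um)
  have "AE t in MI. \<forall>n. norm (u n t) \<le> g t" using ub by (simp add: AE_all_countable)
  then have vb: "AE t in MI. norm (v t) \<le> g t" unfolding v_def by eventually_elim blast
  have vL: "v \<in> L2 a b" by (rule L2_bounded(1)[OF g vm vb])
  define q where "q = (\<lambda>t. h t (s0 t + (r t + G t)) (v t))"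
  have qi: "integrable MI q"
    unfolding q_def by (rule h_integrable[OF _ _ vL]) (use r G in \<open>auto intro!: continuous_intros\<close>)
  have qeq: "q t = f (\<kappa> j) t" if "t \<in> {a + e' j..a + e j}" for j t
    unfolding q_def f_def v_def J[OF that] G(3)[OF that] by simp
  obtain e0 where e0: "e0 > 0" "\<And>x. x \<le> e0 \<Longrightarrow> (\<integral>t. indicator {..a + x} t * \<bar>q t\<bar> \<partial>MI) < \<eta> / 2"
    using small_initial_integral[OF qi, of "\<eta> / 2"] \<eta> by auto
  \<comment> \<open>some interval lies in the region where the glued cost has a small integral\<close>
  have half: "e j \<le> e 0 * (1 / 2) ^ j" for j
  proof (induction j)
    case (Suc j)
    have "e (Suc j) \<le> e j / 2" using e_Suc[of j] e(2)[of j] by linarith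
    then show ?case using Suc by simp
  qed simp
  obtain j where j: "(1 / 2) ^ j < e0 / (e 0)"
    using real_arch_pow_inv[of "e0 / e 0" "1 / 2"] e0(1) e(1)[of 0] e(2)[of 0] by auto
  then have "e 0 * (1 / 2) ^ j < e0" using e(1)[of 0] e(2)[of 0] by (simp add: field_simps)
  then have ej: "e j \<le> e0" using half[of j] by linarith
  have "(\<integral>t. indicator {a + e' j..a + e j} t * \<bar>f (\<kappa> j) t\<bar> \<partial>MI) \<le> (\<integral>t. indicator {..a + e j} t * \<bar>q t\<bar> \<partial>MI)"
  proof (rule integral_mono)
    show "integrable MI (\<lambda>t. indicator {..a + e j} t * \<bar>q t\<bar>)"
      using qi by (intro integrable_indicator_times) auto
    show "indicator {a + e' j..a + e j} t * \<bar>f (\<kappa> j) t\<bar> \<le> indicator {..a + e j} t * \<bar>q t\<bar>" for t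
      using qeq[of t j] by (auto simp: indicator_def)
  qed (rule fa, simp)
  also have "\<dots> < \<eta> / 2" by (rule e0(2)[OF ej])
  finally show False using large[of j] by simp
qed

text \<open>Away from \<open>a\<close> the Lipschitz condition in the state allows replacing \<open>R n\<close> by its limit \<open>r\<close>; then
  convexity bounds the cost of the convex combinations of the controls, and lower semicontinuity in the
  control passes to their limit.\<close>

lemma cost_lower_semicontinuous:
  fixes u :: "nat \<Rightarrow> real \<Rightarrow> 'y"
  assumes g: "g \<in> L2 a b" and um: "\<And>n. u n \<in> borel_measurable MI"
    and ub: "\<And>n. AE t in MI. norm (u n t) \<le> g t"
    and R: "\<And>n. continuous_on {a..b} (R n)" "\<And>n. R n a = 0"
    and r: "continuous_on {a..b} r" "r a = 0"
    and lim: "uniform_limit {a..b} R r sequentially"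
    and c: "\<And>n. c n \<in> tail_weights n"
    and v: "v \<in> L2 a b" "AE t in MI. norm (v t) \<le> g t" "AE t in MI. (\<lambda>n. comb u (c n) t) \<longlonglongrightarrow> v t"
    and le: "\<And>n. n \<ge> K0 \<Longrightarrow> (\<integral>t. h t (s0 t + R n t) (u n t) \<partial>MI) \<le> \<mu>"
  shows "(\<integral>t. h t (s0 t + r t) (v t) \<partial>MI) \<le> \<mu>"
proof (rule field_le_epsilon)
  fix \<epsilon> :: real assume \<epsilon>: "\<epsilon> > 0"
  define \<eta> where "\<eta> = \<epsilon> / 3"
  have \<eta>: "\<eta> > 0" using \<epsilon> by (simp add: \<eta>_def)
  define f where "f = (\<lambda>n t. h t (s0 t + R n t) (u n t))"
  define q where "q = (\<lambda>n t. h t (s0 t + r t) (u n t))"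
  define V where "V = (\<lambda>n t. h t (s0 t + r t) (comb u (c n) t))"
  define f0 where "f0 = (\<lambda>t. h t (s0 t + r t) (v t))"
  have uL: "u n \<in> L2 a b" for n by (rule L2_bounded(1)[OF g um ub])
  have ub': "AE t in MI. \<forall>n. norm (u n t) \<le> g t" using ub by (simp add: AE_all_countable)
  have cb: "AE t in MI. \<forall>n. norm (comb u (c n) t) \<le> g t"
    using ub' by eventually_elim (intro allI, rule norm_comb_le[OF c], blast)
  have cL: "comb u (c n) \<in> L2 a b" for n
  proof (rule L2_bounded(1)[OF g])
    show "comb u (c n) \<in> borel_measurable MI" unfolding comb_def[abs_def] using um by measurable
    show "AE t in MI. norm (comb u (c n) t) \<le> g t" using cb by eventually_elim blast
  qed
  have fi: "integrable MI (f n)" and qi: "integrable MI (q n)" and Vi: "integrable MI (V n)" and f0i: "integrable MI f0" for n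
    unfolding f_def q_def V_def f0_def by (intro h_integrable R r uL cL v)+
  obtain e1 where e1': "e1 > 0 \<and> (\<exists>K. \<forall>n\<ge>K. (\<integral>t. indicator {..a + e1} t * \<bar>f n t\<bar> \<partial>MI) \<le> \<eta>)"
    using uniformly_small_near_start[OF g um ub R r lim \<eta>] unfolding f_def ..
  obtain K1 where K1: "\<forall>n\<ge>K1. (\<integral>t. indicator {..a + e1} t * \<bar>f n t\<bar> \<partial>MI) \<le> \<eta>"
    using e1'[THEN conjunct2] ..
  note e1 = e1'[THEN conjunct1] K1[rule_format]
  obtain e2 where e2: "e2 > 0" "\<And>e'. e' \<le> e2 \<Longrightarrow> (\<integral>t. indicator {..a + e'} t * \<bar>f0 t\<bar> \<partial>MI) < \<eta>"
    using small_initial_integral[OF f0i \<eta>] by auto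
  define e where "e = min e1 e2"
  have e: "e > 0" "e \<le> e1" "e \<le> e2" using e1(1) e2(1) by (auto simp: e_def)
  define \<xi> where "\<xi> = (\<lambda>t. indicator {a + e<..} t :: real)"
  have \<xi>i: "integrable MI (\<lambda>t. \<xi> t * F t)" if "integrable MI F" for F :: "real \<Rightarrow> real"
    unfolding \<xi>_def using that by (intro integrable_indicator_times) auto
  have \<iota>i: "integrable MI (\<lambda>t. indicator {..a + x} t * F t)" if "integrable MI F" for F :: "real \<Rightarrow> real" and x :: real
    using that by (intro integrable_indicator_times) auto
  have split: "(\<integral>t. F t \<partial>MI) = (\<integral>t. indicator {..a + e} t * F t \<partial>MI) + (\<integral>t. \<xi> t * F t \<partial>MI)" if F: "integrable MI F" for F :: "real \<Rightarrow> real"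
  proof -
    have "(\<integral>t. F t \<partial>MI) = (\<integral>t. indicator {..a + e} t * F t + \<xi> t * F t \<partial>MI)"
      by (intro Bochner_Integration.integral_cong) (auto simp: \<xi>_def indicator_def)
    also have "\<dots> = (\<integral>t. indicator {..a + e} t * F t \<partial>MI) + (\<integral>t. \<xi> t * F t \<partial>MI)"
      by (intro Bochner_Integration.integral_add \<iota>i \<xi>i F)
    finally show ?thesis .
  qed
  have start: "\<bar>\<integral>t. indicator {..a + e} t * F t \<partial>MI\<bar> \<le> (\<integral>t. indicator {..a + x} t * \<bar>F t\<bar> \<partial>MI)"
    if F: "integrable MI F" and x: "e \<le> x" for F :: "real \<Rightarrow> real" and x :: real
  proof -
    have "\<bar>\<integral>t. indicator {..a + e} t * F t \<partial>MI\<bar> \<le> (\<integral>t. \<bar>indicator {..a + e} t * F t\<bar> \<partial>MI)"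
      by (rule integral_abs_bound)
    also have "\<dots> \<le> (\<integral>t. indicator {..a + x} t * \<bar>F t\<bar> \<partial>MI)"
      using F x by (intro integral_mono integrable_abs \<iota>i) (auto simp: indicator_def)
    finally show ?thesis .
  qed
  \<comment> \<open>away from \<open>a\<close> the states are bounded, and the growth condition gives a majorant \<open>W\<close>\<close>
  have "bounded (s0 ` {a + e..b})"
    using e(1) by (intro compact_imp_bounded compact_continuous_image continuous_on_subset[OF s0]) auto
  then obtain C1 where C1: "\<And>t. t \<in> {a + e..b} \<Longrightarrow> norm (s0 t) \<le> C1" unfolding bounded_iff by blast
  have "bounded (r ` {a..b})" by (intro compact_imp_bounded compact_continuous_image r) auto
  then obtain C2 where C2: "\<And>t. t \<in> {a..b} \<Longrightarrow> norm (r t) \<le> C2" unfolding bounded_iff by blast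
  have "\<forall>\<^sub>F n in sequentially. \<forall>t\<in>{a..b}. dist (R n t) (r t) < 1" using uniform_limitD[OF lim, of 1] by simp
  then obtain K2 where K2: "\<And>n t. n \<ge> K2 \<Longrightarrow> t \<in> {a..b} \<Longrightarrow> dist (R n t) (r t) < 1"
    unfolding eventually_sequentially by blast
  define c0 where "c0 = \<bar>C1\<bar> + \<bar>C2\<bar> + 1"
  have st: "norm (s0 t + r t) \<le> c0" "n \<ge> K2 \<Longrightarrow> norm (s0 t + R n t) \<le> c0" if t: "t \<in> {a + e..b}" for t n
  proof -
    have t': "t \<in> {a..b}" using t e(1) by auto
    have 1: "norm (s0 t + r t) \<le> C1 + C2" by (rule order_trans[OF norm_triangle_ineq add_mono[OF C1[OF t] C2[OF t']]])
    then show "norm (s0 t + r t) \<le> c0" by (simp add: c0_def)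
    assume n: "n \<ge> K2"
    have "norm (s0 t + R n t) \<le> norm (s0 t + r t) + norm (R n t - r t)"
      using norm_triangle_ineq[of "s0 t + r t" "R n t - r t"] by simp
    then show "norm (s0 t + R n t) \<le> c0" using 1 K2[OF n t'] by (simp add: c0_def dist_norm)
  qed
  define W where "W = (\<lambda>t. k1 t + k2 t * c0 + ch * g t)"
  have Wi: "integrable MI W"
  proof -
    interpret finite_measure MI by (rule finite_MI)
    have "integrable MI (\<lambda>t. 1 * g t)"
      by (rule Cauchy_Schwarz_integral(1)) (use g in \<open>auto simp: L2_def\<close>)
    then show ?thesis using k12 unfolding W_def L1_nonneg_def by simp
  qed
  have W0: "AE t in MI. 0 \<le> W t"
    using ub[of 0] AE_half_open
  proof eventually_elim
    case (elim t)
    have "0 \<le> g t" by (rule order_trans[OF norm_ge_zero elim(1)])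
    then show ?case using k12 ch elim(2) by (auto simp: W_def L1_nonneg_def c0_def intro!: add_nonneg_nonneg mult_nonneg_nonneg)
  qed
  have W: "AE t in MI. \<forall>x y. norm x \<le> c0 \<longrightarrow> norm y \<le> g t \<longrightarrow> \<bar>h t x y\<bar> \<le> W t"
    using h_growth AE_half_open
  proof eventually_elim
    case (elim t)
    show ?case
    proof (intro allI impI)
      fix x :: 'x and y :: 'y assume xy: "norm x \<le> c0" "norm y \<le> g t"
      have "k2 t \<ge> 0" using k12(2) elim(2) by (simp add: L1_nonneg_def)
      then have "k2 t * norm x \<le> k2 t * c0" "ch * norm y \<le> ch * g t" using xy ch by (auto intro: mult_left_mono)
      moreover have "\<bar>h t x y\<bar> \<le> k1 t + k2 t * norm x + ch * norm y" using elim(1) by blast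
      ultimately show "\<bar>h t x y\<bar> \<le> W t" unfolding W_def by linarith
    qed
  qed
  \<comment> \<open>the controls are bounded at almost every time, so the Lipschitz condition applies on a ball\<close>
  have lip: "AE t in MI. \<forall>N::nat. \<exists>L. \<forall>x y. \<forall>u\<in>cball 0 (real N). \<bar>h t x u - h t y u\<bar> \<le> L * norm (x - y)"
    unfolding AE_all_countable
  proof
    fix N :: nat
    obtain aE where aE: "AE t in MI. \<forall>x y. \<forall>u\<in>cball 0 (real N). \<bar>h t x u - h t y u\<bar> \<le> aE t * norm (x - y)"
      using h_lip[OF bounded_cball[of 0 "real N"]] by blast
    show "AE t in MI. \<exists>L. \<forall>x y. \<forall>u\<in>cball 0 (real N). \<bar>h t x u - h t y u\<bar> \<le> L * norm (x - y)"
      using aE by eventually_elim (rule exI)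
  qed
  have "(\<lambda>n. \<integral>t. \<bar>\<xi> t * (f (n + K2) t - q (n + K2) t)\<bar> \<partial>MI) \<longlonglongrightarrow> (\<integral>t. 0 \<partial>MI)"
  proof (rule integral_dominated_convergence[where w = "\<lambda>t. 2 * W t"])
    show "AE t in MI. (\<lambda>n. \<bar>\<xi> t * (f (n + K2) t - q (n + K2) t)\<bar>) \<longlonglongrightarrow> 0"
      using lip ub' AE_half_open
    proof eventually_elim
      case (elim t)
      have t: "t \<in> {a..b}" using elim(3) by auto
      obtain N :: nat where N: "g t \<le> real N" using real_arch_simple by blast
      obtain L where L: "\<And>x y u. u \<in> cball 0 (real N) \<Longrightarrow> \<bar>h t x u - h t y u\<bar> \<le> L * norm (x - y)"
        using elim(1) by blast
      have uN: "u n t \<in> cball 0 (real N)" for n using elim(2) N order_trans by (auto simp: dist_norm)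
      have "(\<lambda>n. R (n + K2) t) \<longlonglongrightarrow> r t" by (rule LIMSEQ_ignore_initial_segment[OF tendsto_uniform_limitI[OF lim t]])
      then have "(\<lambda>n. L * norm ((s0 t + R (n + K2) t) - (s0 t + r t))) \<longlonglongrightarrow> L * norm ((s0 t + r t) - (s0 t + r t))"
        by (intro tendsto_intros)
      then have z: "(\<lambda>n. L * norm ((s0 t + R (n + K2) t) - (s0 t + r t))) \<longlonglongrightarrow> 0" by simp
      show ?case
      proof (rule Lim_null_comparison[OF always_eventually z], intro allI)
        fix n
        have "\<bar>f (n + K2) t - q (n + K2) t\<bar> \<le> L * norm ((s0 t + R (n + K2) t) - (s0 t + r t))"
          unfolding f_def q_def by (rule L[OF uN])
        then show "norm \<bar>\<xi> t * (f (n + K2) t - q (n + K2) t)\<bar> \<le> L * norm ((s0 t + R (n + K2) t) - (s0 t + r t))"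
          by (auto simp: \<xi>_def indicator_def)
      qed
    qed
    show "AE t in MI. norm \<bar>\<xi> t * (f (n + K2) t - q (n + K2) t)\<bar> \<le> 2 * W t" for n
      using W ub' AE_half_open W0
    proof eventually_elim
      case (elim t)
      show ?case
      proof (cases "t \<in> {a + e<..}")
        case True
        then have t: "t \<in> {a + e..b}" using elim(3) by auto
        have "\<bar>f (n + K2) t\<bar> \<le> W t" unfolding f_def
          by (rule elim(1)[rule_format, OF st(2)[OF t] elim(2)[rule_format]]) simp
        moreover have "\<bar>q (n + K2) t\<bar> \<le> W t" unfolding q_def
          by (rule elim(1)[rule_format, OF st(1)[OF t] elim(2)[rule_format]])
        ultimately show ?thesis using True by (simp add: \<xi>_def)
      next
        case False
        then show ?thesis using elim(4) by (simp add: \<xi>_def)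
      qed
    qed
  qed (use fi qi Wi in \<open>auto intro!: borel_measurable_integrable \<xi>i integrable_abs Bochner_Integration.integrable_diff\<close>)
  then have "(\<lambda>n. \<integral>t. \<bar>\<xi> t * (f (n + K2) t - q (n + K2) t)\<bar> \<partial>MI) \<longlonglongrightarrow> 0" by simp
  from LIMSEQ_offset[where f = "\<lambda>n. \<integral>t. \<bar>\<xi> t * (f n t - q n t)\<bar> \<partial>MI", OF this]
  have "\<forall>\<^sub>F n in sequentially. (\<integral>t. \<bar>\<xi> t * (f n t - q n t)\<bar> \<partial>MI) < \<eta>" by (rule order_tendstoD(2)[OF _ \<eta>])
  then obtain K3 where K3: "\<And>n. n \<ge> K3 \<Longrightarrow> (\<integral>t. \<bar>\<xi> t * (f n t - q n t)\<bar> \<partial>MI) < \<eta>"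
    unfolding eventually_sequentially by blast
  define K where "K = max K0 (max K1 K3)"
  have qb: "(\<integral>t. \<xi> t * q n t \<partial>MI) \<le> \<mu> + 2 * \<eta>" if n: "n \<ge> K" for n
  proof -
    have nK: "n \<ge> K0" "n \<ge> K1" "n \<ge> K3" using n by (auto simp: K_def)
    have "(\<integral>t. \<xi> t * q n t \<partial>MI) = (\<integral>t. \<xi> t * f n t \<partial>MI) - (\<integral>t. \<xi> t * (f n t - q n t) \<partial>MI)"
      using \<xi>i[OF fi[of n]] \<xi>i[OF qi[of n]] by (simp add: right_diff_distrib)
    moreover have "\<bar>\<integral>t. \<xi> t * (f n t - q n t) \<partial>MI\<bar> \<le> (\<integral>t. \<bar>\<xi> t * (f n t - q n t)\<bar> \<partial>MI)" by (rule integral_abs_bound)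
    moreover have "(\<integral>t. f n t \<partial>MI) \<le> \<mu>" using le[OF nK(1)] by (simp add: f_def)
    moreover have "\<bar>\<integral>t. indicator {..a + e} t * f n t \<partial>MI\<bar> \<le> \<eta>"
      using start[OF fi e(2), of n] e1(2)[OF nK(2)] by linarith
    ultimately show ?thesis using split[OF fi[of n]] K3[OF nK(3)] by linarith
  qed
  have Vb: "(\<integral>t. \<xi> t * V n t \<partial>MI) \<le> \<mu> + 2 * \<eta>" if n: "n \<ge> K" for n
  proof -
    obtain L where L: "\<And>k. 0 \<le> c n k" "\<And>k. k \<notin> {n..<L} \<Longrightarrow> c n k = 0" "(\<Sum>k\<in>{n..<L}. c n k) = 1"
      using c[of n] unfolding tail_weights_def by blast
    have Lne: "{n..<L} \<noteq> {}" using L(3) by force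
    have si: "integrable MI (\<lambda>t. \<Sum>k\<in>{n..<L}. c n k * (\<xi> t * q k t))"
      using \<xi>i[OF qi] by (intro Bochner_Integration.integrable_sum) simp
    have "(\<integral>t. \<xi> t * V n t \<partial>MI) \<le> (\<integral>t. (\<Sum>k\<in>{n..<L}. c n k * (\<xi> t * q k t)) \<partial>MI)"
    proof (rule integral_mono_AE[OF \<xi>i[OF Vi] si])
      show "AE t in MI. \<xi> t * V n t \<le> (\<Sum>k\<in>{n..<L}. c n k * (\<xi> t * q k t))"
        using h_convex
      proof eventually_elim
        case (elim t)
        have "comb u (c n) t = (\<Sum>k\<in>{n..<L}. c n k *\<^sub>R u k t)" by (rule comb_eq) (use L in auto)
        then have "V n t \<le> (\<Sum>k\<in>{n..<L}. c n k * q k t)"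
          unfolding V_def q_def using elim L Lne
            convex_on_sum[of "{n..<L}" UNIV "\<lambda>z. h t (s0 t + r t) z" "c n" "\<lambda>k. u k t"] by simp
        then have "\<xi> t * V n t \<le> \<xi> t * (\<Sum>k\<in>{n..<L}. c n k * q k t)"
          by (intro mult_left_mono) (auto simp: \<xi>_def)
        also have "\<dots> = (\<Sum>k\<in>{n..<L}. c n k * (\<xi> t * q k t))" by (simp add: sum_distrib_left mult.left_commute)
        finally show ?case .
      qed
    qed
    also have "\<dots> = (\<Sum>k\<in>{n..<L}. c n k * (\<integral>t. \<xi> t * q k t \<partial>MI))"
      using \<xi>i[OF qi] by (subst Bochner_Integration.integral_sum) auto
    also have "\<dots> \<le> (\<Sum>k\<in>{n..<L}. c n k * (\<mu> + 2 * \<eta>))"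
      by (intro sum_mono mult_left_mono qb L) (use n in auto)
    also have "\<dots> = \<mu> + 2 * \<eta>" unfolding sum_distrib_right[symmetric] L(3) by simp
    finally show ?thesis .
  qed
  have "(\<lambda>n. \<integral>t. \<xi> t * min (V n t) (f0 t) \<partial>MI) \<longlonglongrightarrow> (\<integral>t. \<xi> t * f0 t \<partial>MI)"
  proof (rule integral_dominated_convergence[where w = W])
    show "AE t in MI. (\<lambda>n. \<xi> t * min (V n t) (f0 t)) \<longlonglongrightarrow> \<xi> t * f0 t"
      using h_convex v(3)
    proof eventually_elim
      case (elim t)
      show ?case unfolding V_def f0_def
        by (intro tendsto_mult_left lower_semicontinuous_min_limit[OF _ elim(2)]) (use elim(1) in blast)
    qed
    show "AE t in MI. norm (\<xi> t * min (V n t) (f0 t)) \<le> W t" for n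
      using W cb v(2) AE_half_open W0
    proof eventually_elim
      case (elim t)
      show ?case
      proof (cases "t \<in> {a + e<..}")
        case True
        then have t: "t \<in> {a + e..b}" using elim(4) by auto
        have "\<bar>V n t\<bar> \<le> W t" unfolding V_def
          by (rule elim(1)[rule_format, OF st(1)[OF t] elim(2)[rule_format]])
        moreover have "\<bar>f0 t\<bar> \<le> W t" unfolding f0_def
          by (rule elim(1)[rule_format, OF st(1)[OF t] elim(3)])
        ultimately show ?thesis using True by (simp add: \<xi>_def)
      next
        case False
        then show ?thesis using elim(5) by (simp add: \<xi>_def)
      qed
    qed
    show "(\<lambda>t. \<xi> t * min (V n t) (f0 t)) \<in> borel_measurable MI" for n
      by (intro borel_measurable_integrable \<xi>i Bochner_Integration.integrable_min Vi f0i)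
  qed (use \<xi>i f0i Wi in auto)
  then have "(\<integral>t. \<xi> t * f0 t \<partial>MI) \<le> \<mu> + 2 * \<eta>"
  proof (rule LIMSEQ_le_const2, intro exI[of _ K] allI impI)
    fix n assume n: "n \<ge> K"
    have "(\<integral>t. \<xi> t * min (V n t) (f0 t) \<partial>MI) \<le> (\<integral>t. \<xi> t * V n t \<partial>MI)"
      by (intro integral_mono \<xi>i Bochner_Integration.integrable_min Vi f0i mult_left_mono) (auto simp: \<xi>_def)
    then show "(\<integral>t. \<xi> t * min (V n t) (f0 t) \<partial>MI) \<le> \<mu> + 2 * \<eta>" using Vb[OF n] by linarith
  qed
  moreover have "\<bar>\<integral>t. indicator {..a + e} t * f0 t \<partial>MI\<bar> \<le> \<eta>"
    using start[OF f0i e(3)] e2(2)[OF order_refl] by linarith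
  ultimately have "(\<integral>t. f0 t \<partial>MI) \<le> \<mu> + \<epsilon>" using split[OF f0i] unfolding \<eta>_def by linarith
  then show "(\<integral>t. h t (s0 t + r t) (v t) \<partial>MI) \<le> \<mu> + \<epsilon>" unfolding f0_def .
qed

definition J :: "(real \<Rightarrow> 'y) \<Rightarrow> real" where
  "J u = (\<integral>t. h t (s0 t + Q u t) (u t) \<partial>MI)"

text \<open>The minimizing sequence is taken with respect to the infimum in the extended reals, so that the
  value \<open>-\<infinity>\<close> is covered.\<close>

lemma minimizer: "\<exists>v. admissible v \<and> (\<forall>u. admissible u \<longrightarrow> J v \<le> J u)"
proof -
  let ?S = "(\<lambda>u. ereal (J u)) ` Collect admissible"
  have "?S \<noteq> {}" using admissible_exists by blast
  from Inf_as_limit[OF this] obtain s where s: "\<And>n. s n \<in> ?S" "s \<longlonglongrightarrow> Inf ?S" by blast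
  have "\<forall>n. \<exists>u. admissible u \<and> s n = ereal (J u)" using s(1) by blast
  then obtain u where u: "\<And>n. admissible (u n)" "\<And>n. s n = ereal (J (u n))" by metis
  obtain g where g: "g \<in> L2 a b" "\<And>u. admissible u \<Longrightarrow> AE t in MI. norm (u t) \<le> g t"
    using admissible_bound by blast
  have uL: "u n \<in> L2 a b" and uU: "AE t in MI. u n t \<in> U t (s0 t + Q (u n) t)" for n
    using u(1)[of n] by (auto simp: admissible_def)
  have um: "u n \<in> borel_measurable MI" for n using uL[of n] by (simp add: L2_def)
  have "\<exists>\<phi> c v. strict_mono (\<phi> :: nat \<Rightarrow> nat) \<and> (\<forall>n. c n \<in> tail_weights n) \<and> admissible v \<and>
    (AE t in MI. norm (v t) \<le> g t) \<and> uniform_limit {a..b} (\<lambda>n. Q (u (\<phi> n))) (Q v) sequentially \<and>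
    (AE t in MI. (\<lambda>n. comb (\<lambda>i. u (\<phi> i)) (c n) t) \<longlonglongrightarrow> v t)"
    by (rule solutions_closed[OF g(1) um g(2)[OF u(1)], where R = "\<lambda>n. Q (u n)", OF _ uU]) (simp, blast)
  then obtain \<phi> :: "nat \<Rightarrow> nat" and c v where \<phi>: "strict_mono \<phi>" and c: "\<And>n. c n \<in> tail_weights n" and v: "admissible v"
    and vb: "AE t in MI. norm (v t) \<le> g t"
    and lim: "uniform_limit {a..b} (\<lambda>n. Q (u (\<phi> n))) (Q v) sequentially"
    and vlim: "AE t in MI. (\<lambda>n. comb (\<lambda>i. u (\<phi> i)) (c n) t) \<longlonglongrightarrow> v t" by blast
  have vL: "v \<in> L2 a b" using v by (simp add: admissible_def)
  have "ereal (J v) \<le> Inf ?S"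
  proof (rule dense_ge)
    fix x assume x: "Inf ?S < x"
    show "ereal (J v) \<le> x"
    proof (cases x)
      case (real \<mu>)
      have "(\<lambda>n. s (\<phi> n)) \<longlonglongrightarrow> Inf ?S" using LIMSEQ_subseq_LIMSEQ[OF s(2) \<phi>] by (simp add: o_def)
      then have "\<forall>\<^sub>F n in sequentially. s (\<phi> n) < ereal \<mu>" using x unfolding real by (rule order_tendstoD(2))
      then obtain K0 where K0: "\<And>n. n \<ge> K0 \<Longrightarrow> J (u (\<phi> n)) < \<mu>"
        unfolding eventually_sequentially u(2) by auto
      have "J v \<le> \<mu>" unfolding J_def
      proof (rule cost_lower_semicontinuous[OF g(1), of "\<lambda>n. u (\<phi> n)" "\<lambda>n. Q (u (\<phi> n))" "Q v" c v K0])
        show "(\<integral>t. h t (s0 t + Q (u (\<phi> n)) t) (u (\<phi> n) t) \<partial>MI) \<le> \<mu>" if "n \<ge> K0" for n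
          using K0[OF that] by (simp add: J_def)
      qed (rule um g(2)[OF u(1)] continuous_Q uL Q_initial vL lim c vb vlim)+
      then show ?thesis by (simp add: real)
    qed (use x in auto)
  qed
  then have "J v \<le> J u'" if "admissible u'" for u'
    using that INF_lower[of u' "Collect admissible" "\<lambda>u. ereal (J u)"] order_trans by fastforce
  then show ?thesis using v by blast
qed

end

theorem theorem4p10:
  fixes a b \<alpha> \<beta> \<gamma> :: real
    and \<psi> \<psi>' :: "real \<Rightarrow> real"
    and D :: "'x::banach set" and A :: "'x \<Rightarrow> 'x"
    and T :: "real \<Rightarrow> 'x \<Rightarrow>\<^sub>L 'x"
    and B :: "'y::{real_inner, banach, second_countable_topology} \<Rightarrow>\<^sub>L 'x"
    and x0 :: 'x
    and U :: "real \<Rightarrow> 'x \<Rightarrow> 'y set"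
    and h :: "real \<Rightarrow> 'x \<Rightarrow> 'y \<Rightarrow> real"
  assumes "a < b"
    and "1 / 2 < \<alpha>" and "\<alpha> \<le> 1" and "0 \<le> \<beta>" and "\<beta> \<le> 1"
    and "\<gamma> = \<alpha> + \<beta> * (1 - \<alpha>)"
    and psi_deriv: "\<And>t. t \<in> {a..b} \<Longrightarrow> (\<psi> has_real_derivative \<psi>' t) (at t within {a..b})"
    and psi_C1: "continuous_on {a..b} \<psi>'"
    and psi_incr: "mono_on {a..b} \<psi>"
    and psi_nz: "\<And>t. t \<in> {a..b} \<Longrightarrow> \<psi>' t \<noteq> 0"
    and gen: "generates D A T"
    and T_compact: "\<And>t. t > 0 \<Longrightarrow> compact_operator (T t)"
    and U_values: "\<And>t x. t \<in> {a..b} \<Longrightarrow> U t x \<noteq> {} \<and> closed (U t x)"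
    and U1: "\<And>V. closed V \<Longrightarrow>
          {(t, x). t \<in> {a..b} \<and> U t x \<inter> V \<noteq> {}} \<in> sets (lebesgue_on {a..b} \<Otimes>\<^sub>M borel)"
    and U2: "\<And>t x. t \<in> {a..b} \<Longrightarrow> convex (U t x)"
    and U3: "\<exists>a\<^sub>U c\<^sub>U. L2_nonneg a b a\<^sub>U \<and> c\<^sub>U \<ge> 0 \<and>
          (AE t in lebesgue_on {a..b}. \<forall>x.
             set_norm (U t x) \<le> ereal (a\<^sub>U t + c\<^sub>U * (\<psi> t - \<psi> a) powr (1 - \<gamma>) * norm x))"
    and U4: "\<exists>k\<^sub>4. L1_nonneg a b k\<^sub>4 \<and>
          (AE t in lebesgue_on {a..b}. \<forall>x y.
             hausdorff_dist (U t x) (U t y)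
               \<le> ereal (k\<^sub>4 t * (\<psi> t - \<psi> a) powr (1 - \<gamma>) * norm (x - y)))"
    and H1: "\<And>x u. (\<lambda>t. h t x u) \<in> borel_measurable (lebesgue_on {a..b})"
    and H2: "\<exists>k\<^sub>1 k\<^sub>2 c\<^sub>h. L1_nonneg a b k\<^sub>1 \<and> L1_nonneg a b k\<^sub>2 \<and> c\<^sub>h \<ge> 0 \<and>
          (AE t in lebesgue_on {a..b}. \<forall>x u.
             \<bar>h t x u\<bar> \<le> k\<^sub>1 t + k\<^sub>2 t * norm x + c\<^sub>h * norm u)"
    and H3: "AE t in lebesgue_on {a..b}. \<forall>u. lower_semicontinuous (\<lambda>x. h t x u)"
    and H4: "AE t in lebesgue_on {a..b}. \<forall>x.
          lower_semicontinuous (\<lambda>u. h t x u) \<and> convex_on UNIV (\<lambda>u. h t x u)"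
    and H5: "\<And>E. bounded E \<Longrightarrow> \<exists>a\<^sub>E. L2_nonneg a b a\<^sub>E \<and>
          (AE t in lebesgue_on {a..b}. \<forall>x y. \<forall>u\<in>E. \<bar>h t x u - h t y u\<bar> \<le> a\<^sub>E t * norm (x - y))"
    \<comment> \<open>the cost is a well-defined real-valued functional on the whole space\<close>
    and J_real: "\<And>q u. q \<in> C_weighted a b \<psi> \<gamma> \<Longrightarrow> u \<in> L2 a b \<Longrightarrow>
          integrable (lebesgue_on {a..b}) (\<lambda>t. h t (q t) (u t))"
  shows "\<exists>(q', u') \<in> mild_solutions a b \<psi> \<psi>' \<alpha> \<beta> T B U x0.
           ereal (cost a b h q' u')
             = (INF (q, u) \<in> mild_solutions a b \<psi> \<psi>' \<alpha> \<beta> T B U x0. ereal (cost a b h q u))"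
proof -
  obtain aU cU where aU: "L2_nonneg a b aU" "cU \<ge> 0"
    "AE t in lebesgue_on {a..b}. \<forall>x. set_norm (U t x) \<le> ereal (aU t + cU * (\<psi> t - \<psi> a) powr (1 - \<gamma>) * norm x)"
    using U3 by blast
  obtain k4 where k4: "AE t in lebesgue_on {a..b}. \<forall>x y.
      hausdorff_dist (U t x) (U t y) \<le> ereal (k4 t * (\<psi> t - \<psi> a) powr (1 - \<gamma>) * norm (x - y))"
    using U4 by blast
  obtain k1 k2 ch where k12: "L1_nonneg a b k1" "L1_nonneg a b k2" "ch \<ge> 0"
    "AE t in lebesgue_on {a..b}. \<forall>x u. \<bar>h t x u\<bar> \<le> k1 t + k2 t * norm x + ch * norm u"
    using H2 by blast
  interpret cs: compact_semigroup T
    by unfold_locales (use gen T_compact in \<open>auto simp: generates_def\<close>)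
  obtain D' :: "'x set" where D': "separable_banach D'" using cs.separable by blast
  interpret sb: separable_banach D' by (rule D')
  interpret fs: fractional_setting T D' a b \<alpha> \<beta> \<gamma> \<psi> \<psi>' B x0
    by unfold_locales (fact assms)+
  obtain C where "singular_kernel D' a b (\<alpha> - 1) C fs.k" using fs.k_singular_kernel by blast
  then interpret sk: singular_kernel D' a b "\<alpha> - 1" C fs.k .
  obtain Cw where Cw: "\<And>t. t \<in> {a..b} \<Longrightarrow> fs.w t \<le> Cw" using fs.w_bounded by blast
  obtain Cs where Cs: "\<And>t. t \<in> {a<..b} \<Longrightarrow> fs.w t * norm (fs.s0 t) \<le> Cs" using fs.w_s0_bounded by blast
  interpret fc: feedback_cost D' a b "\<alpha> - 1" C fs.k fs.s0 fs.w Cw Cs cU U aU k4 h k1 k2 ch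
  proof unfold_locales
    show "0 \<le> fs.w t \<and> fs.w t \<le> Cw" if "t \<in> {a<..b}" for t
      using fs.w_pos[OF that] Cw[of t] that by auto
    show "integrable (lebesgue_on {a..b}) (\<lambda>t. h t (fs.s0 t + r t) (u t))"
      if "continuous_on {a..b} r" "r a = 0" "u \<in> L2 a b" for r u
      by (rule J_real[OF fs.s0_plus_C_weighted[OF that(1,2)] that(3)])
  qed (fact fs.s0_continuous Cs U_values U1 U2 aU(1,2) aU(3)[folded fs.w_def] k4[folded fs.w_def] k12 H4 H5)+
  let ?S = "mild_solutions a b \<psi> \<psi>' \<alpha> \<beta> T B U x0"
  have integral_eq: "bochner (lebesgue_on {a..t}) (\<lambda>s. \<psi>' s *\<^sub>R K_op T \<alpha> (\<psi> t - \<psi> s) (B (u s))) = sk.Q u t"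
    if "t \<in> {a<..b}" "u \<in> L2 a b" for t u
    unfolding sk.Q_def by (rule fs.mild_integral[OF that(1) sk.abs_int_k]) (use that in auto)
  have solution: "fc.admissible u" "\<forall>t\<in>{a<..b}. q t = fs.s0 t + sk.Q u t" "q \<in> C_weighted a b \<psi> \<gamma>" "u \<in> L2 a b"
    if "(q, u) \<in> ?S" for q u
  proof -
    have m: "q \<in> C_weighted a b \<psi> \<gamma>" "u \<in> L2 a b" "AE t in lebesgue_on {a..b}. u t \<in> U t (q t)"
      "\<forall>t\<in>{a<..b}. q t = S_op T \<alpha> \<beta> (\<psi> t - \<psi> a) x0 +
        bochner (lebesgue_on {a..t}) (\<lambda>s. \<psi>' s *\<^sub>R K_op T \<alpha> (\<psi> t - \<psi> s) (B (u s)))"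
      using that unfolding mild_solutions_def fs.\<gamma>[symmetric] by auto
    show q: "\<forall>t\<in>{a<..b}. q t = fs.s0 t + sk.Q u t" using m(4) integral_eq[OF _ m(2)] by (simp add: fs.s0_def)
    have "AE t in lebesgue_on {a..b}. u t \<in> U t (fs.s0 t + sk.Q u t)"
      using m(3) AE_half_open[of a b]
    proof eventually_elim
      case (elim t)
      then show ?case using q by simp
    qed
    then show "fc.admissible u" using m(2) by (simp add: fc.admissible_def)
    show "q \<in> C_weighted a b \<psi> \<gamma>" "u \<in> L2 a b" by (fact m)+
  qed
  have feasible: "((\<lambda>t. fs.s0 t + sk.Q u t), u) \<in> ?S" if u: "fc.admissible u" for u
  proof -
    have L: "u \<in> L2 a b" and uU: "AE t in lebesgue_on {a..b}. u t \<in> U t (fs.s0 t + sk.Q u t)"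
      using u by (auto simp: fc.admissible_def)
    have "(\<lambda>t. fs.s0 t + sk.Q u t) \<in> C_weighted a b \<psi> \<gamma>"
      by (rule fs.s0_plus_C_weighted[OF sk.continuous_Q[OF L] sk.Q_initial])
    then show ?thesis using L uU integral_eq[OF _ L]
      unfolding mild_solutions_def fs.\<gamma>[symmetric] by (simp add: fs.s0_def)
  qed
  have cost_eq: "cost a b h q u = fc.J u" if "(q, u) \<in> ?S" for q u
    unfolding cost_def fc.J_def
  proof (rule integral_cong_AE)
    note s = solution[OF that]
    show "(\<lambda>t. h t (q t) (u t)) \<in> borel_measurable (lebesgue_on {a..b})"
      by (rule borel_measurable_integrable[OF J_real[OF s(3,4)]])
    show "(\<lambda>t. h t (fs.s0 t + sk.Q u t) (u t)) \<in> borel_measurable (lebesgue_on {a..b})"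
      by (rule borel_measurable_integrable[OF fc.h_integrable[OF sk.continuous_Q[OF s(4)] sk.Q_initial s(4)]])
    show "AE t in lebesgue_on {a..b}. h t (q t) (u t) = h t (fs.s0 t + sk.Q u t) (u t)"
      using AE_half_open[of a b]
    proof eventually_elim
      case (elim t)
      then show ?case using s(2) by simp
    qed
  qed
  obtain v where v: "fc.admissible v" "\<And>u. fc.admissible u \<Longrightarrow> fc.J v \<le> fc.J u" using fc.minimizer by blast
  define q' where "q' = (\<lambda>t. fs.s0 t + sk.Q v t)"
  have mem: "(q', v) \<in> ?S" unfolding q'_def by (rule feasible[OF v(1)])
  have "ereal (cost a b h q' v) = (INF (q, u) \<in> ?S. ereal (cost a b h q u))"
  proof (rule antisym)
    show "ereal (cost a b h q' v) \<le> (INF (q, u) \<in> ?S. ereal (cost a b h q u))"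
    proof (rule INF_greatest, clarify)
      fix q u assume qu: "(q, u) \<in> ?S"
      show "ereal (cost a b h q' v) \<le> ereal (cost a b h q u)"
        unfolding cost_eq[OF mem] cost_eq[OF qu] using v(2)[OF solution(1)[OF qu]] by simp
    qed
    show "(INF (q, u) \<in> ?S. ereal (cost a b h q u)) \<le> ereal (cost a b h q' v)"
      by (rule INF_lower2[OF mem]) simp
  qed
  then show ?thesis using mem by blast
qed

end
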